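(* Let $T$ be a complex torus of dimension $g\ge 3$. Suppose that $T$ is $2$-simple. Then $T$ enjoys the following properties. (i) $T$ is simple. (ii) If $E$ is any subfield of $\mathrm{End}^0(T)$ then it is a number field whose degree over $\mathbb{Q}$ is either $1$ or $g$ or $2g$. (iii) $\mathrm{End}^0(T)$ is a number field whose degree over $\mathbb{Q}$ is either $1$ or $g$ or $2g$. (iv) If $[\mathrm{End}^0(T):\mathbb{Q}]=1$ then $\mathrm{End}^0(T)=\mathbb{Q}$, $\mathrm{End}(T)=\mathbb{Z}$, $\mathrm{Aut}(T)=\{\pm 1\}$. (v) If $E=\mathrm{End}^0(T)$ and $[E:\mathbb{Q}]=2g$ then $E$ is a purely imaginary number field and $\mathrm{Aut}(T)\cong\{\pm 1\}\times \mathbb{Z}^{g-1}$. In addition, if $E$ is not primitive then it contains precisely one proper subfield except $\mathbb{Q}$, and this subfield has degree $g$ over $\mathbb{Q}$. (vi) If $E=\mathrm{End}^0(T)$ and $[E:\mathbb{Q}]=g$ then $E$ is a primitive number field and $\mathrm{Aut}(T)\cong \mathbb{Z}^{d}\times\{\pm 1\}$ where the positive integer $d$ equals $r_E+s_E-1$. In particular, $$\frac{1}{2}\le \frac{g}{2}-1\le d\le g-1.$$ In addition, if $T$ is a complex abelian variety then $E$ is a primitive totally real number field and $d=g-1$.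
   Context: A complex torus of dimension $g$ is $T=V/\Lambda$, with $V$ a $g$-dimensional complex vector space and $\Lambda\subset V$ a discrete subgroup of rank $2g$. Put $\Lambda_{\mathbb{Q}}=\Lambda\otimes\mathbb{Q}=\mathrm{H}_1(T,\mathbb{Q})$. $\mathrm{End}(T)$ is the endomorphism ring of the complex Lie group $T$, $\mathrm{End}^0(T)=\mathrm{End}(T)\otimes\mathbb{Q}$ (a finite-dimensional $\mathbb{Q}$-algebra), and $\mathrm{Aut}(T)=\mathrm{End}(T)^*$ is the automorphism group of the complex Lie group $T$. $T$ is simple if its only complex subtori are $\{0\}$ and $T$. The second rational cohomology group $\mathrm{H}^2(T,\mathbb{Q})=\mathrm{Hom}_{\mathbb{Q}}(\wedge^2_{\mathbb{Q}}\Lambda_{\mathbb{Q}},\mathbb{Q})$ carries its natural rational Hodge structure of weight two, $\mathrm{H}^2(T,\mathbb{C})=\mathrm{H}^{2,0}(T)\oplus\mathrm{H}^{1,1}(T)\oplus\mathrm{H}^{0,2}(T)$, where $\mathrm{H}^{2,0}(T)$ is the $g(g-1)/2$-dimensional space of holomorphic $2$-forms on $T$. A complex torus $T$ of dimension $g\ge 2$ is called $2$-simple if for every rational Hodge substructure $H$ of $\mathrm{H}^2(T,\mathbb{Q})$ with $H_{\mathbb{C}}\cap \mathrm{H}^{2,0}(T)\ne\{0\}$ (where $H_{\mathbb{C}}=H\otimes_{\mathbb{Q}}\mathbb{C}$), $H_{\mathbb{C}}$ contains the whole $\mathrm{H}^{2,0}(T)$. For a number field $E$, the nonnegative integers $r_E,s_E$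 are defined by $E\otimes_{\mathbb{Q}}\mathbb{R}\cong\mathbb{R}^{r_E}\times\mathbb{C}^{s_E}$, so $[E:\mathbb{Q}]=r_E+2s_E$. $E$ is purely imaginary if $r_E=0$, and totally real if $s_E=0$. A number field $E$ is primitive if either $E=\mathbb{Q}$ or the only proper subfield of $E$ is $\mathbb{Q}$. *)

theory Defs
  imports
    "HOL-Analysis.Analysis"
    "HOL-Algebra.Algebra"
    "HOL-Algebra.Algebraic_Closure_Type"
    "HOL-Library.Poly_Mapping"
    "HOL-Library.Function_Algebras"
begin

section \<open>Complex tori\<close>

text \<open>A complex torus \<open>V / \<Lambda>\<close> of dimension \<open>g\<close> is given by \<open>V = complex ^ 'g\<close>, \<open>g = CARD('g)\<close>,
  and the lattice \<open>\<Lambda>\<close>. Since \<open>V\<close> is torsion-free and divisible, \<open>\<Lambda> \<otimes> \<rat>\<close> is the rational span of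
  \<open>\<Lambda>\<close> in \<open>V\<close>, and the rank of \<open>\<Lambda>\<close> is the dimension of that span.\<close>

global_interpretation ratV: vector_space "\<lambda>(q::rat) (v::'a::real_vector). real_of_rat q *\<^sub>R v"
  by unfold_locales (simp_all add: of_rat_add of_rat_mult algebra_simps)

definition vec_group :: "(complex ^ 'g) monoid" where
  "vec_group = \<lparr>carrier = UNIV, monoid.mult = (+), one = 0\<rparr>"

definition is_lattice :: "(complex ^ 'g) set \<Rightarrow> (complex ^ 'g) set \<Rightarrow> bool" where
  "is_lattice W L \<longleftrightarrow>
     subgroup L vec_group \<and> L \<subseteq> W \<and> discrete L \<and> ratV.dim L = 2 * vec.dim W"

definition complex_torus :: "(complex ^ 'g) set \<Rightarrow> bool" where
  "complex_torus \<Lambda> \<longleftrightarrow> is_lattice UNIV \<Lambda>"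

definition torus :: "(complex ^ 'g) set \<Rightarrow> (complex ^ 'g) set monoid" where
  "torus \<Lambda> = vec_group Mod \<Lambda>"

definition torus_proj :: "(complex ^ 'g) set \<Rightarrow> complex ^ 'g \<Rightarrow> (complex ^ 'g) set" where
  "torus_proj \<Lambda> v = \<Lambda> #>\<^bsub>vec_group\<^esub> v"

text \<open>A complex subtorus is the image of a complex subspace \<open>W\<close> for which \<open>W / (W \<inter> \<Lambda>)\<close> is itself
  a complex torus.\<close>

definition complex_subtorus :: "(complex ^ 'g) set \<Rightarrow> (complex ^ 'g) set set \<Rightarrow> bool" where
  "complex_subtorus \<Lambda> S \<longleftrightarrow>
     (\<exists>W. vec.subspace W \<and> is_lattice W (W \<inter> \<Lambda>) \<and> S = torus_proj \<Lambda> ` W)"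

definition simple_torus :: "(complex ^ 'g) set \<Rightarrow> bool" where
  "simple_torus \<Lambda> \<longleftrightarrow>
     (\<forall>S. complex_subtorus \<Lambda> S \<longrightarrow> S = {\<one>\<^bsub>torus \<Lambda>\<^esub>} \<or> S = carrier (torus \<Lambda>))"


section \<open>Endomorphisms\<close>

definition holomorphic_vec_on ::
    "(complex ^ 'g \<Rightarrow> complex ^ 'g) \<Rightarrow> (complex ^ 'g) set \<Rightarrow> bool" where
  "holomorphic_vec_on F U \<longleftrightarrow>
     (\<forall>z\<in>U. \<exists>D. Vector_Spaces.linear (*s) (*s) D \<and> (F has_derivative D) (at z))"

text \<open>The projection from \<open>V\<close> provides the charts of the torus, so a self-map of the torus is
  holomorphic iff it is locally induced by holomorphic maps between open subsets of \<open>V\<close>.\<close>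

definition holomorphic_torus_map ::
    "(complex ^ 'g) set \<Rightarrow> ((complex ^ 'g) set \<Rightarrow> (complex ^ 'g) set) \<Rightarrow> bool" where
  "holomorphic_torus_map \<Lambda> f \<longleftrightarrow>
     (\<forall>v. \<exists>U F. open U \<and> v \<in> U \<and> holomorphic_vec_on F U \<and>
        (\<forall>z\<in>U. f (torus_proj \<Lambda> z) = torus_proj \<Lambda> (F z)))"

definition End_torus ::
    "(complex ^ 'g) set \<Rightarrow> ((complex ^ 'g) set \<Rightarrow> (complex ^ 'g) set) ring" where
  "End_torus \<Lambda> =
     \<lparr>carrier = {f \<in> hom (torus \<Lambda>) (torus \<Lambda>).
                   f \<in> extensional (carrier (torus \<Lambda>)) \<and> holomorphic_torus_map \<Lambda> f},
      monoid.mult = (\<lambda>f g. compose (carrier (torus \<Lambda>)) f g),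
      one = (\<lambda>x\<in>carrier (torus \<Lambda>). x),
      ring.zero = (\<lambda>x\<in>carrier (torus \<Lambda>). \<one>\<^bsub>torus \<Lambda>\<^esub>),
      add = (\<lambda>f g. \<lambda>x\<in>carrier (torus \<Lambda>). f x \<otimes>\<^bsub>torus \<Lambda>\<^esub> g x)\<rparr>"

definition Aut_torus ::
    "(complex ^ 'g) set \<Rightarrow> ((complex ^ 'g) set \<Rightarrow> (complex ^ 'g) set) monoid" where
  "Aut_torus \<Lambda> = units_of (End_torus \<Lambda>)"

text \<open>The integral monoid ring of a monoid; its additive group is
  \<^term>\<open>free_Abelian_group (carrier M)\<close>, and its product extends that of the monoid bilinearly.\<close>

definition monoid_ring :: "('a, 'b) monoid_scheme \<Rightarrow> ('a \<Rightarrow>\<^sub>0 int) ring" where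
  "monoid_ring M =
     \<lparr>carrier = carrier (free_Abelian_group (carrier M)),
      monoid.mult = (\<lambda>c d. frag_extend (\<lambda>x. frag_extend (\<lambda>y. frag_of (x \<otimes>\<^bsub>M\<^esub> y)) d) c),
      one = frag_of \<one>\<^bsub>M\<^esub>,
      ring.zero = 0,
      add = (+)\<rparr>"

text \<open>The tensor product of two rings over the integers: \<open>frag_of (a, b)\<close> represents \<open>a \<otimes> b\<close>. For
  algebras over the rationals this is also their tensor product over the rationals.\<close>

definition tensor_relators ::
    "('a, 'c) ring_scheme \<Rightarrow> ('b, 'd) ring_scheme \<Rightarrow> (('a \<times> 'b) \<Rightarrow>\<^sub>0 int) set" where
  "tensor_relators R S =
     {frag_of (a \<oplus>\<^bsub>R\<^esub> a', b) - frag_of (a, b) - frag_of (a', b) | a a' b.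
        a \<in> carrier R \<and> a' \<in> carrier R \<and> b \<in> carrier S} \<union>
     {frag_of (a, b \<oplus>\<^bsub>S\<^esub> b') - frag_of (a, b) - frag_of (a, b') | a b b'.
        a \<in> carrier R \<and> b \<in> carrier S \<and> b' \<in> carrier S}"

definition tensor_ring ::
    "('a, 'c) ring_scheme \<Rightarrow> ('b, 'd) ring_scheme \<Rightarrow> (('a \<times> 'b) \<Rightarrow>\<^sub>0 int) set ring" where
  "tensor_ring R S =
     (let F = monoid_ring (R \<times>\<times> S) in F Quot (Idl\<^bsub>F\<^esub> (tensor_relators R S)))"

abbreviation rat_ring :: "rat ring" where "rat_ring \<equiv> ring_of_type_algebra"
abbreviation real_ring :: "real ring" where "real_ring \<equiv> ring_of_type_algebra"
abbreviation complex_ring :: "complex ring" where "complex_ring \<equiv> ring_of_type_algebra"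

definition End0_torus ::
    "(complex ^ 'g) set
      \<Rightarrow> ((((complex ^ 'g) set \<Rightarrow> (complex ^ 'g) set) \<times> rat) \<Rightarrow>\<^sub>0 int) set ring" where
  "End0_torus \<Lambda> = tensor_ring (End_torus \<Lambda>) rat_ring"


section \<open>Number fields\<close>

text \<open>The canonical copy of the rationals in a ring containing them.\<close>

definition rat_subfield :: "('a, 'b) ring_scheme \<Rightarrow> 'a set" where
  "rat_subfield R =
     {x \<in> carrier R. \<exists>(n::int) (m::int). n \<noteq> 0 \<and> [n] \<cdot>\<^bsub>R\<^esub> x = [m] \<cdot>\<^bsub>R\<^esub> \<one>\<^bsub>R\<^esub>}"

definition number_field :: "('a, 'b) ring_scheme \<Rightarrow> bool" where
  "number_field E \<longleftrightarrow>
     field E \<and> (\<forall>n::nat. n > 0 \<longrightarrow> [n] \<cdot>\<^bsub>E\<^esub> \<one>\<^bsub>E\<^esub> \<noteq> \<zero>\<^bsub>E\<^esub>) \<and>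
     ring.finite_dimension E (rat_subfield E) (carrier E)"

definition rat_degree :: "('a, 'b) ring_scheme \<Rightarrow> nat" where
  "rat_degree E = ring.dim E (rat_subfield E) (carrier E)"

definition real_complex_product :: "nat \<Rightarrow> nat \<Rightarrow> complex list ring" where
  "real_complex_product r s =
     RDirProd_list (replicate r (complex_ring\<lparr>carrier := \<real>\<rparr>) @ replicate s complex_ring)"

definition field_signature :: "('a, 'b) ring_scheme \<Rightarrow> nat \<times> nat" where
  "field_signature E =
     (THE p. tensor_ring E real_ring \<simeq> real_complex_product (fst p) (snd p))"

definition field_r :: "('a, 'b) ring_scheme \<Rightarrow> nat" where
  "field_r E = fst (field_signature E)"

definition field_s :: "('a, 'b) ring_scheme \<Rightarrow> nat" where
  "field_s E = snd (field_signature E)"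

definition purely_imaginary :: "('a, 'b) ring_scheme \<Rightarrow> bool" where
  "purely_imaginary E \<longleftrightarrow> number_field E \<and> field_r E = 0"

definition totally_real :: "('a, 'b) ring_scheme \<Rightarrow> bool" where
  "totally_real E \<longleftrightarrow> number_field E \<and> field_s E = 0"

definition proper_subfields :: "('a, 'b) ring_scheme \<Rightarrow> 'a set set" where
  "proper_subfields E = {K. subfield K E \<and> K \<noteq> carrier E}"

definition primitive_field :: "('a, 'b) ring_scheme \<Rightarrow> bool" where
  "primitive_field E \<longleftrightarrow>
     number_field E \<and> (carrier E = rat_subfield E \<or> proper_subfields E = {rat_subfield E})"

definition free_abelian_rank :: "nat \<Rightarrow> (nat \<Rightarrow> int) monoid" where
  "free_abelian_rank d = product_group {..<d} (\<lambda>_. integer_group)"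

definition sign_group :: "int monoid" where
  "sign_group = \<lparr>carrier = {1, -1}, monoid.mult = (*), one = 1\<rparr>"


section \<open>The Hodge structure on the second cohomology\<close>

definition rational_lattice :: "(complex ^ 'g) set \<Rightarrow> (complex ^ 'g) set" where
  "rational_lattice \<Lambda> = ratV.span \<Lambda>"

text \<open>\<open>H2 \<Lambda> K\<close> consists of the alternating \<open>\<rat>\<close>-bilinear forms on \<open>\<Lambda> \<otimes> \<rat>\<close> with values in \<open>K\<close>,
  extended by zero outside of \<open>\<Lambda> \<otimes> \<rat>\<close>. The rational and the complex cohomology are \<open>H2 \<Lambda> \<rat>\<close>
  and \<open>H2 \<Lambda> UNIV\<close>.\<close>

definition H2 ::
    "(complex ^ 'g) set \<Rightarrow> complex set \<Rightarrow> (complex ^ 'g \<Rightarrow> complex ^ 'g \<Rightarrow> complex) set" where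
  "H2 \<Lambda> K = {\<omega>.
     (\<forall>v w. \<omega> v w \<in> K) \<and>
     (\<forall>v w. v \<notin> rational_lattice \<Lambda> \<or> w \<notin> rational_lattice \<Lambda> \<longrightarrow> \<omega> v w = 0) \<and>
     (\<forall>v\<in>rational_lattice \<Lambda>. \<omega> v v = 0) \<and>
     (\<forall>u\<in>rational_lattice \<Lambda>. \<forall>v\<in>rational_lattice \<Lambda>. \<forall>w\<in>rational_lattice \<Lambda>.
        \<omega> (u + v) w = \<omega> u w + \<omega> v w \<and> \<omega> w (u + v) = \<omega> w u + \<omega> w v) \<and>
     (\<forall>q::rat. \<forall>v\<in>rational_lattice \<Lambda>. \<forall>w\<in>rational_lattice \<Lambda>.
        \<omega> (real_of_rat q *\<^sub>R v) w = of_rat q * \<omega> v w \<and>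
        \<omega> v (real_of_rat q *\<^sub>R w) = of_rat q * \<omega> v w)}"

definition restrict_form ::
    "(complex ^ 'g) set \<Rightarrow> (complex ^ 'g \<Rightarrow> complex ^ 'g \<Rightarrow> complex)
      \<Rightarrow> (complex ^ 'g \<Rightarrow> complex ^ 'g \<Rightarrow> complex)" where
  "restrict_form \<Lambda> B =
     (\<lambda>v w. if v \<in> rational_lattice \<Lambda> \<and> w \<in> rational_lattice \<Lambda> then B v w else 0)"

definition semibilinear ::
    "(complex \<Rightarrow> complex) \<Rightarrow> (complex \<Rightarrow> complex)
      \<Rightarrow> (complex ^ 'g \<Rightarrow> complex ^ 'g \<Rightarrow> complex) \<Rightarrow> bool" where
  "semibilinear \<sigma> \<tau> B \<longleftrightarrow>
     (\<forall>u v w. B (u + v) w = B u w + B v w \<and> B w (u + v) = B w u + B w v) \<and>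
     (\<forall>c v w. B (c *s v) w = \<sigma> c * B v w \<and> B v (c *s w) = \<tau> c * B v w)"

text \<open>The holomorphic 2-forms on the torus are the translation-invariant ones, i.e. the alternating
  complex bilinear forms on \<open>V\<close>; as cohomology classes they are identified with their values on
  pairs of periods. The (1,1)-part is spanned by the wedge products of a complex linear form
  with a conjugate-linear one.\<close>

definition H20 ::
    "(complex ^ 'g) set \<Rightarrow> (complex ^ 'g \<Rightarrow> complex ^ 'g \<Rightarrow> complex) set" where
  "H20 \<Lambda> = {restrict_form \<Lambda> B | B. semibilinear id id B \<and> (\<forall>v. B v v = 0)}"

definition H11 ::
    "(complex ^ 'g) set \<Rightarrow> (complex ^ 'g \<Rightarrow> complex ^ 'g \<Rightarrow> complex) set" where
  "H11 \<Lambda> = {restrict_form \<Lambda> (\<lambda>v w. B v w - B w v) | B. semibilinear id cnj B}"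

definition H02 ::
    "(complex ^ 'g) set \<Rightarrow> (complex ^ 'g \<Rightarrow> complex ^ 'g \<Rightarrow> complex) set" where
  "H02 \<Lambda> = {restrict_form \<Lambda> B | B. semibilinear cnj cnj B \<and> (\<forall>v. B v v = 0)}"

global_interpretation rat_forms:
  vector_space "\<lambda>(q::rat) (\<omega>::'a \<Rightarrow> 'a \<Rightarrow> complex). (\<lambda>v w. of_rat q * \<omega> v w)"
  by unfold_locales (auto simp: fun_eq_iff of_rat_add of_rat_mult algebra_simps)

global_interpretation complex_forms:
  vector_space "\<lambda>(c::complex) (\<omega>::'a \<Rightarrow> 'a \<Rightarrow> complex). (\<lambda>v w. c * \<omega> v w)"
  by unfold_locales (auto simp: fun_eq_iff algebra_simps)

text \<open>For a rational subspace \<open>H\<close> of \<open>H2 \<Lambda> \<rat>\<close>, the natural map from \<open>H \<otimes> \<complex>\<close> to \<open>H2 \<Lambda> UNIV\<close> is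
  injective with image \<^term>\<open>complex_forms.span H\<close>.\<close>

definition hodge_substructure ::
    "(complex ^ 'g) set \<Rightarrow> (complex ^ 'g \<Rightarrow> complex ^ 'g \<Rightarrow> complex) set \<Rightarrow> bool" where
  "hodge_substructure \<Lambda> H \<longleftrightarrow>
     H \<subseteq> H2 \<Lambda> \<rat> \<and> rat_forms.subspace H \<and>
     (\<forall>\<omega>\<in>complex_forms.span H.
        \<exists>\<alpha>\<in>complex_forms.span H \<inter> H20 \<Lambda>.
        \<exists>\<beta>\<in>complex_forms.span H \<inter> H11 \<Lambda>.
        \<exists>\<gamma>\<in>complex_forms.span H \<inter> H02 \<Lambda>. \<omega> = \<alpha> + \<beta> + \<gamma>)"

definition two_simple :: "(complex ^ 'g) set \<Rightarrow> bool" where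
  "two_simple \<Lambda> \<longleftrightarrow>
     CARD('g) \<ge> 2 \<and>
     (\<forall>H. hodge_substructure \<Lambda> H \<and> complex_forms.span H \<inter> H20 \<Lambda> \<noteq> {0} \<longrightarrow>
        H20 \<Lambda> \<subseteq> complex_forms.span H)"


section \<open>Complex abelian varieties\<close>

text \<open>A complex abelian variety is a complex torus with a Riemann form, i.e. a positive definite
  Hermitian form whose imaginary part is integral on the lattice.\<close>

definition riemann_form ::
    "(complex ^ 'g) set \<Rightarrow> (complex ^ 'g \<Rightarrow> complex ^ 'g \<Rightarrow> complex) \<Rightarrow> bool" where
  "riemann_form \<Lambda> h \<longleftrightarrow>
     semibilinear id cnj h \<and> (\<forall>v w. h w v = cnj (h v w)) \<and>
     (\<forall>v. v \<noteq> 0 \<longrightarrow> Re (h v v) > 0) \<and>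
     (\<forall>v\<in>\<Lambda>. \<forall>w\<in>\<Lambda>. Im (h v w) \<in> \<int>)"

definition abelian_variety :: "(complex ^ 'g) set \<Rightarrow> bool" where
  "abelian_variety \<Lambda> \<longleftrightarrow> complex_torus \<Lambda> \<and> (\<exists>h. riemann_form \<Lambda> h)"

end

theory Submission
  imports Defs
begin

text \<open>
  Consider a family of real alternating forms that is defined over \<open>\<rat>\<close> and stable under the action of
  \<open>\<i>\<close>. Its rational members make up a Hodge substructure, so that the family contains either every
  holomorphic 2-form or no nonzero one.
  Forms vanishing on \<open>W \<times> W'\<close> for rational subspaces give simplicity. Forms for which an endomorphism
  \<open>e\<close> is self-adjoint show that no nonzero holomorphic one exists if \<open>e\<close> is not rational; therefore the eigenspaces
  of \<open>e\<close> are lines, that is, \<open>e\<close> has \<open>g\<close> distinct eigenvalues. It follows that the endomorphism algebra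
  is commutative (otherwise it would contain quadratic elements), and after a change of basis it is
  a field \<open>KF\<close> of diagonal matrices whose nonrational elements have \<open>g\<close> distinct entries. Such an
  element has degree at least \<open>g\<close>, and every subfield acts on the rational lattice of dimension
  \<open>2 g\<close>, so that the degrees are \<open>1\<close>, \<open>g\<close> and \<open>2 g\<close>.

  In degree \<open>2 g\<close> the entries are one out of each pair of conjugate embeddings. In degree
  \<open>g\<close> they are all the embeddings and complex conjugation permutes them. Two subfields of degree \<open>g\<close> in
  a field of degree \<open>2 g\<close> would yield two involutions whose product permutes the coordinates and has
  only rational fixed points, which is impossible as averaging over its powers shows. The units are
  determined as in Dirichlet's theorem, by a pigeonhole argument and the finiteness of the number of
  sublattices \<open>x * Lat\<close> of bounded index.
\<close>

no_notation fps_nth (infixl \<open>$\<close> 75)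

section \<open>Discrete subgroups of Euclidean spaces\<close>

text \<open>Besides supplying a third basis vector for simplicity, the hypothesis
  \<open>CARD('g) \<ge> 3\<close> mainly says that an element with at most two eigenvalues is
  rational. This excludes quadratic elements, and with them quaternion algebras and square roots of
  -1, p and -p; hence 1 and -1 are the only roots of unity. Descent to \<rat> is done with
  \<rat>-linear functionals on \<real> or \<complex>. Applied to coordinates, they cut a real vector
  or a form into rational pieces that satisfy the same rational linear conditions; tensor products
  are met only when the results are carried back to \<open>End0_torus\<close>. The endomorphism ring
  is some order, not necessarily the maximal one, so the lattice takes over the role of ideals:
  \<open>KO\<close> is the ring of multipliers of \<open>Lat\<close>, the determinant of
  multiplication on \<open>Lat\<close> serves as norm, and elements that differ by a unit are
  recognised by their equal sublattices \<open>x * Lat\<close>. This norm is the field norm in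
  degree \<open>2 g\<close> but its square in degree \<open>g\<close>; the constant
  \<open>\<kappa>\<close> in \<open>places\<close> lets one argument serve both cases.\<close>

lemma discrete_subgroup_basis:
  fixes G :: "'a::euclidean_space set"
  assumes "0 \<in> G" and "\<And>x y. x \<in> G \<Longrightarrow> y \<in> G \<Longrightarrow> x - y \<in> G"
    and "\<And>B. finite {x \<in> G. norm x \<le> B}"
  shows "\<exists>B \<subseteq> G. independent B \<and> span B = span G \<and>
           (\<forall>x\<in>G. \<exists>c::'a \<Rightarrow> int. x = (\<Sum>b\<in>B. of_int (c b) *\<^sub>R b))"
  using assms
proof (induction "dim G" arbitrary: G)
  case 0
  have "dim G = 0"
    using 0(1) by simp
  then have "G \<subseteq> {0}"
    by simp
  then have "G = {0}" using 0(2) by blast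
  then have "{} \<subseteq> G \<and> independent ({} :: 'a set) \<and> span {} = span G \<and>
      (\<forall>x\<in>G. \<exists>c::'a \<Rightarrow> int. x = (\<Sum>b\<in>{}. of_int (c b) *\<^sub>R b))"
    using independent_empty[where 'a='a] by simp
  then show ?case by blast
next
  case (Suc n)
  have sub: "x - y \<in> G" if "x \<in> G" "y \<in> G" for x y using Suc.prems(2) that .
  have zero: "0 \<in> G" by fact
  have neg: "- x \<in> G" if "x \<in> G" for x using sub[OF zero that] by simp
  have add: "x + y \<in> G" if "x \<in> G" "y \<in> G" for x y using sub[OF that(1) neg[OF that(2)]] by simp
  have natmul: "of_nat k *\<^sub>R x \<in> G" if "x \<in> G" for k x
    by (induction k) (auto simp: zero algebra_simps intro: add that)
  have zmul: "of_int k *\<^sub>R x \<in> G" if "x \<in> G" for k x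
  proof (cases "k \<ge> 0")
    case True then show ?thesis using natmul[OF that, of "nat k"] by simp
  next
    case False then show ?thesis using neg[OF natmul[OF that, of "nat (- k)"]] by simp
  qed
  have zsum: "(\<Sum>s\<in>T. of_int (k s) *\<^sub>R s) \<in> G" if "T \<subseteq> G" for T :: "'a set" and k
    using that by (induction T rule: infinite_finite_induct) (auto simp: zero intro: add zmul)
  obtain S where S: "S \<subseteq> G" "independent S" "G \<subseteq> span S" "card S = dim G"
    using basis_exists by blast
  have finS: "finite S" using S(2) independent_imp_finite by blast
  have spanS: "span S = span G"
    unfolding span_eq using S(1,3) span_superset[of G] by blast
  have "S \<noteq> {}"
  proof
    assume "S = {}"
    then have "card S = 0" by simp
    then show False using S(4) Suc.hyps(2) by linarith
  qed
  then obtain b0 where b0: "b0 \<in> S" by blast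
  \<comment> \<open>One basis vector \<open>b0\<close> is split off; the members of \<open>G\<close>
    in the span of the others fall under the induction hypothesis.\<close>
  define T where "T = S - {b0}"
  have finT: "finite T" and cardT: "card T = n" and b0T: "b0 \<notin> T"
    using finS S b0 Suc.hyps(2) by (auto simp: T_def)
  have indT: "independent T" using independent_mono[OF S(2), of T] by (simp add: T_def)
  have S_eq: "S = insert b0 T" using b0 by (auto simp: T_def)
  have b0span: "b0 \<notin> span T" using S(2) b0T by (simp add: S_eq independent_insert)
  define G0 where "G0 = G \<inter> span T"
  have TG0: "T \<subseteq> G0" using S(1) span_superset[of T] by (auto simp: G0_def T_def)
  have spanG0: "span G0 = span T"
    unfolding span_eq using TG0 span_superset[of T] span_superset[of G0] by (auto simp: G0_def)
  have dimG0: "dim G0 = n"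
    using dim_span[of G0] dim_span_eq_card_independent[OF indT] cardT by (simp add: spanG0)
  have "\<exists>B \<subseteq> G0. independent B \<and> span B = span G0 \<and>
           (\<forall>x\<in>G0. \<exists>c::'a \<Rightarrow> int. x = (\<Sum>b\<in>B. of_int (c b) *\<^sub>R b))"
  proof (rule Suc.hyps(1))
    show "n = dim G0" using dimG0 by simp
    show "0 \<in> G0" by (simp add: G0_def zero span_zero)
    show "x - y \<in> G0" if "x \<in> G0" "y \<in> G0" for x y
      using that by (auto simp: G0_def intro: sub span_diff)
    show "finite {x \<in> G0. norm x \<le> B}" for B
      by (rule finite_subset[OF _ Suc.prems(3)[of B]]) (auto simp: G0_def)
  qed
  then obtain B0 where B0: "B0 \<subseteq> G0" "independent B0" "span B0 = span G0"
    "\<And>x. x \<in> G0 \<Longrightarrow> \<exists>c::'a \<Rightarrow> int. x = (\<Sum>b\<in>B0. of_int (c b) *\<^sub>R b)" by blast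
  have finB0: "finite B0" using B0(2) independent_imp_finite by blast
  define \<phi> where "\<phi> = (\<lambda>x. representation S x b0)"
  have Gspan: "x \<in> span S" if "x \<in> G" for x using that S(3) by blast
  have \<phi>_diff: "\<phi> (x - y) = \<phi> x - \<phi> y" if "x \<in> span S" "y \<in> span S" for x y
    using representation_diff[OF S(2) that(2,1)] by (simp add: \<phi>_def)
  have \<phi>_scale: "\<phi> (r *\<^sub>R x) = r * \<phi> x" if "x \<in> span S" for r x
    using representation_scale[OF S(2) that] by (simp add: \<phi>_def)
  have \<phi>_b0: "\<phi> b0 = 1" using representation_basis[OF S(2) b0] by (simp add: \<phi>_def)
  have expand: "x = \<phi> x *\<^sub>R b0 + (\<Sum>s\<in>T. representation S x s *\<^sub>R s)" if "x \<in> span S" for x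
    using sum_representation_eq[OF S(2) that finS order_refl] b0T finT
    by (simp add: S_eq \<phi>_def)
  have \<phi>0: "x \<in> span T \<longleftrightarrow> \<phi> x = 0" if x: "x \<in> span S" for x
  proof
    assume 0: "\<phi> x = 0"
    have "(\<Sum>s\<in>T. representation S x s *\<^sub>R s) \<in> span T" by (intro span_sum span_scale span_base)
    then show "x \<in> span T" using expand[OF x] 0 by simp
  next
    assume xT: "x \<in> span T"
    have "(\<Sum>s\<in>T. representation S x s *\<^sub>R s) \<in> span T" by (intro span_sum span_scale span_base)
    then have "x - (\<Sum>s\<in>T. representation S x s *\<^sub>R s) \<in> span T" using xT by (rule span_diff[rotated])
    moreover have "x - (\<Sum>s\<in>T. representation S x s *\<^sub>R s) = \<phi> x *\<^sub>R b0"
      using expand[OF x] by (metis add_diff_cancel_right')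
    ultimately have "\<phi> x *\<^sub>R b0 \<in> span T" by simp
    then have "\<phi> x \<noteq> 0 \<Longrightarrow> b0 \<in> span T" using span_scale[of "\<phi> x *\<^sub>R b0" T "inverse (\<phi> x)"] by simp
    then show "\<phi> x = 0" using b0span by blast
  qed
  \<comment> \<open>\<open>M\<close> bounds every vector whose \<open>b0\<close>-coordinate is
    between 0 and 1 and whose other coordinates are fractional parts. So only finitely many
    candidates for the least positive \<open>b0\<close>-coordinate remain.\<close>
  define M where "M = (\<Sum>s\<in>S. norm s)"
  define F where "F = {x \<in> G. norm x \<le> M} \<inter> {x. \<phi> x > 0}"
  have finF: "finite F" unfolding F_def using Suc.prems(3) by blast
  have b0F: "b0 \<in> F"
    using b0 S(1) finS by (auto simp: F_def M_def \<phi>_b0 intro: member_le_sum)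
  have reduce: "\<exists>x'\<in>F. \<phi> x' = \<phi> x" if x: "x \<in> G" "\<phi> x > 0" "\<phi> x \<le> 1" for x
  proof -
    define x' where "x' = x - (\<Sum>s\<in>T. of_int \<lfloor>representation S x s\<rfloor> *\<^sub>R s)"
    have x'G: "x' \<in> G" unfolding x'_def using S(1) by (intro sub x zsum) (auto simp: T_def)
    let ?s = "\<Sum>s\<in>T. of_int \<lfloor>representation S x s\<rfloor> *\<^sub>R s"
    have sT: "?s \<in> span T" by (intro span_sum span_scale span_base)
    then have sS: "?s \<in> span S" using span_mono[of T S] by (auto simp: S_eq)
    have *: "\<phi> x' = \<phi> x" unfolding x'_def
      using \<phi>_diff[OF Gspan[OF x(1)] sS] \<phi>0[OF sS] sT by simp
    have "x' = \<phi> x *\<^sub>R b0 + (\<Sum>s\<in>T. frac (representation S x s) *\<^sub>R s)"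
      using expand[OF Gspan[OF x(1)]] by (simp add: x'_def frac_def algebra_simps sum_subtractf)
    also have "norm \<dots> \<le> norm (\<phi> x *\<^sub>R b0) + (\<Sum>s\<in>T. norm (frac (representation S x s) *\<^sub>R s))"
      by (intro order_trans[OF norm_triangle_ineq] add_left_mono norm_sum)
    also have "\<dots> \<le> norm b0 + (\<Sum>s\<in>T. norm s)"
    proof (intro add_mono sum_mono)
      show "norm (\<phi> x *\<^sub>R b0) \<le> norm b0" using x by (simp add: mult_left_le_one_le)
      show "norm (frac (representation S x s) *\<^sub>R s) \<le> norm s" for s
        using frac_ge_0[of "representation S x s"] frac_lt_1[of "representation S x s"]
        by (simp add: mult_left_le_one_le)
    qed
    finally have "norm x' \<le> M" using finT b0T by (simp add: M_def S_eq)
    then show ?thesis using x'G * x by (auto simp: F_def)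
  qed
  \<comment> \<open>The candidate with least positive \<open>b0\<close>-coordinate is minimal in all
    of \<open>G\<close>, and it completes the basis of \<open>G0\<close>.\<close>
  obtain x1 where x1: "x1 \<in> F" "\<And>x. x \<in> F \<Longrightarrow> \<phi> x1 \<le> \<phi> x"
    using arg_min_if_finite(1)[OF finF, of \<phi>] arg_min_least[OF finF, of _ \<phi>] b0F by blast
  have x1G: "x1 \<in> G" and x1pos: "\<phi> x1 > 0" using x1(1) by (auto simp: F_def)
  have min: "\<phi> x1 \<le> \<phi> x" if "x \<in> G" "\<phi> x > 0" for x
  proof (cases "\<phi> x \<le> 1")
    case True then show ?thesis using reduce[OF that True] x1(2) by fastforce
  next
    case False then show ?thesis using x1(2)[OF b0F] \<phi>_b0 by simp
  qed
  have x1B0: "x1 \<notin> span B0"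
    using \<phi>0[OF Gspan[OF x1G]] x1pos by (simp add: B0(3) spanG0)
  have decomp: "\<exists>k::int. x - of_int k *\<^sub>R x1 \<in> G0" if x: "x \<in> G" for x
  proof -
    define k where "k = \<lfloor>\<phi> x / \<phi> x1\<rfloor>"
    let ?y = "x - of_int k *\<^sub>R x1"
    have yG: "?y \<in> G" by (intro sub x zmul x1G)
    have \<phi>y: "\<phi> ?y = \<phi> x - of_int k * \<phi> x1"
      using \<phi>_diff[of x "of_int k *\<^sub>R x1"] \<phi>_scale[of x1 "of_int k"] Gspan[OF x] Gspan[OF x1G]
      by (simp add: span_scale)
    have "\<phi> ?y \<ge> 0" "\<phi> ?y < \<phi> x1"
    proof -
      have "of_int k \<le> \<phi> x / \<phi> x1" "\<phi> x / \<phi> x1 < of_int k + 1"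
        unfolding k_def by linarith+
      then show "\<phi> ?y \<ge> 0" "\<phi> ?y < \<phi> x1" unfolding \<phi>y using x1pos by (auto simp: field_simps)
    qed
    \<comment> \<open>Division with remainder: a positive remainder would undercut the minimum
      \<open>\<phi> x1\<close>.\<close>
    then have "\<phi> ?y = 0" using min[OF yG] by force
    then show ?thesis using \<phi>0[OF Gspan[OF yG]] yG by (auto simp: G0_def)
  qed
  let ?B = "insert x1 B0"
  have x1nB0: "x1 \<notin> B0" using x1B0 span_base by blast
  have gen: "\<exists>c::'a \<Rightarrow> int. x = (\<Sum>b\<in>?B. of_int (c b) *\<^sub>R b)" if "x \<in> G" for x
    proof -
      obtain k::int where k: "x - of_int k *\<^sub>R x1 \<in> G0" using decomp \<open>x \<in> G\<close> by blast
      obtain c::"'a \<Rightarrow> int" where c: "x - of_int k *\<^sub>R x1 = (\<Sum>b\<in>B0. of_int (c b) *\<^sub>R b)"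
        using B0(4)[OF k] by blast
      have "(\<Sum>b\<in>B0. of_int ((c(x1 := k)) b) *\<^sub>R b) = (\<Sum>b\<in>B0. of_int (c b) *\<^sub>R b)"
        using x1nB0 by (intro sum.cong) auto
      then have "x = (\<Sum>b\<in>?B. of_int ((c(x1 := k)) b) *\<^sub>R b)"
        using c x1nB0 finB0 by (simp add: algebra_simps)
      then show ?thesis by blast
    qed
  show ?case
  proof (intro exI[of _ ?B] conjI ballI)
    show "?B \<subseteq> G" using x1G B0(1) by (auto simp: G0_def)
    show "independent ?B" using x1B0 B0(2) by (simp add: independent_insert)
    show "\<exists>c::'a \<Rightarrow> int. x = (\<Sum>b\<in>?B. of_int (c b) *\<^sub>R b)" if "x \<in> G" for x
      using gen[OF that] .
    have "G \<subseteq> span ?B"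
    proof
      fix x assume "x \<in> G"
      then obtain c::"'a \<Rightarrow> int" where "x = (\<Sum>b\<in>?B. of_int (c b) *\<^sub>R b)" using gen by blast
      then show "x \<in> span ?B" by (simp only:) (intro span_sum span_scale span_base)
    qed
    moreover have "?B \<subseteq> G" using x1G B0(1) by (auto simp: G0_def)
    ultimately show "span ?B = span G"
      using span_superset[of G] unfolding span_eq by blast
  qed
qed

text \<open>Since differences stay in \<open>G\<close>, isolation of 0 is uniform: distinct elements
  are at least \<open>e\<close> apart. A limit point would have two distinct elements closer to each
  other than that.\<close>

lemma discrete_subgroup_finite_bounded:
  fixes G :: "'a::euclidean_space set"
  assumes "0 \<in> G" and sub: "\<And>x y. x \<in> G \<Longrightarrow> y \<in> G \<Longrightarrow> x - y \<in> G" and "discrete G"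
  shows "finite {x \<in> G. norm x \<le> B}"
proof -
  have "0 isolated_in G" using assms(1,3) by (auto simp: discrete_def)
  then obtain e where e: "e > 0" "\<And>y. y \<in> G \<Longrightarrow> dist 0 y < e \<Longrightarrow> y = 0"
    by (auto simp: isolated_in_dist_Ex_iff)
  have sep: "x = y" if "x \<in> G" "y \<in> G" "dist x y < e" for x y
    using e(2)[OF sub[OF that(1,2)]] that(3) by (simp add: dist_norm norm_minus_commute)
  show ?thesis
  proof (rule ccontr)
    assume inf: "infinite {x \<in> G. norm x \<le> B}"
    have "bounded {x \<in> G. norm x \<le> B}" by (auto simp: bounded_iff)
    then obtain l where l: "l islimpt {x \<in> G. norm x \<le> B}"
      using bounded_infinite_imp_islimpt inf by (metis order_refl)
    obtain x where x: "x \<in> G" "x \<noteq> l" "dist x l < e / 2"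
      using l e(1) unfolding islimpt_approachable by (metis (lifting) half_gt_zero mem_Collect_eq)
    obtain y where y: "y \<in> G" "y \<noteq> l" "dist y l < dist x l"
      using l x(2) unfolding islimpt_approachable by (metis (lifting) mem_Collect_eq zero_less_dist_iff)
    have "dist x y < e" using dist_triangle_half_l[of x l e y] x(3) y(3) by (simp add: dist_commute)
    then show False using sep[OF x(1) y(1)] y(3) by auto
  qed
qed

section \<open>Rational functionals and coordinates\<close>

text \<open>Here \<open>'a\<close> is \<real> or \<complex> in all applications. Such a functional
  turns the coordinates of a vector, or the values of a form on the lattice basis, into rational
  numbers.\<close>

definition ratlin :: "('a::real_vector \<Rightarrow> rat) \<Rightarrow> bool" where
  "ratlin l \<longleftrightarrow> (\<forall>x y. l (x + y) = l x + l y) \<and> (\<forall>q x. l (of_rat q *\<^sub>R x) = q * l x)"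

lemma ratlin_add: "ratlin l \<Longrightarrow> l (x + y) = l x + l y"
  and ratlin_scale: "ratlin l \<Longrightarrow> l (of_rat q *\<^sub>R x) = q * l x"
  by (simp_all add: ratlin_def)

lemma ratlin_0: "ratlin l \<Longrightarrow> l 0 = 0"
  using ratlin_add[of l 0 0] by simp

lemma ratlin_sum: "ratlin l \<Longrightarrow> l (\<Sum>i\<in>I. f i) = (\<Sum>i\<in>I. l (f i))"
  by (induction I rule: infinite_finite_induct) (auto simp: ratlin_0 ratlin_add)

lemma ratlin_minus: "ratlin l \<Longrightarrow> l (- x) = - l x"
  using ratlin_add[of l x "- x"] by (simp add: ratlin_0)

lemma ratlin_mult: "ratlin l \<Longrightarrow> x \<in> \<rat> \<Longrightarrow> of_rat (l (x * y)) = x * (of_rat (l y) :: real)"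
  using ratlin_scale[of l _ y] by (auto elim!: Rats_cases simp: of_rat_mult)

lemma ratlin_representation:
  assumes "ratV.independent B" "ratV.span B = UNIV"
  shows "ratlin (\<lambda>x. ratV.representation B x a)"
  using assms ratV.representation_add[OF assms(1)] ratV.representation_scale[OF assms(1)]
  by (auto simp: ratlin_def)

lemma ratlin_exists: "\<exists>l. ratlin l \<and> l (1::real) = 1"
proof -
  have ind: "ratV.independent {1::real}" by (rule ratV.independent_insertI) (simp_all only: ratV.span_empty singleton_iff one_neq_zero not_False_eq_True ratV.independent_empty)
  let ?B = "ratV.extend_basis {1::real}"
  have B: "ratV.independent ?B" "ratV.span ?B = UNIV" "1 \<in> ?B"
    using ratV.independent_extend_basis[OF ind] ratV.span_extend_basis[OF ind] ratV.extend_basis_superset[OF ind]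
    by auto
  have "ratV.representation ?B 1 1 = 1"
    using ratV.representation_basis[OF B(1,3)] by simp
  then show ?thesis using ratlin_representation[OF B(1,2)] by blast
qed

text \<open>A basis of \<open>'a\<close> over \<rat> provides the functionals; \<open>F\<close>
  collects the basis vectors that occur in some element of the finite set \<open>C\<close>.\<close>

lemma ratlin_coords:
  fixes C :: "'a::real_vector set"
  assumes "finite C"
  shows "\<exists>F l. finite F \<and> (\<forall>a. ratlin (l a)) \<and> (\<forall>c\<in>C. c = (\<Sum>a\<in>F. of_rat (l a c) *\<^sub>R a))"
proof -
  have ind: "ratV.independent ({}::'a set)" by (rule ratV.independent_empty)
  let ?B = "ratV.extend_basis ({}::'a set)"
  have B: "ratV.independent ?B" "ratV.span ?B = UNIV"
    using ratV.independent_extend_basis[OF ind] ratV.span_extend_basis[OF ind] by auto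
  let ?l = "\<lambda>a x. ratV.representation ?B x a"
  let ?F = "\<Union>c\<in>C. {a. ?l a c \<noteq> 0}"
  have fin: "finite ?F" using assms ratV.finite_representation by blast
  have "c = (\<Sum>a\<in>?F. of_rat (?l a c) *\<^sub>R a)" if "c \<in> C" for c
  proof -
    have "(\<Sum>a\<in>?F. of_rat (?l a c) *\<^sub>R a) = (\<Sum>a\<in>{a. ?l a c \<noteq> 0}. of_rat (?l a c) *\<^sub>R a)"
      using that fin by (intro sum.mono_neutral_right) auto
    also have "\<dots> = c" using ratV.sum_nonzero_representation_eq[OF B(1), of c] B(2) by simp
    finally show ?thesis by simp
  qed
  then show ?thesis using fin ratlin_representation[OF B]
    by (intro exI[of _ ?F] exI[of _ ?l]) simp
qed

section \<open>Real coordinates with respect to a lattice basis\<close>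

locale lattice_coords =
  fixes b :: "'k::finite \<Rightarrow> complex ^ 'g" and co :: "complex ^ 'g \<Rightarrow> 'k \<Rightarrow> real"
  assumes co_linear: "linear (\<lambda>v. co v k)"
    and expand: "(\<Sum>k\<in>UNIV. co v k *\<^sub>R b k) = v"
    and co_b: "co (b k) l = (if k = l then 1 else 0)"
begin

definition Lat :: "(complex ^ 'g) set" where "Lat = {v. \<forall>k. co v k \<in> \<int>}"
definition LatQ :: "(complex ^ 'g) set" where "LatQ = {v. \<forall>k. co v k \<in> \<rat>}"

lemma co_add [simp]: "co (v + w) k = co v k + co w k"
  and co_scale [simp]: "co (r *\<^sub>R v) k = r * co v k"
  and co_0 [simp]: "co 0 k = 0"
  and co_diff [simp]: "co (v - w) k = co v k - co w k"
  and co_minus [simp]: "co (- v) k = - co v k"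
  and co_sum: "co (\<Sum>i\<in>I. f i) k = (\<Sum>i\<in>I. co (f i) k)"
  using linear_add[OF co_linear] linear_scale[OF co_linear] linear_0[OF co_linear]
    linear_diff[OF co_linear] linear_neg[OF co_linear] linear_sum[OF co_linear]
  by auto

lemma co_eqI:
  assumes "\<And>k. co v k = co w k"
  shows "v = w"
proof -
  have "v = (\<Sum>k\<in>UNIV. co v k *\<^sub>R b k)" by (rule expand[symmetric])
  also have "\<dots> = (\<Sum>k\<in>UNIV. co w k *\<^sub>R b k)" by (rule sum.cong) (simp_all only: assms)
  also have "\<dots> = w" by (rule expand)
  finally show ?thesis .
qed

lemma co_comb [simp]: "co (\<Sum>k\<in>UNIV. c k *\<^sub>R b k) l = c l"
  by (simp add: co_sum co_b if_distrib cong: if_cong)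

lemma b_Lat [simp]: "b k \<in> Lat"
  by (simp add: Lat_def co_b)

lemma Lat_LatQ: "v \<in> Lat \<Longrightarrow> v \<in> LatQ"
  by (auto simp: Lat_def LatQ_def) (metis Ints_cases Rats_of_int)

lemma b_LatQ [simp]: "b k \<in> LatQ"
  by (simp add: Lat_LatQ)

lemma LatQ_scale: "v \<in> LatQ \<Longrightarrow> r \<in> \<rat> \<Longrightarrow> r *\<^sub>R v \<in> LatQ"
  by (simp add: LatQ_def)

lemma LatQ_0 [simp]: "0 \<in> LatQ" and LatQ_add: "v \<in> LatQ \<Longrightarrow> w \<in> LatQ \<Longrightarrow> v + w \<in> LatQ"
  and LatQ_diff: "v \<in> LatQ \<Longrightarrow> w \<in> LatQ \<Longrightarrow> v - w \<in> LatQ"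
  by (auto simp: LatQ_def)

lemma Lat_0 [simp]: "0 \<in> Lat" and Lat_add: "v \<in> Lat \<Longrightarrow> w \<in> Lat \<Longrightarrow> v + w \<in> Lat"
  and Lat_diff: "v \<in> Lat \<Longrightarrow> w \<in> Lat \<Longrightarrow> v - w \<in> Lat"
  and Lat_minus: "v \<in> Lat \<Longrightarrow> - v \<in> Lat"
  by (auto simp: Lat_def)

lemma Lat_scale: "v \<in> Lat \<Longrightarrow> r \<in> \<int> \<Longrightarrow> r *\<^sub>R v \<in> Lat"
  by (simp add: Lat_def)

lemma Lat_sum: "(\<And>i. i \<in> I \<Longrightarrow> f i \<in> Lat) \<Longrightarrow> (\<Sum>i\<in>I. f i) \<in> Lat"
  by (induction I rule: infinite_finite_induct) (auto intro: Lat_add)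

lemma common_denominator:
  assumes "finite S" "S \<subseteq> LatQ"
  shows "\<exists>n::nat. n > 0 \<and> (\<forall>v\<in>S. of_nat n *\<^sub>R v \<in> Lat)"
proof -
  have "\<exists>n::nat. n > 0 \<and> (\<forall>x\<in>Y. of_nat n * x \<in> \<int>)" if "finite Y" "Y \<subseteq> \<rat>" for Y :: "real set"
    using that
  proof (induction Y rule: finite_induct)
    case (insert x Y)
    then obtain n where n: "n > 0" "\<And>x. x \<in> Y \<Longrightarrow> of_nat n * x \<in> \<int>" by auto
    obtain p q :: int where pq: "q > 0" "x = of_int p / of_int q"
      using insert.prems by (auto elim!: Rats_cases')
    have "of_nat (n * nat q) * y \<in> \<int>" if "y \<in> insert x Y" for y
    proof (cases "y = x")
      case True
      have "of_nat (n * nat q) * y = of_int (int n * p)" using pq True by simp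
      then show ?thesis by (metis Ints_of_int)
    next
      case False
      have "of_nat (n * nat q) * y = of_int q * (of_nat n * y)" using pq by simp
      then show ?thesis using n(2)[of y] False that by (metis Ints_mult Ints_of_int insertE)
    qed
    then show ?case using n pq by (intro exI[of _ "n * nat q"]) auto
  qed (auto intro!: exI[of _ "1::nat"])
  from this[of "(\<lambda>(v, k). co v k) ` (S \<times> UNIV)"]
  obtain n :: nat where "n > 0" "\<And>v k. v \<in> S \<Longrightarrow> of_nat n * co v k \<in> \<int>"
    using assms by (fastforce simp: LatQ_def)
  then show ?thesis by (auto simp: Lat_def)
qed

lemma denominator: "v \<in> LatQ \<Longrightarrow> \<exists>n::nat. n > 0 \<and> of_nat n *\<^sub>R v \<in> Lat"
  using common_denominator[of "{v}"] by simp

lemma co_bound: "\<exists>M>0. \<forall>v k. \<bar>co v k\<bar> \<le> M * norm v"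
proof -
  have "\<exists>M>0. \<forall>v. \<bar>co v k\<bar> \<le> M * norm v" for k
    using linear_bounded_pos[OF co_linear, of k] by auto
  then obtain M where M: "\<And>k. M k > 0" "\<And>k v. \<bar>co v k\<bar> \<le> M k * norm v" by metis
  have "\<bar>co v k\<bar> \<le> (\<Sum>k\<in>UNIV. M k) * norm v" for v k
    by (rule order_trans[OF M(2)], rule mult_right_mono)
       (auto intro!: member_le_sum less_imp_le[OF M(1)])
  moreover have "(\<Sum>k\<in>UNIV. M k) > 0" using M(1) by (intro sum_pos) auto
  ultimately show ?thesis by blast
qed

lemma finite_bounded_Lat: "finite {v \<in> Lat. norm v \<le> B}"
proof -
  obtain M where M: "M > 0" "\<And>v k. \<bar>co v k\<bar> \<le> M * norm v" using co_bound by blast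
  let ?T = "(UNIV :: 'k set) \<rightarrow>\<^sub>E (real_of_int ` {-\<lceil>M * B\<rceil>..\<lceil>M * B\<rceil>})"
  have fin: "finite ?T" by (intro finite_PiE) auto
  have "co ` {v \<in> Lat. norm v \<le> B} \<subseteq> ?T"
  proof (clarsimp simp: PiE_UNIV_domain)
    fix v k assume v: "v \<in> Lat" "norm v \<le> B"
    obtain z where z: "co v k = of_int z" using v(1) by (auto simp: Lat_def elim: Ints_cases)
    have "\<bar>co v k\<bar> \<le> M * B" using M v(2) by (meson less_imp_le mult_left_mono order_trans)
    then have "z \<in> {-\<lceil>M * B\<rceil>..\<lceil>M * B\<rceil>}" unfolding z by (auto simp: abs_le_iff) linarith+
    then show "co v k \<in> real_of_int ` {-\<lceil>M * B\<rceil>..\<lceil>M * B\<rceil>}" using z by blast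
  qed
  moreover have "inj_on co {v \<in> Lat. norm v \<le> B}" by (rule inj_onI) (metis co_eqI)
  ultimately show ?thesis using fin by (meson finite_imageD finite_subset)
qed

text \<open>Applying \<open>l\<close> to each coordinate gives a \<rat>-linear map into
  \<open>LatQ\<close>. It commutes with every real-linear map that preserves \<open>LatQ\<close>,
  because the matrix of such a map in the basis \<open>b\<close> is rational.\<close>

definition rpart :: "(real \<Rightarrow> rat) \<Rightarrow> complex ^ 'g \<Rightarrow> complex ^ 'g" where
  "rpart l v = (\<Sum>k\<in>UNIV. of_rat (l (co v k)) *\<^sub>R b k)"

lemma co_rpart [simp]: "co (rpart l v) k = of_rat (l (co v k))"
  by (simp add: rpart_def)

lemma rpart_LatQ [simp]: "rpart l v \<in> LatQ"
  by (simp add: LatQ_def)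

lemma rpart_fixed: "v \<in> LatQ \<Longrightarrow> ratlin l \<Longrightarrow> l 1 = 1 \<Longrightarrow> rpart l v = v"
  using ratlin_mult[of l _ 1] by (intro co_eqI) (auto simp: LatQ_def)

lemma rpart_linear_commute:
  assumes "linear f" "\<And>v. v \<in> LatQ \<Longrightarrow> f v \<in> LatQ" "ratlin l"
  shows "f (rpart l v) = rpart l (f v)"
proof (rule co_eqI)
  fix k
  have f: "f w = (\<Sum>m\<in>UNIV. co w m *\<^sub>R f (b m))" for w
  proof -
    have "f w = f (\<Sum>m\<in>UNIV. co w m *\<^sub>R b m)" by (simp only: expand)
    also have "\<dots> = (\<Sum>m\<in>UNIV. co w m *\<^sub>R f (b m))"
      by (simp add: linear_sum[OF assms(1)] linear_scale[OF assms(1)])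
    finally show ?thesis .
  qed
  have "co (f (rpart l v)) k = (\<Sum>m\<in>UNIV. of_rat (l (co v m)) * co (f (b m)) k)"
    by (subst f) (simp add: co_sum)
  also have "\<dots> = (\<Sum>m\<in>UNIV. of_rat (l (co (f (b m)) k * co v m)))"
    using assms(2)[OF b_LatQ] by (intro sum.cong refl) (simp add: ratlin_mult[OF assms(3)] LatQ_def)
  also have "\<dots> = co (rpart l (f v)) k"
    by (subst f) (simp add: co_sum ratlin_sum[OF assms(3)] of_rat_sum mult.commute)
  finally show "co (f (rpart l v)) k = co (rpart l (f v)) k" .
qed

text \<open>Every vector is thus a real combination of rational ones that inherit its rational
  linear conditions, such as lying in the kernel of an endomorphism.\<close>

lemma rpart_decomp:
  "\<exists>(F::real set) l. finite F \<and> (\<forall>a. ratlin (l a)) \<and> v = (\<Sum>a\<in>F. a *\<^sub>R rpart (l a) v)"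
proof -
  have "finite (range (co v))" by simp
  from ratlin_coords[OF this] obtain F l where F: "finite F" "\<forall>a. ratlin (l a)"
    "\<forall>c\<in>range (co v). c = (\<Sum>a\<in>F. of_rat (l a c) *\<^sub>R (a::real))" by blast
  have "co v k = co (\<Sum>a\<in>F. a *\<^sub>R rpart (l a) v) k" for k
  proof -
    have "co (\<Sum>a\<in>F. a *\<^sub>R rpart (l a) v) k = (\<Sum>a\<in>F. of_rat (l a (co v k)) *\<^sub>R a)"
      by (simp add: co_sum mult.commute)
    also have "\<dots> = co v k" by (rule F(3)[rule_format, symmetric]) simp
    finally show ?thesis by simp
  qed
  then have "v = (\<Sum>a\<in>F. a *\<^sub>R rpart (l a) v)" by (rule co_eqI)
  then show ?thesis using F(1,2) by blast
qed

lemma span_LatQ: "v \<in> span LatQ"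
proof -
  have "(\<Sum>k\<in>UNIV. co v k *\<^sub>R b k) \<in> span LatQ" by (intro span_sum span_scale span_base b_LatQ)
  then show ?thesis by (simp only: expand)
qed

text \<open>A bijective linear map that preserves the rational span of the lattice has an inverse
  preserving it: the rational part of a preimage of a rational vector is again a preimage.\<close>

lemma LatQ_preimage:
  assumes "linear f" "\<And>v. v \<in> LatQ \<Longrightarrow> f v \<in> LatQ" "inj f" "f u \<in> LatQ"
  shows "u \<in> LatQ"
proof -
  obtain l :: "real \<Rightarrow> rat" where l: "ratlin l" "l 1 = 1" using ratlin_exists by blast
  have "f (rpart l u) = f u"
    using rpart_linear_commute[OF assms(1,2) l(1)] rpart_fixed[OF assms(4) l] by simp
  then have "rpart l u = u" using assms(3) by (simp add: injD)
  then show ?thesis using rpart_LatQ by metis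
qed

end

text \<open>The rank is defined by a rational span, so it counts the integral basis of the discrete
  group. That basis is independent over \<real>, and \<open>2 g\<close> independent vectors are a
  real basis of the whole space.\<close>

lemma torus_lattice_coords:
  fixes \<Lambda> :: "(complex ^ 'g) set"
  assumes "complex_torus \<Lambda>"
  shows "\<exists>(b :: 'g + 'g \<Rightarrow> complex ^ 'g) co. lattice_coords b co \<and>
           \<Lambda> = lattice_coords.Lat co \<and> rational_lattice \<Lambda> = lattice_coords.LatQ co"
proof -
  have sg: "subgroup \<Lambda> vec_group" and disc: "discrete \<Lambda>" and
    dimQ: "ratV.dim \<Lambda> = 2 * vec.dim (UNIV :: (complex ^ 'g) set)"
    using assms by (auto simp: complex_torus_def is_lattice_def)
  have zero: "0 \<in> \<Lambda>" using subgroup.one_closed[OF sg] by (simp add: vec_group_def)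
  have add: "x + y \<in> \<Lambda>" if "x \<in> \<Lambda>" "y \<in> \<Lambda>" for x y
    using subgroup.m_closed[OF sg that] by (simp add: vec_group_def)
  have grp: "Group.group (vec_group :: (complex ^ 'g) monoid)"
    by (rule groupI) (auto simp: vec_group_def add.assoc intro: exI[of _ "- x" for x])
  have neg: "- x \<in> \<Lambda>" if "x \<in> \<Lambda>" for x
  proof -
    have "inv\<^bsub>vec_group\<^esub> x = - x"
      using grp by (intro group.inv_equality) (auto simp: vec_group_def)
    then show ?thesis using subgroup.m_inv_closed[OF sg that] by simp
  qed
  have sub: "x - y \<in> \<Lambda>" if "x \<in> \<Lambda>" "y \<in> \<Lambda>" for x y using add[OF that(1) neg[OF that(2)]] by simp
  have fin: "finite {x \<in> \<Lambda>. norm x \<le> r}" for r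
    using zero sub disc by (rule discrete_subgroup_finite_bounded)
  have "\<exists>B \<subseteq> \<Lambda>. independent B \<and> span B = span \<Lambda> \<and>
      (\<forall>x\<in>\<Lambda>. \<exists>c::complex ^ 'g \<Rightarrow> int. x = (\<Sum>b\<in>B. of_int (c b) *\<^sub>R b))"
    using zero sub fin by (rule discrete_subgroup_basis)
  then obtain B where B: "B \<subseteq> \<Lambda>" "independent B" "span B = span \<Lambda>"
    "\<forall>x\<in>\<Lambda>. \<exists>c::complex ^ 'g \<Rightarrow> int. x = (\<Sum>b\<in>B. of_int (c b) *\<^sub>R b)" by blast
  have finB: "finite B" using B(2) independent_imp_finite by blast
  have indQ: "ratV.independent B"
    unfolding ratV.dependent_explicit
  proof (clarify)
    fix t u v assume t: "finite t" "t \<subseteq> B" "(\<Sum>v\<in>t. real_of_rat (u v) *\<^sub>R v) = 0" "v \<in> t" "u v \<noteq> 0"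
    have "real_of_rat (u v) = 0"
      using independentD[OF B(2) t(1,2), of "\<lambda>v. real_of_rat (u v)"] t(3,4) by simp
    then show False using t(5) by simp
  qed
  have ratspan: "x \<in> ratV.span B" if "x \<in> \<Lambda>" for x
  proof -
    obtain c::"complex ^ 'g \<Rightarrow> int" where c: "x = (\<Sum>b\<in>B. of_int (c b) *\<^sub>R b)" using B(4) \<open>x \<in> \<Lambda>\<close> by blast
    have "(\<Sum>b\<in>B. real_of_rat (of_int (c b)) *\<^sub>R b) \<in> ratV.span B"
      by (intro ratV.span_sum ratV.span_scale ratV.span_base)
    then show ?thesis by (simp add: c)
  qed
  have "ratV.dim \<Lambda> = card B" using B(1) ratspan indQ by (intro ratV.dim_unique) auto
  then have card: "card B = 2 * CARD('g)" using dimQ by (simp add: card_cart_basis)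
  have "dim (span B) = DIM(complex ^ 'g)" using B(2) card by (simp add: dim_eq_card_independent)
  then have spanB: "span B = UNIV" by (metis dim_eq_full span_span)
  have "card B = CARD('g + 'g)" using card by simp
  then obtain b :: "'g + 'g \<Rightarrow> complex ^ 'g" where b: "bij_betw b UNIV B"
    using finB finite_same_card_bij[of "UNIV :: ('g + 'g) set" B] by auto
  define co where "co = (\<lambda>v k. representation B v (b k))"
  have bB: "b k \<in> B" for k using b bij_betwE by blast
  have binj: "b k = b l \<longleftrightarrow> k = l" for k l using b by (metis UNIV_I bij_betw_inv_into_left)
  interpret lattice_coords b co
  proof (rule lattice_coords.intro)
    show "linear (\<lambda>v. co v k)" for k unfolding co_def
      using spanB B(2) by (intro linearI) (simp_all add: representation_add representation_scale)
    show "(\<Sum>k\<in>UNIV. co v k *\<^sub>R b k) = v" for v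
      using sum_representation_eq[OF B(2) _ finB order_refl, of v] spanB
      by (simp add: co_def sum.reindex_bij_betw[OF b, of "\<lambda>x. representation B v x *\<^sub>R x"])
    show "co (b k) l = (if k = l then 1 else 0)" for k l
      using representation_basis[OF B(2) bB] binj by (auto simp: co_def)
  qed
  have Lat: "\<Lambda> = Lat"
  proof safe
    fix x assume "x \<in> \<Lambda>"
    then obtain c::"complex ^ 'g \<Rightarrow> int" where c: "x = (\<Sum>b\<in>B. of_int (c b) *\<^sub>R b)" using B(4) by blast
    have "x = (\<Sum>k\<in>UNIV. of_int (c (b k)) *\<^sub>R b k)"
      unfolding c using sum.reindex_bij_betw[OF b, of "\<lambda>x. of_int (c x) *\<^sub>R x"] by simp
    then show "x \<in> Lat" by (simp add: Lat_def)
  next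
    fix x assume x: "x \<in> Lat"
    have nat: "of_nat k *\<^sub>R y \<in> \<Lambda>" if "y \<in> \<Lambda>" for k y
      by (induction k) (auto simp: zero algebra_simps intro: add that)
    have int: "of_int k *\<^sub>R y \<in> \<Lambda>" if "y \<in> \<Lambda>" for k y
    proof (cases "k \<ge> 0")
      case True then show ?thesis using nat[OF that, of "nat k"] by simp
    next
      case False then show ?thesis using neg[OF nat[OF that, of "nat (- k)"]] by simp
    qed
    have sum: "(\<Sum>i\<in>I. f i) \<in> \<Lambda>" if "\<And>i. i \<in> I \<Longrightarrow> f i \<in> \<Lambda>" for I :: "('g + 'g) set" and f
      using that by (induction I rule: infinite_finite_induct) (auto intro: add simp: zero)
    show "x \<in> \<Lambda>"
    proof -
      have "(\<Sum>k\<in>UNIV. co x k *\<^sub>R b k) \<in> \<Lambda>"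
      proof (rule sum)
      fix k
      obtain z where "co x k = of_int z" using x by (auto simp: Lat_def elim!: allE[of _ k] Ints_cases)
      then show "co x k *\<^sub>R b k \<in> \<Lambda>" using int[of "b k" z] bB[of k] B(1) by auto
      qed
      then show ?thesis by (simp only: expand)
    qed
  qed
  have "rational_lattice \<Lambda> = LatQ"
  proof
    have "ratV.subspace LatQ"
      by (auto simp: ratV.subspace_def intro: LatQ_add LatQ_scale)
    then show "rational_lattice \<Lambda> \<subseteq> LatQ"
      unfolding rational_lattice_def Lat using Lat_LatQ by (intro ratV.span_minimal) auto
    show "LatQ \<subseteq> rational_lattice \<Lambda>"
    proof
      fix x assume x: "x \<in> LatQ"
      have "co x k *\<^sub>R b k \<in> ratV.span \<Lambda>" for k
        using x ratV.span_scale[OF ratV.span_base[of "b k" \<Lambda>]]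
        by (auto simp: LatQ_def Lat elim!: allE[of _ k] Rats_cases)
      then have "(\<Sum>k\<in>UNIV. co x k *\<^sub>R b k) \<in> ratV.span \<Lambda>" by (intro ratV.span_sum) auto
      then show "x \<in> rational_lattice \<Lambda>" by (simp add: expand rational_lattice_def)
    qed
  qed
  then show ?thesis using Lat lattice_coords_axioms by blast
qed

section \<open>The Hodge structure and simplicity\<close>

lemma scaleR_eq_vector_scale: "r *\<^sub>R (v :: complex ^ 'n) = of_real r *s v"
  by (simp add: vec_eq_iff complex_eq_iff)

lemma of_real_of_rat: "of_real (of_rat q) = (of_rat q :: complex)"
  by (cases q) (simp add: of_rat_rat)

lemma sum_fun2: "(\<Sum>a\<in>F. g a) v w = (\<Sum>a\<in>F. (g a :: 'a \<Rightarrow> 'b \<Rightarrow> 'c::comm_monoid_add) v w)"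
  by (induction F rule: infinite_finite_induct) auto

lemmas scaleR_complex = scaleR_conv_of_real[where 'a = complex]

lemma linear_matrix_vector_complex [intro, simp]:
  "linear (\<lambda>v. (A :: complex ^ 'n ^ 'm) *v v)"
  by (rule linearI) (simp_all add: matrix_vector_right_distrib scaleR_eq_vector_scale vector_scalar_commute)

lemma linear_vector_scale [intro, simp]: "linear (\<lambda>v. c *s (v :: complex ^ 'n))"
  by (rule linearI) (simp_all add: scaleR_eq_vector_scale vector_add_ldistrib vector_smult_assoc mult.commute)

text \<open>Cohomology classes live on the rational lattice, whereas \<open>\<i>\<close> acts only
  on the whole space. The argument therefore uses real-bilinear extensions of the classes;
  \<open>restrict_form_inj\<close> shows that restriction loses nothing.\<close>

definition real_form :: "(complex ^ 'g \<Rightarrow> complex ^ 'g \<Rightarrow> complex) \<Rightarrow> bool" where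
  "real_form f \<longleftrightarrow> (\<forall>w. linear (\<lambda>v. f v w)) \<and> (\<forall>v. linear (f v)) \<and> (\<forall>v. f v v = 0)"

definition holo_form :: "(complex ^ 'g \<Rightarrow> complex ^ 'g \<Rightarrow> complex) \<Rightarrow> bool" where
  "holo_form B \<longleftrightarrow> semibilinear id id B \<and> (\<forall>v. B v v = 0)"

lemma real_form_linear: "real_form f \<Longrightarrow> linear (\<lambda>v. f v w)" "real_form f \<Longrightarrow> linear (f v)"
  by (auto simp: real_form_def)

lemma real_form_add1: "real_form f \<Longrightarrow> f (u + v) w = f u w + f v w"
  and real_form_add2: "real_form f \<Longrightarrow> f w (u + v) = f w u + f w v"
  using linear_add[OF real_form_linear(1)] linear_add[OF real_form_linear(2)] by blast+

lemma real_form_scale1: "real_form f \<Longrightarrow> f (r *\<^sub>R v) w = of_real r * f v w"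
  and real_form_scale2: "real_form f \<Longrightarrow> f v (r *\<^sub>R w) = of_real r * f v w"
  using linear_scale[OF real_form_linear(1), of f r v w] linear_scale[OF real_form_linear(2), of f v r w]
  by (simp_all add: scaleR_complex)

lemma real_form_neg1: "real_form f \<Longrightarrow> f (- v) w = - f v w"
  and real_form_neg2: "real_form f \<Longrightarrow> f v (- w) = - f v w"
  using linear_neg[OF real_form_linear(1)] linear_neg[OF real_form_linear(2)] by blast+

lemma real_form_refl: "real_form f \<Longrightarrow> f v v = 0"
  by (simp add: real_form_def)

lemma real_form_skew:
  assumes "real_form f" shows "f v w = - f w v"
proof -
  have "f (v + w) (v + w) = f v v + f v w + (f w v + f w w)"
    using assms by (simp add: real_form_add1 real_form_add2)
  then show ?thesis using assms by (simp add: real_form_refl add_eq_0_iff)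
qed

lemma real_formI:
  assumes "\<And>u v w. f (u + v) w = f u w + f v w" "\<And>r v w. f (r *\<^sub>R v) w = of_real r * f v w"
    and "\<And>v w. f v w = - f w v"
  shows "real_form f"
proof -
  have "f w (u + v) = f w u + f w v" "f w (r *\<^sub>R v) = of_real r * f w v" for u v w r
    by (simp_all only: assms(3)[of w] assms(1,2) minus_add_distrib mult_minus_right)
  moreover have "f v v = 0" for v using assms(3)[of v v] by simp
  ultimately show ?thesis using assms(1,2)
    by (auto simp: real_form_def scaleR_complex intro!: linearI)
qed

lemma holo_form_add1: "holo_form B \<Longrightarrow> B (u + v) w = B u w + B v w"
  and holo_form_add2: "holo_form B \<Longrightarrow> B w (u + v) = B w u + B w v"
  and holo_form_scale1: "holo_form B \<Longrightarrow> B (c *s v) w = c * B v w"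
  and holo_form_scale2: "holo_form B \<Longrightarrow> B v (c *s w) = c * B v w"
  and holo_form_refl: "holo_form B \<Longrightarrow> B v v = 0"
  by (auto simp: holo_form_def semibilinear_def)

lemma holo_form_real_form: "holo_form B \<Longrightarrow> real_form B"
  by (auto simp: real_form_def scaleR_eq_vector_scale scaleR_complex holo_form_add1 holo_form_add2
      holo_form_scale1 holo_form_scale2 holo_form_refl intro!: linearI)

lemma real_form_lincomb:
  assumes "real_form f" "real_form f'"
  shows "real_form (\<lambda>v w. c * f v w + c' * f' v w)"
proof (rule real_formI)
  show "c * f (u + v) w + c' * f' (u + v) w = c * f u w + c' * f' u w + (c * f v w + c' * f' v w)"
    "c * f (r *\<^sub>R v) w + c' * f' (r *\<^sub>R v) w = of_real r * (c * f v w + c' * f' v w)" for u v w r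
    using assms by (simp_all add: real_form_add1 real_form_scale1 algebra_simps)
  show "c * f v w + c' * f' v w = - (c * f w v + c' * f' w v)" for v w
    using real_form_skew[OF assms(1), of v w] real_form_skew[OF assms(2), of v w]
    by (simp add: algebra_simps)
qed

lemma real_form_J:
  assumes "real_form f"
  shows "real_form (\<lambda>v w. f (\<i> *s v) (\<i> *s w))" "real_form (\<lambda>v w. f (\<i> *s v) w + f v (\<i> *s w))"
proof -
  have *: "f (\<i> *s (u + v)) w = f (\<i> *s u) w + f (\<i> *s v) w" "f (\<i> *s (r *\<^sub>R v)) w = of_real r * f (\<i> *s v) w" for u v w r
    using assms linear_scale[OF linear_vector_scale, of \<i> r v]
    by (simp_all add: vector_add_ldistrib real_form_add1 real_form_scale1)
  show "real_form (\<lambda>v w. f (\<i> *s v) (\<i> *s w))"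
    by (intro real_formI * real_form_skew[OF assms])
  show "real_form (\<lambda>v w. f (\<i> *s v) w + f v (\<i> *s w))"
  proof (rule real_formI)
    fix u v w :: "complex ^ 'a" and r
    show "f (\<i> *s (u + v)) w + f (u + v) (\<i> *s w) = f (\<i> *s u) w + f u (\<i> *s w) + (f (\<i> *s v) w + f v (\<i> *s w))"
      by (simp add: * real_form_add1[OF assms])
    show "f (\<i> *s (r *\<^sub>R v)) w + f (r *\<^sub>R v) (\<i> *s w) = of_real r * (f (\<i> *s v) w + f v (\<i> *s w))"
      by (simp add: * real_form_scale1[OF assms] algebra_simps)
    show "f (\<i> *s v) w + f v (\<i> *s w) = - (f (\<i> *s w) v + f w (\<i> *s v))"
      using real_form_skew[OF assms, of "\<i> *s v" w] real_form_skew[OF assms, of v "\<i> *s w"] by simp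
  qed
qed

lemma complex_scale_decomp: "c *s v = Re c *\<^sub>R v + Im c *\<^sub>R (\<i> *s (v :: complex ^ 'n))"
  by (simp add: vec_eq_iff complex_eq_iff)

lemma semibilinearI_id:
  assumes "real_form f" "\<And>v w. f (\<i> *s v) w = \<i> * f v w"
  shows "holo_form f"
proof -
  have 1: "f (c *s v) w = c * f v w" for c v w
    using assms by (simp add: complex_scale_decomp[of c v] real_form_add1 real_form_scale1)
      (metis (no_types, lifting) complex_eq distrib_right mult.assoc mult.commute)
  have 2: "f v (c *s w) = c * f v w" for c v w
    using 1[of c w v] real_form_skew[OF assms(1), of v] by simp
  show ?thesis using assms(1) 1 2
    by (auto simp: holo_form_def semibilinear_def real_form_add1 real_form_add2 real_form_refl)
qed

lemma semibilinearI_cnj: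
  assumes "real_form f" "\<And>v w. f (\<i> *s v) w = - \<i> * f v w"
  shows "semibilinear cnj cnj f \<and> (\<forall>v. f v v = 0)"
proof -
  have 1: "f (c *s v) w = cnj c * f v w" for c v w
    using assms by (simp add: complex_scale_decomp[of c v] real_form_add1 real_form_scale1)
      (simp add: complex_eq_iff algebra_simps)
  have 2: "f v (c *s w) = cnj c * f v w" for c v w
    using 1[of c w v] real_form_skew[OF assms(1), of v] by simp
  show ?thesis using assms(1) 1 2
    by (auto simp: semibilinear_def real_form_add1 real_form_add2 real_form_refl)
qed

text \<open>The coefficients project onto the eigenspaces of multiplication by \<open>\<i>\<close>.\<close>

lemma hodge_components:
  assumes "real_form (f :: complex ^ 'g \<Rightarrow> complex ^ 'g \<Rightarrow> complex)"
  defines "g \<equiv> \<lambda>v w. f (\<i> *s v) (\<i> *s w)" and "h \<equiv> \<lambda>v w. f (\<i> *s v) w + f v (\<i> *s w)"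
  shows "holo_form (\<lambda>v w. 1 * (1/4 * f v w + (-1/4) * g v w) + (- \<i> / 4) * h v w)" (is ?A)
    and "\<exists>B. semibilinear id cnj B \<and> (\<lambda>v w. 1/2 * f v w + 1/2 * g v w) = (\<lambda>v w. B v w - B w v)" (is ?B)
    and "semibilinear cnj cnj (\<lambda>v w. 1 * (1/4 * f v w + (-1/4) * g v w) + (\<i> / 4) * h v w) \<and>
          (\<forall>v. 1 * (1/4 * f v v + (-1/4) * g v v) + (\<i> / 4) * h v v = 0)" (is ?C)
proof -
  note f = assms(1)
  have g: "real_form g" and h: "real_form h" using real_form_J[OF f] by (simp_all add: g_def h_def)
  have fi: "f (- v) w = - f v w" "f v (- w) = - f v w" for v w
    using real_form_neg1[OF f] real_form_neg2[OF f] by auto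
  show ?A by (rule semibilinearI_id, intro real_form_lincomb f g h)
      (simp add: g_def h_def fi field_simps)
  show ?C by (rule semibilinearI_cnj, intro real_form_lincomb f g h)
      (simp add: g_def h_def fi field_simps)
  show ?B
  proof (intro exI conjI)
    define t where "t = (\<lambda>v w. 1/2 * f v w + 1/2 * g v w)"
    have t: "real_form t" unfolding t_def by (intro real_form_lincomb f g)
    have tJ: "t (\<i> *s v) (\<i> *s w) = t v w" for v w by (simp add: t_def g_def fi)
    have tJ': "t v (\<i> *s w) = - t (\<i> *s v) w" for v w
    proof -
      have "- t v (\<i> *s w) = t (\<i> *s v) w" using tJ[of "\<i> *s v" w] by (simp add: real_form_neg1[OF t])
      then show ?thesis by (metis minus_minus)
    qed
    \<comment> \<open>The usual passage from an alternating form invariant under \<open>\<i>\<close>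
      to a sesquilinear one, normalised so that \<open>t v w = B v w - B w v\<close>.\<close>
    define B where "B = (\<lambda>v w. 1/2 * (t v w - \<i> * t (\<i> *s v) w))"
    have add: "B (u + v) w = B u w + B v w" "B w (u + v) = B w u + B w v" for u v w
      by (simp_all add: B_def real_form_add1[OF t] real_form_add2[OF t] vector_add_ldistrib field_simps)
    have sc: "B (r *\<^sub>R v) w = of_real r * B v w" "B v (r *\<^sub>R w) = of_real r * B v w" for r v w
      using linear_scale[OF linear_vector_scale, of \<i> r v]
      by (simp_all add: B_def real_form_scale1[OF t] real_form_scale2[OF t] algebra_simps)
    have J: "B (\<i> *s v) w = \<i> * B v w" "B v (\<i> *s w) = - \<i> * B v w" for v w
      by (simp_all add: B_def real_form_neg1[OF t] tJ' algebra_simps)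
    have "B (c *s v) w = c * B v w" for c v w
      by (simp add: complex_scale_decomp[of c v] add sc J) (simp add: complex_eq_iff algebra_simps)
    moreover have "B v (c *s w) = cnj c * B v w" for c v w
      by (simp add: complex_scale_decomp[of c w] add sc J) (simp add: complex_eq_iff algebra_simps)
    ultimately show "semibilinear id cnj B" by (simp add: semibilinear_def add)
    have "t v w = B v w - B w v" for v w
      using real_form_skew[OF t, of w v] real_form_skew[OF t, of "\<i> *s w" v]
      by (simp add: B_def tJ' field_simps)
    then show "(\<lambda>v w. 1/2 * f v w + 1/2 * g v w) = (\<lambda>v w. B v w - B w v)"
      by (simp add: t_def fun_eq_iff)
  qed
qed

context lattice_coords
begin

lemma real_form_expand:
  assumes "real_form f"
  shows "f v w = (\<Sum>k\<in>UNIV. \<Sum>l\<in>UNIV. of_real (co v k * co w l) * f (b k) (b l))"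
proof -
  have "f v w = f (\<Sum>k\<in>UNIV. co v k *\<^sub>R b k) (\<Sum>l\<in>UNIV. co w l *\<^sub>R b l)" by (simp only: expand)
  also have "\<dots> = (\<Sum>k\<in>UNIV. of_real (co v k) * f (b k) (\<Sum>l\<in>UNIV. co w l *\<^sub>R b l))"
    by (simp add: linear_sum[OF real_form_linear(1)[OF assms]] real_form_scale1[OF assms])
  also have "\<dots> = (\<Sum>k\<in>UNIV. \<Sum>l\<in>UNIV. of_real (co v k * co w l) * f (b k) (b l))"
    by (simp add: linear_sum[OF real_form_linear(2)[OF assms]] real_form_scale2[OF assms] sum_distrib_left mult.assoc)
  finally show ?thesis .
qed

lemma real_form_eqI:
  assumes "real_form f" "real_form f'" "\<And>k l. f (b k) (b l) = f' (b k) (b l)"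
  shows "f = f'"
proof (intro ext)
  fix v w
  have "f v w = (\<Sum>k\<in>UNIV. \<Sum>l\<in>UNIV. of_real (co v k * co w l) * f (b k) (b l))"
    by (rule real_form_expand[OF assms(1)])
  also have "\<dots> = (\<Sum>k\<in>UNIV. \<Sum>l\<in>UNIV. of_real (co v k * co w l) * f' (b k) (b l))"
    by (simp add: assms(3))
  also have "\<dots> = f' v w" by (rule real_form_expand[OF assms(2), symmetric])
  finally show "f v w = f' v w" .
qed

text \<open>The values of \<open>f\<close> on the lattice basis are replaced by their images under
  \<open>l\<close>, and the result is extended bilinearly. Composing \<open>l\<close> with
  \<open>f\<close> everywhere would destroy real bilinearity; on \<open>LatQ\<close> both
  agree.\<close>

definition ratform :: "(complex \<Rightarrow> rat) \<Rightarrow> (complex ^ 'g \<Rightarrow> complex ^ 'g \<Rightarrow> complex)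
    \<Rightarrow> complex ^ 'g \<Rightarrow> complex ^ 'g \<Rightarrow> complex" where
  "ratform l f v w = (\<Sum>k\<in>UNIV. \<Sum>m\<in>UNIV. of_real (co v k * co w m) * of_rat (l (f (b k) (b m))))"

lemma ratform_real_form:
  assumes "real_form f" "ratlin l"
  shows "real_form (ratform l f)"
proof (rule real_formI)
  fix u v w r
  show "ratform l f (u + v) w = ratform l f u w + ratform l f v w"
    by (simp add: ratform_def sum.distrib algebra_simps)
  show "ratform l f (r *\<^sub>R v) w = of_real r * ratform l f v w"
    by (simp add: ratform_def sum_distrib_left algebra_simps)
  have *: "of_rat (l (f (b k) (b m))) = - (of_rat (l (f (b m) (b k))) :: complex)" for k m
    using real_form_skew[OF assms(1), of "b k" "b m"] ratlin_minus[OF assms(2)] by (simp add: of_rat_minus)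
  have "ratform l f w v = (\<Sum>k\<in>UNIV. \<Sum>m\<in>UNIV. - (of_real (co v m * co w k) * of_rat (l (f (b m) (b k)))))"
    unfolding ratform_def
  proof (intro sum.cong refl)
    fix k m
    show "of_real (co w k * co v m) * of_rat (l (f (b k) (b m))) =
        - (of_real (co v m * co w k) * of_rat (l (f (b m) (b k))) :: complex)"
      using *[of k m] by (simp add: mult.commute)
  qed
  also have "\<dots> = - ratform l f v w"
    unfolding ratform_def by (subst sum.swap) (simp add: sum_negf)
  finally show "ratform l f v w = - ratform l f w v" by simp
qed

lemma ratform_b [simp]: "ratform l f (b k) (b m) = of_rat (l (f (b k) (b m)))"
proof -
  have "ratform l f (b k) (b m) = (\<Sum>k'\<in>UNIV. \<Sum>m'\<in>UNIV.
      if k' = k then if m' = m then of_rat (l (f (b k') (b m'))) else 0 else 0)"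
    unfolding ratform_def co_b by (intro sum.cong refl) auto
  also have "\<dots> = of_rat (l (f (b k) (b m)))" by (simp add: sum.If_cases)
  finally show ?thesis .
qed

lemma ratform_LatQ:
  assumes "real_form f" "ratlin l" "v \<in> LatQ" "w \<in> LatQ"
  shows "ratform l f v w = of_rat (l (f v w))"
proof -
  have *: "of_rat (l (of_real x * y)) = of_real x * (of_rat (l y) :: complex)" if "x \<in> \<rat>" for x y
  proof -
    obtain q where "x = of_rat q" using \<open>x \<in> \<rat>\<close> by (rule Rats_cases)
    then show ?thesis using ratlin_scale[OF assms(2), of q y]
      by (simp add: scaleR_complex of_rat_mult of_real_of_rat)
  qed
  have "of_rat (l (f v w)) = (\<Sum>k\<in>UNIV. \<Sum>m\<in>UNIV. of_rat (l (of_real (co v k * co w m) * f (b k) (b m))) :: complex)"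
    by (simp add: real_form_expand[OF assms(1), of v w] ratlin_sum[OF assms(2)] of_rat_sum)
  also have "\<dots> = ratform l f v w"
    unfolding ratform_def using assms(3,4) by (intro sum.cong refl *) (simp add: LatQ_def)
  finally show ?thesis by simp
qed

end

section \<open>The dichotomy for families of forms\<close>

locale torus_coords = lattice_coords b co
  for b :: "'k::finite \<Rightarrow> complex ^ 'g" and co +
  fixes \<Lambda> :: "(complex ^ 'g) set"
  assumes \<Lambda>_Lat: "\<Lambda> = Lat" and ratlat: "rational_lattice \<Lambda> = LatQ"
begin

lemma restrict_form_inj:
  assumes "real_form f" "real_form f'" "restrict_form \<Lambda> f = restrict_form \<Lambda> f'"
  shows "f = f'"
proof (rule real_form_eqI[OF assms(1,2)])
  fix k l
  show "f (b k) (b l) = f' (b k) (b l)"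
    using fun_cong[OF fun_cong[OF assms(3)], of "b k" "b l"] by (simp add: restrict_form_def ratlat)
qed

lemma restrict_form_lincomb:
  "restrict_form \<Lambda> (\<lambda>v w. c * f v w + c' * f' v w) =
     (\<lambda>v w. c * restrict_form \<Lambda> f v w) + (\<lambda>v w. c' * restrict_form \<Lambda> f' v w)"
  by (simp add: restrict_form_def fun_eq_iff)

lemma restrict_form_H2:
  assumes "real_form f" "\<And>k l. f (b k) (b l) \<in> \<rat>"
  shows "restrict_form \<Lambda> f \<in> H2 \<Lambda> \<rat>"
proof -
  have r: "of_real x \<in> (\<rat> :: complex set)" if "x \<in> \<rat>" for x
    using that by (auto elim!: Rats_cases simp: of_real_of_rat)
  have rat: "f v w \<in> \<rat>" if "v \<in> LatQ" "w \<in> LatQ" for v w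
    unfolding real_form_expand[OF assms(1), of v w]
    using that by (intro Rats_sum Rats_mult r assms(2)) (auto simp: LatQ_def)
  have sc: "of_rat q * x = of_real (of_rat q) * x" for q and x :: complex
    by (simp add: of_real_of_rat)
  show ?thesis
    unfolding H2_def restrict_form_def ratlat
    by (auto simp: rat LatQ_add LatQ_scale real_form_refl[OF assms(1)] real_form_add1[OF assms(1)]
        real_form_add2[OF assms(1)] real_form_scale1[OF assms(1)] real_form_scale2[OF assms(1)] sc)
qed

text \<open>\<open>P\<close> describes a complex subspace of forms. Closure under
  \<open>ratform\<close> means that it is spanned by rational forms, and closure under the two
  operations of \<open>\<i>\<close> that it contains the three Hodge components of each member. So
  its rational part is a Hodge substructure, to which 2-simplicity applies.\<close>

lemma hodge_dichotomy:
  assumes "two_simple \<Lambda>"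
    and P_lin: "\<And>f f' c c'. P f \<Longrightarrow> P f' \<Longrightarrow> P (\<lambda>v w. c * f v w + c' * f' v w)"
    and P_J: "\<And>f. real_form f \<Longrightarrow> P f \<Longrightarrow> P (\<lambda>v w. f (\<i> *s v) (\<i> *s w))"
      "\<And>f. real_form f \<Longrightarrow> P f \<Longrightarrow> P (\<lambda>v w. f (\<i> *s v) w + f v (\<i> *s w))"
    and P_rat: "\<And>f l. real_form f \<Longrightarrow> P f \<Longrightarrow> ratlin l \<Longrightarrow> P (ratform l f)"
    and P_0: "P (\<lambda>v w. 0)"
  shows "(\<forall>B. holo_form B \<and> P B \<longrightarrow> B = (\<lambda>v w. 0)) \<or> (\<forall>B. holo_form B \<longrightarrow> P B)"
proof -
  define S where "S = {restrict_form \<Lambda> f | f. real_form f \<and> P f}"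
  define H where "H = S \<inter> H2 \<Lambda> \<rat>"
  have S_I: "restrict_form \<Lambda> f \<in> S" if "real_form f" "P f" for f
    using that by (auto simp: S_def)
  have zero_form: "real_form (\<lambda>v w. 0)" by (rule real_formI) auto
  have zero_res: "restrict_form \<Lambda> (\<lambda>v w. 0) = 0" by (simp add: restrict_form_def fun_eq_iff)
  have S_0: "0 \<in> S" using S_I[OF zero_form P_0] by (simp add: zero_res)
  have S_lin: "(\<lambda>v w. c * x v w) + (\<lambda>v w. c' * y v w) \<in> S" if "x \<in> S" "y \<in> S" for c c' x y
    using that S_I[OF real_form_lincomb P_lin]
    by (auto simp: S_def restrict_form_lincomb[symmetric])
  have S_add: "x + y \<in> S" if "x \<in> S" "y \<in> S" for x y
    using S_lin[OF that, of 1 1] by simp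
  have S_scale: "(\<lambda>v w. c * x v w) \<in> S" if "x \<in> S" for c x
    using S_lin[OF that S_0, of c 0] by (simp add: plus_fun_def)
  have H2_0: "0 \<in> H2 \<Lambda> \<rat>" using restrict_form_H2[OF zero_form] by (simp add: zero_res)
  have H2_add: "x + y \<in> H2 \<Lambda> \<rat>" if "x \<in> H2 \<Lambda> \<rat>" "y \<in> H2 \<Lambda> \<rat>" for x y
    using that unfolding H2_def by (auto simp: algebra_simps)
  have H2_scale: "(\<lambda>v w. of_rat q * x v w) \<in> H2 \<Lambda> \<rat>" if "x \<in> H2 \<Lambda> \<rat>" for q x
    using that unfolding H2_def by (auto simp: algebra_simps)
  have subH: "rat_forms.subspace H"
    unfolding rat_forms.subspace_def H_def
    using S_0 S_add S_scale H2_0 H2_add H2_scale by auto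
  have subS: "complex_forms.subspace S"
    unfolding complex_forms.subspace_def using S_0 S_add S_scale by auto
  \<comment> \<open>Functionals \<open>l a\<close> split a member \<open>f\<close> into rational
    forms: it is the sum of \<open>a * ratform (l a) f\<close> over finitely many complex numbers
    \<open>a\<close>.\<close>
  have spanH: "complex_forms.span H = S"
  proof
    show "complex_forms.span H \<subseteq> S"
      by (rule complex_forms.span_minimal[OF _ subS]) (auto simp: H_def)
    show "S \<subseteq> complex_forms.span H"
    proof
      fix \<omega> assume "\<omega> \<in> S"
      then obtain f where f: "\<omega> = restrict_form \<Lambda> f" "real_form f" "P f" by (auto simp: S_def)
      have "finite ((\<lambda>(k, l). f (b k) (b l)) ` UNIV)" by simp
      from ratlin_coords[OF this] obtain F l where F: "finite F" "\<And>a. ratlin (l a)"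
        "\<And>k m. f (b k) (b m) = (\<Sum>a\<in>F. of_rat (l a (f (b k) (b m))) *\<^sub>R (a::complex))"
        by (auto simp: image_iff)
      define \<omega>' where "\<omega>' = (\<lambda>a. restrict_form \<Lambda> (ratform (l a) f))"
      have H: "\<omega>' a \<in> H" for a
        unfolding \<omega>'_def H_def
        by (intro IntI S_I ratform_real_form f F(2) P_rat restrict_form_H2) simp
      have "f v w = (\<Sum>a\<in>F. a * ratform (l a) f v w)" for v w
      proof -
        have "f v w = (\<Sum>k\<in>UNIV. \<Sum>m\<in>UNIV. of_real (co v k * co w m) * f (b k) (b m))"
          by (rule real_form_expand[OF f(2)])
        also have "\<dots> = (\<Sum>k\<in>UNIV. \<Sum>m\<in>UNIV. of_real (co v k * co w m) *
            (\<Sum>a\<in>F. of_rat (l a (f (b k) (b m))) *\<^sub>R a))"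
          by (intro sum.cong refl arg_cong2[where f = "(*)"] F(3))
        also have "\<dots> = (\<Sum>k\<in>UNIV. \<Sum>m\<in>UNIV. \<Sum>a\<in>F.
            a * (of_real (co v k * co w m) * of_rat (l a (f (b k) (b m)))))"
          by (simp add: sum_distrib_left scaleR_complex of_real_of_rat algebra_simps)
        also have "\<dots> = (\<Sum>k\<in>UNIV. \<Sum>a\<in>F. \<Sum>m\<in>UNIV.
            a * (of_real (co v k * co w m) * of_rat (l a (f (b k) (b m)))))"
          by (intro sum.cong refl sum.swap)
        also have "\<dots> = (\<Sum>a\<in>F. a * ratform (l a) f v w)"
          by (subst sum.swap) (simp add: ratform_def sum_distrib_left)
        finally show ?thesis .
      qed
      then have "\<omega> v w = (\<Sum>a\<in>F. a * \<omega>' a v w)" for v w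
        by (cases "v \<in> rational_lattice \<Lambda> \<and> w \<in> rational_lattice \<Lambda>")
           (auto simp: f(1) \<omega>'_def restrict_form_def)
      then have "\<omega> = (\<Sum>a\<in>F. (\<lambda>v w. a * \<omega>' a v w))"
        by (simp add: fun_eq_iff sum_fun2)
      also have "\<dots> \<in> complex_forms.span H"
        by (intro complex_forms.span_sum complex_forms.span_scale complex_forms.span_base H)
      finally show "\<omega> \<in> complex_forms.span H" .
    qed
  qed
  have "hodge_substructure \<Lambda> H"
    unfolding hodge_substructure_def
  proof (intro conjI ballI subH)
    show "H \<subseteq> H2 \<Lambda> \<rat>" by (simp add: H_def)
    fix \<omega> assume "\<omega> \<in> complex_forms.span H"
    then obtain f where f: "\<omega> = restrict_form \<Lambda> f" "real_form f" "P f" by (auto simp: spanH S_def)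
    define g h where "g = (\<lambda>v w. f (\<i> *s v) (\<i> *s w))" and "h = (\<lambda>v w. f (\<i> *s v) w + f v (\<i> *s w))"
    have gh: "real_form g" "real_form h" "P g" "P h"
      using real_form_J[OF f(2)] P_J[OF f(2,3)] by (simp_all add: g_def h_def)
    let ?a = "\<lambda>v w. 1 * (1/4 * f v w + (-1/4) * g v w) + (- \<i> / 4) * h v w"
    let ?b = "\<lambda>v w. 1/2 * f v w + 1/2 * g v w"
    let ?c = "\<lambda>v w. 1 * (1/4 * f v w + (-1/4) * g v w) + (\<i> / 4) * h v w"
    have comp1: "semibilinear id id ?a \<and> (\<forall>v. ?a v v = 0)"
      using hodge_components(1)[OF f(2)] unfolding g_def h_def holo_form_def .
    have comp2: "\<exists>B. semibilinear id cnj B \<and> ?b = (\<lambda>v w. B v w - B w v)"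
      using hodge_components(2)[OF f(2)] unfolding g_def h_def .
    have comp3: "semibilinear cnj cnj ?c \<and> (\<forall>v. ?c v v = 0)"
      using hodge_components(3)[OF f(2)] unfolding g_def h_def .
    have "restrict_form \<Lambda> ?a \<in> S" "restrict_form \<Lambda> ?b \<in> S" "restrict_form \<Lambda> ?c \<in> S"
      by (intro S_I real_form_lincomb P_lin f gh)+
    moreover have "restrict_form \<Lambda> ?a \<in> H20 \<Lambda>"
      unfolding H20_def by (rule CollectI, rule exI[of _ ?a], rule conjI[OF refl comp1])
    moreover have "restrict_form \<Lambda> ?c \<in> H02 \<Lambda>"
      unfolding H02_def by (rule CollectI, rule exI[of _ ?c], rule conjI[OF refl comp3])
    moreover have "restrict_form \<Lambda> ?b \<in> H11 \<Lambda>"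
    proof -
      obtain B where B: "semibilinear id cnj B" "?b = (\<lambda>v w. B v w - B w v)"
        using comp2 by (elim exE conjE)
      show ?thesis unfolding H11_def B(2) by (rule CollectI, rule exI[of _ B], rule conjI[OF refl B(1)])
    qed
    moreover have "\<omega> = restrict_form \<Lambda> ?a + restrict_form \<Lambda> ?b + restrict_form \<Lambda> ?c"
      by (simp add: f(1) restrict_form_def fun_eq_iff algebra_simps)
    ultimately show "\<exists>\<alpha>\<in>complex_forms.span H \<inter> H20 \<Lambda>. \<exists>\<beta>\<in>complex_forms.span H \<inter> H11 \<Lambda>.
        \<exists>\<gamma>\<in>complex_forms.span H \<inter> H02 \<Lambda>. \<omega> = \<alpha> + \<beta> + \<gamma>"
      unfolding spanH by blast
  qed
  then have *: "S \<inter> H20 \<Lambda> \<noteq> {0} \<longrightarrow> H20 \<Lambda> \<subseteq> S"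
    using assms(1) unfolding two_simple_def spanH[symmetric] by blast
  show ?thesis
  proof (cases "S \<inter> H20 \<Lambda> = {0}")
    case True
    have "B = (\<lambda>v w. 0)" if B: "holo_form B" "P B" for B
    proof -
      have "restrict_form \<Lambda> B \<in> S \<inter> H20 \<Lambda>"
        using S_I[OF holo_form_real_form[OF B(1)] B(2)] B(1) by (auto simp: H20_def holo_form_def)
      then have "restrict_form \<Lambda> B = restrict_form \<Lambda> (\<lambda>v w. 0)" using True zero_res by auto
      then show ?thesis using restrict_form_inj[OF holo_form_real_form[OF B(1)] zero_form] by blast
    qed
    then show ?thesis by blast
  next
    case False
    have "P B" if B: "holo_form B" for B
    proof -
      have "restrict_form \<Lambda> B \<in> S" using * False B by (auto simp: H20_def holo_form_def)
      then obtain f where "restrict_form \<Lambda> B = restrict_form \<Lambda> f" "real_form f" "P f" by (auto simp: S_def)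
      then show ?thesis using restrict_form_inj[OF holo_form_real_form[OF B]] by metis
    qed
    then show ?thesis by blast
  qed
qed

end

section \<open>Rational subspaces and simplicity\<close>

definition wedge :: "(complex ^ 'g \<Rightarrow> complex) \<Rightarrow> (complex ^ 'g \<Rightarrow> complex) \<Rightarrow> complex ^ 'g \<Rightarrow> complex ^ 'g \<Rightarrow> complex" where
  "wedge a c = (\<lambda>v w. a v * c w - a w * c v)"

definition clinear_form :: "(complex ^ 'g \<Rightarrow> complex) \<Rightarrow> bool" where
  "clinear_form a \<longleftrightarrow> (\<forall>v w. a (v + w) = a v + a w) \<and> (\<forall>c v. a (c *s v) = c * a v)"

lemma wedge_holo_form: "clinear_form a \<Longrightarrow> clinear_form c \<Longrightarrow> holo_form (wedge a c)"
  by (simp add: holo_form_def semibilinear_def wedge_def clinear_form_def algebra_simps)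

lemma representation_clinear_form:
  assumes "vec.independent C" "vec.span C = (UNIV :: (complex ^ 'g) set)"
  shows "clinear_form (\<lambda>v. vec.representation C v x)"
  using vec.representation_add[OF assms(1)] vec.representation_scale[OF assms(1)] assms(2)
  by (simp add: clinear_form_def)

lemma mat_mult_vec [simp]: "mat c *v v = c *s (v :: complex ^ 'n)"
  by (simp add: vec_eq_iff matrix_vector_mult_def mat_def if_distrib if_distribR cong: if_cong)

lemma real_form_sum1: "real_form f \<Longrightarrow> f (\<Sum>k\<in>I. x k *\<^sub>R p k) w = (\<Sum>k\<in>I. of_real (x k) * f (p k) w)"
  and real_form_sum2: "real_form f \<Longrightarrow> f v (\<Sum>k\<in>I. x k *\<^sub>R p k) = (\<Sum>k\<in>I. of_real (x k) * f v (p k))"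
  by (simp_all add: linear_sum[OF real_form_linear(1)] linear_sum[OF real_form_linear(2)]
      real_form_scale1 real_form_scale2)

lemma vec_dim_real_le:
  assumes "vec.subspace (W :: (complex ^ 'g) set)"
  shows "dim W \<le> 2 * vec.dim W"
proof -
  obtain C where C: "C \<subseteq> W" "vec.independent C" "W \<subseteq> vec.span C" "card C = vec.dim W"
    using vec.basis_exists by blast
  have fin: "finite C" using C(2) vec.finiteI_independent by blast
  let ?T = "C \<union> (\<lambda>v. \<i> *s v) ` C"
  have "vec.span C \<subseteq> span ?T"
  proof
    fix v assume "v \<in> vec.span C"
    then obtain u where "v = (\<Sum>x\<in>C. u x *s x)" using vec.span_finite[OF fin] by auto
    moreover have "u x *s x \<in> span ?T" if "x \<in> C" for x
      using that by (subst complex_scale_decomp) (intro span_add span_scale span_base, auto)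
    then have "(\<Sum>x\<in>C. u x *s x) \<in> span ?T" by (rule span_sum)
    ultimately show "v \<in> span ?T" by simp
  qed
  then have "dim W \<le> card ?T" using C(3) fin by (intro dim_le_card) auto
  also have "\<dots> \<le> card C + card C" using fin by (intro order_trans[OF card_Un_le] add_left_mono card_image_le)
  finally show ?thesis using C(4) by simp
qed

context lattice_coords
begin

text \<open>A functional that does not vanish on one of the coefficients turns a real relation
  between rational vectors into a nontrivial rational one.\<close>

lemma LatQ_independent:
  assumes "C \<subseteq> LatQ" "ratV.independent C"
  shows "independent C"
  unfolding dependent_explicit
proof (rule notI, elim exE conjE bexE)
  fix T u v0
  assume T: "finite T" "T \<subseteq> C" "(\<Sum>v\<in>T. u v *\<^sub>R v) = 0" and v0: "v0 \<in> T" "u v0 \<noteq> 0"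
  obtain l :: "real \<Rightarrow> rat" where l: "ratlin l" "l (u v0) \<noteq> 0"
  proof -
    have "finite {u v0}" by simp
    from ratlin_coords[OF this] obtain F l where F: "finite F" "\<And>a. ratlin (l a)"
      "u v0 = (\<Sum>a\<in>F. of_rat (l a (u v0)) *\<^sub>R a)" by blast
    have "\<exists>a\<in>F. l a (u v0) \<noteq> 0"
    proof (rule ccontr)
      assume "\<not> ?thesis"
      then have "(\<Sum>a\<in>F. of_rat (l a (u v0)) *\<^sub>R a) = 0" by (intro sum.neutral) auto
      then show False using F(3) v0(2) by linarith
    qed
    then show ?thesis using F(2) that by blast
  qed
  have "(\<Sum>v\<in>T. of_rat (l (u v)) *\<^sub>R v) = 0"
  proof (rule co_eqI)
    fix k
    have "co (\<Sum>v\<in>T. of_rat (l (u v)) *\<^sub>R v) k = (\<Sum>v\<in>T. of_rat (l (u v)) * co v k)"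
      by (simp add: co_sum)
    also have "\<dots> = (\<Sum>v\<in>T. of_rat (l (co v k * u v)))"
    proof (intro sum.cong refl)
      fix v assume "v \<in> T"
      then have "co v k \<in> \<rat>" using T(2) assms(1) by (auto simp: LatQ_def)
      from ratlin_mult[OF l(1) this, of "u v"] show "of_rat (l (u v)) * co v k = of_rat (l (co v k * u v))"
        by simp
    qed
    also have "\<dots> = of_rat (l (co (\<Sum>v\<in>T. u v *\<^sub>R v) k))"
      by (simp add: co_sum ratlin_sum[OF l(1)] of_rat_sum mult.commute)
    also have "\<dots> = co 0 k" by (simp add: T(3) ratlin_0[OF l(1)])
    finally show "co (\<Sum>v\<in>T. of_rat (l (u v)) *\<^sub>R v) k = co 0 k" .
  qed
  then have "l (u v0) = 0"
    using ratV.independentD[OF assms(2) T(1,2), of "\<lambda>v. l (u v)"] v0(1) by blast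
  then show False using l(2) by simp
qed

text \<open>On rational vectors \<open>ratform l f\<close> is \<open>l\<close> applied to
  \<open>f\<close>, hence 0. Rational vectors span both subspaces over \<real>, and bilinearity does
  the rest.\<close>

lemma ratform_vanish:
  assumes f: "real_form f" "ratlin l" and z: "\<And>v w. v \<in> W \<Longrightarrow> w \<in> W' \<Longrightarrow> f v w = 0"
    and W: "W \<subseteq> span (W \<inter> LatQ)" "W' \<subseteq> span (W' \<inter> LatQ)" and vw: "v \<in> W" "w \<in> W'"
  shows "ratform l f v w = 0"
proof -
  note rf = ratform_real_form[OF f]
  have 0: "ratform l f v w = 0" if "v \<in> W \<inter> LatQ" "w \<in> W' \<inter> LatQ" for v w
    using that z[of v w] by (simp add: ratform_LatQ[OF f] ratlin_0[OF f(2)])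
  have 1: "ratform l f v w = 0" if w: "w \<in> W' \<inter> LatQ" and v: "v \<in> span (W \<inter> LatQ)" for v w
    using v by (rule linear_eq_0_on_span[OF real_form_linear(1)[OF rf], rotated]) (rule 0[OF _ w])
  have "ratform l f v w = 0" if v: "v \<in> span (W \<inter> LatQ)" and w: "w \<in> span (W' \<inter> LatQ)" for v w
    using w by (rule linear_eq_0_on_span[OF real_form_linear(2)[OF rf], rotated]) (rule 1[OF _ v])
  then show ?thesis using W vw by blast
qed

end

context torus_coords
begin

lemma vanishing_dichotomy:
  assumes "two_simple \<Lambda>" "vec.subspace W" "vec.subspace W'"
    and "W \<subseteq> span (W \<inter> LatQ)" "W' \<subseteq> span (W' \<inter> LatQ)" 
  shows "(\<forall>B. holo_form B \<and> (\<forall>v\<in>W. \<forall>w\<in>W'. B v w = 0) \<longrightarrow> B = (\<lambda>v w. 0)) \<or>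
         (\<forall>B. holo_form B \<longrightarrow> (\<forall>v\<in>W. \<forall>w\<in>W'. B v w = 0))"
  using vec.subspace_scale[OF assms(2)] vec.subspace_scale[OF assms(3)] ratform_vanish[OF _ _ _ assms(4,5)]
  by (intro hodge_dichotomy[OF assms(1)]) simp_all

text \<open>For a proper nonzero \<open>W\<close> one finds a pair of subspaces on which some
  nonzero holomorphic form vanishes but not all do, against the dichotomy. The pair is
  \<open>W\<close> and \<open>W\<close> if its dimension is at least 2, and \<open>W\<close> and the
  whole space if \<open>W\<close> is a line; in the latter case the nonzero form needs a third basis
  vector.\<close>

lemma rational_subspace_trivial:
  assumes two: "two_simple \<Lambda>" and g: "CARD('g) \<ge> 3" and W: "vec.subspace W" "W \<subseteq> span (W \<inter> LatQ)"
  shows "W = {0} \<or> W = UNIV"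
proof -
  obtain C0 where C0: "C0 \<subseteq> W" "vec.independent C0" "W \<subseteq> vec.span C0" "card C0 = vec.dim W"
    using vec.basis_exists by blast
  define C where "C = vec.extend_basis C0"
  have C: "vec.independent C" "vec.span C = UNIV" "C0 \<subseteq> C"
    using vec.independent_extend_basis[OF C0(2)] vec.span_extend_basis[OF C0(2)] vec.extend_basis_superset[OF C0(2)]
    by (simp_all add: C_def)
  have finC: "finite C" using C(1) vec.finiteI_independent by blast
  have cardC: "card C = CARD('g)"
    using vec.dim_eq_card[OF C(2)[symmetric, THEN trans[rotated]] C(1)] C(2) vec.dim_span_eq_card_independent[OF C(1)]
    by (simp add: card_cart_basis)
  have spanC0: "vec.span C0 = W"
    using C0(1,3) W(1) by (metis subset_antisym vec.span_minimal)
  define \<phi> where "\<phi> = (\<lambda>x v. vec.representation C v x)"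
  have lin: "clinear_form (\<phi> x)" for x
    unfolding \<phi>_def by (rule representation_clinear_form[OF C(1,2)])
  have dual: "\<phi> x y = (if y = x then 1 else 0)" if "y \<in> C" for x y
    using vec.representation_basis[OF C(1) that] by (simp add: \<phi>_def)
  have vanish: "\<phi> x v = 0" if "x \<notin> C0" "v \<in> W" for x v
  proof -
    have "\<phi> x v = vec.representation C0 v x"
      unfolding \<phi>_def using vec.representation_extend[OF C(1) _ C(3), of v] that(2) spanC0 by simp
    then show ?thesis using vec.representation_ne_zero[of C0 v x] that(1) by auto
  qed
  have nz: "wedge (\<phi> x) (\<phi> y) x y = 1" if "x \<in> C" "y \<in> C" "x \<noteq> y" for x y
    using that by (simp add: wedge_def dual)
  have other: "\<exists>y\<in>C. y \<noteq> x \<and> y \<notin> {z}" if "x \<in> C" for x z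
  proof (rule ccontr)
    assume "\<not> ?thesis"
    then have "C \<subseteq> {x, z}" by blast
    then have "card C \<le> card {x, z}" by (intro card_mono) auto
    also have "\<dots> \<le> 2" by (simp add: card_insert_if)
    finally show False using cardC g by simp
  qed
  show ?thesis
  proof (cases "C0 = {} \<or> C0 = C")
    case True
    then show ?thesis using spanC0 C(2) by (auto simp: vec.span_empty)
  next
    case False
    then obtain x0 x where x: "x0 \<in> C0" "x \<in> C" "x \<notin> C0" using C(3) by blast
    show ?thesis
    proof (cases "C0 = {x0}")
      case True
      have U: "UNIV \<subseteq> span (UNIV \<inter> LatQ)" using span_LatQ by auto
      obtain y where y: "y \<in> C" "y \<noteq> x" "y \<noteq> x0" using other[OF x(2), of x0] by auto
      have "wedge (\<phi> x) (\<phi> y) v w = 0" if "v \<in> W" for v w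
        using vanish[OF x(3) that] vanish[of y v] that y(3) True by (simp add: wedge_def)
      moreover have "wedge (\<phi> x) (\<phi> y) \<noteq> (\<lambda>v w. 0)" using nz[OF x(2) y(1)] y(2) by (metis zero_neq_one)
      moreover have "holo_form (wedge (\<phi> x) (\<phi> y))" "holo_form (wedge (\<phi> x0) (\<phi> y))"
        by (intro wedge_holo_form lin)+
      ultimately have "wedge (\<phi> x0) (\<phi> y) x0 y = 0"
        using vanishing_dichotomy[OF two W(1) vec.subspace_UNIV W(2) U] x(1) C0(1) by blast
      then show ?thesis using nz[of x0 y] x(1) C(3) y by auto
    next
      case False
      then obtain y where y: "y \<in> C0" "y \<noteq> x0" using x(1) by blast
      have "wedge (\<phi> x) (\<phi> y) v w = 0" if "v \<in> W" "w \<in> W" for v w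
        using vanish[OF x(3) that(1)] vanish[OF x(3) that(2)] by (simp add: wedge_def)
      moreover have "wedge (\<phi> x) (\<phi> y) \<noteq> (\<lambda>v w. 0)"
        using nz[OF x(2), of y] y(1) x(3) C(3) by (metis subsetD zero_neq_one)
      moreover have "holo_form (wedge (\<phi> x) (\<phi> y))" "holo_form (wedge (\<phi> x0) (\<phi> y))"
        by (intro wedge_holo_form lin)+
      ultimately have "wedge (\<phi> x0) (\<phi> y) x0 y = 0"
        using vanishing_dichotomy[OF two W(1) W(1) W(2) W(2)] x(1) y(1) C0(1) by blast
      then show ?thesis using nz[of x0 y] x(1) C(3) y by auto
    qed
  qed
qed

lemma simple_torusI:
  assumes two: "two_simple \<Lambda>" and g: "CARD('g) \<ge> 3"
  shows "simple_torus \<Lambda>"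
  unfolding simple_torus_def
proof (intro allI impI)
  fix S assume "complex_subtorus \<Lambda> S"
  then obtain W where W: "vec.subspace W" "is_lattice W (W \<inter> \<Lambda>)" and S: "S = torus_proj \<Lambda> ` W"
    by (auto simp: complex_subtorus_def)
  obtain C where C: "C \<subseteq> W \<inter> \<Lambda>" "ratV.independent C" "W \<inter> \<Lambda> \<subseteq> ratV.span C"
    "card C = ratV.dim (W \<inter> \<Lambda>)"
    by (rule ratV.basis_exists)
  have CQ: "C \<subseteq> W \<inter> LatQ" using C(1) Lat_LatQ by (auto simp: \<Lambda>_Lat)
  have ind: "independent C" using LatQ_independent CQ C(2) by blast
  \<comment> \<open>The lattice of the subtorus has full rank, so a rational basis of it already
    spans \<open>W\<close> over \<real>.\<close>
  have "card C = 2 * vec.dim W" using C(4) W(2) by (simp add: is_lattice_def)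
  then have "W \<subseteq> span C"
    using vec_dim_real_le[OF W(1)] ind CQ by (intro card_ge_dim_independent) auto
  then have "W \<subseteq> span (W \<inter> LatQ)" using span_mono[OF CQ] by blast
  then have "W = {0} \<or> W = UNIV" by (rule rational_subspace_trivial[OF two g W(1)])
  moreover have "torus_proj \<Lambda> 0 = \<one>\<^bsub>torus \<Lambda>\<^esub>"
    by (auto simp: torus_proj_def torus_def FactGroup_def r_coset_def vec_group_def)
  moreover have "torus_proj \<Lambda> ` UNIV = carrier (torus \<Lambda>)"
    by (auto simp: torus_proj_def torus_def FactGroup_def RCOSETS_def vec_group_def r_coset_def)
  ultimately show "S = {\<one>\<^bsub>torus \<Lambda>\<^esub>} \<or> S = carrier (torus \<Lambda>)" using S by auto
qed

section \<open>Endomorphisms of the rational lattice\<close>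

lemma scalar_rational:
  assumes two: "two_simple \<Lambda>" and g: "CARD('g) \<ge> 3" and c: "\<And>v. v \<in> LatQ \<Longrightarrow> c *s v \<in> LatQ"
  shows "c \<in> \<rat>"
proof (cases "Im c = 0")
  case True
  obtain k :: 'k where True by blast
  have "Re c *\<^sub>R b k = c *s b k" using True by (simp add: scaleR_eq_vector_scale complex_eq_iff)
  then have "Re c *\<^sub>R b k \<in> LatQ" using c[OF b_LatQ] by simp
  then have "co (Re c *\<^sub>R b k) k \<in> \<rat>" unfolding LatQ_def by blast
  then have "Re c \<in> \<rat>" by (simp add: co_b)
  then obtain q where "Re c = of_rat q" by (rule Rats_cases)
  then have "c = of_rat q" using True by (simp add: complex_eq_iff flip: of_real_of_rat)
  then show ?thesis by simp
next
  case False
  obtain k :: 'k where True by blast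
  let ?x = "b k"
  \<comment> \<open>If \<open>c\<close> is not real, then \<open>?x\<close> and
    \<open>c *s ?x\<close> span the complex line through \<open>?x\<close> over \<real>. That line
    is then a rational subspace, which is impossible as its dimension is 1.\<close>
  define W where "W = range (\<lambda>z. z *s ?x)"
  have x0: "?x \<noteq> 0" using co_b[of k k] by (metis co_0 zero_neq_one)
  have Wspan: "W = vec.span {?x}" by (simp add: W_def vec.span_singleton)
  have W: "vec.subspace W" by (simp add: Wspan vec.subspace_span)
  have "W \<subseteq> span (W \<inter> LatQ)"
  proof
    fix w assume "w \<in> W"
    then obtain z where z: "w = z *s ?x" by (auto simp: W_def)
    have "z = of_real (Re z - Im z / Im c * Re c) + of_real (Im z / Im c) * c"
      using False by (simp add: complex_eq_iff)
    then have "w = (Re z - Im z / Im c * Re c) *\<^sub>R ?x + (Im z / Im c) *\<^sub>R (c *s ?x)"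
      unfolding z scaleR_eq_vector_scale
      by (metis vector_sadd_rdistrib vector_smult_assoc)
    moreover have "?x \<in> W" "c *s ?x \<in> W"
      by (auto simp: W_def image_iff intro: exI[of _ 1])
    ultimately show "w \<in> span (W \<inter> LatQ)"
      using c[OF b_LatQ, of k] by (simp only:) (intro span_add span_scale span_base IntI b_LatQ)
  qed
  from rational_subspace_trivial[OF two g W this] show ?thesis
  proof
    assume "W = {0}"
    then show ?thesis using x0 Wspan vec.span_base[of ?x "{?x}"] by auto
  next
    assume "W = UNIV"
    then have "vec.dim (UNIV :: (complex ^ 'g) set) \<le> card {?x}"
      using Wspan by (metis finite.emptyI finite_insert subset_UNIV vec.dim_le_card)
    then show ?thesis using g by (simp add: card_cart_basis)
  qed
qed

definition EndQ :: "(complex ^ 'g ^ 'g) set" where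
  "EndQ = {A. \<forall>v\<in>LatQ. A *v v \<in> LatQ}"

text \<open>The kernel of \<open>A\<close> is spanned by rational vectors, because taking rational
  parts commutes with \<open>A\<close>; being a proper rational subspace it is 0. This is what makes
  the endomorphism algebra a division algebra.\<close>

lemma EndQ_inj:
  assumes two: "two_simple \<Lambda>" and g: "CARD('g) \<ge> 3" and A: "A \<in> EndQ" "A \<noteq> 0"
  shows "inj ((*v) A)"
proof -
  let ?W = "{v. A *v v = 0}"
  have W: "vec.subspace ?W"
    by (auto simp: vec.subspace_def matrix_vector_right_distrib vector_scalar_commute)
  have "?W \<subseteq> span (?W \<inter> LatQ)"
  proof
    fix v assume "v \<in> ?W"
    then have v: "A *v v = 0" by simp
    obtain F :: "real set" and l where F: "\<And>a. ratlin (l a)" "v = (\<Sum>a\<in>F. a *\<^sub>R rpart (l a) v)"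
      using rpart_decomp[of v] by blast
    have "A *v rpart (l a) v = 0" for a
    proof -
      have "A *v rpart (l a) v = rpart (l a) (A *v v)"
        using A(1) by (intro rpart_linear_commute[OF linear_matrix_vector_complex _ F(1)]) (auto simp: EndQ_def)
      also have "\<dots> = 0" by (simp add: v rpart_def ratlin_0[OF F(1)])
      finally show ?thesis .
    qed
    then have "(\<Sum>a\<in>F. a *\<^sub>R rpart (l a) v) \<in> span (?W \<inter> LatQ)"
      by (intro span_sum span_scale span_base) auto
    then show "v \<in> span (?W \<inter> LatQ)" using F(2) by simp
  qed
  from rational_subspace_trivial[OF two g W this]
  have "?W = {0}"
  proof
    assume "?W = UNIV"
    then have "A *v v = 0 *v v" for v by auto
    then have "A = 0" by (simp add: matrix_eq)
    then show ?thesis using A(2) by simp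
  qed
  show ?thesis
  proof (rule injI)
    fix x y assume "A *v x = A *v y"
    then have "x - y \<in> ?W" by (simp add: matrix_vector_mult_diff_distrib)
    then have "x - y \<in> {0}" using \<open>?W = {0}\<close> by blast
    then show "x = y" by simp
  qed
qed

text \<open>In the other alternative of the dichotomy \<open>A\<close> is self-adjoint for every
  holomorphic form \<open>B\<close>. Then
  \<open>B v (A *v v) = B (A *v v) v = - B v (A *v v)\<close>, so this vanishes for all
  \<open>B\<close>. Hence every \<open>v\<close> is an eigenvector, \<open>A\<close> is a scalar,
  and \<open>scalar_rational\<close> makes the scalar rational.\<close>

lemma EndQ_no_symmetric_form:
  assumes two: "two_simple \<Lambda>" and g: "CARD('g) \<ge> 3" and A: "A \<in> EndQ" "\<And>q. q \<in> \<rat> \<Longrightarrow> A \<noteq> mat q"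
    and B: "holo_form B" "\<And>v w. B (A *v v) w = B v (A *v w)"
  shows "B = (\<lambda>v w. 0)"
proof -
  define P where "P = (\<lambda>f :: complex ^ 'g \<Rightarrow> complex ^ 'g \<Rightarrow> complex. \<forall>v w. f (A *v v) w = f v (A *v w))"
  have "(\<forall>B. holo_form B \<and> P B \<longrightarrow> B = (\<lambda>v w. 0)) \<or> (\<forall>B. holo_form B \<longrightarrow> P B)"
  proof (rule hodge_dichotomy[OF two])
    fix f :: "complex ^ 'g \<Rightarrow> complex ^ 'g \<Rightarrow> complex" and l :: "complex \<Rightarrow> rat"
    assume f: "real_form f" "P f" "ratlin l"
    note rf = ratform_real_form[OF f(1,3)]
    let ?r = "ratform l f"
    have 0: "?r (A *v b k) (b m) = ?r (b k) (A *v b m)" for k m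
    proof -
      have AQ: "A *v b k \<in> LatQ" "A *v b m \<in> LatQ" using A(1) by (simp_all add: EndQ_def)
      show ?thesis using f(2) by (simp add: ratform_LatQ[OF f(1,3)] AQ P_def)
    qed
    have A_expand: "A *v v = (\<Sum>k\<in>UNIV. co v k *\<^sub>R (A *v b k))" for v
    proof -
      have "A *v v = A *v (\<Sum>k\<in>UNIV. co v k *\<^sub>R b k)" by (simp only: expand)
      also have "\<dots> = (\<Sum>k\<in>UNIV. co v k *\<^sub>R (A *v b k))"
        by (simp add: linear_sum[OF linear_matrix_vector_complex] linear_scale[OF linear_matrix_vector_complex])
      finally show ?thesis .
    qed
    have "?r (A *v v) w = ?r v (A *v w)" for v w
    proof -
      have "?r (A *v v) w = ?r (\<Sum>k\<in>UNIV. co v k *\<^sub>R (A *v b k)) (\<Sum>m\<in>UNIV. co w m *\<^sub>R b m)"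
        by (simp only: expand A_expand[of v])
      also have "\<dots> = (\<Sum>k\<in>UNIV. \<Sum>m\<in>UNIV. of_real (co v k) * (of_real (co w m) * ?r (A *v b k) (b m)))"
        by (subst real_form_sum1[OF rf], subst real_form_sum2[OF rf]) (simp only: sum_distrib_left)
      also have "\<dots> = (\<Sum>k\<in>UNIV. \<Sum>m\<in>UNIV. of_real (co v k) * (of_real (co w m) * ?r (b k) (A *v b m)))"
        by (simp only: 0)
      also have "\<dots> = ?r (\<Sum>k\<in>UNIV. co v k *\<^sub>R b k) (\<Sum>m\<in>UNIV. co w m *\<^sub>R (A *v b m))"
        by (subst real_form_sum1[OF rf], subst real_form_sum2[OF rf]) (simp only: sum_distrib_left)
      also have "\<dots> = ?r v (A *v w)" by (simp only: expand A_expand[of w])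
      finally show ?thesis .
    qed
    then show "P (ratform l f)" by (simp add: P_def)
  qed (simp_all add: P_def vector_scalar_commute[symmetric])
  then show ?thesis
  proof
    assume "\<forall>B. holo_form B \<and> P B \<longrightarrow> B = (\<lambda>v w. 0)"
    then show ?thesis using B by (simp add: P_def)
  next
    assume all: "\<forall>B. holo_form B \<longrightarrow> P B"
    have eig: "\<exists>c. A *v v = c *s v" for v
    proof (rule ccontr)
      assume no: "\<nexists>c. A *v v = c *s v"
      then have "v \<noteq> 0" by (metis vec.scale_zero_right matrix_vector_mult_0_right)
      then have ind: "vec.independent {A *v v, v}"
        using no by (intro vec.independent_insertI vec.independent_empty) (auto simp: vec.span_singleton)
      have ne: "A *v v \<noteq> v" using no by (metis vec.scale_one)
      define C where "C = vec.extend_basis {A *v v, v}"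
      have C: "vec.independent C" "vec.span C = UNIV" "{A *v v, v} \<subseteq> C"
        using vec.independent_extend_basis[OF ind] vec.span_extend_basis[OF ind] vec.extend_basis_superset[OF ind]
        by (simp_all add: C_def)
      define \<phi> where "\<phi> = (\<lambda>x v. vec.representation C v x)"
      have dual: "\<phi> x y = (if y = x then 1 else 0)" if "y \<in> C" for x y
        using vec.representation_basis[OF C(1) that] by (simp add: \<phi>_def)
      have h: "holo_form (wedge (\<phi> v) (\<phi> (A *v v)))"
        unfolding \<phi>_def by (intro wedge_holo_form representation_clinear_form[OF C(1,2)])
      then have "wedge (\<phi> v) (\<phi> (A *v v)) (A *v v) v = wedge (\<phi> v) (\<phi> (A *v v)) v (A *v v)"
        using all by (simp add: P_def)
      then show False using C(3) ne by (simp add: wedge_def dual)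
    qed
    then obtain c where c: "\<And>v. A *v v = c v *s v" by metis
    have same: "c (axis i 1) = c (axis j 1)" for i j
    proof (cases "i = j")
      case False
      have "c (axis i 1 + axis j 1) *s (axis i 1 + axis j 1) = c (axis i 1) *s axis i 1 + c (axis j 1) *s axis j 1"
        using c[of "axis i 1 + axis j 1"] c by (simp add: matrix_vector_right_distrib)
      from this[THEN arg_cong, of "\<lambda>x. x $ i"] this[THEN arg_cong, of "\<lambda>x. x $ j"] False
      show ?thesis by (simp add: axis_def)
    qed simp
    obtain i0 :: 'g where True by blast
    define c0 where "c0 = c (axis i0 1)"
    have A_eq: "A *v v = c0 *s v" for v
    proof -
      have "A *v v = A *v (\<Sum>i\<in>UNIV. v $ i *s axis i 1)" by (simp add: basis_expansion)
      also have "\<dots> = (\<Sum>i\<in>UNIV. v $ i *s (A *v axis i 1))"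
        by (simp only: linear_sum[OF linear_matrix_vector_complex] vector_scalar_commute)
      also have "\<dots> = (\<Sum>i\<in>UNIV. c0 *s (v $ i *s axis i 1))"
        using same by (intro sum.cong refl) (simp add: c c0_def vector_smult_assoc mult.commute)
      also have "\<dots> = c0 *s (\<Sum>i\<in>UNIV. v $ i *s axis i 1)" by (simp only: vec.scale_sum_right)
      also have "\<dots> = c0 *s v" by (simp only: basis_expansion)
      finally show ?thesis .
    qed
    have "c0 \<in> \<rat>"
      using A(1) by (intro scalar_rational[OF two g]) (simp add: EndQ_def A_eq)
    moreover have "A = mat c0"
      by (simp add: matrix_eq A_eq)
    ultimately show ?thesis using A(2) by blast
  qed
qed

end

section \<open>Polynomials in a matrix and diagonalisation\<close>

text \<open>Evaluation of a polynomial at a matrix. The product \<open>*\<close> of the type is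
  componentwise, so \<open>poly\<close> would evaluate entry by entry. Most facts are stated for the
  action on vectors, where no ring structure is needed.\<close>

definition pm :: "complex ^ 'n ^ 'n \<Rightarrow> complex poly \<Rightarrow> complex ^ 'n ^ 'n" where
  "pm A p = fold_coeffs (\<lambda>a B. mat a + A ** B) p 0"

lemma pm_0 [simp]: "pm A 0 = 0"
  by (simp add: pm_def)

lemma pm_pCons [simp]: "pm A (pCons a p) = mat a + A ** pm A p"
  by (cases "p = 0"; cases "a = 0") (simp_all add: pm_def)

lemma pm_pCons_vec: "pm A (pCons a p) *v v = a *s v + A *v (pm A p *v v)"
  by (simp add: matrix_vector_mult_add_rdistrib matrix_vector_mul_assoc)

lemma pm_add_vec: "pm A (p + q) *v v = pm A p *v v + pm A q *v v"
  by (induction p q rule: poly_induct2)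
     (simp_all add: pm_pCons_vec matrix_vector_right_distrib vector_sadd_rdistrib del: pm_pCons)

lemma pm_smult_vec: "pm A (Polynomial.smult c p) *v v = c *s (pm A p *v v)"
  by (induction p)
     (simp_all add: pm_pCons_vec vector_add_ldistrib vector_smult_assoc vector_scalar_commute del: pm_pCons)

lemma pm_mult_vec: "pm A (p * q) *v v = pm A p *v (pm A q *v v)"
  by (induction p)
     (simp_all add: pm_pCons_vec pm_add_vec pm_smult_vec del: pm_pCons)

lemma pm_diff_vec: "pm A (p - q) *v v = pm A p *v v - pm A q *v v"
  using pm_add_vec[of A "p - q" q v] by simp

lemma pm_1_vec [simp]: "pm A 1 *v v = v"
  using pm_pCons_vec[of A 1 0 v] by (simp add: one_pCons)

lemma pm_sum_vec: "pm A (\<Sum>i\<in>I. f i) *v v = (\<Sum>i\<in>I. pm A (f i) *v v)"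
  by (induction I rule: infinite_finite_induct) (simp_all add: pm_add_vec)

lemma pm_commute_vec:
  assumes "\<And>v. C *v (A *v v) = A *v (C *v v)"
  shows "C *v (pm A p *v v) = pm A p *v (C *v v)"
  by (induction p arbitrary: v)
     (simp_all add: pm_pCons_vec matrix_vector_right_distrib vector_scalar_commute assms del: pm_pCons)

lemma pm_eigenvector:
  assumes "A *v v = c *s v" shows "pm A p *v v = poly p c *s v"
  by (induction p)
     (simp_all add: pm_pCons_vec vector_scalar_commute assms vector_smult_assoc vector_sadd_rdistrib mult.commute
       del: pm_pCons)

lemma pm_eigenform:
  fixes f :: "complex ^ 'n \<Rightarrow> complex"
  assumes "clinear_form f" "\<And>v. f (A *v v) = c * f v"
  shows "f (pm A p *v v) = poly p c * f v"
proof (induction p arbitrary: v)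
  case 0
  have "f (0 *s 0) = 0 * f 0" using assms(1) unfolding clinear_form_def by blast
  then show ?case by simp
next
  case (pCons a p)
  then show ?case using assms
    by (simp add: pm_pCons_vec clinear_form_def algebra_simps del: pm_pCons)
qed

text \<open>Applying all factors but one to \<open>v\<close> gives an eigenvector \<open>w\<close>;
  subtracting a suitable multiple of it leaves a vector that the remaining factors
  annihilate.\<close>

lemma eigenvectors_span:
  assumes "finite S" "pm A (\<Prod>c\<in>S. [:- c, 1:]) *v v = 0"
  shows "v \<in> vec.span {v. \<exists>c. A *v v = c *s v}"
  using assms
proof (induction S arbitrary: v rule: finite_induct)
  case empty
  then show ?case by (simp add: vec.span_zero)
next
  case (insert c S)
  define q where "q = (\<Prod>c\<in>S. [:- c, 1:])"
  define w where "w = pm A q *v v"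
  have "pm A ([:- c, 1:] * q) *v v = 0"
    using insert.prems unfolding q_def prod.insert[OF insert.hyps(1,2)] .
  then have "pm A [:- c, 1:] *v w = 0" by (simp only: w_def pm_mult_vec)
  then have w: "A *v w = c *s w" by (simp add: pm_pCons_vec del: pm_pCons)
  have nz: "poly q c \<noteq> 0" using insert.hyps by (auto simp: q_def poly_prod)
  define u where "u = v - inverse (poly q c) *s w"
  have "pm A q *v u = w - inverse (poly q c) *s (pm A q *v w)"
    by (simp add: u_def w_def matrix_vector_mult_diff_distrib vector_scalar_commute)
  also have "\<dots> = 0" using nz by (simp add: pm_eigenvector[OF w] vector_smult_assoc)
  finally have "u \<in> vec.span {v. \<exists>c. A *v v = c *s v}"
    using insert.IH by (simp add: q_def)
  moreover have "w \<in> vec.span {v. \<exists>c. A *v v = c *s v}" using w by (intro vec.span_base) auto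
  ultimately have "u + inverse (poly q c) *s w \<in> vec.span {v. \<exists>c. A *v v = c *s v}"
    by (intro vec.span_add vec.span_scale)
  then show ?case by (simp add: u_def)
qed

lemma pm_zeroI: "(\<And>v. pm A p *v v = 0) \<Longrightarrow> pm A p = 0"
  by (simp add: matrix_eq)

text \<open>Stated for families instead of sets, so that a repeated member counts as a
  relation.\<close>

lemma rat_relation:
  fixes x :: "'i \<Rightarrow> 'a::real_vector"
  assumes "finite I" "finite T" "card T < card I" "\<And>i. i \<in> I \<Longrightarrow> x i \<in> ratV.span T"
  shows "\<exists>c. (\<exists>i\<in>I. c i \<noteq> 0) \<and> (\<Sum>i\<in>I. of_rat (c i) *\<^sub>R x i) = 0"
proof (cases "inj_on x I")
  case False
  then obtain i j where ij: "i \<in> I" "j \<in> I" "i \<noteq> j" "x i = x j" by (auto simp: inj_on_def)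
  define c where "c = (\<lambda>k. if k = i then 1 else if k = j then -1 else (0::rat))"
  have "(\<Sum>k\<in>I. of_rat (c k) *\<^sub>R x k) = (\<Sum>k\<in>{i, j}. of_rat (c k) *\<^sub>R x k)"
    using assms(1) ij by (intro sum.mono_neutral_right) (auto simp: c_def)
  also have "\<dots> = 0" using ij by (simp add: c_def of_rat_minus)
  finally show ?thesis using ij(1) by (intro exI[of _ c]) (auto simp: c_def)
next
  case True
  have "\<not> ratV.independent (x ` I)"
  proof
    assume "ratV.independent (x ` I)"
    then have "card (x ` I) \<le> card T"
      using ratV.independent_span_bound[OF assms(2), of "x ` I"] assms(4) by auto
    then show False using card_image[OF True] assms(3) by simp
  qed
  then obtain u where u: "(\<Sum>v\<in>x ` I. real_of_rat (u v) *\<^sub>R v) = 0" "\<exists>v\<in>x ` I. u v \<noteq> 0"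
    using ratV.dependent_finite[of "x ` I"] assms(1) by auto
  have "(\<Sum>i\<in>I. of_rat (u (x i)) *\<^sub>R x i) = 0"
    using u(1) by (simp add: sum.reindex[OF True])
  then show ?thesis using u(2) by (intro exI[of _ "\<lambda>i. u (x i)"]) auto
qed

definition ratpoly :: "complex poly \<Rightarrow> bool" where
  "ratpoly p \<longleftrightarrow> (\<forall>i. Polynomial.coeff p i \<in> \<rat>)"

lemma ratpoly_pderiv: "ratpoly p \<Longrightarrow> ratpoly (pderiv p)"
  by (simp add: ratpoly_def coeff_pderiv)

lemma ratpoly_pCons: "ratpoly (pCons a p) \<longleftrightarrow> a \<in> \<rat> \<and> ratpoly p"
  by (auto simp: ratpoly_def coeff_pCons split: nat.splits)

lemma ratpoly_0 [simp]: "ratpoly 0"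
  by (simp add: ratpoly_def)

context lattice_coords
begin

lemma LatQ_span: "v \<in> LatQ \<Longrightarrow> v \<in> ratV.span (range b)"
proof -
  assume v: "v \<in> LatQ"
  have "(\<Sum>k\<in>UNIV. co v k *\<^sub>R b k) \<in> ratV.span (range b)"
  proof (intro ratV.span_sum)
    fix k
    have "co v k \<in> \<rat>" using v by (simp add: LatQ_def)
    then obtain q where "co v k = of_rat q" by (rule Rats_cases)
    then show "co v k *\<^sub>R b k \<in> ratV.span (range b)" by (simp add: ratV.span_scale ratV.span_base)
  qed
  then show ?thesis by (simp only: expand)
qed

lemma LatQ_relation:
  assumes "finite I" "CARD('k) < card I" "\<And>i. i \<in> I \<Longrightarrow> x i \<in> LatQ"
  shows "\<exists>c. (\<exists>i\<in>I. c i \<noteq> 0) \<and> (\<Sum>i\<in>I. of_rat (c i) *\<^sub>R x i) = 0"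
proof (rule rat_relation[OF assms(1)])
  show "finite (range b)" by simp
  show "card (range b) < card I" using assms(2) card_image_le[of UNIV b] by simp
qed (rule LatQ_span[OF assms(3)])

lemma LatQ_vscale: "v \<in> LatQ \<Longrightarrow> c \<in> \<rat> \<Longrightarrow> c *s v \<in> LatQ"
proof -
  assume v: "v \<in> LatQ" and "c \<in> \<rat>"
  then obtain q where "c = of_rat q" by (auto elim: Rats_cases)
  then have "c *s v = of_rat q *\<^sub>R v" by (simp add: scaleR_eq_vector_scale of_real_of_rat)
  then show ?thesis using v by (simp add: LatQ_scale)
qed

end

context torus_coords
begin

lemma EndQ_pm:
  assumes "A \<in> EndQ" "ratpoly p"
  shows "pm A p \<in> EndQ"
  unfolding EndQ_def
proof (intro CollectI ballI)
  fix v assume v: "v \<in> LatQ"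
  show "pm A p *v v \<in> LatQ"
    using assms(2)
  proof (induction p)
    case (pCons a p)
    then show ?case using assms(1) v
      by (simp add: pm_pCons_vec ratpoly_pCons EndQ_def LatQ_add LatQ_vscale del: pm_pCons)
  qed simp
qed

end

section \<open>Separability and distinct eigenvalues\<close>

locale two_simple_torus = torus_coords b co \<Lambda>
  for b :: "'k::finite \<Rightarrow> complex ^ 'g" and co and \<Lambda> :: "(complex ^ 'g) set" +
  assumes two: "two_simple \<Lambda>" and g3: "CARD('g) \<ge> 3" and cardk: "CARD('k) = 2 * CARD('g)"
begin

lemma EndQ_kernel:
  assumes "A \<in> EndQ" "A *v v = 0" "v \<noteq> 0"
  shows "A = 0"
  using EndQ_inj[OF two g3 assms(1)] assms(2,3) by (metis injD matrix_vector_mult_0_right)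

lemma exists_LatQ_nonzero: "\<exists>x\<in>LatQ. x \<noteq> 0"
  using co_b[of undefined undefined] by (metis b_LatQ co_0 zero_neq_one)

text \<open>The images of a rational vector \<open>x\<close> under the powers of \<open>A\<close> up
  to exponent \<open>2 g\<close> satisfy a rational relation. It is a polynomial whose value at
  \<open>A\<close> kills \<open>x\<close>, and an element of \<open>EndQ\<close> with a kernel
  vanishes.\<close>

lemma annihilating_ratpoly:
  assumes "A \<in> EndQ"
  shows "\<exists>p. p \<noteq> 0 \<and> ratpoly p \<and> pm A p = 0"
proof -
  obtain x where x: "x \<in> LatQ" "x \<noteq> 0" using exists_LatQ_nonzero by blast
  have rp: "ratpoly (Polynomial.monom 1 i)" for i by (simp add: ratpoly_def)
  have "pm A (Polynomial.monom 1 i) *v x \<in> LatQ" for i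
    using EndQ_pm[OF assms rp] x(1) by (simp add: EndQ_def)
  then obtain c where c: "\<exists>i\<le>CARD('k). c i \<noteq> 0"
    "(\<Sum>i\<le>CARD('k). of_rat (c i) *\<^sub>R (pm A (Polynomial.monom 1 i) *v x)) = 0"
    using LatQ_relation[of "{..CARD('k)}" "\<lambda>i. pm A (Polynomial.monom 1 i) *v x"] by auto
  define p where "p = (\<Sum>i\<le>CARD('k). Polynomial.smult (of_rat (c i)) (Polynomial.monom (1::complex) i))"
  have coeff: "Polynomial.coeff p i = (if i \<le> CARD('k) then of_rat (c i) else 0)" for i
    by (simp add: p_def coeff_sum if_distrib cong: if_cong)
  have rat: "ratpoly p" by (simp add: ratpoly_def coeff)
  obtain i where "i \<le> CARD('k)" "c i \<noteq> 0" using c(1) by blast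
  then have "Polynomial.coeff p i \<noteq> 0" by (simp add: coeff)
  then have "p \<noteq> 0" by auto
  moreover have "pm A p *v x = 0"
    using c(2) by (simp add: p_def pm_sum_vec pm_smult_vec scaleR_eq_vector_scale of_real_of_rat)
  then have "pm A p = 0" using EndQ_kernel[OF EndQ_pm[OF assms rat] _ x(2)] by blast
  ultimately show ?thesis using rat by blast
qed

text \<open>A multiple root of the complex minimal polynomial \<open>q\<close> is also a root of
  \<open>pderiv p\<close>, where \<open>p\<close> is the rational annihilator of least degree. Then
  \<open>pm A (pderiv p)\<close> kills an eigenvector, so it vanishes, against the choice of
  \<open>p\<close>.\<close>

lemma separable_annihilator:
  assumes A: "A \<in> EndQ"
  shows "\<exists>q. q \<noteq> 0 \<and> rsquarefree q \<and> pm A q = 0"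
proof -
  define p where "p = arg_min Polynomial.degree (\<lambda>p. p \<noteq> 0 \<and> ratpoly p \<and> pm A p = 0)"
  have p: "p \<noteq> 0" "ratpoly p" "pm A p = 0"
    and pmin: "\<And>r. r \<noteq> 0 \<Longrightarrow> ratpoly r \<Longrightarrow> pm A r = 0 \<Longrightarrow> Polynomial.degree p \<le> Polynomial.degree r"
    using arg_min_nat_lemma[of "\<lambda>p. p \<noteq> 0 \<and> ratpoly p \<and> pm A p = 0" _ Polynomial.degree] annihilating_ratpoly[OF A]
    unfolding p_def by auto
  define q where "q = arg_min Polynomial.degree (\<lambda>p. p \<noteq> 0 \<and> pm A p = 0)"
  have q: "q \<noteq> 0" "pm A q = 0"
    and qmin: "\<And>r. r \<noteq> 0 \<Longrightarrow> pm A r = 0 \<Longrightarrow> Polynomial.degree q \<le> Polynomial.degree r"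
    using arg_min_nat_lemma[of "\<lambda>p. p \<noteq> 0 \<and> pm A p = 0" _ Polynomial.degree] p
    unfolding q_def by auto
  have "pm A (p mod q) = 0"
  proof (rule pm_zeroI)
    fix v
    have "p mod q = p - (p div q) * q" by (simp add: minus_div_mult_eq_mod)
    then show "pm A (p mod q) *v v = 0" by (simp add: pm_diff_vec pm_mult_vec p(3) q(2))
  qed
  then have "p mod q = 0"
    using qmin[of "p mod q"] degree_mod_less'[OF q(1), of p] by linarith
  then have qp: "q dvd p" by (simp add: mod_eq_0_iff_dvd)
  have "\<not> (poly q c = 0 \<and> poly (pderiv q) c = 0)" for c
  proof
    assume c: "poly q c = 0 \<and> poly (pderiv q) c = 0"
    then obtain r where r: "q = [:- c, 1:] * r" by (auto simp: poly_eq_0_iff_dvd elim: dvdE)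
    have r0: "r \<noteq> 0" using q(1) r by auto
    have "Polynomial.degree q = Suc (Polynomial.degree r)" unfolding r using r0 by (subst degree_mult_eq) auto
    then have "pm A r \<noteq> 0" using qmin[OF r0] by auto
    then obtain v where v: "pm A r *v v \<noteq> 0" using pm_zeroI by blast
    define w where "w = pm A r *v v"
    have "pm A [:- c, 1:] *v w = 0" using q(2) unfolding r w_def by (metis pm_mult_vec matrix_vector_mult_0)
    then have w: "A *v w = c *s w" by (simp add: pm_pCons_vec del: pm_pCons)
    obtain s where s: "p = q * s" using qp by (auto elim: dvdE)
    have "poly (pderiv p) c = 0" using c by (simp add: s pderiv_mult)
    then have "pm A (pderiv p) *v w = 0" by (simp add: pm_eigenvector[OF w])
    then have "pm A (pderiv p) = 0"
      using EndQ_kernel[OF EndQ_pm[OF A ratpoly_pderiv[OF p(2)]]] v by (simp add: w_def)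
    moreover have deg: "Polynomial.degree p \<noteq> 0"
    proof
      assume "Polynomial.degree p = 0"
      then obtain a where "p = [:a:]" by (rule degree_eq_zeroE)
      moreover have "poly p c = 0" using c by (simp add: s)
      ultimately show False using p(1) by simp
    qed
    then have "pderiv p \<noteq> 0" by (simp add: pderiv_eq_0_iff)
    ultimately have "Polynomial.degree p \<le> Polynomial.degree (pderiv p)"
      using pmin ratpoly_pderiv[OF p(2)] by blast
    then show False using deg by (simp add: degree_pderiv)
  qed
  then have "rsquarefree q" by (simp add: rsquarefree_roots)
  then show ?thesis using q by blast
qed

text \<open>\<open>A\<close> is self-adjoint for the wedge product of two eigenforms with the same
  eigenvalue, as it acts on either argument by the factor \<open>c\<close>. The wedge product
  therefore vanishes, and the two forms are proportional.\<close>

lemma eigenspaces_one_dimensional: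
  assumes A: "A \<in> EndQ" "\<And>q. q \<in> \<rat> \<Longrightarrow> A \<noteq> mat q"
    and a: "clinear_form f" "\<And>v. f (A *v v) = c * f v" and b: "clinear_form h" "\<And>v. h (A *v v) = c * h v"
  shows "f v * h w = f w * h v"
proof -
  have "wedge f h = (\<lambda>v w. 0)"
    by (rule EndQ_no_symmetric_form[OF two g3 A wedge_holo_form[OF a(1) b(1)]])
       (simp_all add: wedge_def a b)
  from fun_cong[OF fun_cong[OF this], of v w] show ?thesis by (simp add: wedge_def)
qed

text \<open>The rows of \<open>P\<close> are linear eigenforms of \<open>A\<close> with the entries
  of \<open>x\<close> as eigenvalues; the product on the right is componentwise.\<close>

definition eigenbasis :: "complex ^ 'g ^ 'g \<Rightarrow> complex ^ 'g ^ 'g \<Rightarrow> (complex ^ 'g) \<Rightarrow> bool" where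
  "eigenbasis P A x \<longleftrightarrow> (\<forall>v. P *v (A *v v) = x * (P *v v))"

lemma diagonalizable:
  assumes A: "A \<in> EndQ" "\<And>q. q \<in> \<rat> \<Longrightarrow> A \<noteq> mat q"
  shows "\<exists>P x. invertible P \<and> inj (($) x) \<and> eigenbasis P A x"
proof -
  obtain q where q: "q \<noteq> 0" "rsquarefree q" "pm A q = 0" using separable_annihilator[OF A(1)] by blast
  \<comment> \<open>Eigenforms of \<open>A\<close> are eigenvectors of its transpose.\<close>
  let ?M = "transpose A"
  define S where "S = {z. poly q z = 0}"
  have finS: "finite S" using q(1) by (simp add: S_def poly_roots_finite)
  have q_eq: "Polynomial.smult (Polynomial.lead_coeff q) (\<Prod>z\<in>S. [:- z, 1:]) = q"
    using complex_poly_decompose_rsquarefree[OF q(2)] by (simp add: S_def)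
  have trans_pm: "pm ?M p = transpose (pm A p)" for p
  proof -
    have "pm ?M p *v v = transpose (pm A p) *v v" for v
    proof (induction p arbitrary: v)
      case 0
      then show ?case by (simp add: transpose_def vec_eq_iff matrix_vector_mult_def)
    next
      case (pCons a p)
      have com: "pm A p ** A = A ** pm A p"
      proof -
        have "(pm A p ** A) *v w = (A ** pm A p) *v w" for w
          using pm_commute_vec[of A A p w] by (simp add: matrix_vector_mul_assoc[symmetric])
        then show ?thesis by (simp add: matrix_eq)
      qed
      have "transpose (pm A (pCons a p)) = mat a + ?M ** transpose (pm A p)"
        by (simp add: com[symmetric] flip: matrix_transpose_mul)
           (simp add: transpose_def vec_eq_iff mat_def)
      then show ?case using pCons.IH
        by (simp add: pm_pCons_vec matrix_vector_mult_add_rdistrib matrix_vector_mul_assoc[symmetric] del: pm_pCons)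
    qed
    then show ?thesis by (simp add: matrix_eq)
  qed
  have "pm ?M (\<Prod>z\<in>S. [:- z, 1:]) *v v = 0" for v
  proof -
    have "Polynomial.lead_coeff q *s (pm ?M (\<Prod>z\<in>S. [:- z, 1:]) *v v) = pm ?M q *v v"
      by (subst (2) q_eq[symmetric]) (simp add: pm_smult_vec)
    also have "\<dots> = transpose 0 *v v" by (simp only: trans_pm q(3))
    also have "transpose (0 :: complex ^ 'g ^ 'g) = 0" by (simp add: transpose_def vec_eq_iff)
    finally have "Polynomial.lead_coeff q *s (pm ?M (\<Prod>z\<in>S. [:- z, 1:]) *v v) = 0" by simp
    then show ?thesis using q(1) by (simp add: vec.scale_eq_0_iff)
  qed
  let ?Eig = "{v. \<exists>c. ?M *v v = c *s v}"
  have span: "v \<in> vec.span ?Eig" for v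
    using eigenvectors_span[OF finS \<open>pm ?M (\<Prod>z\<in>S. [:- z, 1:]) *v v = 0\<close>] .
  obtain C where C: "C \<subseteq> ?Eig" "vec.independent C" "?Eig \<subseteq> vec.span C"
    using vec.maximal_independent_subset by blast
  have spanC: "vec.span C = UNIV"
    using span vec.span_minimal[OF C(3) vec.subspace_span] by auto
  have "card C = vec.dim (UNIV :: (complex ^ 'g) set)"
    using vec.dim_span_eq_card_independent[OF C(2)] spanC by simp
  then have "card C = CARD('g)" by (simp add: card_cart_basis)
  moreover have "finite C" using C(2) vec.finiteI_independent by blast
  ultimately obtain r where r: "bij_betw r (UNIV :: 'g set) C"
    using finite_same_card_bij[of "UNIV :: 'g set" C] by auto
  have rC: "r i \<in> C" for i using r bij_betwE by blast
  then have "\<exists>c. ?M *v r i = c *s r i" for i using C(1) by blast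
  then obtain c where c: "\<And>i. ?M *v r i = c i *s r i" by metis
  define P where "P = (\<chi> i j. r i $ j)"
  define f where "f = (\<lambda>i v. \<Sum>j\<in>UNIV. r i $ j * v $ j)"
  have Pf: "(P *v v) $ i = f i v" for v i by (simp add: P_def f_def matrix_vector_mult_def)
  have f_lin: "clinear_form (f i)" for i
    by (simp add: clinear_form_def f_def sum.distrib sum_distrib_left algebra_simps)
  have f_eig: "f i (A *v v) = c i * f i v" for i v
  proof -
    have "f i (A *v v) = (\<Sum>j\<in>UNIV. \<Sum>k\<in>UNIV. r i $ j * (A $ j $ k * v $ k))"
      by (simp add: f_def matrix_vector_mult_def sum_distrib_left)
    also have "\<dots> = (\<Sum>k\<in>UNIV. (\<Sum>j\<in>UNIV. A $ j $ k * r i $ j) * v $ k)"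
      by (subst sum.swap) (simp add: sum_distrib_left sum_distrib_right mult_ac)
    also have "\<dots> = (\<Sum>k\<in>UNIV. c i * r i $ k * v $ k)"
    proof (intro sum.cong refl arg_cong2[where f = "(*)"])
      fix k
      show "(\<Sum>j\<in>UNIV. A $ j $ k * r i $ j) = c i * r i $ k"
        using arg_cong[OF c[of i], of "\<lambda>x. x $ k"]
        unfolding matrix_vector_mult_def transpose_def by simp
    qed
    also have "\<dots> = c i * f i v" by (simp add: f_def sum_distrib_left mult_ac)
    finally show ?thesis .
  qed
  \<comment> \<open>Equal eigenvalues would make two rows of \<open>P\<close> proportional.\<close>
  have inj: "inj c"
  proof (rule injI, rule ccontr)
    fix i j assume ij: "c i = c j" "i \<noteq> j"
    have "f i (axis k 1) * f j (axis l 1) = f i (axis l 1) * f j (axis k 1)" for k l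
      using eigenspaces_one_dimensional[OF A f_lin f_eig f_lin] f_eig[of j] ij(1) by simp
    then have eq: "r i $ k * r j $ l = r i $ l * r j $ k" for k l
      by (simp add: f_def axis_def if_distrib cong: if_cong)
    have ne: "r i \<noteq> r j" using r ij(2) by (metis UNIV_I bij_betw_inv_into_left)
    have "r i \<noteq> 0" using C(2) rC vec.dependent_zero by metis
    then obtain k where k: "r i $ k \<noteq> 0" by (auto simp: vec_eq_iff)
    have "r j = (r j $ k / r i $ k) *s r i"
      using k eq[of k] by (simp add: vec_eq_iff field_simps)
    then have "r j \<in> vec.span {r i}" by (metis vec.span_base vec.span_scale singletonI)
    then have "r j \<in> vec.span (C - {r j})"
      using vec.span_mono[of "{r i}" "C - {r j}"] rC ne by auto
    then show False using C(2) rC unfolding vec.dependent_def by blast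
  qed
  have inv: "invertible P"
  proof -
    have "v = 0" if v: "P *v v = 0" for v
    proof -
      have "vec.span C \<subseteq> {w. (\<Sum>j\<in>UNIV. w $ j * v $ j) = 0}"
      proof (rule vec.span_minimal)
        show "C \<subseteq> {w. (\<Sum>j\<in>UNIV. w $ j * v $ j) = 0}"
        proof
          fix w assume "w \<in> C"
          then obtain i where "w = r i" using r by (auto simp: bij_betw_def)
          then show "w \<in> {w. (\<Sum>j\<in>UNIV. w $ j * v $ j) = 0}"
            using Pf[of v i] by (simp add: v f_def)
        qed
        show "vec.subspace {w. (\<Sum>j\<in>UNIV. w $ j * v $ j) = 0}"
          by (auto simp: vec.subspace_def algebra_simps sum.distrib simp flip: sum_distrib_left)
      qed
      then have "(\<Sum>j\<in>UNIV. axis k 1 $ j * v $ j) = 0" for k using spanC by blast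
      then show ?thesis by (simp add: vec_eq_iff axis_def if_distrib if_distribR cong: if_cong)
    qed
    then have "x = y" if "P *v x = P *v y" for x y
      using that matrix_vector_mult_diff_distrib[of P x y] by (metis right_minus_eq)
    then have "inj ((*v) P)" by (rule injI)
    then show ?thesis by (simp add: invertible_left_inverse matrix_left_invertible_injective)
  qed
  have "eigenbasis P A (\<chi> i. c i)"
    by (simp add: eigenbasis_def vec_eq_iff Pf f_eig)
  moreover have "inj (($) (\<chi> i. c i))" using inj by (simp add: inj_def)
  ultimately show ?thesis using inv by blast
qed

end

section \<open>Commutativity of the endomorphism algebra\<close>

lemma pm_intertwine:
  assumes "\<And>v. C *v (A *v v) = B *v (C *v v)"
  shows "C *v (pm A p *v v) = pm B p *v (C *v v)"
  by (induction p arbitrary: v)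
     (simp_all add: pm_pCons_vec matrix_vector_right_distrib vector_scalar_commute assms del: pm_pCons)

lemma eigenbasis_pm:
  assumes "\<And>v. P *v (A *v v) = (x :: complex ^ 'g) * (P *v v)"
  shows "(P *v (pm A p *v v)) $ i = poly p (x $ i) * (P *v v) $ i"
proof (rule pm_eigenform[where f = "\<lambda>v. (P *v v) $ i"])
  show "clinear_form (\<lambda>v. (P *v v) $ i)"
    by (simp add: clinear_form_def matrix_vector_right_distrib vector_scalar_commute)
qed (simp add: assms)

lemma times_axis: "(x :: complex ^ 'g) * axis i 1 = x $ i *s axis i 1"
  by (simp add: vec_eq_iff axis_def)

lemma invertible_inverse_ex:
  assumes "invertible (P :: complex ^ 'g ^ 'g)"
  shows "\<exists>Q. (\<forall>v. P *v (Q *v v) = v) \<and> (\<forall>v. Q *v (P *v v) = v)"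
proof -
  obtain Q where "P ** Q = mat 1" "Q ** P = mat 1" using assms unfolding invertible_def by blast
  then show ?thesis by (intro exI[of _ Q]) (simp add: matrix_vector_mul_assoc)
qed

lemma invertible_cancel:
  assumes "invertible (P :: complex ^ 'g ^ 'g)" "P *v v = P *v w"
  shows "v = w"
proof -
  obtain Q where Q: "\<forall>v. P *v (Q *v v) = v" "\<forall>v. Q *v (P *v v) = v"
      using invertible_inverse_ex[OF assms(1)] by (elim exE conjE)
  have "Q *v (P *v v) = Q *v (P *v w)" by (rule arg_cong[OF assms(2)])
  then show ?thesis by (simp only: Q(2))
qed

lemmas matrix_vector_mult_minus = linear_neg[OF linear_matrix_vector_complex]

context torus_coords
begin

lemma EndQ_mult: "A \<in> EndQ \<Longrightarrow> B \<in> EndQ \<Longrightarrow> A ** B \<in> EndQ"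
  by (simp add: EndQ_def matrix_vector_mul_assoc[symmetric])

lemma EndQ_add: "A \<in> EndQ \<Longrightarrow> B \<in> EndQ \<Longrightarrow> A + B \<in> EndQ"
  by (simp add: EndQ_def matrix_vector_mult_add_rdistrib LatQ_add)

lemma EndQ_diff: "A \<in> EndQ \<Longrightarrow> B \<in> EndQ \<Longrightarrow> A - B \<in> EndQ"
  by (simp add: EndQ_def matrix_vector_mult_diff_rdistrib LatQ_diff)

lemma EndQ_mat: "q \<in> \<rat> \<Longrightarrow> mat q \<in> EndQ"
  by (simp add: EndQ_def LatQ_vscale)

end

context two_simple_torus
begin

lemma EndQ_cancel:
  assumes "A \<in> EndQ" "A \<noteq> 0" "A *v v = A *v w"
  shows "v = w"
  using EndQ_inj[OF two g3 assms(1,2)] assms(3) by (rule injD)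

text \<open>In the eigenbasis of \<open>A\<close>, \<open>C\<close> becomes a matrix
  \<open>R\<close> that commutes with a diagonal matrix with distinct entries, so \<open>R\<close>
  is diagonal.\<close>

lemma commuting_eigenbasis:
  assumes P: "invertible P" "eigenbasis P A x" "inj (vec_nth x)"
    and C: "\<And>v. C *v (A *v v) = A *v (C *v v)"
  shows "\<exists>y. eigenbasis P C y"
proof -
  obtain Q where Q: "\<forall>v. P *v (Q *v v) = v" "\<forall>v. Q *v (P *v v) = v"
      using invertible_inverse_ex[OF P(1)] by (elim exE conjE)
  have PA: "P *v (A *v v) = x * (P *v v)" for v using P(2) by (simp add: eigenbasis_def)
  define R where "R = P ** C ** Q"
  have R: "R *v u = P *v (C *v (Q *v u))" for u by (simp add: R_def matrix_vector_mul_assoc[symmetric])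
  have com: "R *v (x * u) = x * (R *v u)" for u
  proof -
    have "Q *v (x * u) = A *v (Q *v u)"
      using PA[of "Q *v u"] Q(2)[rule_format, of "A *v (Q *v u)"] by (simp add: Q(1))
    then show ?thesis by (simp add: R C PA)
  qed
  have offdiag: "R $ i $ j = 0" if "i \<noteq> j" for i j
  proof -
    have col: "(R *v axis j 1) $ i = R $ i $ j"
      by (simp add: matrix_vector_mult_def axis_def if_distrib cong: if_cong)
    have "x $ j * R $ i $ j = x $ i * R $ i $ j"
      using arg_cong[OF com[of "axis j 1"], of "\<lambda>v. v $ i"]
      by (simp add: times_axis vector_scalar_commute col)
    then show ?thesis using P(3) that by (auto dest: injD)
  qed
  have "P *v (C *v v) = (\<chi> i. R $ i $ i) * (P *v v)" for v
  proof -
    have "(R *v u) $ i = R $ i $ i * u $ i" for u i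
    proof -
      have "(R *v u) $ i = (\<Sum>j\<in>UNIV. R $ i $ j * u $ j)" by (simp add: matrix_vector_mult_def)
      also have "\<dots> = (\<Sum>j\<in>UNIV. if j = i then R $ i $ i * u $ i else 0)"
        by (intro sum.cong refl) (auto simp: offdiag)
      finally have "(R *v u) $ i = (\<Sum>j\<in>UNIV. if j = i then R $ i $ i * u $ i else 0)" .
      then show ?thesis by simp
    qed
    moreover have "P *v (C *v v) = R *v (P *v v)" by (simp add: R Q)
    ultimately show ?thesis by (simp add: vec_eq_iff)
  qed
  then show ?thesis by (auto simp: eigenbasis_def)
qed

lemma eigenbasis_commute:
  assumes "invertible P" "eigenbasis P A x" "eigenbasis P C y"
  shows "A *v (C *v v) = C *v (A *v v)"
proof (rule invertible_cancel[OF assms(1)])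
  show "P *v (A *v (C *v v)) = P *v (C *v (A *v v))"
    using assms(2,3) by (simp add: eigenbasis_def mult.left_commute)
qed

lemma centralizer_commutative:
  assumes S: "S \<in> EndQ" "\<And>q. q \<in> \<rat> \<Longrightarrow> S \<noteq> mat q"
    and "\<And>v. A *v (S *v v) = S *v (A *v v)" "\<And>v. C *v (S *v v) = S *v (C *v v)"
  shows "A *v (C *v v) = C *v (A *v v)"
proof -
  obtain P x where P: "invertible P" "inj (vec_nth x)" "eigenbasis P S x"
    using diagonalizable[OF S] by blast
  obtain y z where "eigenbasis P A y" "eigenbasis P C z"
    using commuting_eigenbasis[OF P(1,3,2) assms(3)] commuting_eigenbasis[OF P(1,3,2) assms(4)] by blast
  then show ?thesis using eigenbasis_commute[OF P(1)] by blast
qed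

text \<open>\<open>A\<close> has \<open>g\<close> distinct eigenvalues, and all of them are roots of
  \<open>p\<close>.\<close>

lemma annihilator_degree:
  assumes A: "A \<in> EndQ" "\<And>q. q \<in> \<rat> \<Longrightarrow> A \<noteq> mat q" and p: "p \<noteq> 0" "pm A p = 0"
  shows "CARD('g) \<le> Polynomial.degree p"
proof -
  obtain P x where P: "invertible P" "inj (vec_nth x)" "eigenbasis P A x"
    using diagonalizable[OF A] by blast
  obtain Q where Q: "\<forall>v. P *v (Q *v v) = v" "\<forall>v. Q *v (P *v v) = v"
      using invertible_inverse_ex[OF P(1)] by (elim exE conjE)
  have "poly p (x $ i) = 0" for i
    using eigenbasis_pm[of P A x p "Q *v axis i 1" i] P(3) p(2) by (simp add: eigenbasis_def Q)
  then have "range (vec_nth x) \<subseteq> {z. poly p z = 0}" by auto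
  then have "card (range (vec_nth x)) \<le> card {z. poly p z = 0}"
    using poly_roots_finite[OF p(1)] by (intro card_mono)
  also have "\<dots> \<le> Polynomial.degree p" using p(1) by (rule card_poly_roots_bound)
  finally show ?thesis using card_image[OF P(2)] by simp
qed

text \<open>If \<open>J\<close> does not commute with \<open>A\<close>, then \<open>\<rat>[A]\<close> and \<open>\<rat>[A] J\<close> together exhaust the dimension
  \<open>2 g\<close> that a division algebra acting on the rational period lattice can have at most.\<close>

lemma noncommuting_span:
  assumes A: "A \<in> EndQ" and J: "J \<in> EndQ" and nc: "J *v (A *v v0) \<noteq> A *v (J *v v0)" and X: "Y \<in> EndQ"
  shows "\<exists>p q. ratpoly p \<and> ratpoly q \<and> (\<forall>v. Y *v v = pm A p *v v + pm A q *v (J *v v))"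
proof -
  have Anr: "A \<noteq> mat q" if "q \<in> \<rat>" for q
    using nc by (auto simp: vector_scalar_commute)
  obtain x where x: "x \<in> LatQ" "x \<noteq> 0" using exists_LatQ_nonzero by blast
  define m where "m = (\<lambda>i. Polynomial.monom (1::complex) i)"
  have rm: "ratpoly (m i)" for i by (simp add: ratpoly_def m_def)
  \<comment> \<open>The indices stand for \<open>g\<close> powers of \<open>A\<close>, the same
    powers times \<open>J\<close>, and \<open>Y\<close>: one more than the dimension
    \<open>2 g\<close> of the rational lattice.\<close>
  let ?I = "{..<CARD('g)} <+> ({..<CARD('g)} <+> {()})"
  define z where "z = case_sum (\<lambda>i. pm A (m i) *v x) (case_sum (\<lambda>i. pm A (m i) *v (J *v x)) (\<lambda>_::unit. Y *v x))"
  have "z i \<in> LatQ" for i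
    using x(1) J X EndQ_pm[OF A rm] by (auto simp: z_def EndQ_def split: sum.splits)
  moreover have "card ?I = 2 * CARD('g) + 1" by (simp add: card_Plus)
  ultimately obtain c where c: "\<exists>i\<in>?I. c i \<noteq> 0" "(\<Sum>i\<in>?I. of_rat (c i) *\<^sub>R z i) = 0"
    using LatQ_relation[of ?I z] by (auto simp: cardk simp del: sum.Plus)
  define pol where "pol = (\<lambda>d. \<Sum>i<CARD('g). Polynomial.smult (of_rat (d i)) (m i))"
  have coeff: "Polynomial.coeff (pol d) i = (if i < CARD('g) then of_rat (d i) else 0)" for d i
    by (simp add: pol_def m_def coeff_sum if_distrib cong: if_cong)
  have rat: "ratpoly (pol d)" for d by (simp add: ratpoly_def coeff)
  have deg: "Polynomial.degree (pol d) < CARD('g)" for d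
  proof (cases "pol d = 0")
    case False
    then have "Polynomial.coeff (pol d) (Polynomial.degree (pol d)) \<noteq> 0" by simp
    then show ?thesis by (auto simp: coeff split: if_splits)
  qed simp
  have nz: "d i = 0" if "pol d = 0" "i < CARD('g)" for d i
    using coeff[of d i] that by simp
  define p q r where "p = pol (\<lambda>i. c (Inl i))" and "q = pol (\<lambda>i. c (Inr (Inl i)))" and "r = c (Inr (Inr ()))"
  have pol_vec: "(\<Sum>i<CARD('g). of_rat (d i) *s (pm A (m i) *v w)) = pm A (pol d) *v w" for d w
    by (simp add: pol_def pm_sum_vec pm_smult_vec scaleR_eq_vector_scale of_real_of_rat)
  have rel: "pm A p *v x + (pm A q *v (J *v x) + of_rat r *s (Y *v x)) = 0"
    using c(2) by (simp add: sum.Plus z_def p_def q_def r_def pol_vec scaleR_eq_vector_scale of_real_of_rat)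
  \<comment> \<open>Otherwise \<open>pm A q\<close> could be cancelled: \<open>pm A q ** J\<close>
    equals \<open>- pm A p\<close> and commutes with \<open>A\<close>, so \<open>J\<close> would
    commute with \<open>A\<close> as well.\<close>
  have indep: "pm A q = 0" if "pm A p + pm A q ** J = 0"
  proof (rule ccontr)
    assume q0: "pm A q \<noteq> 0"
    have e: "pm A p *v v + pm A q *v (J *v v) = 0" for v
      using arg_cong[OF that, of "\<lambda>B. B *v v"]
      by (simp add: matrix_vector_mult_add_rdistrib matrix_vector_mul_assoc[symmetric])
    have comA: "A *v (pm A p *v v) = pm A p *v (A *v v)" for p v by (rule pm_commute_vec) simp
    have "pm A q *v (J *v (A *v v0)) = - (pm A p *v (A *v v0))"
      using e[of "A *v v0"] by (simp add: eq_neg_iff_add_eq_0 add.commute)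
    also have "\<dots> = A *v (- (pm A p *v v0))" by (simp add: comA matrix_vector_mult_minus)
    also have "- (pm A p *v v0) = pm A q *v (J *v v0)"
      using e[of v0] by (simp add: neg_eq_iff_add_eq_0)
    also have "A *v \<dots> = pm A q *v (A *v (J *v v0))" by (simp add: comA)
    finally show False using EndQ_cancel[OF EndQ_pm[OF A rat] q0[unfolded q_def], folded q_def] nc by blast
  qed
  have r0: "r \<noteq> 0"
  proof
    assume r: "r = 0"
    have "(pm A p + pm A q ** J) *v x = 0"
      using rel r by (simp add: matrix_vector_mult_add_rdistrib matrix_vector_mul_assoc[symmetric])
    moreover have "pm A p + pm A q ** J \<in> EndQ"
      unfolding p_def q_def by (intro EndQ_add EndQ_mult EndQ_pm A rat J)
    ultimately have s0: "pm A p + pm A q ** J = 0" using EndQ_kernel x(2) by blast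
    then have q0: "pm A q = 0" by (rule indep)
    then have p0: "pm A p = 0" using s0 by simp
    have "q = 0"
      using annihilator_degree[OF A Anr _ q0] deg[of "\<lambda>i. c (Inr (Inl i))"] by (auto simp: q_def)
    moreover have "p = 0"
      using annihilator_degree[OF A Anr _ p0] deg[of "\<lambda>i. c (Inl i)"] by (auto simp: p_def)
    ultimately have "c i = 0" if "i \<in> ?I" for i
      using that r nz[of "\<lambda>i. c (Inl i)"] nz[of "\<lambda>i. c (Inr (Inl i))"] by (auto simp: p_def q_def r_def)
    then show False using c(1) by blast
  qed
  define s where "s = - inverse (of_rat r :: complex)"
  have sQ: "s \<in> \<rat>" by (simp add: s_def)
  have "Y = mat s ** (pm A p + pm A q ** J)"
  proof -
    let ?D = "Y - mat s ** (pm A p + pm A q ** J)"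
    have "?D *v x = Y *v x - s *s (pm A p *v x + pm A q *v (J *v x))"
      by (simp add: matrix_vector_mult_diff_rdistrib matrix_vector_mul_assoc[symmetric] matrix_vector_mult_add_rdistrib)
    also have "pm A p *v x + pm A q *v (J *v x) = - (of_rat r *s (Y *v x))"
      using rel by (simp add: eq_neg_iff_add_eq_0 add.assoc)
    also have "Y *v x - s *s (- (of_rat r *s (Y *v x))) = 0"
      using r0 by (simp add: s_def vec_eq_iff)
    finally have "?D *v x = 0" .
    moreover have "?D \<in> EndQ"
      unfolding p_def q_def by (intro EndQ_diff EndQ_add EndQ_mult EndQ_pm EndQ_mat A rat J X sQ)
    ultimately have "?D = 0" using EndQ_kernel x(2) by blast
    then show ?thesis by simp
  qed
  then have "Y *v v = pm A (Polynomial.smult s p) *v v + pm A (Polynomial.smult s q) *v (J *v v)" for v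
    by (simp add: matrix_vector_mul_assoc[symmetric] matrix_vector_mult_add_rdistrib pm_smult_vec vector_add_ldistrib)
  moreover have "ratpoly (Polynomial.smult s p)" "ratpoly (Polynomial.smult s q)"
    using rat sQ by (simp_all add: p_def q_def ratpoly_def)
  ultimately show ?thesis by blast
qed

text \<open>The identity and \<open>N\<close> are independent over the commutant of
  \<open>A\<close>: if \<open>Z ** N = - U\<close> with \<open>Z \<noteq> 0\<close>, then
  \<open>Z ** N\<close> commutes with \<open>A\<close>, and cancelling \<open>Z\<close> shows that
  \<open>N\<close> does.\<close>

lemma noncommuting_independent:
  assumes A: "A \<in> EndQ" and nc: "N *v (A *v v0) \<noteq> A *v (N *v v0)"
    and U: "\<And>v. U *v (A *v v) = A *v (U *v v)"
    and Z: "Z \<in> EndQ" "\<And>v. Z *v (A *v v) = A *v (Z *v v)"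
    and e: "\<And>v. U *v v + Z *v (N *v v) = 0"
  shows "U *v v = 0"
proof -
  have "Z = 0"
  proof (rule ccontr)
    assume Z0: "Z \<noteq> 0"
    have "Z *v (N *v (A *v v0)) = - (U *v (A *v v0))"
      using e[of "A *v v0"] by (simp add: eq_neg_iff_add_eq_0 add.commute)
    also have "\<dots> = A *v (- (U *v v0))" by (simp add: U matrix_vector_mult_minus)
    also have "- (U *v v0) = Z *v (N *v v0)" using e[of v0] by (simp add: neg_eq_iff_add_eq_0)
    also have "A *v \<dots> = Z *v (A *v (N *v v0))" by (simp add: Z(2))
    finally show False using EndQ_cancel[OF Z(1) Z0] nc by blast
  qed
  then show ?thesis using e[of v] by simp
qed

text \<open>If \<open>J\<close> does not commute with \<open>A\<close>, a modification
  \<open>N\<close> of it satisfies \<open>N ** A = F ** N\<close> with \<open>F\<close> a polynomial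
  in \<open>A\<close>. Expressing \<open>N ** N\<close> through the identity and \<open>N\<close>
  shows that this conjugation is an involution on the polynomials in \<open>A\<close>. Trace
  \<open>A + F\<close> and norm \<open>A ** F\<close> then commute with both \<open>A\<close> and
  \<open>N\<close>, so they are rational. This is the structure of a quaternion algebra;
  \<open>A\<close> is quadratic, which contradicts \<open>annihilator_degree\<close>.\<close>

theorem EndQ_commute:
  assumes A: "A \<in> EndQ" and J: "J \<in> EndQ"
  shows "J *v (A *v v) = A *v (J *v v)"
proof (rule ccontr)
  assume nc: "J *v (A *v v) \<noteq> A *v (J *v v)"
  have Anr: "A \<noteq> mat q" if "q \<in> \<rat>" for q
    using nc by (auto simp: vector_scalar_commute)
  have comA: "pm A p *v (A *v v) = A *v (pm A p *v v)" for p v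
    by (rule pm_commute_vec[symmetric]) simp
  have comp: "pm A p *v (pm A q *v v) = pm A q *v (pm A p *v v)" for p q v
    by (simp add: pm_mult_vec[symmetric] mult.commute)
  obtain f h where f: "ratpoly f" and h: "ratpoly h"
    and JA0: "\<And>v. (J ** A) *v v = pm A f *v v + pm A h *v (J *v v)"
    using noncommuting_span[OF A J nc EndQ_mult[OF J A]] by blast
  define F where "F = pm A h"
  have JA: "J *v (A *v v) = pm A f *v v + F *v (J *v v)" for v
    using JA0[of v] by (simp add: F_def matrix_vector_mul_assoc[symmetric])
  have FQ: "F \<in> EndQ" unfolding F_def by (rule EndQ_pm[OF A h])
  have FA: "F *v (A *v v) = A *v (F *v v)" for v unfolding F_def by (rule comA)
  define D where "D = A - F"
  have DQ: "D \<in> EndQ" unfolding D_def by (intro EndQ_diff A FQ)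
  have Dv: "D *v v = A *v v - F *v v" for v by (simp add: D_def matrix_vector_mult_diff_rdistrib)
  \<comment> \<open>If \<open>F = A\<close>, then \<open>pm A f\<close> is the commutator of
    \<open>J\<close> and \<open>A\<close>. In an eigenbasis of \<open>A\<close> such a commutator
    has zero diagonal, whereas \<open>pm A f\<close> is diagonal. So it is 0 and \<open>J\<close>
    commutes with \<open>A\<close>.\<close>
  have D0: "D \<noteq> 0"
  proof
    assume "D = 0"
    then have FA_eq: "F *v v = A *v v" for v using Dv[of v] by simp
    obtain P x where P: "invertible P" "inj (vec_nth x)" "eigenbasis P A x"
      using diagonalizable[OF A Anr] by blast
    obtain Q where Q: "\<forall>v. P *v (Q *v v) = v" "\<forall>v. Q *v (P *v v) = v"
      using invertible_inverse_ex[OF P(1)] by (elim exE conjE)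
    have PA: "P *v (A *v v) = x * (P *v v)" for v using P(3) by (simp add: eigenbasis_def)
    have "poly f (x $ i) = 0" for i
    proof -
      let ?w = "Q *v axis i 1"
      have Aw: "A *v ?w = x $ i *s ?w"
      proof -
        have "P *v (A *v ?w) = P *v (x $ i *s ?w)" by (simp add: PA Q times_axis vector_scalar_commute)
        then show ?thesis by (rule invertible_cancel[OF P(1)])
      qed
      have "(P *v (J *v (A *v ?w))) $ i = (P *v (pm A f *v ?w)) $ i + (P *v (A *v (J *v ?w))) $ i"
        by (simp add: JA FA_eq matrix_vector_right_distrib)
      moreover have "(P *v (J *v (A *v ?w))) $ i = x $ i * (P *v (J *v ?w)) $ i"
        by (simp add: Aw vector_scalar_commute)
      moreover have "(P *v (pm A f *v ?w)) $ i = poly f (x $ i)"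
        using eigenbasis_pm[of P A x f ?w i] by (simp add: PA Q)
      ultimately show ?thesis by (simp add: PA)
    qed
    then have "P *v (pm A f *v v) = 0"
      using eigenbasis_pm[of P A x f v] by (simp add: PA vec_eq_iff)
    then have "P *v (pm A f *v v) = P *v 0" by simp
    then have "pm A f *v v = 0" by (rule invertible_cancel[OF P(1)])
    then show False using nc JA[of v] by (simp add: FA_eq)
  qed
  \<comment> \<open>From \<open>J ** A = pm A f + F ** J\<close>: subtracting \<open>pm A f\<close>
    from \<open>(A - F) ** J\<close> cancels the inhomogeneous term and gives
    \<open>N ** A = F ** N\<close>.\<close>
  define N where "N = D ** J - pm A f"
  have Nv: "N *v v = D *v (J *v v) - pm A f *v v" for v
    by (simp add: N_def matrix_vector_mult_diff_rdistrib matrix_vector_mul_assoc[symmetric])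
  have NQ: "N \<in> EndQ" unfolding N_def by (intro EndQ_diff EndQ_mult DQ J EndQ_pm A f)
  have DA: "D *v (A *v v) = A *v (D *v v)" for v
    by (simp add: Dv FA matrix_vector_mult_diff_distrib)
  have Ff: "F *v (pm A f *v v) = pm A f *v (F *v v)" for v unfolding F_def by (rule comp)
  have NA: "N *v (A *v v) = F *v (N *v v)" for v
    by (simp add: Nv Dv JA FA Ff comA matrix_vector_right_distrib matrix_vector_mult_diff_distrib algebra_simps)
  have Nnc: "N *v (A *v v) \<noteq> A *v (N *v v)"
  proof
    assume "N *v (A *v v) = A *v (N *v v)"
    then have "D *v (J *v (A *v v)) = D *v (A *v (J *v v))"
      by (simp add: Nv matrix_vector_mult_diff_distrib comA DA)
    then show False using EndQ_cancel[OF DQ D0] nc by blast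
  qed
  define G where "G = pm F h"
  have GA: "G *v (A *v v) = A *v (G *v v)" for v
    unfolding G_def using pm_commute_vec[of A F h v] FA by simp
  have NF: "N *v (F *v v) = G *v (N *v v)" for v
    unfolding F_def G_def by (rule pm_intertwine) (simp add: NA F_def)
  have GQ: "G \<in> EndQ" unfolding G_def by (rule EndQ_pm[OF FQ h])
  obtain p q where p: "ratpoly p" and q: "ratpoly q"
    and NN0: "\<And>v. (N ** N) *v v = pm A p *v v + pm A q *v (N *v v)"
    using noncommuting_span[OF A NQ Nnc EndQ_mult[OF NQ NQ]] by blast
  have NN: "N *v (N *v v) = pm A p *v v + pm A q *v (N *v v)" for v
    using NN0[of v] by (simp add: matrix_vector_mul_assoc[symmetric])
  have Gpm: "G *v (pm A p *v v) = pm A p *v (G *v v)" for p v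
    using pm_commute_vec[of G A p v] GA by simp
  have Fpm: "F *v (pm A p *v v) = pm A p *v (F *v v)" for p v
    unfolding F_def by (rule comp)
  \<comment> \<open>\<open>U + Z ** N = 0\<close> results from computing the product
    \<open>N F N\<close> in two ways, as \<open>(N N) A\<close> and as
    \<open>G (N N)\<close>.\<close>
  define U where "U = pm A p ** A - G ** pm A p"
  define Z where "Z = pm A q ** F - G ** pm A q"
  have Uv: "U *v v = pm A p *v (A *v v) - G *v (pm A p *v v)" for v
    by (simp add: U_def matrix_vector_mult_diff_rdistrib matrix_vector_mul_assoc[symmetric])
  have Zv: "Z *v v = pm A q *v (F *v v) - G *v (pm A q *v v)" for v
    by (simp add: Z_def matrix_vector_mult_diff_rdistrib matrix_vector_mul_assoc[symmetric])
  have "U *v v = 0" for v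
  proof (rule noncommuting_independent[OF A Nnc])
    show "Z \<in> EndQ" unfolding Z_def by (intro EndQ_diff EndQ_mult EndQ_pm A q FQ GQ)
    show "U *v (A *v v) = A *v (U *v v)" "Z *v (A *v v) = A *v (Z *v v)" for v
      by (simp_all add: Uv Zv comA GA FA matrix_vector_mult_diff_distrib)
    show "U *v v + Z *v (N *v v) = 0" for v
    proof -
      have "N *v (F *v (N *v v)) = pm A p *v (A *v v) + pm A q *v (F *v (N *v v))"
        using NN[of "A *v v"] by (simp only: NA)
      moreover have "N *v (F *v (N *v v)) = G *v (pm A p *v v) + G *v (pm A q *v (N *v v))"
        using NF[of "N *v v"] NN[of v] by (simp only: matrix_vector_right_distrib)
      ultimately have "pm A p *v (A *v v) + pm A q *v (F *v (N *v v)) =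
          G *v (pm A p *v v) + G *v (pm A q *v (N *v v))" by (rule trans[OF sym])
      then show ?thesis by (simp add: Uv Zv algebra_simps)
    qed
  qed
  then have AG0: "pm A p *v (A *v v) = pm A p *v (G *v v)" for v
    using Uv[of v] Gpm[of p v] by simp
  have "pm A p \<noteq> 0"
  proof
    assume p0: "pm A p = 0"
    have "N \<noteq> 0" using Nnc by auto
    then obtain w where w: "N *v w \<noteq> 0" by (metis matrix_eq matrix_vector_mult_0)
    have "(N - pm A q) *v (N *v w) = 0" using NN[of w] p0 by (simp add: matrix_vector_mult_diff_rdistrib)
    then have "N - pm A q = 0" using EndQ_kernel[OF EndQ_diff[OF NQ EndQ_pm[OF A q]]] w by blast
    then have "N = pm A q" by simp
    then show False using Nnc comA by simp
  qed
  then have AG: "G *v v = A *v v" for v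
    using EndQ_cancel[OF EndQ_pm[OF A p]] AG0 by metis
  \<comment> \<open>The centralizer of a nonrational \<open>S\<close> is commutative, but it would
    contain both \<open>A\<close> and \<open>N\<close>.\<close>
  have "\<exists>q\<in>\<rat>. S = mat q" if S: "S \<in> EndQ" "\<And>v. S *v (A *v v) = A *v (S *v v)"
    "\<And>v. S *v (N *v v) = N *v (S *v v)" for S
  proof (rule ccontr)
    assume "\<not> ?thesis"
    then have nr: "S \<noteq> mat q" if "q \<in> \<rat>" for q using that by blast
    have "N *v (A *v v) = A *v (N *v v)"
      by (rule centralizer_commutative[OF S(1) nr S(3)[symmetric] S(2)[symmetric]])
    then show False using Nnc by simp
  qed
  note rat = this
  have "\<exists>q\<in>\<rat>. A + F = mat q"
    by (rule rat) (simp_all add: EndQ_add A FQ matrix_vector_mult_add_rdistrib matrix_vector_right_distrib FA NA NF AG)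
  then obtain q1 where q1: "q1 \<in> \<rat>" "A + F = mat q1" by blast
  have "\<exists>q\<in>\<rat>. A ** F = mat q"
    by (rule rat) (simp_all add: EndQ_mult A FQ matrix_vector_mul_assoc[symmetric] FA NA NF AG)
  then obtain q2 where q2: "q2 \<in> \<rat>" "A ** F = mat q2" by blast
  have "pm A [:q2, - q1, 1:] *v v = 0" for v
  proof -
    have 1: "A *v v = q1 *s v - F *v v" for v
      using arg_cong[OF q1(2), of "\<lambda>B. B *v v"] by (simp add: matrix_vector_mult_add_rdistrib eq_diff_eq)
    have 2: "A *v (F *v v) = q2 *s v"
      using arg_cong[OF q2(2), of "\<lambda>B. B *v v"] by (simp add: matrix_vector_mul_assoc[symmetric])
    have "A *v (A *v v) = q1 *s (A *v v) - q2 *s v"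
      by (subst (2) 1) (simp add: matrix_vector_mult_diff_distrib vector_scalar_commute 2)
    then show ?thesis
      by (simp add: pm_pCons_vec matrix_vector_mult_diff_distrib vector_scalar_commute del: pm_pCons)
  qed
  then have "pm A [:q2, - q1, 1:] = 0" by (rule pm_zeroI)
  then have "CARD('g) \<le> Polynomial.degree [:q2, - q1, 1:]"
    by (intro annihilator_degree[OF A Anr]) auto
  then show False using g3 by simp
qed

text \<open>One nonrational element has distinct eigenvalues, and everything commutes with it, so
  its eigenbasis serves for all. If there is none, all elements are scalars.\<close>

theorem simultaneous_eigenbasis:
  "\<exists>P. invertible P \<and> (\<forall>A\<in>EndQ. \<exists>x. eigenbasis P A x \<and> ((\<exists>q\<in>\<rat>. A = mat q) \<or> inj (vec_nth x)))"
proof (cases "\<forall>A\<in>EndQ. \<exists>q\<in>\<rat>. A = mat q")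
  case True
  have "invertible (mat 1 :: complex ^ 'g ^ 'g)" by (simp add: invertible_def)
  moreover have "\<exists>x. eigenbasis (mat 1) A x \<and> ((\<exists>q\<in>\<rat>. A = mat q) \<or> inj (vec_nth x))" if A: "A \<in> EndQ" for A
  proof -
    obtain q where q: "q \<in> \<rat>" "A = mat q" using True A by blast
    have "eigenbasis (mat 1) A (\<chi> i. q)" unfolding q(2) by (simp add: eigenbasis_def vec_eq_iff)
    then show ?thesis using q by blast
  qed
  ultimately show ?thesis by (intro exI[of _ "mat 1"]) simp
next
  case False
  then obtain A where A: "A \<in> EndQ" "\<And>q. q \<in> \<rat> \<Longrightarrow> A \<noteq> mat q" by blast
  then obtain P x where P: "invertible P" "inj (vec_nth x)" "eigenbasis P A x"
    using diagonalizable[OF A] by blast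
  have "\<exists>y. eigenbasis P C y \<and> ((\<exists>q\<in>\<rat>. C = mat q) \<or> inj (vec_nth y))" if C: "C \<in> EndQ" for C
  proof -
    obtain y where y: "eigenbasis P C y"
      using commuting_eigenbasis[OF P(1,3,2) EndQ_commute[OF A(1) C]] by blast
    have "inj (vec_nth y)" if nr: "\<not> (\<exists>q\<in>\<rat>. C = mat q)"
    proof (rule injI, rule ccontr)
      fix i j assume ij: "y $ i = y $ j" "i \<noteq> j"
      obtain Q where Q: "\<forall>v. P *v (Q *v v) = v" "\<forall>v. Q *v (P *v v) = v"
      using invertible_inverse_ex[OF P(1)] by (elim exE conjE)
      define f where "f = (\<lambda>i v. (P *v v) $ i)"
      have lin: "clinear_form (f i)" for i
        by (simp add: f_def clinear_form_def matrix_vector_right_distrib vector_scalar_commute)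
      have eig: "f i (C *v v) = y $ i * f i v" for i v using y by (simp add: f_def eigenbasis_def)
      have "f i (Q *v axis i 1) * f j (Q *v axis j 1) = f i (Q *v axis j 1) * f j (Q *v axis i 1)"
        using nr ij(1) eig[of j]
        by (intro eigenspaces_one_dimensional[OF C _ lin eig lin]) auto
      then show False using ij(2) by (simp add: f_def Q(1) axis_def)
    qed
    then show ?thesis using y by blast
  qed
  then show ?thesis using P(1) by blast
qed

end

section \<open>The endomorphism algebra as an algebra of diagonal matrices\<close>

lemma vec_power_nth [simp]: "(x ^ k) $ i = (x $ i :: 'a::comm_ring_1) ^ k"
  by (induction k) auto

lemma vec_prod_nth [simp]: "(\<Prod>k\<in>S. f k) $ i = (\<Prod>k\<in>S. f k $ i :: 'a::comm_ring_1)"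
  by (induction S rule: infinite_finite_induct) auto

lemma linear_vec_times [intro, simp]: "linear (\<lambda>v. x * (v :: complex ^ 'g))"
  by (rule linearI) (simp_all add: distrib_left)

definition vinv :: "complex ^ 'g \<Rightarrow> complex ^ 'g" where
  "vinv x = (\<chi> i. inverse (x $ i))"

lemma vinv_nth [simp]: "vinv x $ i = inverse (x $ i)"
  by (simp add: vinv_def)

abbreviation rdiag :: "rat \<Rightarrow> complex ^ 'g" where
  "rdiag q \<equiv> of_rat q *\<^sub>R 1"

lemma rdiag_nth: "rdiag q $ i = of_rat q"
  by (simp add: of_real_of_rat scaleR_complex)

context lattice_coords
begin

text \<open>Diagonal matrices are represented by the vectors of their entries. As the product of
  \<open>complex ^ 'g\<close> is componentwise, \<open>KF\<close> and \<open>KO\<close> are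
  commutative rings under the operations of the type. After the change of basis they become the
  endomorphism algebra and the endomorphism ring.\<close>

definition KF :: "(complex ^ 'g) set" where "KF = {x. \<forall>v\<in>LatQ. x * v \<in> LatQ}"
definition KO :: "(complex ^ 'g) set" where "KO = {x. \<forall>v\<in>Lat. x * v \<in> Lat}"

lemma KF_diff: "x \<in> KF \<Longrightarrow> y \<in> KF \<Longrightarrow> x - y \<in> KF"
  and KF_add: "x \<in> KF \<Longrightarrow> y \<in> KF \<Longrightarrow> x + y \<in> KF"
  and KF_times: "x \<in> KF \<Longrightarrow> y \<in> KF \<Longrightarrow> x * y \<in> KF"
  and KF_1: "1 \<in> KF" and KF_0: "0 \<in> KF"
  by (simp_all add: KF_def left_diff_distrib distrib_right LatQ_diff LatQ_add mult.assoc)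

lemma KF_scale: "x \<in> KF \<Longrightarrow> of_rat q *\<^sub>R x \<in> KF"
  by (simp add: KF_def LatQ_scale)

lemma KF_power: "x \<in> KF \<Longrightarrow> x ^ k \<in> KF"
  by (induction k) (simp_all add: KF_1 KF_times)

lemma KF_prod: "(\<And>k. k \<in> S \<Longrightarrow> f k \<in> KF) \<Longrightarrow> (\<Prod>k\<in>S. f k) \<in> KF"
  by (induction S rule: infinite_finite_induct) (simp_all add: KF_1 KF_times)

lemma KF_sum: "(\<And>k. k \<in> S \<Longrightarrow> f k \<in> KF) \<Longrightarrow> (\<Sum>k\<in>S. f k) \<in> KF"
  by (induction S rule: infinite_finite_induct) (simp_all add: KF_0 KF_add)

lemma KO_KF: "x \<in> KO \<Longrightarrow> x \<in> KF"
proof -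
  assume x: "x \<in> KO"
  have "x * v \<in> LatQ" if v: "v \<in> LatQ" for v
  proof -
    obtain n :: nat where n: "n > 0" "of_nat n *\<^sub>R v \<in> Lat" using denominator[OF v] by blast
    have "x * (of_nat n *\<^sub>R v) \<in> LatQ" using x n(2) Lat_LatQ unfolding KO_def by blast
    then have "inverse (of_nat n) *\<^sub>R (x * (of_nat n *\<^sub>R v)) \<in> LatQ" by (rule LatQ_scale) simp
    then show ?thesis using n(1) by simp
  qed
  then show ?thesis by (simp add: KF_def)
qed

lemma KF_denominator:
  assumes "x \<in> KF"
  shows "\<exists>n::nat. n > 0 \<and> of_nat n *\<^sub>R x \<in> KO"
proof -
  have "range (\<lambda>k. x * b k) \<subseteq> LatQ" using assms by (auto simp: KF_def)
  from common_denominator[OF _ this] obtain n :: nat where n: "n > 0" "\<And>k. of_nat n *\<^sub>R (x * b k) \<in> Lat"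
    by auto
  have "(of_nat n *\<^sub>R x) * v \<in> Lat" if v: "v \<in> Lat" for v
  proof -
    have "(of_nat n *\<^sub>R x) * v = (of_nat n *\<^sub>R x) * (\<Sum>k\<in>UNIV. co v k *\<^sub>R b k)" by (simp only: expand)
    also have "\<dots> = (\<Sum>k\<in>UNIV. co v k *\<^sub>R (of_nat n *\<^sub>R (x * b k)))"
      by (simp add: sum_distrib_left mult.commute)
    also have "\<dots> \<in> Lat" using v by (intro Lat_sum Lat_scale n(2)) (simp add: Lat_def)
    finally show ?thesis .
  qed
  then show ?thesis using n(1) by (auto simp: KO_def)
qed

lemma KO_diff: "x \<in> KO \<Longrightarrow> y \<in> KO \<Longrightarrow> x - y \<in> KO"
  and KO_add: "x \<in> KO \<Longrightarrow> y \<in> KO \<Longrightarrow> x + y \<in> KO"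
  and KO_times: "x \<in> KO \<Longrightarrow> y \<in> KO \<Longrightarrow> x * y \<in> KO"
  and KO_1: "1 \<in> KO" and KO_0: "0 \<in> KO"
  by (simp_all add: KO_def left_diff_distrib distrib_right Lat_diff Lat_add mult.assoc)

end

text \<open>These axioms are the form in which 2-simplicity enters the arithmetic; the index type of
  the basis records the rank \<open>2 g\<close> of the lattice.\<close>

locale diag_lattice = lattice_coords b co
  for b :: "'g::finite + 'g \<Rightarrow> complex ^ 'g" and co +
  assumes g3: "CARD('g) \<ge> 3"
    and KF_inj: "x \<in> KF \<Longrightarrow> x \<notin> range rdiag \<Longrightarrow> inj (vec_nth x)"
    and KF_nonzero: "x \<in> KF \<Longrightarrow> x \<noteq> 0 \<Longrightarrow> x $ i \<noteq> 0"
begin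

lemma KF_vinv:
  assumes "x \<in> KF" "x \<noteq> 0"
  shows "vinv x \<in> KF" "x * vinv x = 1"
proof -
  show 1: "x * vinv x = 1" using KF_nonzero[OF assms] by (simp add: vec_eq_iff)
  have inj: "inj (\<lambda>v. x * v)"
  proof (rule injI)
    fix v w assume "x * v = x * w"
    then have "vinv x * x * v = vinv x * x * w" by (simp only: mult.assoc)
    then show "v = w" using 1 by (simp add: mult.commute)
  qed
  have "vinv x * v \<in> LatQ" if v: "v \<in> LatQ" for v
  proof (rule LatQ_preimage[OF linear_vec_times _ inj])
    show "x * w \<in> LatQ" if "w \<in> LatQ" for w using assms(1) that by (simp add: KF_def)
    show "x * (vinv x * v) \<in> LatQ" using v 1 by (simp add: mult.assoc[symmetric])
  qed
  then show "vinv x \<in> KF" by (simp add: KF_def)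
qed

lemma rdiag_KF: "rdiag q \<in> KF"
  by (rule KF_scale[OF KF_1])

lemma KF_two_values:
  assumes "x \<in> KF" "\<And>i. x $ i \<in> {u, v}"
  shows "x \<in> range rdiag"
proof (rule ccontr)
  assume "x \<notin> range rdiag"
  then have inj: "inj (vec_nth x)" by (rule KF_inj[OF assms(1)])
  have "CARD('g) = card (range (vec_nth x))" using card_image[OF inj] by simp
  also have "\<dots> \<le> card {u, v}" using assms(2) by (intro card_mono) auto
  also have "\<dots> \<le> 2" by (simp add: card_insert_if)
  finally show False using g3 by simp
qed

text \<open>All entries of \<open>x\<close> are roots of one quadratic polynomial, so they take at
  most two values, fewer than \<open>g\<close>.\<close>

lemma KF_quadratic:
  assumes "x \<in> KF" "x * x + rdiag p * x + rdiag q = 0"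
  shows "x \<in> range rdiag"
proof -
  define z where "z = x $ undefined"
  have e: "x $ i * x $ i + of_rat p * x $ i + of_rat q = 0" for i
    using arg_cong[OF assms(2), of "\<lambda>v. v $ i"]
    by (simp only: vector_add_component vector_mult_component rdiag_nth zero_index)
  have "x $ i = z \<or> x $ i = - of_rat p - z" for i
  proof -
    have "(x $ i - z) * (x $ i + of_rat p + z) = 0"
    proof -
      have "(x $ i - z) * (x $ i + of_rat p + z) =
          (x $ i * x $ i + of_rat p * x $ i + of_rat q) - (z * z + of_rat p * z + of_rat q)"
        by (simp add: algebra_simps)
      then show ?thesis unfolding z_def e by simp
    qed
    then have "x $ i - z = 0 \<or> x $ i + of_rat p + z = 0" by simp
    moreover have "x $ i = - of_rat p - z" if "x $ i + of_rat p + z = 0"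
    proof -
      have "x $ i = (x $ i + of_rat p + z) - of_rat p - z" by simp
      then show ?thesis using that by simp
    qed
    ultimately show ?thesis by auto
  qed
  then show ?thesis by (intro KF_two_values[OF assms(1), of z "- of_rat p - z"]) auto
qed

lemma KF_square:
  assumes "x \<in> KF" "x * x = rdiag q"
  shows "x \<in> range rdiag"
  by (rule KF_quadratic[OF assms(1), of 0 "- q"]) (simp add: assms(2) of_rat_minus)

text \<open>A relation is a polynomial of degree below \<open>g\<close> with the \<open>g\<close>
  distinct entries of \<open>x\<close> as roots.\<close>

lemma powers_independent:
  fixes x :: "complex ^ 'g"
  assumes "inj (vec_nth x)" "(\<Sum>k<CARD('g). c k *s x ^ k) = 0" "k < CARD('g)"
  shows "c k = 0"
proof (rule ccontr)
  assume "c k \<noteq> 0"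
  define p where "p = (\<Sum>k<CARD('g). Polynomial.monom (c k) k)"
  have coeff: "Polynomial.coeff p i = (if i < CARD('g) then c i else 0)" for i
    by (simp add: p_def coeff_sum if_distrib cong: if_cong)
  have p0: "p \<noteq> 0" using coeff[of k] \<open>c k \<noteq> 0\<close> assms(3) by auto
  have "poly p (x $ i) = 0" for i
    using arg_cong[OF assms(2), of "\<lambda>v. v $ i"] by (simp add: p_def poly_sum poly_monom)
  then have "range (vec_nth x) \<subseteq> {z. poly p z = 0}" by auto
  then have "card (range (vec_nth x)) \<le> card {z. poly p z = 0}"
    using poly_roots_finite[OF p0] by (intro card_mono)
  also have "\<dots> \<le> Polynomial.degree p" using p0 by (rule card_poly_roots_bound)
  also have "\<dots> < CARD('g)"
    using p0 leading_coeff_0_iff[of p] by (auto simp: coeff split: if_splits)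
  finally show False using card_image[OF assms(1)] by simp
qed

section \<open>Subfields of \<open>KF\<close> and their degrees\<close>

definition subfld :: "(complex ^ 'g) set \<Rightarrow> bool" where
  "subfld S \<longleftrightarrow> S \<subseteq> KF \<and> 1 \<in> S \<and> (\<forall>x\<in>S. \<forall>y\<in>S. x - y \<in> S \<and> x * y \<in> S) \<and> (\<forall>x\<in>S. x \<noteq> 0 \<longrightarrow> vinv x \<in> S)"

lemma subfld_KF: "subfld KF"
  by (simp add: subfld_def KF_1 KF_diff KF_times KF_vinv)

lemma subfld_0: "subfld S \<Longrightarrow> 0 \<in> S"
  unfolding subfld_def by (metis diff_self)

lemma subfld_diff: "subfld S \<Longrightarrow> x \<in> S \<Longrightarrow> y \<in> S \<Longrightarrow> x - y \<in> S"
  and subfld_times: "subfld S \<Longrightarrow> x \<in> S \<Longrightarrow> y \<in> S \<Longrightarrow> x * y \<in> S"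
  and subfld_1: "subfld S \<Longrightarrow> 1 \<in> S"
  and subfld_vinv: "subfld S \<Longrightarrow> x \<in> S \<Longrightarrow> x \<noteq> 0 \<Longrightarrow> vinv x \<in> S"
  and subfld_in_KF: "subfld S \<Longrightarrow> x \<in> S \<Longrightarrow> x \<in> KF"
  by (auto simp: subfld_def)

lemma subfld_add: "subfld S \<Longrightarrow> x \<in> S \<Longrightarrow> y \<in> S \<Longrightarrow> x + y \<in> S"
  using subfld_diff[of S x "0 - y"] subfld_diff[of S 0 y] subfld_0[of S] by simp

lemma subfld_power: "subfld S \<Longrightarrow> x \<in> S \<Longrightarrow> x ^ k \<in> S"
  by (induction k) (simp_all add: subfld_1 subfld_times)

lemma subfld_rdiag:
  assumes "subfld S" shows "rdiag q \<in> S"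
proof -
  have nat: "of_nat n *\<^sub>R 1 \<in> S" for n
    by (induction n) (simp_all add: subfld_0[OF assms] scaleR_left_distrib subfld_add[OF assms] subfld_1[OF assms])
  have int: "of_int n *\<^sub>R 1 \<in> S" for n
  proof (cases "n \<ge> 0")
    case True then show ?thesis using nat[of "nat n"] by simp
  next
    case False
    then show ?thesis using subfld_diff[OF assms subfld_0[OF assms] nat[of "nat (- n)"]] by simp
  qed
  obtain m n where q: "q = Rat.Fract m n" "n > 0" by (cases q) auto
  have "(of_int n *\<^sub>R 1 :: complex ^ 'g) \<noteq> 0" using q(2) by simp
  from subfld_vinv[OF assms int this] have "inverse (of_int n) *\<^sub>R 1 \<in> S"
    by (rule back_subst[of "\<lambda>x. x \<in> S"]) (simp add: vec_eq_iff scaleR_complex)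
  from subfld_times[OF assms int[of m] this] show ?thesis
    using q by (simp add: of_rat_rat divide_inverse mult.commute)
qed

lemma subfld_scale: "subfld S \<Longrightarrow> x \<in> S \<Longrightarrow> of_rat q *\<^sub>R x \<in> S"
  using subfld_times[OF _ subfld_rdiag[of S q], of x] by simp

lemma subfld_sum: "subfld S \<Longrightarrow> (\<And>i. i \<in> I \<Longrightarrow> f i \<in> S) \<Longrightarrow> (\<Sum>i\<in>I. f i) \<in> S"
  by (induction I rule: infinite_finite_induct) (simp_all add: subfld_0 subfld_add)

lemma KF_times_eq_0: "x \<in> KF \<Longrightarrow> x * v = 0 \<Longrightarrow> v \<noteq> 0 \<Longrightarrow> x = 0"
proof (rule ccontr)
  assume x: "x \<in> KF" "x * v = 0" "v \<noteq> 0" "x \<noteq> 0"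
  have "vinv x * (x * v) = (x * vinv x) * v" by (simp add: mult_ac)
  then show False using x KF_vinv(2)[OF x(1,4)] by simp
qed

lemma ratspan_range:
  assumes "finite C" "y \<in> ratV.span (f ` C)"
  shows "\<exists>c. y = (\<Sum>k\<in>C. of_rat (c k) *\<^sub>R f k)"
  using assms
proof (induction C arbitrary: y rule: finite_induct)
  case empty
  then show ?case by (simp add: ratV.span_empty)
next
  case (insert a C)
  then obtain q where "y - of_rat q *\<^sub>R f a \<in> ratV.span (f ` C)" by (auto simp: ratV.span_insert)
  then obtain c where c: "y - of_rat q *\<^sub>R f a = (\<Sum>k\<in>C. of_rat (c k) *\<^sub>R f k)" using insert.IH by blast
  have "y = (\<Sum>k\<in>insert a C. of_rat ((c(a := q)) k) *\<^sub>R f k)"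
  proof -
    have "(\<Sum>k\<in>C. of_rat ((c(a := q)) k) *\<^sub>R f k) = (\<Sum>k\<in>C. of_rat (c k) *\<^sub>R f k)"
      using insert.hyps by (intro sum.cong) auto
    then show ?thesis using insert.hyps c by (simp add: algebra_simps)
  qed
  then show ?case by blast
qed

text \<open>Evaluation at a lattice vector embeds \<open>KF\<close> into \<open>LatQ\<close>, which
  has dimension \<open>2 g\<close>.\<close>

lemma independent_KF_card:
  assumes "T \<subseteq> KF" "ratV.independent T"
  shows "finite T \<and> card T \<le> 2 * CARD('g)"
proof (rule ccontr)
  assume "\<not> ?thesis"
  then have "\<exists>T' \<subseteq> T. finite T' \<and> card T' = 2 * CARD('g) + 1"
  proof (cases "finite T")
    case True
    then have "2 * CARD('g) + 1 \<le> card T" using \<open>\<not> (finite T \<and> card T \<le> 2 * CARD('g))\<close> by simp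
    then show ?thesis using True by (metis obtain_subset_with_card_n)
  next
    case False
    then show ?thesis using infinite_arbitrarily_large[OF False, of "2 * CARD('g) + 1"] by blast
  qed
  then obtain T' where T': "T' \<subseteq> T" "finite T'" "card T' = 2 * CARD('g) + 1" by blast
  let ?v = "b undefined"
  have v0: "?v \<noteq> 0" using co_b[of undefined undefined] by (metis co_0 zero_neq_one)
  have "x * ?v \<in> LatQ" if "x \<in> T'" for x using that T'(1) assms(1) by (auto simp: KF_def)
  then obtain c where c: "\<exists>x\<in>T'. c x \<noteq> 0" "(\<Sum>x\<in>T'. of_rat (c x) *\<^sub>R (x * ?v)) = 0"
    using LatQ_relation[of T' "\<lambda>x. x * ?v"] T'(2,3) by auto
  have "(\<Sum>x\<in>T'. of_rat (c x) *\<^sub>R x) * ?v = 0" using c(2) by (simp add: sum_distrib_right)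
  moreover have "(\<Sum>x\<in>T'. of_rat (c x) *\<^sub>R x) \<in> KF" using T'(1) assms(1) by (intro KF_sum KF_scale) auto
  ultimately have "(\<Sum>x\<in>T'. of_rat (c x) *\<^sub>R x) = 0" using KF_times_eq_0 v0 by blast
  then have "c x = 0" if "x \<in> T'" for x
    using ratV.independentD[OF assms(2) T'(2,1), of c] that by blast
  then show False using c(1) by blast
qed

lemma subfld_basis:
  assumes "S \<subseteq> KF"
  obtains C where "C \<subseteq> S" "ratV.independent C" "S \<subseteq> ratV.span C" "finite C" "card C = ratV.dim S"
proof -
  obtain C where C: "C \<subseteq> S" "ratV.independent C" "S \<subseteq> ratV.span C" "card C = ratV.dim S"
    by (rule ratV.basis_exists)
  then show ?thesis using that independent_KF_card[of C] assms by blast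
qed

lemma independent_le_dim:
  assumes "S \<subseteq> KF" "T \<subseteq> S" "ratV.independent T"
  shows "card T \<le> ratV.dim S"
proof -
  obtain C where C: "C \<subseteq> S" "ratV.independent C" "S \<subseteq> ratV.span C" "finite C" "card C = ratV.dim S"
    using subfld_basis[OF assms(1)] by metis
  have "T \<subseteq> ratV.span C" using assms(2) C(3) by blast
  then show ?thesis using ratV.independent_span_bound[OF C(4) assms(3)] C(5) by simp
qed

lemma powers_ratindependent:
  fixes x :: "complex ^ 'g"
  assumes "inj (vec_nth x)"
  shows "inj_on (\<lambda>k. x ^ k) {..<CARD('g)}" "ratV.independent ((\<lambda>k. x ^ k) ` {..<CARD('g)})"
proof -
  let ?n = "CARD('g)"
  show inj: "inj_on (\<lambda>k. x ^ k) {..<?n}"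
  proof (rule inj_onI, rule ccontr)
    fix k l assume kl: "k \<in> {..<?n}" "l \<in> {..<?n}" "x ^ k = x ^ l" "k \<noteq> l"
    define c where "c = (\<lambda>m. if m = k then 1 else if m = l then -1 else (0::complex))"
    have "(\<Sum>m<?n. c m *s x ^ m) = (\<Sum>m\<in>{k, l}. c m *s x ^ m)"
      using kl by (intro sum.mono_neutral_right) (auto simp: c_def)
    also have "\<dots> = 0" using kl by (simp add: c_def)
    finally have "c k = 0" using powers_independent[OF assms, of c k] kl(1) by simp
    then show False by (simp add: c_def)
  qed
  show "ratV.independent ((\<lambda>k. x ^ k) ` {..<?n})"
  proof (rule ratV.independent_if_scalars_zero)
    fix f y assume e: "(\<Sum>y\<in>(\<lambda>k. x ^ k) ` {..<?n}. real_of_rat (f y) *\<^sub>R y) = 0" and y: "y \<in> (\<lambda>k. x ^ k) ` {..<?n}"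
    have "(\<Sum>k<?n. of_rat (f (x ^ k)) *s x ^ k) = 0"
      using e by (simp add: sum.reindex[OF inj] scaleR_eq_vector_scale of_real_of_rat)
    then have "of_rat (f (x ^ k)) = (0::complex)" if "k < ?n" for k
      using powers_independent[OF assms, of "\<lambda>k. of_rat (f (x ^ k))" k] that by blast
    then show "f y = 0" using y by auto
  qed simp
qed

lemma subfld_dim_ge:
  assumes "subfld S" "x \<in> S" "x \<notin> range rdiag"
  shows "CARD('g) \<le> ratV.dim S"
proof -
  have inj: "inj (vec_nth x)" using KF_inj assms subfld_in_KF by blast
  have "CARD('g) = card ((\<lambda>k. x ^ k) ` {..<CARD('g)})"
    using card_image[OF powers_ratindependent(1)[OF inj]] by simp
  also have "\<dots> \<le> ratV.dim S"
    using assms powers_ratindependent(2)[OF inj] by (intro independent_le_dim) (auto simp: subfld_def intro: subfld_power)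
  finally show ?thesis .
qed

lemma b_nonzero: "b k \<noteq> 0"
  using co_b[of k k] by (metis co_0 zero_neq_one)

text \<open>\<open>LatQ\<close> is a vector space over the field \<open>S\<close>. If it is a line,
  \<open>S\<close> has degree \<open>2 g\<close>. Otherwise two vectors independent over
  \<open>S\<close> show that twice the degree is at most \<open>2 g\<close>, and the lower bound
  \<open>g\<close> from \<open>subfld_dim_ge\<close> leaves only \<open>g\<close>.\<close>

lemma subfld_dim_cases:
  assumes "subfld S" "x \<in> S" "x \<notin> range rdiag"
  shows "ratV.dim S = CARD('g) \<or> (ratV.dim S = 2 * CARD('g) \<and> LatQ \<subseteq> (\<lambda>s. s * b k) ` S)"
proof -
  let ?v = "b k"
  have SK: "S \<subseteq> KF" using assms(1) by (simp add: subfld_def)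
  obtain C where C: "C \<subseteq> S" "ratV.independent C" "S \<subseteq> ratV.span C" "finite C" "card C = ratV.dim S"
    using subfld_basis[OF SK] by metis
  have ge: "CARD('g) \<le> ratV.dim S" using subfld_dim_ge[OF assms] .
  show ?thesis
  proof (cases "LatQ \<subseteq> (\<lambda>s. s * ?v) ` S")
    case False
    then obtain w where w: "w \<in> LatQ" "w \<notin> (\<lambda>s. s * ?v) ` S" by blast
    have "card (C <+> C) \<le> 2 * CARD('g)"
    proof (rule ccontr)
      assume "\<not> ?thesis"
      then have big: "2 * CARD('g) < card (C <+> C)" by simp
      define z where "z = case_sum (\<lambda>c. c * ?v) (\<lambda>c. c * w)"
      have "z i \<in> LatQ" if "i \<in> C <+> C" for i
        using that C(1) SK w(1) by (auto simp: z_def KF_def)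
      then obtain c where c: "\<exists>i\<in>C <+> C. c i \<noteq> 0" "(\<Sum>i\<in>C <+> C. of_rat (c i) *\<^sub>R z i) = 0"
        using LatQ_relation[of "C <+> C" z] big C(4) by (auto simp del: sum.Plus)
      define s t where "s = (\<Sum>i\<in>C. of_rat (c (Inl i)) *\<^sub>R i)" and "t = (\<Sum>i\<in>C. of_rat (c (Inr i)) *\<^sub>R i)"
      have st: "s \<in> S" "t \<in> S"
        unfolding s_def t_def using C(1) by (intro subfld_sum[OF assms(1)] subfld_scale[OF assms(1)]; blast)+
      have e: "s * ?v + t * w = 0"
        using c(2) C(4) by (simp add: sum.Plus z_def s_def t_def sum_distrib_right)
      have t0: "t = 0"
      proof (rule ccontr)
        assume t: "t \<noteq> 0"
        have "t \<in> KF" using st SK by blast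
        have "w = vinv t * (t * w)" using KF_vinv(2)[OF \<open>t \<in> KF\<close> t] by (simp add: mult.assoc[symmetric] mult.commute)
        also have "t * w = - s * ?v" using e by (simp add: eq_neg_iff_add_eq_0 add.commute)
        finally have "w = (0 - vinv t * s) * ?v" by (simp add: mult.assoc)
        moreover have "0 - vinv t * s \<in> S"
          using st t assms(1) by (intro subfld_diff subfld_0 subfld_times subfld_vinv)
        ultimately show False using w(2) by blast
      qed
      then have s0: "s = 0" using e KF_times_eq_0[of s ?v] st SK b_nonzero by auto
      have "c (Inl i) = 0" "c (Inr i) = 0" if "i \<in> C" for i
        using ratV.independentD[OF C(2,4) order_refl, of "\<lambda>i. c (Inl i)" i]
          ratV.independentD[OF C(2,4) order_refl, of "\<lambda>i. c (Inr i)" i] s0 t0 that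
        by (simp_all add: s_def t_def)
      then show False using c(1) by blast
    qed
    then show ?thesis using ge C(4,5) by (simp add: card_Plus)
  next
    case True
    then have "\<exists>s\<in>S. b m = s * ?v" for m using b_LatQ[of m] by blast
    then obtain s where s: "\<And>m. s m \<in> S" "\<And>m. b m = s m * ?v" by metis
    have inj: "inj s" by (rule injI) (metis s(2) co_b zero_neq_one)
    have "ratV.independent (range s)"
    proof (rule ratV.independent_if_scalars_zero)
      fix f y assume e: "(\<Sum>y\<in>range s. real_of_rat (f y) *\<^sub>R y) = 0" and y: "y \<in> range s"
      have "(\<Sum>m\<in>UNIV. real_of_rat (f (s m)) *\<^sub>R b m) = (\<Sum>m\<in>UNIV. real_of_rat (f (s m)) *\<^sub>R s m) * ?v"
        by (subst s(2)) (simp add: sum_distrib_right)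
      also have "\<dots> = 0" using e by (simp add: sum.reindex[OF inj])
      finally have "co (\<Sum>m\<in>UNIV. real_of_rat (f (s m)) *\<^sub>R b m) l = 0" for l by simp
      then show "f y = 0" using y by auto
    qed simp
    then have "card (range s) \<le> ratV.dim S" using s(1) by (intro independent_le_dim[OF SK]) auto
    then have "2 * CARD('g) \<le> ratV.dim S" using card_image[OF inj] by simp
    moreover have "card C \<le> 2 * CARD('g)" using independent_KF_card[OF _ C(2)] C(1) SK by blast
    ultimately show ?thesis using C(5) True by simp
  qed
qed

lemma subfld_dim_rational:
  assumes "subfld S" "S \<subseteq> range rdiag"
  shows "S = range rdiag" "ratV.dim S = 1"
proof -
  show S: "S = range rdiag" using assms subfld_rdiag by blast
  have "ratV.dim S = card {1 :: complex ^ 'g}"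
  proof (rule ratV.dim_unique[symmetric, THEN sym])
    show "{1} \<subseteq> S" using assms(1) by (simp add: subfld_1)
    show "S \<subseteq> ratV.span {1}" unfolding S by (auto intro: ratV.span_scale ratV.span_base)
    show "ratV.independent {1 :: complex ^ 'g}"
      by (rule ratV.independent_insertI) (simp_all add: ratV.span_empty ratV.independent_empty)
  qed simp
  then show "ratV.dim S = 1" by simp
qed

lemma subfld_dim: "subfld S \<Longrightarrow> ratV.dim S \<in> {1, CARD('g), 2 * CARD('g)}"
  using subfld_dim_cases[of S] subfld_dim_rational[of S] by blast

lemma subfld_dim_g_powers:
  assumes S: "subfld S" "ratV.dim S = CARD('g)" and x: "x \<in> S" "x \<notin> range rdiag" and y: "y \<in> S"
  shows "\<exists>c. y = (\<Sum>k<CARD('g). of_rat (c k) *\<^sub>R x ^ k)"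
proof -
  have SK: "S \<subseteq> KF" using S(1) by (simp add: subfld_def)
  have inj: "inj (vec_nth x)" using KF_inj x SK by blast
  let ?P = "(\<lambda>k. x ^ k) ` {..<CARD('g)}"
  note P = powers_ratindependent[OF inj]
  have PS: "?P \<subseteq> S" using subfld_power[OF S(1) x(1)] by blast
  have "y \<in> ratV.span ?P"
  proof (rule ccontr)
    assume n: "y \<notin> ratV.span ?P"
    then have "ratV.independent (insert y ?P)" using P(2) by (rule ratV.independent_insertI)
    then have "card (insert y ?P) \<le> ratV.dim S" using PS y by (intro independent_le_dim[OF SK]) auto
    moreover have "y \<notin> ?P" using n ratV.span_base[of y ?P] by metis
    ultimately show False using S(2) card_image[OF P(1)] by simp
  qed
  then show ?thesis by (intro ratspan_range) auto
qed

text \<open>A subfield of degree \<open>g\<close> is closed under complex conjugation up to a permutation of the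
  coordinates: the coordinates of a generator are all the roots of its minimal polynomial.\<close>

lemma subfld_dim_g_conjugation:
  assumes S: "subfld S" "ratV.dim S = CARD('g)" and ex: "\<not> S \<subseteq> range rdiag"
  shows "\<exists>c. \<forall>y\<in>S. \<forall>i. cnj (y $ i) = y $ c i"
proof -
  obtain x where x: "x \<in> S" "x \<notin> range rdiag" using ex by blast
  have SK: "S \<subseteq> KF" using S(1) by (simp add: subfld_def)
  have inj: "inj (vec_nth x)" using KF_inj x SK by blast
  obtain q where q: "x ^ CARD('g) = (\<Sum>k<CARD('g). of_rat (q k) *\<^sub>R x ^ k)"
    using subfld_dim_g_powers[OF S x subfld_power[OF S(1) x(1)]] by blast
  \<comment> \<open>A monic polynomial of degree \<open>g\<close> with rational coefficients. The
    \<open>g\<close> distinct entries of \<open>x\<close> are all its roots, so complex conjugation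
    permutes them.\<close>
  define p where "p = Polynomial.monom (1::complex) CARD('g) - (\<Sum>k<CARD('g). Polynomial.monom (of_rat (q k)) k)"
  have ev: "poly p z = z ^ CARD('g) - (\<Sum>k<CARD('g). of_rat (q k) * z ^ k)" for z
    by (simp add: p_def poly_sum poly_monom)
  have "Polynomial.coeff p CARD('g) = 1" by (simp add: p_def coeff_sum)
  then have p0: "p \<noteq> 0" by auto
  have "Polynomial.degree p \<le> CARD('g)"
    by (rule degree_le) (auto simp: p_def coeff_sum)
  then have "card {z. poly p z = 0} \<le> CARD('g)" using card_poly_roots_bound[OF p0] by simp
  moreover have sub: "range (vec_nth x) \<subseteq> {z. poly p z = 0}"
    using arg_cong[OF q, of "\<lambda>v. v $ i" for i] by (auto simp: ev scaleR_complex of_real_of_rat)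
  ultimately have roots: "range (vec_nth x) = {z. poly p z = 0}"
    using card_image[OF inj] by (intro card_seteq poly_roots_finite p0) simp_all
  have "poly p (cnj z) = cnj (poly p z)" for z
    by (simp add: ev) (simp flip: of_real_of_rat)
  then have "poly p (cnj (x $ i)) = 0" for i using sub by auto
  then have "\<exists>j. cnj (x $ i) = x $ j" for i using roots by (metis (mono_tags, lifting) mem_Collect_eq rangeE)
  then obtain c where c: "\<And>i. cnj (x $ i) = x $ c i" by metis
  have "cnj (y $ i) = y $ c i" if "y \<in> S" for y i
  proof -
    obtain d where d: "y = (\<Sum>k<CARD('g). of_rat (d k) *\<^sub>R x ^ k)" using subfld_dim_g_powers[OF S x \<open>y \<in> S\<close>] by blast
    have "y $ j = (\<Sum>k<CARD('g). of_rat (d k) * x $ j ^ k)" for j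
      by (simp add: d scaleR_complex of_real_of_rat)
    then show ?thesis by (simp add: c[symmetric]) (simp flip: of_real_of_rat)
  qed
  then show ?thesis by blast
qed

end

section \<open>Embeddings and subfields\<close>

lemma linear_zero_on_span: "linear f \<Longrightarrow> (\<And>v. v \<in> S \<Longrightarrow> f v = 0) \<Longrightarrow> v \<in> span S \<Longrightarrow> f v = (0 :: 'b::real_vector)"
  by (rule linear_eq_0_on_span)

lemma involution_product_finite_order:
  fixes p :: "'a::finite \<Rightarrow> 'a"
  assumes "inj p"
  shows "\<exists>m>0. (p ^^ m) = id"
proof -
  have "\<not> inj (\<lambda>k::nat. p ^^ k)"
    using finite_imageD[of "\<lambda>k::nat. p ^^ k" UNIV] by auto
  then obtain a c :: nat where ac: "p ^^ a = p ^^ c" "a < c"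
    unfolding inj_def by (metis linorder_neqE_nat)
  have "(p ^^ (c - a)) x = x" for x
  proof -
    have "(p ^^ a) ((p ^^ (c - a)) x) = (p ^^ a) x"
      using ac by (metis comp_apply funpow_add le_add_diff_inverse less_imp_le_nat)
    moreover have "inj (p ^^ a)" using assms by (rule inj_fn)
    ultimately show ?thesis by (simp add: injD)
  qed
  then show ?thesis using ac(2) by (intro exI[of _ "c - a"]) (auto simp: fun_eq_iff)
qed

context diag_lattice
begin

lemma KF_nonconstant:
  assumes "ratV.dim KF \<noteq> 1"
  obtains x where "x \<in> KF" "x \<notin> range rdiag"
  using assms subfld_dim_rational[OF subfld_KF] that by blast

text \<open>In degree \<open>2 g\<close> every vector of \<open>LatQ\<close> is a multiple of
  \<open>v\<close> by an element of \<open>KF\<close>, and \<open>LatQ\<close> spans the whole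
  space. So \<open>v\<close> has no zero entry and can be cancelled. This identifies
  \<open>KF \<otimes> \<real>\<close> with \<open>complex ^ 'g\<close>.\<close>

lemma KF_span_full:
  assumes dim: "ratV.dim KF = 2 * CARD('g)"
  shows "z \<in> span KF"
proof -
  obtain x where x: "x \<in> KF" "x \<notin> range rdiag" using KF_nonconstant dim g3 by (metis mult_is_0 nat_mult_eq_1_iff numeral_eq_one_iff semiring_norm(85))
  define v where "v = b undefined"
  have L: "LatQ \<subseteq> (\<lambda>s. s * v) ` KF"
    using subfld_dim_cases[OF subfld_KF x, of undefined] dim g3 by (auto simp: v_def)
  have vi: "v $ i \<noteq> 0" for i
  proof
    assume 0: "v $ i = 0"
    have lin: "linear (\<lambda>w :: complex ^ 'g. w $ i)" by (rule linearI) simp_all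
    have "(axis i 1 :: complex ^ 'g) $ i = 0"
      by (rule linear_zero_on_span[OF lin _ span_LatQ]) (use L 0 in auto)
    then show False by (simp add: axis_def)
  qed
  have lin: "linear (\<lambda>s. s * v)" by (rule linearI) (simp_all add: distrib_right)
  have "z * v \<in> span ((\<lambda>s. s * v) ` KF)" using span_LatQ span_mono[OF L] by blast
  then obtain s where s: "s \<in> span KF" "z * v = s * v"
    unfolding linear_span_image[OF lin] by blast
  have "z = s" using arg_cong[OF s(2), of "\<lambda>w. w $ i" for i] vi by (simp add: vec_eq_iff)
  then show ?thesis using s(1) by simp
qed

text \<open>The relation would extend to the real span, hence to the vector with all entries
  \<open>\<i>\<close>, where it fails. So in degree \<open>2 g\<close> no coordinate is a real
  embedding, and no two are conjugate.\<close>

lemma KF_no_conjugate_pair: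
  assumes dim: "ratV.dim KF = 2 * CARD('g)"
  shows "\<not> (\<forall>y\<in>KF. cnj (y $ i) = y $ j)"
proof
  assume a: "\<forall>y\<in>KF. cnj (y $ i) = y $ j"
  have lin: "linear (\<lambda>w :: complex ^ 'g. cnj (w $ i) - w $ j)" by (rule linearI) (simp_all add: algebra_simps)
  define z :: "complex ^ 'g" where "z = (\<chi> i. \<i>)"
  have "cnj (z $ i) - z $ j = 0"
    by (rule linear_zero_on_span[OF lin _ KF_span_full[OF dim]]) (use a in simp)
  then show False by (simp add: z_def complex_eq_iff)
qed

text \<open>The powers of \<open>x\<close> are a complex basis of the whole space. Since the
  coefficients of \<open>z\<close> are unique, its symmetry under \<open>c\<close> forces them to be
  real.\<close>

lemma KF_span_conjugation:
  assumes dim: "ratV.dim KF = CARD('g)" and c: "\<And>y i. y \<in> KF \<Longrightarrow> cnj (y $ i) = y $ c i"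
    and z: "\<And>i. cnj (z $ i) = z $ c i"
  shows "c (c i) = i" "z \<in> span KF"
proof -
  obtain x where x: "x \<in> KF" "x \<notin> range rdiag" using KF_nonconstant dim g3 by (metis numeral_le_one_iff semiring_norm(70))
  have inj: "inj (vec_nth x)" using KF_inj x by blast
  have cc: "c (c i) = i" for i
  proof -
    have "x $ c (c i) = x $ i" using c[OF x(1), of i] c[OF x(1), of "c i"] by (metis complex_cnj_cnj)
    then show ?thesis using inj by (simp add: injD)
  qed
  then show "c (c i) = i" .
  let ?n = "CARD('g)" and ?P = "(\<lambda>k. x ^ k) ` {..<CARD('g)}"
  note P = powers_ratindependent(1)[OF inj]
  have "vec.independent ?P"
  proof (rule vec.independent_if_scalars_zero)
    fix f y assume e: "(\<Sum>y\<in>?P. f y *s y) = 0" and y: "y \<in> ?P"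
    have "(\<Sum>k<?n. f (x ^ k) *s x ^ k) = 0" using e by (simp add: sum.reindex[OF P])
    then have "f (x ^ k) = 0" if "k < ?n" for k
      using powers_independent[OF inj, of "\<lambda>k. f (x ^ k)" k] that by blast
    then show "f y = 0" using y by auto
  qed simp
  moreover have "card ?P = vec.dim (UNIV :: (complex ^ 'g) set)" using card_image[OF P] by (simp add: card_cart_basis)
  ultimately have "UNIV \<subseteq> vec.span ?P" by (intro vec.card_ge_dim_independent) auto
  then have "z \<in> vec.span ?P" by blast
  then obtain u where "z = (\<Sum>y\<in>?P. u y *s y)" using vec.span_finite[of ?P] by auto
  then have zs: "z = (\<Sum>k<?n. u (x ^ k) *s x ^ k)" by (simp add: sum.reindex[OF P])
  define a where "a = (\<lambda>k. u (x ^ k))"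
  have zi: "z $ i = (\<Sum>k<?n. a k * x $ i ^ k)" for i by (simp add: zs a_def)
  have "(\<Sum>k<?n. (a k - cnj (a k)) *s x ^ k) = 0"
  proof -
    have "(\<Sum>k<?n. (a k - cnj (a k)) * x $ i ^ k) = 0" for i
    proof -
      have "(\<Sum>k<?n. cnj (a k) * x $ i ^ k) = cnj (\<Sum>k<?n. a k * x $ c i ^ k)"
        using c[OF x(1), of "c i"] by (simp add: cc)
      also have "\<dots> = cnj (z $ c i)" by (simp only: zi)
      also have "\<dots> = z $ i" using z[of "c i"] by (simp add: cc)
      also have "\<dots> = (\<Sum>k<?n. a k * x $ i ^ k)" by (simp only: zi)
      finally show ?thesis by (simp add: algebra_simps sum_subtractf)
    qed
    then show ?thesis
      unfolding vec_eq_iff sum_component vector_smult_component vec_power_nth zero_index by blast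
  qed
  from powers_independent[OF inj this] have "a k = cnj (a k)" if "k < ?n" for k using that by simp
  then have ar: "a k = of_real (Re (a k))" if "k < ?n" for k using that by (metis Reals_cnj_iff of_real_Re)
  have "z = (\<Sum>k<?n. Re (a k) *\<^sub>R x ^ k)"
    unfolding zs scaleR_eq_vector_scale using ar by (intro sum.cong refl arg_cong2[where f = "(*s)"]) (auto simp: a_def)
  moreover have "(\<Sum>k<?n. Re (a k) *\<^sub>R x ^ k) \<in> span KF"
    by (intro span_sum span_scale span_base KF_power x(1))
  ultimately show "z \<in> span KF" by simp
qed

text \<open>A choice of representatives \<open>range \<rho>\<close> of the archimedean places of \<open>KF\<close>, among them the
  real places \<open>Ir\<close>; the coordinates \<open>i\<close> and \<open>\<rho> i\<close> are equal or complex conjugate on \<open>KF\<close>.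
  The local degree at a place is \<open>\<kappa>\<close> times the number of coordinates belonging to it.\<close>

definition places :: "('g \<Rightarrow> 'g) \<Rightarrow> 'g set \<Rightarrow> nat \<Rightarrow> bool" where
  "places \<rho> Ir \<kappa> \<longleftrightarrow>
     (\<forall>i. \<rho> (\<rho> i) = \<rho> i) \<and> Ir \<subseteq> range \<rho> \<and>
     (\<forall>x\<in>KF. \<forall>i. norm (x $ i) = norm (x $ \<rho> i)) \<and>
     (\<forall>x\<in>KF. \<forall>i\<in>Ir. x $ i \<in> \<real>) \<and>
     (\<forall>y. (\<forall>i\<in>Ir. y i \<in> \<real>) \<longrightarrow> (\<exists>z\<in>span KF. \<forall>i\<in>range \<rho>. z $ i = y i)) \<and>
     (\<forall>z\<in>span KF. (\<forall>i\<in>range \<rho>. z $ i = 0) \<longrightarrow> z = 0) \<and>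
     \<kappa> > 0 \<and> (\<forall>j\<in>range \<rho>. \<kappa> * card {i. \<rho> i = j} = (if j \<in> Ir then 1 else 2)) \<and>
     card Ir + 2 * card (range \<rho> - Ir) = ratV.dim KF \<and>
     (ratV.dim KF = 2 * CARD('g) \<longrightarrow> Ir = {})"

lemma places_exist:
  assumes "ratV.dim KF \<noteq> 1"
  shows "\<exists>\<rho> Ir \<kappa>. places \<rho> Ir \<kappa>"
proof -
  obtain x where x: "x \<in> KF" "x \<notin> range rdiag" using KF_nonconstant assms by blast
  from subfld_dim_cases[OF subfld_KF x]
  have "ratV.dim KF = CARD('g) \<or> ratV.dim KF = 2 * CARD('g)" by blast
  then show ?thesis
  proof
    assume dim: "ratV.dim KF = 2 * CARD('g)"
    \<comment> \<open>In degree \<open>2 g\<close> each coordinate is a complex place of its own: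
      the fibres have one element and the local degree is 2.\<close>
    have "places id {} 2"
      unfolding places_def
    proof (intro conjI allI impI ballI)
      fix y :: "'g \<Rightarrow> complex"
      show "\<exists>z\<in>span KF. \<forall>i\<in>range id. z $ i = y i"
        by (rule bexI[OF _ KF_span_full[OF dim, of "\<chi> i. y i"]]) simp
    next
      fix z :: "complex ^ 'g" assume "\<forall>i\<in>range id. z $ i = 0"
      then show "z = 0" by (simp add: vec_eq_iff)
    qed (use dim in auto)
    then show ?thesis by blast
  next
    assume dim: "ratV.dim KF = CARD('g)"
    have "\<not> KF \<subseteq> range rdiag" using x by blast
    from subfld_dim_g_conjugation[OF subfld_KF dim this]
    obtain c where c: "\<And>y i. y \<in> KF \<Longrightarrow> cnj (y $ i) = y $ c i" by blast
    have cc: "c (c i) = i" for i using KF_span_conjugation(1)[OF dim c, of 0] by simp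
    \<comment> \<open>The choice depends only on the set \<open>{i, c i}\<close>, so conjugate
      coordinates get the same representative.\<close>
    define \<rho> where "\<rho> = (\<lambda>i. SOME j. j \<in> {i, c i})"
    have \<rho>: "\<rho> i \<in> {i, c i}" for i unfolding \<rho>_def by (rule someI[of _ i]) simp
    have \<rho>c: "\<rho> (c i) = \<rho> i" for i
    proof -
      have "{c i, c (c i)} = {i, c i}" by (auto simp: cc)
      then show ?thesis by (simp only: \<rho>_def)
    qed
    have \<rho>\<rho>: "\<rho> (\<rho> i) = \<rho> i" for i using \<rho>[of i] \<rho>c[of i] by auto
    define Ir where "Ir = {i. c i = i}"
    have IrI: "Ir \<subseteq> range \<rho>"
    proof
      fix i assume "i \<in> Ir"
      then have "\<rho> i = i" using \<rho>[of i] by (auto simp: Ir_def)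
      then show "i \<in> range \<rho>" by (metis rangeI)
    qed
    have fib: "{i. \<rho> i = j} = {j, c j}" if "j \<in> range \<rho>" for j
    proof -
      have j: "\<rho> j = j" using that \<rho>\<rho> by auto
      show ?thesis
      proof (rule equalityI; rule subsetI)
        fix i assume "i \<in> {i. \<rho> i = j}"
        then show "i \<in> {j, c j}" using \<rho>[of i] cc[of i] by auto
      next
        fix i assume "i \<in> {j, c j}"
        then show "i \<in> {i. \<rho> i = j}" using j \<rho>c[of j] by auto
      qed
    qed
    have fibcard: "card {i. \<rho> i = j} = (if j \<in> Ir then 1 else 2)" if "j \<in> range \<rho>" for j
      using that by (simp add: fib Ir_def card_insert_if)
    have span_c: "cnj (z $ i) = z $ c i" if "z \<in> span KF" for z i
    proof -
      have lin: "linear (\<lambda>w :: complex ^ 'g. cnj (w $ i) - w $ c i)" by (rule linearI) (simp_all add: algebra_simps)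
      have "cnj (z $ i) - z $ c i = 0"
        by (rule linear_zero_on_span[OF lin _ that]) (simp add: c)
      then show ?thesis by simp
    qed
    \<comment> \<open>In degree \<open>g\<close> both coordinates of a complex place occur, so the
      size of the fibre is already the local degree.\<close>
    have "places \<rho> Ir 1"
      unfolding places_def
    proof (intro conjI allI impI ballI)
      show "\<rho> (\<rho> i) = \<rho> i" for i by (rule \<rho>\<rho>)
      show "Ir \<subseteq> range \<rho>" by (rule IrI)
      show "norm (x $ i) = norm (x $ \<rho> i)" if "x \<in> KF" for x i
        using \<rho>[of i] c[OF that, of i] by (auto simp flip: complex_mod_cnj[of "x $ i"])
      show "x $ i \<in> \<real>" if "x \<in> KF" "i \<in> Ir" for x i
        using c[OF that(1), of i] that(2) by (simp add: Ir_def Reals_cnj_iff)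
      show "\<exists>z\<in>span KF. \<forall>i\<in>range \<rho>. z $ i = y i" if y: "\<forall>i\<in>Ir. y i \<in> \<real>" for y
      proof -
        define z :: "complex ^ 'g" where "z = (\<chi> i. if \<rho> i = i then y i else cnj (y (\<rho> i)))"
        have "cnj (z $ i) = z $ c i" for i
        proof (cases "c i = i")
          case True
          then have "\<rho> i = i" using \<rho>[of i] by simp
          then show ?thesis using True y by (simp add: z_def Ir_def Reals_cnj_iff)
        next
          case False
          then show ?thesis using \<rho>[of i] by (auto simp: z_def \<rho>c)
        qed
        then have "z \<in> span KF" using KF_span_conjugation(2)[OF dim c] by blast
        moreover have "z $ i = y i" if "i \<in> range \<rho>" for i using that \<rho>\<rho> by (auto simp: z_def)
        ultimately show ?thesis by blast
      qed
      show "z = 0" if z: "z \<in> span KF" "\<forall>i\<in>range \<rho>. z $ i = 0" for z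
      proof -
        have "z $ i = 0" for i
        proof -
          have "z $ \<rho> i = 0" using z(2) by blast
          then show ?thesis using \<rho>[of i] span_c[OF z(1), of i] by (auto simp: complex_eq_iff)
        qed
        then show ?thesis by (simp add: vec_eq_iff)
      qed
      show "1 * card {i. \<rho> i = j} = (if j \<in> Ir then 1 else 2)" if "j \<in> range \<rho>" for j
        using fibcard[OF that] by simp
      have "CARD('g) = (\<Sum>j\<in>range \<rho>. card {i. \<rho> i = j})"
        using sum.image_gen[of UNIV "\<lambda>_. 1::nat" \<rho>] by simp
      also have "\<dots> = (\<Sum>j\<in>range \<rho>. if j \<in> Ir then 1 else 2)"
        by (intro sum.cong refl fibcard)
      also have "\<dots> = card Ir + 2 * card (range \<rho> - Ir)"
        using IrI by (simp add: sum.If_cases Int_absorb1 Diff_eq)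
      finally show "card Ir + 2 * card (range \<rho> - Ir) = ratV.dim KF" using dim by simp
      show "ratV.dim KF = 2 * CARD('g) \<Longrightarrow> Ir = {}" using dim g3 by simp
    qed simp
    then show ?thesis by blast
  qed
qed

text \<open>\<open>KF\<close> arises from \<open>E\<close> by adjoining a square root
  \<open>u\<close> of an element of \<open>E\<close>. As \<open>\<tau>\<close> fixes
  \<open>E\<close>, it changes each entry of \<open>u\<close> at most by a sign. The sign is always
  minus, because a plus at one coordinate would give a conjugate pair on all of \<open>KF\<close>.
  So \<open>\<tau>\<close> is the nontrivial automorphism of \<open>KF\<close> over
  \<open>E\<close>.\<close>

lemma quadratic_subfield_involution:
  assumes dim: "ratV.dim KF = 2 * CARD('g)" and E: "subfld E" "ratV.dim E = CARD('g)"
    and c0: "\<forall>y\<in>E. \<forall>i. cnj (y $ i) = y $ c i"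
  defines "\<tau> \<equiv> \<lambda>y :: complex ^ 'g. \<chi> i. cnj (y $ c i)"
  shows "c (c i) = i" and "y \<in> KF \<Longrightarrow> \<tau> y \<in> KF" and "y \<in> KF \<Longrightarrow> \<tau> y = y \<longleftrightarrow> y \<in> E"
proof -
  have c: "cnj (y $ i) = y $ c i" if "y \<in> E" for y i using c0 that by blast
  have EK: "E \<subseteq> KF" using E(1) by (simp add: subfld_def)
  obtain x where x: "x \<in> E" "x \<notin> range rdiag" using subfld_dim_rational[OF E(1)] E(2) g3 by auto
  have inj: "inj (vec_nth x)" using KF_inj x EK by blast
  have cc: "c (c i) = i" for i
  proof -
    have "x $ c (c i) = x $ i" using c[OF x(1), of i] c[OF x(1), of "c i"] by (metis complex_cnj_cnj)
    then show ?thesis using inj by (simp add: injD)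
  qed
  then show "c (c i) = i" .
  have \<tau>E: "\<tau> y = y" if "y \<in> E" for y using c[OF that] by (simp add: \<tau>_def vec_eq_iff cc)
  have \<tau>_times: "\<tau> (y * z) = \<tau> y * \<tau> z" and \<tau>_add: "\<tau> (y + z) = \<tau> y + \<tau> z" for y z
    by (simp_all add: \<tau>_def vec_eq_iff)
  have "E \<noteq> KF" using dim E(2) g3 by auto
  then obtain w where w: "w \<in> KF" "w \<notin> E" using EK by blast
  have decomp: "\<exists>a\<in>E. \<exists>d\<in>E. y = a + d * w" if y: "y \<in> KF" for y
  proof -
    obtain C where C: "C \<subseteq> E" "ratV.independent C" "E \<subseteq> ratV.span C" "finite C" "card C = ratV.dim E"
      using subfld_basis[OF EK] by metis
    define z where "z = case_sum (\<lambda>e. e) (case_sum (\<lambda>e. e * w) (\<lambda>_::unit. y))"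
    \<comment> \<open>A rational basis of \<open>E\<close>, its products with \<open>w\<close>, and
      \<open>y\<close> are \<open>2 g + 1\<close> elements, so there is a relation between
      them.\<close>
    let ?I = "C <+> (C <+> {()})"
    have zK: "z i * b undefined \<in> LatQ" if "i \<in> ?I" for i
      using that C(1) EK w(1) y KF_times by (auto simp: z_def KF_def[symmetric]) (auto simp: KF_def mult.assoc)
    have "card ?I = 2 * CARD('g) + 1" using C(4,5) E(2) by (simp add: card_Plus)
    then obtain q where q: "\<exists>i\<in>?I. q i \<noteq> 0" "(\<Sum>i\<in>?I. of_rat (q i) *\<^sub>R (z i * b undefined)) = 0"
      using LatQ_relation[of ?I "\<lambda>i. z i * b undefined"] zK C(4) by (auto simp del: sum.Plus)
    define s t r where "s = (\<Sum>e\<in>C. of_rat (q (Inl e)) *\<^sub>R e)" and "t = (\<Sum>e\<in>C. of_rat (q (Inr (Inl e))) *\<^sub>R e)"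
      and "r = q (Inr (Inr ()))"
    have st: "s \<in> E" "t \<in> E"
      unfolding s_def t_def using C(1) by (intro subfld_sum[OF E(1)] subfld_scale[OF E(1)]; blast)+
    have "(s + (t * w + of_rat r *\<^sub>R y)) * b undefined = 0"
      using q(2) C(4) by (simp add: sum.Plus z_def s_def t_def r_def distrib_right sum_distrib_right)
    moreover have "s + (t * w + of_rat r *\<^sub>R y) \<in> KF"
      using st EK w(1) y by (intro KF_add KF_times KF_scale) auto
    ultimately have e: "s + (t * w + of_rat r *\<^sub>R y) = 0" using KF_times_eq_0 b_nonzero by blast
    have "r \<noteq> 0"
    proof
      assume r: "r = 0"
      have t0: "t = 0"
      proof (rule ccontr)
        assume t: "t \<noteq> 0"
        have tK: "t \<in> KF" using st EK by blast
        have "w = vinv t * (t * w)" using KF_vinv(2)[OF tK t] by (simp add: mult.assoc[symmetric] mult.commute)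
        also have "t * w = 0 - s" using e r by (simp add: eq_neg_iff_add_eq_0 add.commute)
        also have "vinv t * (0 - s) \<in> E"
          using st t E(1) by (intro subfld_diff subfld_0 subfld_times subfld_vinv)
        finally show False using w(2) by simp
      qed
      then have s0: "s = 0" using e r by simp
      have "q (Inl i) = 0" "q (Inr (Inl i)) = 0" if "i \<in> C" for i
        using ratV.independentD[OF C(2,4) order_refl, of "\<lambda>i. q (Inl i)" i]
          ratV.independentD[OF C(2,4) order_refl, of "\<lambda>i. q (Inr (Inl i))" i] s0 t0 that
        by (simp_all add: s_def t_def)
      then show False using q(1) r by (auto simp: r_def)
    qed
    then have "y = of_rat (- inverse r) *\<^sub>R s + (of_rat (- inverse r) *\<^sub>R t) * w"
    proof -
      have "of_rat r *\<^sub>R y = (s + (t * w + of_rat r *\<^sub>R y)) - (s + t * w)" by simp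
      then have "of_rat r *\<^sub>R y = - (s + t * w)" unfolding e by simp
      then have "inverse (of_rat r) *\<^sub>R (of_rat r *\<^sub>R y) = inverse (of_rat r) *\<^sub>R (- (s + t * w))" by simp
      then show ?thesis using \<open>r \<noteq> 0\<close> by (simp add: of_rat_minus of_rat_inverse scaleR_right_distrib algebra_simps)
    qed
    then show ?thesis using st subfld_scale[OF E(1)] by blast
  qed
  obtain a d where ad: "a \<in> E" "d \<in> E" "w * w = a + d * w" using decomp KF_times w(1) by blast
  \<comment> \<open>Completing the square in the quadratic equation of \<open>w\<close>.\<close>
  define u where "u = w - of_rat (1/2) *\<^sub>R d"
  have uK: "u \<in> KF" using w(1) ad(2) EK by (auto simp: u_def intro!: KF_diff KF_scale)
  have uE: "u \<notin> E"
  proof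
    assume "u \<in> E"
    then have "u + of_rat (1/2) *\<^sub>R d \<in> E" using ad(2) by (intro subfld_add[OF E(1)] subfld_scale[OF E(1)])
    then show False using w(2) by (simp add: u_def)
  qed
  have uu: "u * u \<in> E"
  proof -
    have "u * u = w * w - d * w + of_rat (1/4) *\<^sub>R (d * d)"
      by (simp add: u_def vec_eq_iff scaleR_complex of_real_of_rat of_rat_divide field_simps)
    also have "\<dots> = a + of_rat (1/4) *\<^sub>R (d * d)" by (simp add: ad(3))
    also have "\<dots> \<in> E" using ad by (intro subfld_add[OF E(1)] subfld_scale[OF E(1)] subfld_times[OF E(1)])
    finally show ?thesis .
  qed
  have decomp': "\<exists>a\<in>E. \<exists>d\<in>E. y = a + d * u" if y: "y \<in> KF" for y
  proof -
    obtain p q where pq: "p \<in> E" "q \<in> E" "y = p + q * w" using decomp[OF y] by blast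
    have "y = (p + of_rat (1/2) *\<^sub>R (q * d)) + q * u" by (simp add: pq(3) u_def algebra_simps)
    moreover have "p + of_rat (1/2) *\<^sub>R (q * d) \<in> E"
      using pq ad(2) by (intro subfld_add[OF E(1)] subfld_scale[OF E(1)] subfld_times[OF E(1)])
    ultimately show ?thesis using pq(2) by blast
  qed
  have \<tau>u: "\<tau> u = - u"
  proof -
    have "\<tau> u $ i = - u $ i" for i
    proof -
      have "\<tau> u * \<tau> u = u * u" using \<tau>E[OF uu] by (simp add: \<tau>_times)
      then have "\<tau> u $ i * \<tau> u $ i = u $ i * u $ i" by (metis vector_mult_component)
      then have "\<tau> u $ i = u $ i \<or> \<tau> u $ i = - u $ i" by (simp add: square_eq_iff)
      moreover have "\<tau> u $ i \<noteq> u $ i"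
      proof
        assume eq: "\<tau> u $ i = u $ i"
        have "cnj (y $ c i) = y $ i" if y: "y \<in> KF" for y
        proof -
          obtain p q where pq: "p \<in> E" "q \<in> E" "y = p + q * u" using decomp'[OF y] by blast
          have "\<tau> y $ i = y $ i" by (simp add: pq(3) \<tau>_add \<tau>_times \<tau>E[OF pq(1)] \<tau>E[OF pq(2)] eq)
          then show ?thesis by (simp add: \<tau>_def)
        qed
        then show False using KF_no_conjugate_pair[OF dim] by blast
      qed
      ultimately show ?thesis by blast
    qed
    then show ?thesis by (simp add: vec_eq_iff)
  qed
  show "\<tau> y \<in> KF" if y: "y \<in> KF"
  proof -
    obtain p q where pq: "p \<in> E" "q \<in> E" "y = p + q * u" using decomp'[OF y] by blast
    have "\<tau> y = p - q * u" by (simp add: pq(3) \<tau>_add \<tau>_times \<tau>E[OF pq(1)] \<tau>E[OF pq(2)] \<tau>u)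
    then show ?thesis using pq EK uK by (auto intro!: KF_diff KF_times)
  qed
  show "\<tau> y = y \<longleftrightarrow> y \<in> E" if y: "y \<in> KF"
  proof
    assume fixed: "\<tau> y = y"
    obtain p q where pq: "p \<in> E" "q \<in> E" "y = p + q * u" using decomp'[OF y] by blast
    have "\<tau> y = p - q * u" by (simp add: pq(3) \<tau>_add \<tau>_times \<tau>E[OF pq(1)] \<tau>E[OF pq(2)] \<tau>u)
    then have "q * u = - (q * u)" using fixed pq(3) by (metis add_uminus_conv_diff add_left_cancel)
    then have "q * u = 0" by (simp add: vec_eq_iff)
    then show "y \<in> E" using pq by simp
  qed (rule \<tau>E)
qed

theorem subfield_dim_g_unique:
  assumes dim: "ratV.dim KF = 2 * CARD('g)"
    and E: "subfld E" "ratV.dim E = CARD('g)" and F: "subfld F" "ratV.dim F = CARD('g)"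
  shows "E = F"
proof -
  have nE: "\<not> E \<subseteq> range rdiag" and nF: "\<not> F \<subseteq> range rdiag"
    using subfld_dim_rational E F g3 by auto
  obtain c where c: "\<forall>y\<in>E. \<forall>i. cnj (y $ i) = y $ c i"
    using subfld_dim_g_conjugation[OF E nE] by blast
  obtain d where d: "\<forall>y\<in>F. \<forall>i. cnj (y $ i) = y $ d i"
    using subfld_dim_g_conjugation[OF F nF] by blast
  note Ec = quadratic_subfield_involution[OF dim E c]
  note Fd = quadratic_subfield_involution[OF dim F d]
  define p where "p = (\<lambda>i. d (c i))"
  \<comment> \<open>The composite of the two involutions: the complex conjugations cancel and a
    permutation of the coordinates remains.\<close>
  define R where "R = (\<lambda>y :: complex ^ 'g. \<chi> i. y $ p i)"
  have RK: "R y \<in> KF" if "y \<in> KF" for y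
    using Ec(2)[OF Fd(2)[OF that]] by (simp add: R_def p_def)
  have pinj: "inj p" by (rule injI) (metis Ec(1) Fd(1) p_def)
  show ?thesis
  proof (cases "p = id")
    case True
    then have "c i = d i" for i using Fd(1)[of "c i"] by (metis p_def id_apply)
    then have "c = d" by (rule ext)
    then have "y \<in> E \<longleftrightarrow> y \<in> F" if "y \<in> KF" for y
      using Ec(3)[OF that] Fd(3)[OF that] by simp
    moreover have "E \<subseteq> KF" "F \<subseteq> KF" using E F by (simp_all add: subfld_def)
    ultimately show ?thesis by blast
  next
    case False
    then obtain i0 where i0: "p i0 \<noteq> i0" by (auto simp: fun_eq_iff)
    obtain m where m: "m > 0" "p ^^ m = id" using involution_product_finite_order[OF pinj] by blast
    \<comment> \<open>Summation over the powers of the permutation \<open>p\<close>. The result is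
      fixed by \<open>p\<close>, so its entries at \<open>i0\<close> and \<open>p i0\<close> agree;
      being in \<open>KF\<close>, it is rational and in particular real.\<close>
    define A where "A = (\<lambda>y :: complex ^ 'g. \<Sum>k<m. \<chi> i. y $ (p ^^ k) i)"
    have Rk: "(\<chi> i. y $ (p ^^ k) i) \<in> KF" if "y \<in> KF" for y k
    proof (induction k)
      case (Suc k)
      from RK[OF Suc] show ?case by (simp add: R_def funpow_swap1)
    qed (use that in \<open>simp add: vec_lambda_eta\<close>)
    have AK: "A y \<in> KF" if "y \<in> KF" for y unfolding A_def by (intro KF_sum Rk that)
    have Afix: "A y $ p i = A y $ i" for y i
    proof -
      have "A y $ p i = (\<Sum>k<m. y $ (p ^^ Suc k) i)" by (simp add: A_def funpow_swap1)
      also have "\<dots> = (\<Sum>k<m. y $ (p ^^ k) i) + y $ (p ^^ m) i - y $ (p ^^ 0) i"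
        using sum.lessThan_Suc_shift[of "\<lambda>k. y $ (p ^^ k) i" m] by (simp add: algebra_simps)
      also have "\<dots> = A y $ i" by (simp add: m(2) A_def)
      finally show ?thesis .
    qed
    have Areal: "A y $ i \<in> \<real>" if "y \<in> KF" for y i
    proof -
      have "\<not> inj (vec_nth (A y))" using Afix[of y i0] i0 by (auto dest: injD)
      then have "A y \<in> range rdiag" using KF_inj[OF AK[OF that]] by blast
      then show ?thesis by (auto simp: scaleR_complex)
    qed
    define z :: "complex ^ 'g" where "z = (\<chi> i. \<i>)"
    have lin: "linear (\<lambda>y. Im (A y $ i0))"
      by (rule linearI) (simp_all add: A_def sum.distrib sum_distrib_left)
    \<comment> \<open>Reality passes to the real span of \<open>KF\<close>, which is everything. But
      on the constant vector \<open>\<i>\<close> the sum is \<open>m\<close> times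
      \<open>\<i>\<close>.\<close>
    have "Im (A z $ i0) = 0"
      by (rule linear_zero_on_span[OF lin _ KF_span_full[OF dim]]) (use Areal in \<open>simp add: complex_is_Real_iff\<close>)
    moreover have "A z $ i0 = (\<Sum>k<m. \<i>)"
      unfolding A_def z_def by (simp only: sum_component vec_lambda_beta)
    ultimately show ?thesis using m(1) by simp
  qed
qed

section \<open>The Rosati involution and abelian varieties\<close>

lemma rosati_adjoint:
  assumes h: "semibilinear id cnj h" "\<And>v w. h w v = cnj (h v w)" "\<And>v. v \<noteq> 0 \<Longrightarrow> Re (h v v) > 0"
    and hint: "\<And>k l. Im (h (b k) (b l)) \<in> \<rat>"
    and diag: "\<And>A. (\<And>v. v \<in> LatQ \<Longrightarrow> A *v v \<in> LatQ) \<Longrightarrow> \<exists>x. \<forall>v. A *v v = x * v"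
    and x: "x \<in> KF"
  shows "\<exists>y\<in>KF. \<forall>v w. h (x * v) w = h v (y * w)"
proof -
  have add1: "h (u + v) w = h u w + h v w" and add2: "h w (u + v) = h w u + h w v"
    and sc1: "h (c *s v) w = c * h v w" and sc2: "h v (c *s w) = cnj c * h v w" for u v w c
    using h(1) by (auto simp: semibilinear_def)
  have r1: "h (r *\<^sub>R v) w = of_real r * h v w" and r2: "h v (r *\<^sub>R w) = of_real r * h v w" for r v w
    by (simp_all add: scaleR_eq_vector_scale sc1 sc2)
  have lin1: "linear (\<lambda>v. h v w)" and lin2: "linear (h v)" for v w
    by (rule linearI, simp_all add: add1 add2 r1 r2 scaleR_complex)+
  have diff2: "h v (u - w) = h v u - h v w" for u v w using linear_diff[OF lin2] .
  have expand_axis: "h v w = (\<Sum>i\<in>UNIV. v $ i * h (axis i 1) w)" for v w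
  proof -
    have "h v w = h (\<Sum>i\<in>UNIV. v $ i *s axis i 1) w" by (simp add: basis_expansion)
    also have "\<dots> = (\<Sum>i\<in>UNIV. v $ i * h (axis i 1) w)" by (simp only: linear_sum[OF lin1] sc1)
    finally show ?thesis .
  qed
  have nondeg: "u = w" if "\<And>v. h v u = h v w" for u w
  proof (rule ccontr)
    assume "u \<noteq> w"
    then have "Re (h (u - w) (u - w)) > 0" using h(3) by simp
    moreover have "h (u - w) (u - w) = 0" using that by (simp add: diff2)
    ultimately show False by simp
  qed
  \<comment> \<open>\<open>T u\<close> lists the coefficients of the linear form represented by
    \<open>u\<close>. Over \<real> this is a linear injection of a space into itself, so every
    complex linear form is represented by some vector.\<close>
  define T where "T = (\<lambda>u. \<chi> i. h (axis i 1) u)"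
  have Tlin: "linear T" by (rule linearI) (simp_all add: T_def vec_eq_iff add2 r2 scaleR_complex)
  have "inj T"
  proof (rule injI, rule nondeg)
    fix u w v assume "T u = T w"
    then have "h (axis i 1) u = h (axis i 1) w" for i by (simp add: T_def vec_eq_iff)
    then show "h v u = h v w" by (simp add: expand_axis[of v])
  qed
  then have Tsurj: "surj T" using Tlin linear_injective_imp_surjective by blast
  have "\<exists>u. \<forall>v. h (x * v) w = h v u" for w
  proof -
    obtain u where u: "T u = (\<chi> i. h (x * axis i 1) w)" using Tsurj by (metis surjD)
    have "h (x * v) w = h v u" for v
    proof -
      have "h v u = (\<Sum>i\<in>UNIV. v $ i * h (axis i 1) u)" by (rule expand_axis)
      also have "\<dots> = (\<Sum>i\<in>UNIV. v $ i * h (x * axis i 1) w)" using u by (simp add: T_def vec_eq_iff)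
      also have "\<dots> = (\<Sum>i\<in>UNIV. (x * v) $ i * h (axis i 1) w)" by (simp add: times_axis sc1 mult_ac)
      also have "\<dots> = h (x * v) w" by (rule expand_axis[symmetric])
      finally show ?thesis by simp
    qed
    then show ?thesis by blast
  qed
  then obtain adj where adj: "\<And>v w. h (x * v) w = h v (adj w)" by metis
  have adj_add: "adj (u + w) = adj u + adj w" for u w
    by (rule nondeg) (simp add: adj[symmetric] add2)
  have adj_sc: "adj (c *s w) = c *s adj w" for c w
    by (rule nondeg) (simp add: adj[symmetric] sc2)
  have lin: "Vector_Spaces.linear (*s) (*s) adj"
    by unfold_locales (simp_all add: adj_add adj_sc)
  define E where "E = (\<lambda>v w. Im (h v w))"
  have Eadd2: "E v (u + w) = E v u + E v w" and Esc2: "E v (r *\<^sub>R w) = r * E v w"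
    and Eadd1: "E (u + v) w = E u w + E v w" and Esc1: "E (r *\<^sub>R v) w = r * E v w" for u v w r
    by (simp_all add: E_def add1 add2 r1 r2)
  have Elin: "linear (E v)" "linear (\<lambda>v. E v w)" for v w
    by (rule linearI, simp_all add: Eadd2 Esc2 Eadd1 Esc1)+
  have Eexp: "E v w = (\<Sum>m\<in>UNIV. co w m * E v (b m))" for v w
  proof -
    have "E v w = E v (\<Sum>m\<in>UNIV. co w m *\<^sub>R b m)" by (simp only: expand)
    then show ?thesis by (simp add: linear_sum[OF Elin(1)] Esc2)
  qed
  have Eexp1: "E v w = (\<Sum>m\<in>UNIV. co v m * E (b m) w)" for v w
  proof -
    have "E v w = E (\<Sum>m\<in>UNIV. co v m *\<^sub>R b m) w" by (simp only: expand)
    then show ?thesis by (simp add: linear_sum[OF Elin(2)] Esc1)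
  qed
  have EQ: "E v w \<in> \<rat>" if "v \<in> LatQ" "w \<in> LatQ" for v w
  proof -
    have "E v (b m) \<in> \<rat>" for m
      unfolding Eexp1[of v] using that(1) hint by (intro Rats_sum Rats_mult) (auto simp: LatQ_def E_def)
    then show ?thesis unfolding Eexp[of v w] using that(2) by (intro Rats_sum Rats_mult) (auto simp: LatQ_def)
  qed
  have Enondeg: "u = w" if "\<And>k. E (b k) u = E (b k) w" for u w
  proof (rule ccontr)
    assume "u \<noteq> w"
    then have "Re (h (u - w) (u - w)) > 0" using h(3) by simp
    moreover have "E v u = E v w" for v using that by (simp add: Eexp1[of v])
    then have "Im (h (\<i> *s (u - w)) (u - w)) = 0" unfolding E_def diff2 by simp
    then have "Im (\<i> * h (u - w) (u - w)) = 0" by (simp only: sc1)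
    ultimately show False by simp
  qed
  have "adj w \<in> LatQ" if w: "w \<in> LatQ" for w
  proof -
    obtain l :: "real \<Rightarrow> rat" where l: "ratlin l" "l 1 = 1" using ratlin_exists by blast
    \<comment> \<open>The basis vectors have rational pairings with each other and with
      \<open>adj w\<close>. Hence the rational part of \<open>adj w\<close> has the same pairings as
      \<open>adj w\<close>, and nondegeneracy identifies the two.\<close>
    have "E (b k) (rpart l (adj w)) = E (b k) (adj w)" for k
    proof -
      have "E (b k) (rpart l (adj w)) = (\<Sum>m\<in>UNIV. E (b k) (b m) * of_rat (l (co (adj w) m)))"
        by (simp add: Eexp[of _ "rpart l (adj w)"] mult.commute)
      also have "\<dots> = (\<Sum>m\<in>UNIV. of_rat (l (E (b k) (b m) * co (adj w) m)))"
        using EQ by (intro sum.cong refl ratlin_mult[OF l(1), symmetric]) simp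
      also have "\<dots> = of_rat (l (E (b k) (adj w)))"
        by (subst Eexp[of "b k" "adj w"]) (simp add: ratlin_sum[OF l(1)] of_rat_sum mult.commute)
      also have "\<dots> = E (b k) (adj w)"
      proof -
        have "E (b k) (adj w) = E (x * b k) w" by (simp add: E_def adj)
        then have "E (b k) (adj w) \<in> \<rat>" using EQ[OF _ w] x by (simp add: KF_def)
        from ratlin_mult[OF l(1) this, of 1] show ?thesis using l(2) by simp
      qed
      finally show ?thesis .
    qed
    then have "rpart l (adj w) = adj w" by (rule Enondeg)
    then show ?thesis using rpart_LatQ by metis
  qed
  then have "\<exists>y. \<forall>v. matrix adj *v v = y * v" by (intro diag) (simp add: matrix_works[OF lin])
  then obtain y where y: "\<And>v. adj v = y * v" using matrix_works[OF lin] by metis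
  have "y \<in> KF" using \<open>\<And>w. w \<in> LatQ \<Longrightarrow> adj w \<in> LatQ\<close> by (simp add: KF_def y)
  then show ?thesis using adj y by auto
qed

text \<open>It suffices that \<open>x\<close> is self-adjoint for \<open>h\<close>, as the unit
  vectors are its eigenvectors. If some nonrational element is self-adjoint, so is all of
  \<open>KF\<close>, which consists of the rational polynomials in it. Such an element is
  \<open>x\<close> plus its adjoint or, if this sum is a rational \<open>q\<close>, the square of
  \<open>t = 2 x - q\<close>, since the adjoint of \<open>t\<close> is \<open>- t\<close>. If the
  square is rational too, then \<open>t\<close> and \<open>x\<close> are rational by
  \<open>KF_square\<close>.\<close>

theorem abelian_totally_real:
  assumes dim: "ratV.dim KF = CARD('g)"
    and h: "semibilinear id cnj h" "\<And>v w. h w v = cnj (h v w)" "\<And>v. v \<noteq> 0 \<Longrightarrow> Re (h v v) > 0"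
    and hint: "\<And>k l. Im (h (b k) (b l)) \<in> \<rat>"
    and diag: "\<And>A. (\<And>v. v \<in> LatQ \<Longrightarrow> A *v v \<in> LatQ) \<Longrightarrow> \<exists>x. \<forall>v. A *v v = x * v"
    and x: "x \<in> KF"
  shows "x $ i \<in> \<real>"
proof -
  define adj where "adj = (\<lambda>x y. \<forall>v w. h (x * v) w = h v (y * w))"
  have add1: "h (u + v) w = h u w + h v w" and add2: "h w (u + v) = h w u + h w v"
    and sc1: "h (c *s v) w = c * h v w" and sc2: "h v (c *s w) = cnj c * h v w" for u v w c
    using h(1) by (auto simp: semibilinear_def)
  have r1: "h (r *\<^sub>R v) w = of_real r * h v w" and r2: "h v (r *\<^sub>R w) = of_real r * h v w" for r v w
    by (simp_all add: scaleR_eq_vector_scale sc1 sc2)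
  have lin2: "linear (h v)" for v by (rule linearI) (simp_all add: add2 r2 scaleR_complex)
  have diff2: "h v (u - w) = h v u - h v w" for u v w using linear_diff[OF lin2] .
  have adj_add: "adj (x + x') (y + y')" if "adj x y" "adj x' y'" for x x' y y'
    using that by (simp add: adj_def add1 add2 distrib_right)
  have adj_times: "adj (x * x') (y * y')" if "adj x y" "adj x' y'" for x x' y y'
    using that by (simp add: adj_def mult.assoc mult.left_commute[of y])
  have adj_scale: "adj (of_rat q *\<^sub>R x) (of_rat q *\<^sub>R y)" if "adj x y" for q x y
    using that by (simp add: adj_def r1 r2)
  have adj_1: "adj 1 1" by (simp add: adj_def)
  have adj_0: "adj 0 0" using adj_scale[OF adj_1, of 0] by simp
  have adj_power: "adj (x ^ k) (x ^ k)" if "adj x x" for x k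
    by (induction k) (simp_all add: adj_1 adj_times that)
  have adj_sum: "adj (\<Sum>i\<in>I. f i) (\<Sum>i\<in>I. f i)" if "\<And>i. i \<in> I \<Longrightarrow> adj (f i) (f i)" for f :: "nat \<Rightarrow> complex ^ 'g" and I
    using that by (induction I rule: infinite_finite_induct) (simp_all add: adj_0 adj_add)
  have adj_sym: "adj y x" if "adj x y" for x y
  proof -
    have "h (y * v) w = h v (x * w)" for v w
      using that h(2)[of w "y * v"] h(2)[of "x * w" v] by (simp add: adj_def)
    then show ?thesis by (simp add: adj_def)
  qed
  have adj_unique: "y = y'" if "adj x y" "adj x y'" for x y y'
  proof -
    have "h v (y * w) = h v (y' * w)" for v w using that unfolding adj_def by metis
    then have "h (y * w - y' * w) (y * w - y' * w) = 0" for w by (simp add: diff2)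
    then have "y * w - y' * w = 0" for w using h(3)[of "y * w - y' * w"] by fastforce
    from this[of 1] show ?thesis by simp
  qed
  have self: "adj y y" if S: "s \<in> KF" "s \<notin> range rdiag" "adj s s" and y: "y \<in> KF" for s y
  proof -
    obtain c where "y = (\<Sum>k<CARD('g). of_rat (c k) *\<^sub>R s ^ k)"
      using subfld_dim_g_powers[OF subfld_KF dim S(1,2) y] by blast
    then show ?thesis using adj_sum adj_scale adj_power[OF S(3)] by simp
  qed
  obtain y where y: "y \<in> KF" "adj x y"
    using rosati_adjoint[OF h hint diag x] by (auto simp: adj_def)
  have "adj x x"
  proof (cases "x + y \<in> range rdiag")
    case False
    then show ?thesis using self[OF KF_add[OF x y(1)] _ _ x] adj_add[OF y(2) adj_sym[OF y(2)]]
      by (simp add: add.commute)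
  next
    case True
    then obtain q where q: "x + y = rdiag q" by blast
    then have y_eq: "y = rdiag q + of_rat (- 1) *\<^sub>R x" by (simp add: eq_diff_eq add.commute)
    define t where "t = of_rat 2 *\<^sub>R x + rdiag (- q)"
    have tK: "t \<in> KF" unfolding t_def by (intro KF_add KF_scale x KF_1)
    have "adj t (of_rat 2 *\<^sub>R y + rdiag (- q))"
      unfolding t_def by (intro adj_add adj_scale y adj_1)
    also have "of_rat 2 *\<^sub>R y + rdiag (- q) = of_rat (- 1) *\<^sub>R t"
      by (simp add: y_eq t_def algebra_simps vec_eq_iff scaleR_complex of_rat_minus)
    finally have "adj (t * t) (of_rat (- 1) *\<^sub>R t * of_rat (- 1) *\<^sub>R t)"
      by (intro adj_times)
    then have tt: "adj (t * t) (t * t)" by simp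
    have "t \<in> range rdiag \<or> adj x x"
    proof (cases "t * t \<in> range rdiag")
      case True
      then show ?thesis using KF_square[OF tK] by blast
    next
      case False
      then show ?thesis using self[OF KF_times[OF tK tK] False tt x] by blast
    qed
    then show ?thesis
    proof
      assume "t \<in> range rdiag"
      then obtain r where "t = rdiag r" by blast
      then have "x = of_rat (1/2) *\<^sub>R (rdiag (r + q))"
        by (simp add: t_def of_rat_add of_rat_minus of_rat_divide vec_eq_iff scaleR_complex field_simps)
      then show ?thesis using adj_scale[OF adj_scale[OF adj_1]] by simp
    qed
  qed
  then have "h (x * axis i 1) (axis i 1) = h (axis i 1) (x * axis i 1)" by (simp add: adj_def)
  then have "x $ i * h (axis i 1) (axis i 1) = cnj (x $ i) * h (axis i 1) (axis i 1)"
    by (simp add: times_axis sc1 sc2)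
  moreover have "h (axis i 1) (axis i 1) \<noteq> 0"
    using h(3)[of "axis i 1"] by (fastforce simp: axis_eq_0_iff)
  ultimately have "x $ i = cnj (x $ i)" by simp
  then show ?thesis by (metis Reals_cnj_iff)
qed

end

section \<open>Units of an order\<close>

lemma det_Ints:
  fixes A :: "real ^ 'n ^ 'n"
  assumes "\<And>i j. A $ i $ j \<in> \<int>"
  shows "det A \<in> \<int>"
  unfolding det_def by (intro Ints_sum Ints_mult Ints_prod Ints_of_int assms)

lemma det_of_real: "det (\<chi> i j. complex_of_real ((A :: real ^ 'n ^ 'n) $ i $ j)) = of_real (det A)"
  by (simp add: det_def)

context diag_lattice
begin

definition mult_matrix :: "complex ^ 'g \<Rightarrow> real ^ ('g + 'g) ^ ('g + 'g)" where
  "mult_matrix x = (\<chi> k l. co (x * b l) k)"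

text \<open>In the coordinates of \<open>complex ^ 'g\<close> and their conjugates, multiplication by \<open>x\<close> is diagonal.\<close>

lemma det_mult_matrix: "det (mult_matrix x) = (\<Prod>i\<in>UNIV. (norm (x $ i))\<^sup>2)"
proof -
  define P :: "complex ^ ('g + 'g) ^ ('g + 'g)" where
    "P = (\<chi> r k. case r of Inl i \<Rightarrow> b k $ i | Inr i \<Rightarrow> cnj (b k $ i))"
  define e where "e = case_sum (\<lambda>i. x $ i) (\<lambda>i. cnj (x $ i))"
  define D :: "complex ^ ('g + 'g) ^ ('g + 'g)" where "D = (\<chi> r s. if r = s then e r else 0)"
  define M :: "complex ^ ('g + 'g) ^ ('g + 'g)" where "M = (\<chi> k l. of_real (mult_matrix x $ k $ l))"
  have xb: "(\<Sum>k\<in>UNIV. b k $ i * of_real (co (x * b l) k)) = x $ i * b l $ i" for i l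
  proof -
    have "(\<Sum>k\<in>UNIV. b k $ i * of_real (co (x * b l) k)) = (\<Sum>k\<in>UNIV. co (x * b l) k *\<^sub>R b k) $ i"
      by (simp add: scaleR_complex mult.commute)
    also have "\<dots> = x $ i * b l $ i" by (simp only: expand vector_mult_component)
    finally show ?thesis .
  qed
  have "P ** M = D ** P"
  proof -
    have "(P ** M) $ r $ l = (D ** P) $ r $ l" for r l
    proof -
      have R: "(D ** P) $ r $ l = e r * P $ r $ l"
        by (simp add: matrix_matrix_mult_def D_def if_distrib if_distribR cong: if_cong)
      show ?thesis
      proof (cases r)
        case (Inl i)
        then show ?thesis unfolding R using xb[of i l]
          by (simp add: matrix_matrix_mult_def P_def M_def e_def mult_matrix_def)
      next
        case (Inr i)
        then show ?thesis unfolding R using arg_cong[OF xb[of i l], of cnj]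
          by (simp add: matrix_matrix_mult_def P_def M_def e_def mult_matrix_def)
      qed
    qed
    then show ?thesis by (simp add: vec_eq_iff)
  qed
  then have "det P * det M = det D * det P" by (metis det_mul)
  \<comment> \<open>A vector \<open>z\<close> in the kernel and its conjugate both give relations
    between the \<open>b k\<close>. So do the real and the imaginary parts of its entries, which
    therefore vanish.\<close>
  moreover have "det P \<noteq> 0"
  proof -
    have "z = 0" if z: "P *v z = 0" for z
    proof -
      have 1: "(\<Sum>k\<in>UNIV. b k $ i * z $ k) = 0" and 2: "(\<Sum>k\<in>UNIV. cnj (b k $ i) * z $ k) = 0" for i
        using arg_cong[OF z, of "\<lambda>v. v $ Inl i"] arg_cong[OF z, of "\<lambda>v. v $ Inr i"]
        by (simp_all add: matrix_vector_mult_def P_def)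
      have 3: "(\<Sum>k\<in>UNIV. b k $ i * cnj (z $ k)) = 0" for i
        using arg_cong[OF 2[of i], of cnj] by simp
      have "(\<Sum>k\<in>UNIV. Re (z $ k) *\<^sub>R b k) = 0" "(\<Sum>k\<in>UNIV. Im (z $ k) *\<^sub>R b k) = 0"
      proof -
        have re: "of_real (Re w) = (w + cnj w) / 2" and im: "of_real (Im w) = (w - cnj w) / (2 * \<i>)" for w
          by (simp_all add: complex_eq_iff)
        have "(\<Sum>k\<in>UNIV. Re (z $ k) *\<^sub>R b k $ i) = ((\<Sum>k\<in>UNIV. b k $ i * z $ k) + (\<Sum>k\<in>UNIV. b k $ i * cnj (z $ k))) / 2" for i
          by (simp add: scaleR_complex re sum.distrib[symmetric] sum_divide_distrib algebra_simps)
        then show "(\<Sum>k\<in>UNIV. Re (z $ k) *\<^sub>R b k) = 0" by (simp add: vec_eq_iff 1 3)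
        have "(\<Sum>k\<in>UNIV. Im (z $ k) *\<^sub>R b k $ i) = ((\<Sum>k\<in>UNIV. b k $ i * z $ k) - (\<Sum>k\<in>UNIV. b k $ i * cnj (z $ k))) / (2 * \<i>)" for i
          by (simp add: scaleR_complex im sum_subtractf[symmetric] sum_divide_distrib algebra_simps)
        then show "(\<Sum>k\<in>UNIV. Im (z $ k) *\<^sub>R b k) = 0" by (simp add: vec_eq_iff 1 3)
      qed
      then have "co (\<Sum>k\<in>UNIV. Re (z $ k) *\<^sub>R b k) l = 0" "co (\<Sum>k\<in>UNIV. Im (z $ k) *\<^sub>R b k) l = 0" for l
        by simp_all
      then show ?thesis by (simp add: vec_eq_iff complex_eq_iff)
    qed
    then have "inj ((*v) P)"
      by (metis (no_types, lifting) injI matrix_vector_mult_diff_distrib right_minus_eq)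
    then have "invertible P" by (simp add: invertible_left_inverse matrix_left_invertible_injective)
    then show ?thesis by (simp add: invertible_det_nz)
  qed
  ultimately have "det M = det D" by simp
  moreover have "det M = of_real (det (mult_matrix x))" unfolding M_def by (rule det_of_real)
  moreover have "det D = of_real (\<Prod>i\<in>UNIV. (norm (x $ i))\<^sup>2)"
  proof -
    have "det D = (\<Prod>r\<in>UNIV. e r)" by (subst det_diagonal) (simp_all add: D_def)
    also have "\<dots> = (\<Prod>r\<in>UNIV <+> UNIV. e r)" by (simp only: UNIV_Plus_UNIV)
    also have "\<dots> = (\<Prod>i\<in>UNIV. x $ i) * (\<Prod>i\<in>UNIV. cnj (x $ i))"
      by (subst prod.Plus) (simp_all add: e_def)
    also have "\<dots> = of_real (\<Prod>i\<in>UNIV. (norm (x $ i))\<^sup>2)"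
      by (simp only: prod.distrib[symmetric] of_real_prod complex_norm_square)
    finally show ?thesis .
  qed
  ultimately show ?thesis by (metis of_real_eq_iff)
qed

lemma KO_norm_Ints:
  assumes "x \<in> KO"
  shows "(\<Prod>i\<in>UNIV. (norm (x $ i))\<^sup>2) \<in> \<int>"
proof -
  have "x * b l \<in> Lat" for l using assms by (simp add: KO_def)
  then have "det (mult_matrix x) \<in> \<int>" by (intro det_Ints) (simp add: mult_matrix_def Lat_def)
  then show ?thesis by (simp add: det_mult_matrix)
qed

lemma KO_norm_pos:
  assumes "x \<in> KO" "x \<noteq> 0"
  shows "(\<Prod>i\<in>UNIV. (norm (x $ i))\<^sup>2) > 0"
  using KF_nonzero[OF KO_KF[OF assms(1)] assms(2)] by (intro prod_pos) simp

lemma KO_norm_ge_1: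
  assumes "x \<in> KO" "x \<noteq> 0"
  shows "(\<Prod>i\<in>UNIV. (norm (x $ i))\<^sup>2) \<ge> 1"
  using KO_norm_Ints[OF assms(1)] KO_norm_pos[OF assms] by (auto elim!: Ints_cases)

text \<open>Cramer's rule for the integral matrix of multiplication by \<open>x\<close>, whose
  determinant is the norm. So \<open>x * Lat\<close> contains the norm times
  \<open>Lat\<close>.\<close>

lemma Lat_norm_divide:
  assumes x: "x \<in> KO" "x \<noteq> 0" and v: "v \<in> Lat"
  shows "\<exists>w\<in>Lat. x * w = (\<Prod>i\<in>UNIV. (norm (x $ i))\<^sup>2) *\<^sub>R v"
proof -
  let ?A = "mult_matrix x"
  have Aint: "?A $ k $ l \<in> \<int>" for k l
  proof -
    have "x * b l \<in> Lat" using x(1) b_Lat unfolding KO_def by blast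
    then show ?thesis by (simp add: mult_matrix_def Lat_def)
  qed
  have det: "det ?A \<noteq> 0" using KO_norm_pos[OF x] unfolding det_mult_matrix by linarith
  define c where "c = (\<lambda>k. det (\<chi> i j. if j = k then co v i else ?A $ i $ j))"
  have cint: "c k \<in> \<int>" for k
    unfolding c_def using v Aint by (intro det_Ints) (simp add: Lat_def)
  have sol: "?A *v (\<chi> k. c k / det ?A) = (\<chi> i. co v i)"
    by (subst cramer[OF det]) (simp add: c_def cong: if_cong)
  define w where "w = (\<Sum>k\<in>UNIV. c k *\<^sub>R b k)"
  have "x * w = det ?A *\<^sub>R v"
  proof (rule co_eqI)
    fix k
    have "co (x * w) k = (\<Sum>l\<in>UNIV. c l * co (x * b l) k)"
      by (simp add: w_def sum_distrib_left co_sum)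
    also have "\<dots> = det ?A * (\<Sum>l\<in>UNIV. ?A $ k $ l * (c l / det ?A))"
      using det by (simp add: sum_distrib_left mult_matrix_def mult.commute)
    also have "(\<Sum>l\<in>UNIV. ?A $ k $ l * (c l / det ?A)) = co v k"
      using arg_cong[OF sol, of "\<lambda>u. u $ k"] by (simp add: matrix_vector_mult_def)
    finally show "co (x * w) k = co (det ?A *\<^sub>R v) k" by simp
  qed
  moreover have "w \<in> Lat" using cint by (simp add: Lat_def w_def)
  ultimately show ?thesis by (auto simp: det_mult_matrix)
qed

text \<open>Only finitely many sublattices \<open>x * Lat\<close> have bounded index: they all contain a fixed multiple
  of the lattice.\<close>

lemma finite_multiples:
  "finite ((\<lambda>x. (\<lambda>v. x * v) ` Lat) ` {x \<in> KO. x \<noteq> 0 \<and> (\<Prod>i\<in>UNIV. (norm (x $ i))\<^sup>2) \<le> C})"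
    (is "finite (?f ` ?X)")
proof -
  \<comment> \<open>The factorial is a common multiple of all positive integers up to
    \<open>C\<close>, in particular of the norms in question; hence all these sublattices contain
    \<open>N\<close> times \<open>Lat\<close>.\<close>
  define N :: nat where "N = fact (nat \<lfloor>C\<rfloor>)"
  have N0: "N > 0" by (simp add: N_def)
  have NS: "of_nat N *\<^sub>R v \<in> ?f x" if x: "x \<in> ?X" and v: "v \<in> Lat" for x v
  proof -
    let ?n = "\<Prod>i\<in>UNIV. (norm (x $ i))\<^sup>2"
    obtain z where z: "?n = of_int z" using KO_norm_Ints x by (auto elim: Ints_cases)
    have z1: "z \<ge> 1" "of_int z \<le> C" using KO_norm_ge_1[of x] x z by auto
    then have "nat z dvd N" unfolding N_def by (intro dvd_fact) (auto simp: le_nat_floor nat_le_iff le_floor_iff)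
    then obtain m where m: "N = nat z * m" by (elim dvdE)
    obtain w where w: "w \<in> Lat" "x * w = ?n *\<^sub>R v" using Lat_norm_divide[OF _ _ v] x by blast
    have "x * (of_nat m *\<^sub>R w) = of_nat m *\<^sub>R (x * w)" by simp
    also have "\<dots> = (of_nat m * of_int z) *\<^sub>R v" unfolding w(2) z by simp
    also have "of_nat m * of_int z = real N" using z1 m by simp
    finally have "of_nat N *\<^sub>R v = x * (of_nat m *\<^sub>R w)" by (rule sym)
    moreover have "of_nat m *\<^sub>R w \<in> Lat" by (rule Lat_scale[OF w(1)]) simp
    ultimately show ?thesis by (simp only:) (rule imageI)
  qed
  \<comment> \<open>Representatives of \<open>Lat\<close> modulo \<open>N\<close> times
    \<open>Lat\<close>. A sublattice that contains the latter is determined by its members in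
    \<open>F\<close>.\<close>
  define F where "F = {v. \<forall>k. co v k \<in> real ` {..<N}}"
  have "inj_on co F" by (rule inj_onI) (rule co_eqI, simp)
  moreover have "co ` F \<subseteq> UNIV \<rightarrow>\<^sub>E (real ` {..<N})" by (auto simp: F_def PiE_UNIV_domain)
  moreover have "finite ((UNIV :: ('g + 'g) set) \<rightarrow>\<^sub>E (real ` {..<N}))" by (intro finite_PiE) auto
  ultimately have finF: "finite F" by (meson finite_imageD finite_subset)
  have inj: "inj_on (\<lambda>S. S \<inter> F) (?f ` ?X)"
  proof (rule inj_onI)
    have sub: "?f x \<subseteq> ?f y" if x: "x \<in> ?X" and y: "y \<in> ?X" and e: "?f x \<inter> F = ?f y \<inter> F" for x y
    proof
      fix v assume v: "v \<in> ?f x"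
      then have vL: "v \<in> Lat" using x by (auto simp: KO_def)
      define q where "q = (\<Sum>k\<in>UNIV. of_int \<lfloor>co v k / of_nat N\<rfloor> *\<^sub>R b k)"
      have qL: "q \<in> Lat" by (simp add: q_def Lat_def)
      have closed: "u + s \<in> ?f z" "u - s \<in> ?f z" if "u \<in> ?f z" "s \<in> ?f z" for u s z
        using that Lat_add Lat_diff by (auto simp flip: distrib_left right_diff_distrib)
      define r where "r = v - of_nat N *\<^sub>R q"
      have rF: "r \<in> F"
        unfolding F_def
      proof (intro CollectI allI)
        fix k
        obtain z where z: "co v k = of_int z" using vL by (auto simp: Lat_def elim!: allE[of _ k] Ints_cases)
        have "co r k = of_int z - of_nat N * of_int \<lfloor>co v k / of_nat N\<rfloor>" by (simp add: r_def q_def z)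
        also have "\<lfloor>co v k / of_nat N\<rfloor> = z div int N"
          unfolding z using floor_divide_of_int_eq[of z "int N"] by (metis of_int_of_nat_eq)
        also have "of_int z - of_nat N * of_int (z div int N) = real_of_int (z - int N * (z div int N))" by simp
        also have "z - int N * (z div int N) = z mod int N" by (simp add: minus_mult_div_eq_mod)
        finally have "co r k = real (nat (z mod int N))" using N0 by simp
        moreover have "nat (z mod int N) < N" using N0 by (simp add: nat_less_iff)
        ultimately show "co r k \<in> real ` {..<N}" by blast
      qed
      have "r \<in> ?f x" unfolding r_def by (rule closed(2)[OF v NS[OF x qL]])
      then have "r \<in> ?f y" using e rF by blast
      then have "r + of_nat N *\<^sub>R q \<in> ?f y" using closed(1) NS[OF y qL] by blast
      then show "v \<in> ?f y" by (simp add: r_def)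
    qed
    fix S T assume "S \<in> ?f ` ?X" "T \<in> ?f ` ?X" "S \<inter> F = T \<inter> F"
    then obtain x y where xy: "x \<in> ?X" "S = ?f x" "y \<in> ?X" "T = ?f y" by (elim imageE)
    then have e: "?f x \<inter> F = ?f y \<inter> F" using \<open>S \<inter> F = T \<inter> F\<close> by simp
    show "S = T" unfolding xy(2,4) by (rule subset_antisym[OF sub[OF xy(1,3) e] sub[OF xy(3,1) e[symmetric]]])
  qed
  show ?thesis
    by (rule inj_on_finite[OF inj, of "Pow F"]) (use finF in auto)
qed

section \<open>Units, small elements and cocompactness\<close>

definition KU :: "(complex ^ 'g) set" where
  "KU = {u \<in> KO. \<exists>v\<in>KO. u * v = 1}"

lemma KU_inverse: "u \<in> KU \<Longrightarrow> \<exists>v\<in>KU. u * v = 1"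
proof -
  assume "u \<in> KU"
  then obtain v where v: "u \<in> KO" "v \<in> KO" "u * v = 1" by (auto simp: KU_def)
  then have "v * u = 1" by (simp add: mult.commute)
  then have "v \<in> KU" using v unfolding KU_def by blast
  then show ?thesis using v(3) by blast
qed

lemma KU_times: "u \<in> KU \<Longrightarrow> v \<in> KU \<Longrightarrow> u * v \<in> KU"
proof -
  assume "u \<in> KU" "v \<in> KU"
  then obtain u' v' where *: "u \<in> KO" "v \<in> KO" "u' \<in> KO" "v' \<in> KO" "u * u' = 1" "v * v' = 1"
    by (auto simp: KU_def)
  have "(u * v) * (u' * v') = (u * u') * (v * v')" by (simp only: mult_ac)
  then have "(u * v) * (u' * v') = 1" using * by simp
  then show ?thesis using * KO_times unfolding KU_def by blast
qed

lemma KU_1: "1 \<in> KU"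
  unfolding KU_def using KO_1 by force

lemma KU_nonzero: "u \<in> KU \<Longrightarrow> u $ i \<noteq> 0"
proof
  assume "u \<in> KU" and 0: "u $ i = 0"
  then obtain v where "u * v = 1" by (auto simp: KU_def)
  then have "(u * v) $ i = 1" by simp
  then show False using 0 by simp
qed

text \<open>Both quotients map \<open>Lat\<close> into itself, so both belong to
  \<open>KO\<close>.\<close>

lemma KU_multiple_eq:
  assumes "x \<in> KO" "x \<noteq> 0" "r \<in> KO" "r \<noteq> 0" "(\<lambda>v. x * v) ` Lat = (\<lambda>v. r * v) ` Lat"
  shows "x * vinv r \<in> KU"
proof -
  have *: "x * vinv r \<in> KO" if h: "x \<in> KO" "x \<noteq> 0" "r \<in> KO" "r \<noteq> 0" "(\<lambda>v. x * v) ` Lat = (\<lambda>v. r * v) ` Lat" for x r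
    unfolding KO_def
  proof (intro CollectI ballI)
    fix v assume "v \<in> Lat"
    then obtain w where w: "w \<in> Lat" "x * v = r * w" using h(5) by blast
    have "x * vinv r * v = vinv r * (x * v)" by (simp only: mult_ac)
    also have "\<dots> = vinv r * (r * w)" by (simp only: w(2))
    also have "\<dots> = (r * vinv r) * w" by (simp only: mult_ac)
    also have "\<dots> = w" using KF_vinv(2)[OF KO_KF[OF h(3)] h(4)] by simp
    finally show "x * vinv r * v \<in> Lat" using w(1) by simp
  qed
  have "(x * vinv r) * (r * vinv x) = (x * vinv x) * (r * vinv r)" by (simp only: mult_ac)
  also have "\<dots> = 1" using KF_vinv(2)[OF KO_KF] assms by simp
  finally show ?thesis
    unfolding KU_def using *[OF assms] *[OF assms(3,4,1,2) assms(5)[symmetric]] by blast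
qed

lemma places_idem: "places \<rho> Ir \<kappa> \<Longrightarrow> \<forall>i. \<rho> (\<rho> i) = \<rho> i"
  unfolding places_def by (elim conjE)

lemma places_real_subset: "places \<rho> Ir \<kappa> \<Longrightarrow> Ir \<subseteq> range \<rho>"
  unfolding places_def by (elim conjE)

lemma places_norm: "places \<rho> Ir \<kappa> \<Longrightarrow> \<forall>x\<in>KF. \<forall>i. norm (x $ i) = norm (x $ \<rho> i)"
  unfolding places_def by (elim conjE)

lemma places_real: "places \<rho> Ir \<kappa> \<Longrightarrow> \<forall>x\<in>KF. \<forall>i\<in>Ir. x $ i \<in> \<real>"
  unfolding places_def by (elim conjE)

lemma places_fibre: "places \<rho> Ir \<kappa> \<Longrightarrow> \<forall>j\<in>range \<rho>. \<kappa> * card {i. \<rho> i = j} = (if j \<in> Ir then 1 else 2)"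
  unfolding places_def by (elim conjE)

lemma places_card: "places \<rho> Ir \<kappa> \<Longrightarrow> card Ir + 2 * card (range \<rho> - Ir) = ratV.dim KF"
  unfolding places_def by (elim conjE)

lemma KO_combination_basis:
  "\<exists>C w. finite C \<and> card C = ratV.dim KF \<and> (\<forall>c\<in>C. w c \<in> KO) \<and>
     (\<forall>q :: complex ^ 'g \<Rightarrow> int. (\<Sum>c\<in>C. of_int (q c) *\<^sub>R w c) = 0 \<longrightarrow> (\<forall>c\<in>C. q c = 0))"
proof -
  obtain C where C: "C \<subseteq> KF" "ratV.independent C" "KF \<subseteq> ratV.span C" "finite C" "card C = ratV.dim KF"
    using subfld_basis[OF order_refl] by metis
  have "\<forall>c\<in>C. \<exists>n::nat. n > 0 \<and> of_nat n *\<^sub>R c \<in> KO" using KF_denominator C(1) by blast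
  then obtain n :: "complex ^ 'g \<Rightarrow> nat" where n: "\<forall>c\<in>C. n c > 0 \<and> of_nat (n c) *\<^sub>R c \<in> KO" by metis
  have "q c = 0" if "(\<Sum>c\<in>C. of_int (q c) *\<^sub>R (of_nat (n c) *\<^sub>R c)) = 0" "c \<in> C" for q :: "complex ^ 'g \<Rightarrow> int" and c
  proof -
    have "(\<Sum>c\<in>C. real_of_rat (of_int (q c) * of_nat (n c)) *\<^sub>R c) = 0"
      using that(1) by (simp add: of_rat_mult)
    then have "rat_of_int (q c) * of_nat (n c) = 0"
      using ratV.independentD[OF C(2,4) order_refl, of "\<lambda>c. of_int (q c) * of_nat (n c)"] that(2) by blast
    then show ?thesis using n that(2) by auto
  qed
  then show ?thesis using C(4,5) n by (intro exI[of _ C] exI[of _ "\<lambda>c. of_nat (n c) *\<^sub>R c"]) auto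
qed

text \<open>The box principle in place of Minkowski's theorem. Integral combinations with
  coefficients from 0 to \<open>M - 1\<close> are sorted into boxes by their real coordinates at the
  places, the sides being inversely proportional to the weights \<open>y\<close>. There are fewer
  boxes than combinations, and two combinations in one box differ by the required element.\<close>

lemma small_element:
  assumes "places \<rho> Ir \<kappa>"
  shows "\<exists>C>0. \<forall>y. (\<forall>i. y i > 0) \<longrightarrow> (\<Prod>i\<in>range \<rho>. y i ^ (if i \<in> Ir then 1 else 2)) = 1 \<longrightarrow>
           (\<exists>x\<in>KO. x \<noteq> 0 \<and> (\<forall>i\<in>range \<rho>. norm (x $ i) * y i \<le> C))"
proof -
  let ?I = "range \<rho>"
  note Ir = places_real_subset[OF assms] and dimKF = places_card[OF assms]
    and real = places_real[OF assms, rule_format]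
  obtain C w where C: "finite C" "card C = ratV.dim KF" "\<forall>c\<in>C. w c \<in> KO"
    "\<forall>q :: complex ^ 'g \<Rightarrow> int. (\<Sum>c\<in>C. of_int (q c) *\<^sub>R w c) = 0 \<longrightarrow> (\<forall>c\<in>C. q c = 0)"
    using KO_combination_basis by (elim exE conjE)
  define A where "A = 1 + (\<Sum>c\<in>C. norm (w c))"
  have A1: "A \<ge> 1" by (simp add: A_def sum_nonneg)
  \<comment> \<open>One real coordinate for each place in \<open>Ir\<close> and two, real and
    imaginary part, for each other place: as many as the degree of \<open>KF\<close>.\<close>
  define J where "J = (?I \<times> {False}) \<union> ((?I - Ir) \<times> {True})"
  have finJ: "finite J" by (simp add: J_def)
  have prodJ: "(\<Prod>j\<in>J. f (fst j)) = (\<Prod>i\<in>?I. f i ^ (if i \<in> Ir then 1 else 2))" for f :: "'g \<Rightarrow> real"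
  proof -
    have "(\<Prod>j\<in>J. f (fst j)) = (\<Prod>j\<in>?I \<times> {False}. f (fst j)) * (\<Prod>j\<in>(?I - Ir) \<times> {True}. f (fst j))"
      unfolding J_def by (intro prod.union_disjoint) auto
    also have "(\<Prod>j\<in>?I \<times> {False}. f (fst j)) = (\<Prod>i\<in>?I. f i)"
      by (rule prod.reindex_cong[where l = "\<lambda>i. (i, False)"]) (auto simp: inj_on_def)
    also have "(\<Prod>j\<in>(?I - Ir) \<times> {True}. f (fst j)) = (\<Prod>i\<in>?I - Ir. f i)"
      by (rule prod.reindex_cong[where l = "\<lambda>i. (i, True)"]) (auto simp: inj_on_def)
    also have "(\<Prod>i\<in>?I - Ir. f i) = (\<Prod>i\<in>?I. if i \<in> Ir then 1 else f i)"
      by (intro prod.mono_neutral_cong_left) auto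
    also have "(\<Prod>i\<in>?I. f i) * (\<Prod>i\<in>?I. if i \<in> Ir then 1 else f i) = (\<Prod>i\<in>?I. f i ^ (if i \<in> Ir then 1 else 2))"
      by (simp add: prod.distrib[symmetric] power2_eq_square if_distrib cong: if_cong)
    finally show ?thesis .
  qed
  have cardJ: "card J = card C"
  proof -
    have "card J = card (?I \<times> {False}) + card ((?I - Ir) \<times> {True})"
      unfolding J_def by (intro card_Un_disjoint) auto
    also have "\<dots> = card ?I + card (?I - Ir)" by (simp add: card_cartesian_product)
    also have "card ?I = card Ir + card (?I - Ir)"
      using Ir card_Diff_subset[of Ir ?I] card_mono[OF _ Ir] by simp
    finally show ?thesis using dimKF C(2) by simp
  qed
  define form where "form = (\<lambda>(i, t) x :: complex ^ 'g. if t then Im (x $ i) else Re (x $ i))"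
  have form_le: "\<bar>form j x\<bar> \<le> norm (x $ fst j)" for j x
    by (cases j) (auto simp: form_def abs_Re_le_cmod abs_Im_le_cmod)
  have form_diff: "form j (x - x') = form j x - form j x'" for j x x'
    by (cases j) (auto simp: form_def)
  show ?thesis
  proof (intro exI[of _ "10 * A"] conjI allI impI)
    show "10 * A > 0" using A1 by simp
    fix y :: "'g \<Rightarrow> real"
    assume y0: "\<forall>i. y i > 0" and y1: "(\<Prod>i\<in>?I. y i ^ (if i \<in> Ir then 1 else 2)) = 1"
    \<comment> \<open>So large that \<open>2 * M * y i / 5 \<ge> 1\<close>. The number of boxes in a
      direction at place \<open>i\<close>, at most \<open>2 * M * y i / 5 + 1\<close>, is then at
      most \<open>4 * M * y i / 5\<close>. As the weights multiply to 1, the factor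
      \<open>4 / 5\<close> makes the boxes fewer than the combinations.\<close>
    define M :: nat where "M = nat \<lceil>\<Sum>i\<in>UNIV. 5 / (2 * y i)\<rceil> + 1"
    have M1: "M \<ge> 1" by (simp add: M_def)
    have My: "2 * M * y i / 5 \<ge> 1" for i
    proof -
      have "5 / (2 * y i) \<le> (\<Sum>i\<in>UNIV. 5 / (2 * y i))" using y0 by (intro member_le_sum) (auto intro: less_imp_le)
      also have "\<dots> \<le> M" unfolding M_def by linarith
      finally show ?thesis using y0 by (simp add: field_simps)
    qed
    define Y where "Y = (\<lambda>q. \<Sum>c\<in>C. real (q c) *\<^sub>R w c)"
    define B where "B = (\<lambda>j :: 'g \<times> bool. nat \<lfloor>2 * M * y (fst j) / 5\<rfloor>)"
    \<comment> \<open>The coordinates lie between \<open>- A * M\<close> and \<open>A * M\<close>;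
      they are shifted to be nonnegative and cut into intervals of length
      \<open>5 * A / y (fst j)\<close>. Real and imaginary part contribute \<open>5 * A\<close>
      each, which explains the constant \<open>10 * A\<close>.\<close>
    define box where "box = (\<lambda>q. \<lambda>j\<in>J. nat \<lfloor>(form j (Y q) + A * M) * y (fst j) / (5 * A)\<rfloor>)"
    let ?Q = "C \<rightarrow>\<^sub>E {..<M}"
    have Xle: "norm (Y q $ i) \<le> A * M" if "q \<in> ?Q" for q i
    proof -
      have "norm (Y q $ i) \<le> norm (Y q)" by (rule Finite_Cartesian_Product.norm_nth_le)
      also have "\<dots> \<le> (\<Sum>c\<in>C. norm (real (q c) *\<^sub>R w c))" unfolding Y_def by (rule norm_sum)
      also have "\<dots> \<le> (\<Sum>c\<in>C. M * norm (w c))"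
      proof (rule sum_mono)
        fix c assume "c \<in> C"
        then have "q c < M" using that by auto
        then show "norm (real (q c) *\<^sub>R w c) \<le> M * norm (w c)" by (simp add: mult_right_mono)
      qed
      also have "\<dots> \<le> A * M" using M1 by (simp add: A_def sum_distrib_left[symmetric] algebra_simps)
      finally show ?thesis .
    qed
    have box_in: "box q \<in> PiE J (\<lambda>j. {..B j})" if q: "q \<in> ?Q" for q
    proof (rule PiE_I)
      fix j assume j: "j \<in> J"
      have "form j (Y q) \<le> A * M" using form_le[of j "Y q"] Xle[OF q, of "fst j"] by linarith
      then have "(form j (Y q) + A * M) * y (fst j) / (5 * A) \<le> (2 * (A * M)) * y (fst j) / (5 * A)"
        using y0 A1 by (intro divide_right_mono mult_right_mono) (auto intro: less_imp_le)
      also have "\<dots> = 2 * M * y (fst j) / 5" using A1 by simp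
      finally show "box q j \<in> {..B j}" using j by (simp add: box_def B_def nat_mono floor_mono)
    qed (simp add: box_def)
    have "card (PiE J (\<lambda>j. {..B j})) < card ?Q"
    proof -
      have "real (card (PiE J (\<lambda>j. {..B j}))) = (\<Prod>j\<in>J. real (B j + 1))"
        by (simp add: card_PiE finJ)
      also have "\<dots> \<le> (\<Prod>j\<in>J. (4 * M / 5) * y (fst j))"
      proof (intro prod_mono conjI)
        fix j
        have "real (B j) \<le> 2 * M * y (fst j) / 5" unfolding B_def using My[of "fst j"] by (intro of_nat_floor) simp
        then show "real (B j + 1) \<le> (4 * M / 5) * y (fst j)" using My[of "fst j"] by simp
      qed simp
      also have "\<dots> = (4 * M / 5) ^ card J * (\<Prod>j\<in>J. y (fst j))"
        by (simp only: prod.distrib prod_constant)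
      also have "(\<Prod>j\<in>J. y (fst j)) = 1" using prodJ[of y] y1 by simp
      also have "(4 * M / 5) ^ card J * 1 < real M ^ card J"
      proof -
        have "card J > 0"
        proof -
          have "undefined \<in> UNIV" by simp
          then have "(\<rho> undefined, False) \<in> J" by (simp add: J_def)
          then show ?thesis using finJ card_gt_0_iff by blast
        qed
        then show ?thesis using M1 by (simp add: power_strict_mono)
      qed
      also have "real M ^ card J = real (card ?Q)" by (simp add: card_PiE C(1) cardJ)
      finally show ?thesis by simp
    qed
    then have "\<not> inj_on box ?Q"
      using card_inj_on_le[of box ?Q "PiE J (\<lambda>j. {..B j})"] box_in finJ by (auto simp: finite_PiE)
    then obtain q q' where q: "q \<in> ?Q" "q' \<in> ?Q" "q \<noteq> q'" "box q = box q'" by (auto simp: inj_on_def)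
    define x where "x = Y q - Y q'"
    have x_eq: "x = (\<Sum>c\<in>C. of_int (int (q c) - int (q' c)) *\<^sub>R w c)"
      by (simp add: x_def Y_def sum_subtractf[symmetric] algebra_simps)
    have KO_int: "of_int z *\<^sub>R u \<in> KO" if "u \<in> KO" for z u
      using that by (auto simp: KO_def Lat_scale)
    have xO: "x \<in> KO"
    proof -
      have "(\<Sum>c\<in>S. of_int (int (q c) - int (q' c)) *\<^sub>R w c) \<in> KO" if "S \<subseteq> C" for S
        using that C(3) by (induction S rule: infinite_finite_induct) (auto simp: KO_0 simp del: of_int_diff intro!: KO_add KO_int)
      then show ?thesis unfolding x_eq by blast
    qed
    have "x \<noteq> 0"
    proof
      assume "x = 0"
      then have "\<forall>c\<in>C. int (q c) - int (q' c) = 0" unfolding x_eq by (rule C(4)[THEN spec, THEN mp])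
      then have "q = q'" using q(1,2) by (intro PiE_ext[of q C "\<lambda>_. {..<M}" q']) auto
      then show False using q(3) by simp
    qed
    moreover have "norm (x $ i) * y i \<le> 10 * A" if i: "i \<in> ?I" for i
    proof -
      have fj: "\<bar>form j x\<bar> * y (fst j) \<le> 5 * A" if j: "j \<in> J" for j
      proof -
        let ?t = "\<lambda>q. (form j (Y q) + A * M) * y (fst j) / (5 * A)"
        have t0: "?t p \<ge> 0" if "p \<in> ?Q" for p
          using form_le[of j "Y p"] Xle[OF that, of "fst j"] y0 A1
          by (intro divide_nonneg_nonneg mult_nonneg_nonneg) (auto intro: less_imp_le)
        have "nat \<lfloor>?t q\<rfloor> = nat \<lfloor>?t q'\<rfloor>" using fun_cong[OF q(4), of j] j by (simp add: box_def)
        then have "\<lfloor>?t q\<rfloor> = \<lfloor>?t q'\<rfloor>" using t0[OF q(1)] t0[OF q(2)] by (simp add: nat_eq_iff2)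
        then have "\<bar>?t q - ?t q'\<bar> \<le> 1" by linarith
        moreover have "?t q - ?t q' = form j x * y (fst j) / (5 * A)"
          by (simp add: x_def form_diff diff_divide_distrib[symmetric] algebra_simps)
        ultimately have "\<bar>form j x * y (fst j)\<bar> \<le> 5 * A" using A1 by (simp add: abs_divide field_simps)
        then show ?thesis using y0[rule_format, of "fst j"] by (simp add: abs_mult)
      qed
      have "norm (x $ i) \<le> \<bar>Re (x $ i)\<bar> + \<bar>Im (x $ i)\<bar>" by (rule cmod_le)
      then have "norm (x $ i) * y i \<le> \<bar>Re (x $ i)\<bar> * y i + \<bar>Im (x $ i)\<bar> * y i"
        using y0 by (metis distrib_right less_imp_le mult_right_mono)
      also have "\<bar>Re (x $ i)\<bar> * y i \<le> 5 * A" using fj[of "(i, False)"] i by (simp add: J_def form_def)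
      also have "\<bar>Im (x $ i)\<bar> * y i \<le> 5 * A"
      proof (cases "i \<in> Ir")
        case True
        then have "Im (x $ i) = 0" using real[OF KO_KF[OF xO]] by (simp add: complex_is_Real_iff)
        then show ?thesis using A1 by simp
      next
        case False
        then show ?thesis using fj[of "(i, True)"] i by (simp add: J_def form_def)
      qed
      finally show ?thesis by simp
    qed
    ultimately show "\<exists>x\<in>KO. x \<noteq> 0 \<and> (\<forall>i\<in>?I. norm (x $ i) * y i \<le> 10 * A)" using xO by blast
  qed
qed

text \<open>A small element \<open>x\<close> has norm bounded independently of \<open>y\<close>, so
  \<open>x * Lat\<close> equals one of finitely many sublattices \<open>r * Lat\<close>. Then
  \<open>x * vinv r\<close> is a unit, and its entries exceed those of \<open>x\<close> by a bounded
  factor at most.\<close>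

lemma units_cocompact:
  assumes pl: "places \<rho> Ir \<kappa>"
  shows "\<exists>C>0. \<forall>y. (\<forall>i. y i > 0) \<longrightarrow> (\<forall>i. y (\<rho> i) = y i) \<longrightarrow> (\<Prod>i\<in>UNIV. y i) = 1 \<longrightarrow>
           (\<exists>u\<in>KU. \<forall>i. norm (u $ i) * y i \<le> C)"
proof -
  have nrm: "norm (x $ i) = norm (x $ \<rho> i)" if "x \<in> KF" for x i
    using places_norm[OF pl] that by blast
  have fib: "\<kappa> * card {i. \<rho> i = j} = (if j \<in> Ir then 1 else 2)" if "j \<in> range \<rho>" for j
    using places_fibre[OF pl] that by blast
  obtain C where C: "C > 0" "\<And>y. (\<forall>i. y i > 0) \<Longrightarrow> (\<Prod>i\<in>range \<rho>. y i ^ (if i \<in> Ir then 1 else 2)) = 1 \<Longrightarrow>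
           (\<exists>x\<in>KO. x \<noteq> 0 \<and> (\<forall>i\<in>range \<rho>. norm (x $ i) * y i \<le> C))"
    using small_element[OF pl] by blast
  let ?X = "{x \<in> KO. x \<noteq> 0 \<and> (\<Prod>i\<in>UNIV. (norm (x $ i))\<^sup>2) \<le> (C ^ CARD('g))\<^sup>2}"
  let ?f = "\<lambda>x. (\<lambda>v. x * v) ` Lat"
  obtain R where R: "R \<subseteq> ?X" "finite R" "?f ` ?X = ?f ` R"
    using finite_subset_image[OF finite_multiples order_refl, of "(C ^ CARD('g))\<^sup>2"] by (elim exE conjE)
  define D where "D = 1 + (\<Sum>r\<in>R. \<Sum>i\<in>UNIV. inverse (norm (r $ i)))"
  have D1: "D \<ge> 1" by (simp add: D_def sum_nonneg)
  have Dr: "inverse (norm (r $ i)) \<le> D" if "r \<in> R" for r i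
  proof -
    have "inverse (norm (r $ i)) \<le> (\<Sum>i\<in>UNIV. inverse (norm (r $ i)))" by (intro member_le_sum) auto
    also have "\<dots> \<le> (\<Sum>r\<in>R. \<Sum>i\<in>UNIV. inverse (norm (r $ i)))"
      using that R(2) by (intro member_le_sum[of r R "\<lambda>r. \<Sum>i\<in>UNIV. inverse (norm (r $ i))"] sum_nonneg) auto
    finally show ?thesis by (simp add: D_def)
  qed
  show ?thesis
  proof (intro exI[of _ "C * D"] conjI allI impI)
    show "C * D > 0" using C(1) D1 by simp
    fix y :: "'g \<Rightarrow> real"
    assume y: "\<forall>i. y i > 0" "\<forall>i. y (\<rho> i) = y i" "(\<Prod>i\<in>UNIV. y i) = 1"
    \<comment> \<open>The exponent is the local degree, \<open>\<kappa>\<close> times the size of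
      the fibre. As \<open>y\<close> is constant on fibres, the weighted product is the
      \<open>\<kappa>\<close>-th power of the product over all coordinates.\<close>
    have "(\<Prod>i\<in>range \<rho>. y i ^ (if i \<in> Ir then 1 else 2)) = (\<Prod>j\<in>range \<rho>. (\<Prod>i | \<rho> i = j. y i) ^ \<kappa>)"
    proof (intro prod.cong refl)
      fix j assume j: "j \<in> range \<rho>"
      have "(\<Prod>i | \<rho> i = j. y i) = (\<Prod>i | \<rho> i = j. y j)"
      proof (intro prod.cong refl)
        fix i assume "i \<in> {i. \<rho> i = j}"
        then show "y i = y j" using y(2)[rule_format, of i] by simp
      qed
      then have "(\<Prod>i | \<rho> i = j. y i) ^ \<kappa> = y j ^ (\<kappa> * card {i. \<rho> i = j})"
        by (simp add: power_mult[symmetric] mult.commute)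
      then show "y j ^ (if j \<in> Ir then 1 else 2) = (\<Prod>i | \<rho> i = j. y i) ^ \<kappa>" using fib[OF j] by simp
    qed
    also have "\<dots> = (\<Prod>i\<in>UNIV. y i) ^ \<kappa>"
      using prod.image_gen[of UNIV y \<rho>] by (simp add: prod_power_distrib)
    finally obtain x where x: "x \<in> KO" "x \<noteq> 0" "\<And>i. i \<in> range \<rho> \<Longrightarrow> norm (x $ i) * y i \<le> C"
      using C(2)[OF y(1)] y(3) by auto
    have xi: "norm (x $ i) * y i \<le> C" for i
      using x(3)[of "\<rho> i"] nrm[OF KO_KF[OF x(1)], of i] y(2) by simp
    have "(\<Prod>i\<in>UNIV. norm (x $ i)) = (\<Prod>i\<in>UNIV. norm (x $ i) * y i)"
      by (simp add: prod.distrib y(3))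
    also have "\<dots> \<le> (\<Prod>i\<in>(UNIV :: 'g set). C)" using xi y(1) by (intro prod_mono conjI mult_nonneg_nonneg norm_ge_zero) (auto intro: less_imp_le)
    finally have "(\<Prod>i\<in>UNIV. norm (x $ i)) \<le> C ^ CARD('g)" by simp
    then have "(\<Prod>i\<in>UNIV. norm (x $ i))\<^sup>2 \<le> (C ^ CARD('g))\<^sup>2" by (intro power_mono prod_nonneg) auto
    then have xX: "x \<in> ?X" using x by (simp add: prod_power_distrib)
    then have "?f x \<in> ?f ` R" unfolding R(3)[symmetric] by (rule imageI)
    then obtain r where r: "r \<in> R" "?f x = ?f r" by (elim imageE)
    have rX: "r \<in> KO" "r \<noteq> 0" using r(1) R(1) by auto
    have "x * vinv r \<in> KU" by (rule KU_multiple_eq[OF x(1,2) rX r(2)])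
    moreover have "norm ((x * vinv r) $ i) * y i \<le> C * D" for i
    proof -
      have "norm ((x * vinv r) $ i) * y i = (norm (x $ i) * y i) * inverse (norm (r $ i))"
        by (simp add: norm_mult norm_inverse)
      also have "\<dots> \<le> C * D" using xi[of i] Dr[OF r(1), of i] C(1) y(1) by (intro mult_mono) auto
      finally show ?thesis .
    qed
    ultimately show "\<exists>u\<in>KU. \<forall>i. norm (u $ i) * y i \<le> C * D" by blast
  qed
qed

end

section \<open>Roots of unity\<close>

lemma root_of_unity_coprime:
  fixes z :: complex
  assumes "z ^ p = 1" "z ^ d = 1" "coprime d p" "d \<noteq> 0"
  shows "z = 1"
proof -
  obtain x y where "d * x = p * y + gcd d p" using bezout_nat[OF assms(4)] by blast
  then have "d * x = p * y + 1" using assms(3) by simp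
  then have "z ^ (d * x) = z ^ (p * y) * z" by simp
  then show ?thesis by (simp add: power_mult assms(1,2))
qed

text \<open>The value of the \<open>p\<close>-th cyclotomic polynomial at 1, read off from its
  factorisation \<open>f\<close> and from its expansion \<open>s\<close> as a sum of powers.\<close>

lemma prod_one_minus_root_powers:
  fixes z :: complex
  assumes p: "Factorial_Ring.prime p" and z: "z ^ p = 1" "z \<noteq> 1"
  shows "(\<Prod>k\<in>{1..<p}. 1 - z ^ k) = of_nat p"
proof -
  have p1: "p > 1" using p prime_gt_1_nat by blast
  have cop: "coprime d p" if "0 < d" "d < p" for d
    using p that prime_imp_coprime[of p d] nat_dvd_not_less by (metis coprime_commute)
  have ne1: "z ^ d \<noteq> 1" if "0 < d" "d < p" for d
    using root_of_unity_coprime[OF z(1) _ cop[OF that]] that z(2) by auto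
  have z0: "z \<noteq> 0" using z p1 by (auto simp: power_0_left)
  have inj: "inj_on (\<lambda>k. z ^ k) {1..<p}"
  proof (rule linorder_inj_onI)
    fix a c assume ac: "a < c" "a \<in> {1..<p}" "c \<in> {1..<p}"
    show "z ^ a \<noteq> z ^ c"
    proof
      assume "z ^ a = z ^ c"
      moreover have "z ^ c = z ^ a * z ^ (c - a)" using ac by (subst power_add[symmetric]) simp
      ultimately have "z ^ a * z ^ (c - a) = z ^ a * 1" by simp
      then have "z ^ (c - a) = 1" using z0 by simp
      moreover have "0 < c - a" "c - a < p" using ac by auto
      ultimately show False using ne1[of "c - a"] by blast
    qed
  qed auto
  define f where "f = (\<Prod>k\<in>{1..<p}. [:- (z ^ k), 1:])"
  define s where "s = (\<Sum>k<p. Polynomial.monom (1::complex) k)"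
  have coeff_s: "Polynomial.coeff s i = (if i < p then 1 else 0)" for i
    by (simp add: s_def coeff_sum)
  have deg_s: "Polynomial.degree s = p - 1"
  proof (rule antisym)
    show "Polynomial.degree s \<le> p - 1" by (rule degree_le) (auto simp: coeff_s)
    show "p - 1 \<le> Polynomial.degree s" using p1 by (intro le_degree) (simp add: coeff_s)
  qed
  have deg_f: "Polynomial.degree f = p - 1"
    unfolding f_def by (subst degree_prod_eq_sum_degree) auto
  have lead_f: "Polynomial.lead_coeff f = 1"
    unfolding f_def by (simp add: lead_coeff_prod)
  have "f = s"
  proof (rule poly_eqI_degree_lead_coeff[where n = "p - 1" and A = "(\<lambda>k. z ^ k) ` {1..<p}"])
    show "poly f x = poly s x" if "x \<in> (\<lambda>k. z ^ k) ` {1..<p}" for x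
    proof -
      obtain k where k: "k \<in> {1..<p}" "x = z ^ k" using \<open>x \<in> _\<close> by blast
      have "poly f x = 0" using k by (auto simp: f_def poly_prod)
      moreover have "poly s x = (\<Sum>j<p. x ^ j)" by (simp add: s_def poly_sum poly_monom)
      moreover have "(1 - x) * (\<Sum>j<p. x ^ j) = 1 - x ^ p" by (rule one_diff_power_eq[symmetric])
      moreover have "x ^ p = 1" by (simp add: k(2) power_mult[symmetric] mult.commute[of k] power_mult z(1))
      moreover have "x \<noteq> 1" using ne1[of k] k by auto
      ultimately show ?thesis by simp
    qed
  qed (use deg_f deg_s lead_f p1 card_image[OF inj] in \<open>auto simp: coeff_s\<close>)
  then have "poly f 1 = poly s 1" by simp
  then show ?thesis by (simp add: f_def s_def poly_prod poly_sum poly_monom)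
qed

text \<open>Hence a field with a primitive \<open>p\<close>-th root of unity contains a square root of \<open>p\<close> or \<open>- p\<close>. Since
  the endomorphism algebra has no quadratic subfield, its only roots of unity are \<open>1\<close> and \<open>- 1\<close>.\<close>

lemma sine_product_square:
  fixes z :: complex
  assumes p: "Factorial_Ring.prime p" "p = 2 * h + 1" and z: "z ^ p = 1" "z \<noteq> 1"
  shows "(\<Prod>k\<in>{1..h}. z ^ k - z ^ (p - k)) ^ 2 = (-1) ^ h * of_nat p"
proof -
  have h1: "h \<ge> 1" using p prime_gt_1_nat[OF p(1)] by simp
  have z0: "z \<noteq> 0" using z p(2) by (auto simp: power_0_left)
  let ?W = "\<Prod>k\<in>{1..h}. z ^ k - z ^ (p - k)"
  \<comment> \<open>\<open>w\<close> is the inverse square of \<open>z\<close>, so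
    \<open>z ^ k - z ^ (p - k) = z ^ k * (1 - w ^ k)\<close>. Over all \<open>k\<close> the powers
    of \<open>z\<close> multiply to 1 and the other factors to \<open>p\<close>.\<close>
  define w where "w = z ^ (p - 2)"
  have wp: "w ^ p = 1" by (simp add: w_def power_mult[symmetric] mult.commute[of _ p] power_mult z(1))
  have w1: "w \<noteq> 1"
  proof
    assume "w = 1"
    have "z ^ p = z ^ (p - 2) * z ^ 2" using h1 p(2) by (simp add: power_add[symmetric])
    then have "z ^ 2 = 1" using z(1) \<open>w = 1\<close> by (simp add: w_def)
    moreover have "coprime 2 p" using p(2) by simp
    ultimately show False using root_of_unity_coprime[OF z(1), of 2] z(2) by simp
  qed
  have split: "{1..<p} = {1..h} \<union> {h+1..2*h}" using p(2) by auto
  have "(\<Prod>k\<in>{1..<p}. z ^ k - z ^ (p - k)) = ?W * (\<Prod>k\<in>{h+1..2*h}. z ^ k - z ^ (p - k))"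
    unfolding split by (rule prod.union_disjoint) auto
  \<comment> \<open>Replacing \<open>k\<close> by \<open>p - k\<close> turns the upper half of the
    product into the lower one, up to one sign for each factor.\<close>
  also have "(\<Prod>k\<in>{h+1..2*h}. z ^ k - z ^ (p - k)) = (\<Prod>k\<in>{1..h}. z ^ (p - k) - z ^ k)"
    by (rule prod.reindex_bij_witness[of _ "\<lambda>k. p - k" "\<lambda>k. p - k"]) (use p(2) in auto)
  also have "\<dots> = (\<Prod>k\<in>{1..h}. (-1) * (z ^ k - z ^ (p - k)))" by (intro prod.cong) auto
  also have "\<dots> = (-1) ^ h * ?W" by (subst prod.distrib) simp
  finally have 1: "(\<Prod>k\<in>{1..<p}. z ^ k - z ^ (p - k)) = (-1) ^ h * ?W ^ 2"
    by (simp add: power2_eq_square mult_ac)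
  have fac: "z ^ k - z ^ (p - k) = z ^ k * (1 - w ^ k)" if "k \<in> {1..<p}" for k
  proof -
    have "z ^ k * (z ^ k * w ^ k) = z ^ (p * k)"
      using h1 p(2) by (simp add: w_def power_mult[symmetric] power_add[symmetric] algebra_simps)
    also have "\<dots> = z ^ k * z ^ (p - k)" using that by (simp add: power_mult z(1) power_add[symmetric])
    finally have "z ^ k * w ^ k = z ^ (p - k)" using z0 by simp
    then show ?thesis by (simp add: right_diff_distrib)
  qed
  have "(\<Prod>k\<in>{1..<p}. z ^ k - z ^ (p - k)) = (\<Prod>k\<in>{1..<p}. z ^ k) * (\<Prod>k\<in>{1..<p}. 1 - w ^ k)"
    by (simp add: fac prod.distrib[symmetric])
  also have "(\<Prod>k\<in>{1..<p}. z ^ k) = z ^ (\<Sum>k\<in>{1..<p}. k)" by (rule power_sum[symmetric])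
  also have "(\<Sum>k\<in>{1..<p}. k) = p * h"
  proof -
    have "(\<Sum>k\<in>{1..<p}. k) = (\<Sum>k\<in>{0..<p}. k)" by (rule sum.mono_neutral_left) auto
    also have "\<dots> = p * (p - 1) div 2" by (simp add: Sum_Ico_nat)
    also have "\<dots> = p * h" using p(2) by simp
    finally show ?thesis .
  qed
  finally have "(\<Prod>k\<in>{1..<p}. z ^ k - z ^ (p - k)) = of_nat p"
    using prod_one_minus_root_powers[OF p(1) wp w1] by (simp add: power_mult z(1))
  then have "(-1) ^ h * ((-1) ^ h * ?W ^ 2) = (-1) ^ h * of_nat p" using 1 by simp
  then show ?thesis by (simp add: mult.assoc[symmetric] power_mult_distrib[symmetric])
qed

lemma rat_square_not_prime:
  assumes "Factorial_Ring.prime (p :: nat)" shows "(q :: rat) ^ 2 \<noteq> of_nat p"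
proof
  assume e: "q ^ 2 = of_nat p"
  obtain a c where q: "q = Rat.Fract a c" "c > 0" "coprime a c" by (cases q)
  have "of_int a ^ 2 = (of_nat p * of_int c ^ 2 :: rat)"
    using e q by (simp add: Fract_of_int_quotient power_divide field_simps)
  then have "(of_int (a ^ 2) :: rat) = of_int (int p * c ^ 2)" by simp
  then have ac: "a ^ 2 = int p * c ^ 2" by (simp only: of_int_eq_iff)
  have ip: "Factorial_Ring.prime (int p)" using assms by simp
  have "int p dvd a ^ 2" using ac by simp
  then have "int p dvd a" using ip by (simp add: prime_dvd_power_iff)
  then obtain d where d: "a = int p * d" by (elim dvdE)
  have "int p * (int p * d ^ 2) = int p * c ^ 2" using ac d by (simp add: power2_eq_square algebra_simps)
  then have "int p * d ^ 2 = c ^ 2" using ip by (metis mult_cancel_left not_prime_0)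
  then have "int p dvd c ^ 2" by (metis dvd_triv_left)
  then have "int p dvd c" using ip by (simp add: prime_dvd_power_iff)
  then show False using q(3) \<open>int p dvd a\<close> ip by (meson coprime_common_divisor not_prime_unit)
qed

context diag_lattice
begin

lemma rdiag_mult: "rdiag p * rdiag q = (rdiag (p * q) :: complex ^ 'g)"
  by (simp add: of_rat_mult)

lemma rdiag_inject: "rdiag p = (rdiag q :: complex ^ 'g) \<longleftrightarrow> p = q"
  by simp

lemma KF_square_1:
  assumes "t \<in> KF" "t * t = 1" shows "t = 1 \<or> t = - 1"
proof -
  have "(t - 1) * (t + 1) = 0" using assms(2) by (simp add: algebra_simps)
  then have "t - 1 = 0 \<or> t + 1 = 0"
    using KF_times_eq_0[of "t - 1" "t + 1"] KF_diff[OF assms(1) KF_1] by blast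
  then show ?thesis by (auto simp: eq_neg_iff_add_eq_0)
qed

lemma KF_square_neq_minus_1:
  assumes "t \<in> KF" shows "t * t \<noteq> - 1"
proof
  assume t: "t * t = - 1"
  then have "t * t = rdiag (- 1)" by (simp add: of_rat_minus)
  then obtain q where q: "t = rdiag q" using KF_square[OF assms] by blast
  then have "rdiag (q * q) = (rdiag (- 1) :: complex ^ 'g)"
    using t by (simp only: rdiag_mult of_rat_minus) simp
  then have "q * q = - 1" by (simp only: rdiag_inject)
  then show False using zero_le_square[of q] by linarith
qed

lemma KF_odd_prime_root:
  assumes t: "t \<in> KF" "t ^ p = 1" and p: "Factorial_Ring.prime p" "odd p"
  shows "t = 1"
proof (rule ccontr)
  assume t1: "t \<noteq> 1"
  then have ti: "t $ i \<noteq> 1" for i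
    using KF_nonzero[OF KF_diff[OF t(1) KF_1], of i] by simp
  have tp: "(t $ i) ^ p = 1" for i using arg_cong[OF t(2), of "\<lambda>v. v $ i"] by simp
  obtain h where h: "p = 2 * h + 1" using p(2) by (elim oddE)
  define W where "W = (\<Prod>k\<in>{1..h}. t ^ k - t ^ (p - k))"
  have WK: "W \<in> KF" unfolding W_def by (intro KF_prod KF_diff KF_power t(1))
  have "W * W = rdiag ((- 1) ^ h * of_nat p)"
  proof -
    have "(W * W) $ i = rdiag ((- 1) ^ h * of_nat p) $ i" for i
      using sine_product_square[OF p(1) h tp ti, of i]
      unfolding rdiag_nth by (simp add: W_def power2_eq_square of_rat_mult of_rat_power of_rat_minus)
    then show ?thesis unfolding vec_eq_iff by blast
  qed
  then obtain q where q: "W = rdiag q" using KF_square[OF WK] by blast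
  then have "rdiag (q * q) = (rdiag ((- 1) ^ h * of_nat p) :: complex ^ 'g)"
    using \<open>W * W = _\<close> by (simp only: rdiag_mult)
  then have qq: "q * q = (- 1) ^ h * of_nat p" by (simp only: rdiag_inject)
  have p0: "p > 0" using p(1) prime_gt_0_nat by blast
  show False
  proof (cases "even h")
    case True
    then have "q ^ 2 = of_nat p" using qq by (simp add: power2_eq_square)
    then show False using rat_square_not_prime[OF p(1)] by blast
  next
    case False
    then have "q * q = - of_nat p" using qq by simp
    then show False using zero_le_square[of q] p0 by simp
  qed
qed

text \<open>Odd primes are removed from the exponent by \<open>KF_odd_prime_root\<close>. The
  remaining exponent is a power of 2; above 2 itself its half \<open>k\<close> is even, so
  \<open>t ^ k = - 1\<close> would give a square root of -1, and the exponent can be halved.\<close>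

lemma KF_roots_of_unity:
  assumes "t \<in> KF" "t ^ m = 1" "m > 0"
  shows "t = 1 \<or> t = - 1"
  using assms
proof (induction m arbitrary: t rule: less_induct)
  case (less m)
  show ?case
  proof (cases "\<exists>p. Factorial_Ring.prime p \<and> odd p \<and> p dvd m")
    case True
    then obtain p k where p: "Factorial_Ring.prime p" "odd p" "m = p * k" by (auto elim: dvdE)
    have "k > 0" using less.prems(3) p(3) by (cases k) auto
    have "k < m" using p \<open>k > 0\<close> prime_gt_1_nat[OF p(1)] by simp
    have "(t ^ k) ^ p = 1" using less.prems(2) p(3) by (simp add: power_mult[symmetric] mult.commute)
    then have "t ^ k = 1" by (intro KF_odd_prime_root[OF KF_power[OF less.prems(1)] _ p(1,2)])
    then show ?thesis using less.IH[OF \<open>k < m\<close> less.prems(1)] \<open>k > 0\<close> by blast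
  next
    case False
    then have two: "Factorial_Ring.prime p \<Longrightarrow> p dvd m \<Longrightarrow> p = 2" for p
      using prime_odd_nat by (metis order_le_less prime_ge_2_nat)
    show ?thesis
    proof (cases "m = 1")
      case False
      then obtain k where k: "m = 2 * k" using prime_factor_nat[OF False] two by (metis dvdE)
      then have k0: "k > 0" "k < m" using less.prems(3) by auto
      have sq: "t ^ k * t ^ k = 1" using less.prems(2) k by (simp add: power_add[symmetric] mult_2)
      show ?thesis
      proof (cases "k = 1")
        case True
        then show ?thesis using KF_square_1[OF less.prems(1)] sq by simp
      next
        case False
        then obtain q where "Factorial_Ring.prime q" "q dvd k" using prime_factor_nat by blast
        moreover have "q dvd m" using \<open>q dvd k\<close> k by simp
        ultimately obtain l where l: "k = 2 * l" using two by (metis dvdE)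
        have "t ^ k = 1 \<or> t ^ k = - 1" by (rule KF_square_1[OF KF_power[OF less.prems(1)] sq])
        moreover have "t ^ k \<noteq> - 1"
          using KF_square_neq_minus_1[OF KF_power[OF less.prems(1)], of l] l by (simp add: power_add[symmetric] mult_2)
        ultimately show ?thesis using less.IH[OF k0(2) less.prems(1)] k0(1) by blast
      qed
    qed (use less.prems in simp)
  qed
qed

text \<open>An element is determined by its products with the lattice basis, which are lattice
  vectors of bounded length.\<close>

lemma KO_bounded_finite: "finite {x \<in> KO. \<forall>i. norm (x $ i) \<le> R}"
proof -
  define R' where "R' = (\<Sum>l\<in>UNIV. \<Sum>i\<in>(UNIV :: 'g set). \<bar>R\<bar> * norm (b l))"
  let ?T = "(UNIV :: ('g + 'g) set) \<rightarrow>\<^sub>E {v \<in> Lat. norm v \<le> R'}"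
  have bound: "norm (x * b l) \<le> R'" if "\<forall>i. norm (x $ i) \<le> R" for x l
  proof -
    have "norm (x * b l) \<le> (\<Sum>i\<in>UNIV. norm ((x * b l) $ i))"
      unfolding norm_vec_def by (rule L2_set_le_sum) simp
    also have "\<dots> \<le> (\<Sum>i\<in>(UNIV :: 'g set). \<bar>R\<bar> * norm (b l))"
    proof (rule sum_mono)
      fix i
      have "norm (x $ i) \<le> \<bar>R\<bar>" using that by (meson abs_ge_self order_trans)
      then show "norm ((x * b l) $ i) \<le> \<bar>R\<bar> * norm (b l)"
        using Finite_Cartesian_Product.norm_nth_le[of "b l" i] by (simp add: norm_mult mult_mono)
    qed
    also have "\<dots> \<le> R'" unfolding R'_def
      by (rule member_le_sum[where f = "\<lambda>l. \<Sum>i\<in>UNIV. \<bar>R\<bar> * norm (b l)"]) (auto intro: sum_nonneg)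
    finally show ?thesis .
  qed
  have "inj (\<lambda>x l. x * b l)"
  proof (rule injI)
    fix x y assume "(\<lambda>l. x * b l) = (\<lambda>l. y * b l)"
    then have e: "x * b l = y * b l" for l by (rule fun_cong)
    have "x * 1 = x * (\<Sum>k\<in>UNIV. co 1 k *\<^sub>R b k)" by (simp only: expand)
    also have "\<dots> = (\<Sum>k\<in>UNIV. co 1 k *\<^sub>R (x * b k))" by (simp add: sum_distrib_left)
    also have "\<dots> = (\<Sum>k\<in>UNIV. co 1 k *\<^sub>R (y * b k))" by (simp only: e)
    also have "\<dots> = y * (\<Sum>k\<in>UNIV. co 1 k *\<^sub>R b k)" by (simp add: sum_distrib_left)
    also have "\<dots> = y * 1" by (simp only: expand)
    finally show "x = y" by simp
  qed
  then have "inj_on (\<lambda>x l. x * b l) {x \<in> KO. \<forall>i. norm (x $ i) \<le> R}" by (rule inj_on_subset) simp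
  moreover have "(\<lambda>x l. x * b l) ` {x \<in> KO. \<forall>i. norm (x $ i) \<le> R} \<subseteq> ?T"
    using bound by (auto simp: PiE_UNIV_domain KO_def)
  moreover have "finite ?T" using finite_bounded_Lat by (intro finite_PiE) auto
  ultimately show ?thesis by (rule inj_on_finite)
qed

lemma KU_power: "u \<in> KU \<Longrightarrow> u ^ k \<in> KU"
  by (induction k) (simp_all add: KU_1 KU_times)

lemma KU_KO: "u \<in> KU \<Longrightarrow> u \<in> KO"
  by (simp add: KU_def)

section \<open>The logarithmic embedding and the rank of the unit group\<close>

definition Lg :: "complex ^ 'g \<Rightarrow> real ^ 'g" where
  "Lg u = (\<chi> i. ln (norm (u $ i)))"

lemma Lg_times: "u \<in> KU \<Longrightarrow> v \<in> KU \<Longrightarrow> Lg (u * v) = Lg u + Lg v"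
  by (simp add: Lg_def vec_eq_iff norm_mult ln_mult KU_nonzero)

lemma Lg_1 [simp]: "Lg 1 = 0"
  by (simp add: Lg_def vec_eq_iff)

text \<open>All entries of the powers of \<open>u\<close> have absolute value 1, so two powers agree
  and \<open>u\<close> is a root of unity.\<close>

lemma Lg_kernel:
  assumes u: "u \<in> KU" "Lg u = 0"
  shows "u = 1 \<or> u = - 1"
proof -
  have n: "norm (u $ i) = 1" for i
    using arg_cong[OF u(2), of "\<lambda>v. v $ i"] KU_nonzero[OF u(1), of i] by (simp add: Lg_def ln_eq_zero_iff)
  have "range (\<lambda>k. u ^ k) \<subseteq> {x \<in> KO. \<forall>i. norm (x $ i) \<le> 1}"
    using KU_KO[OF KU_power[OF u(1)]] by (auto simp: norm_power n)
  then have "finite (range (\<lambda>k. u ^ k))" using KO_bounded_finite finite_subset by blast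
  then have "\<not> inj (\<lambda>k::nat. u ^ k)" using finite_imageD[of "\<lambda>k::nat. u ^ k" UNIV] by auto
  then obtain a c :: nat where ac: "u ^ a = u ^ c" "a < c"
    unfolding inj_def by (metis linorder_neqE_nat)
  have "u ^ (c - a) = 1"
  proof -
    obtain v where v: "u ^ a * v = 1" using KU_power[OF u(1)] KU_inverse by blast
    have "u ^ (c - a) = (u ^ a * v) * u ^ (c - a)" by (simp add: v)
    also have "\<dots> = v * (u ^ a * u ^ (c - a))" by (simp only: mult_ac)
    also have "u ^ a * u ^ (c - a) = u ^ (a + (c - a))" by (rule power_add[symmetric])
    also have "\<dots> = u ^ a" using ac by simp
    finally show ?thesis using v by (simp add: mult.commute)
  qed
  then show ?thesis using KF_roots_of_unity[OF KO_KF[OF KU_KO[OF u(1)]]] ac(2) by (metis zero_less_diff)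
qed

text \<open>The logarithms of the units form a discrete group in the space \<open>H\<close> of
  vectors that have trace 0 and are constant on places. If they spanned less, some nonzero
  \<open>a\<close> in \<open>H\<close> would be orthogonal to all of them; but cocompactness
  provides a unit with logarithm within bounded distance of any given multiple of
  \<open>a\<close>.\<close>

lemma unit_log_basis:
  assumes pl: "places \<rho> Ir \<kappa>"
  shows "\<exists>u d. d + 1 = card (range \<rho>) \<and> (\<forall>k<d. u k \<in> KU) \<and>
           (\<forall>x\<in>KU. \<exists>c :: nat \<Rightarrow> int. Lg x = (\<Sum>k<d. of_int (c k) *\<^sub>R Lg (u k))) \<and>
           (\<forall>r. (\<Sum>k<d. r k *\<^sub>R Lg (u k)) = 0 \<longrightarrow> (\<forall>k<d. r k = 0))"
proof -
  define G where "G = Lg ` KU"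
  define H where "H = {z :: real ^ 'g. (\<forall>i. z $ \<rho> i = z $ i) \<and> (\<Sum>i\<in>UNIV. z $ i) = 0}"
  have zero: "0 \<in> G" unfolding G_def using KU_1 by (metis Lg_1 imageI)
  have sub: "x - y \<in> G" if xy: "x \<in> G" "y \<in> G" for x y
  proof -
    obtain u v where uv: "u \<in> KU" "v \<in> KU" "x = Lg u" "y = Lg v" using xy unfolding G_def by blast
    obtain w where w: "w \<in> KU" "v * w = 1" using KU_inverse[OF uv(2)] by blast
    have "Lg v + Lg w = 0" using Lg_times[OF uv(2) w(1)] w(2) by simp
    then have "x - y = Lg (u * w)" using uv Lg_times[OF uv(1) w(1)] by (simp add: minus_unique)
    then show ?thesis unfolding G_def using KU_times[OF uv(1) w(1)] by blast
  qed
  have fin: "finite {x \<in> G. norm x \<le> R}" for R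
  proof -
    have "{x \<in> G. norm x \<le> R} \<subseteq> Lg ` {x \<in> KO. \<forall>i. norm (x $ i) \<le> exp R}"
    proof
      fix x assume "x \<in> {x \<in> G. norm x \<le> R}"
      then obtain u where u: "u \<in> KU" "x = Lg u" "norm x \<le> R" by (auto simp: G_def)
      have "norm (u $ i) \<le> exp R" for i
      proof -
        have "ln (norm (u $ i)) \<le> R"
          using component_le_norm_cart[of x i] u by (simp add: Lg_def)
        then show ?thesis using KU_nonzero[OF u(1), of i] by (metis exp_le_cancel_iff exp_ln zero_less_norm_iff)
      qed
      then show "x \<in> Lg ` {x \<in> KO. \<forall>i. norm (x $ i) \<le> exp R}" using u KU_KO by blast
    qed
    then show ?thesis using KO_bounded_finite finite_subset by blast
  qed
  have "\<exists>B \<subseteq> G. independent B \<and> span B = span G \<and>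
      (\<forall>x\<in>G. \<exists>c::real ^ 'g \<Rightarrow> int. x = (\<Sum>b\<in>B. of_int (c b) *\<^sub>R b))"
    using zero sub fin by (rule discrete_subgroup_basis)
  then obtain B where B: "B \<subseteq> G" "independent B" "span B = span G"
    "\<forall>x\<in>G. \<exists>c::real ^ 'g \<Rightarrow> int. x = (\<Sum>b\<in>B. of_int (c b) *\<^sub>R b)" by blast
  have GH: "G \<subseteq> H"
  proof
    fix x assume "x \<in> G"
    then obtain u where u: "u \<in> KU" "x = Lg u" by (auto simp: G_def)
    obtain v where v: "v \<in> KU" "u * v = 1" using KU_inverse[OF u(1)] by blast
    \<comment> \<open>A unit and its inverse have norms at least 1 with product 1. So both norms are
      1 and the logarithms add up to 0.\<close>
    define N where "N = (\<lambda>x :: complex ^ 'g. \<Prod>i\<in>UNIV. (norm (x $ i))\<^sup>2)"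
    have nz: "u \<noteq> 0" "v \<noteq> 0" using v(2) by auto
    have "N u \<ge> 1" "N v \<ge> 1"
      using KO_norm_ge_1[OF KU_KO[OF u(1)] nz(1)] KO_norm_ge_1[OF KU_KO[OF v(1)] nz(2)] by (simp_all add: N_def)
    moreover have "N u * N v = N (u * v)"
      by (simp add: N_def prod.distrib norm_mult power_mult_distrib)
    moreover have "N (u * v) = 1" unfolding v(2) by (simp add: N_def)
    ultimately have "N u = 1"
      using mult_left_mono[of 1 "N v" "N u"] by simp
    then have "ln (N u) = 0" by simp
    then have "2 * (\<Sum>i\<in>UNIV. ln (norm (u $ i))) = 0"
      unfolding N_def using KU_nonzero[OF u(1)]
      by (subst (asm) ln_prod) (auto simp: ln_realpow sum_distrib_left)
    moreover have "norm (u $ \<rho> i) = norm (u $ i)" for i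
      using places_norm[OF pl] KO_KF[OF KU_KO[OF u(1)]] by metis
    ultimately show "x \<in> H" by (simp add: H_def u(2) Lg_def)
  qed
  have subH: "subspace H" by (auto simp: subspace_def H_def sum.distrib sum_distrib_left[symmetric])
  have spanG: "span G = H"
  proof (rule ccontr)
    assume ne: "span G \<noteq> H"
    have "span G \<subset> span H" using ne span_minimal[OF GH subH] span_eq_iff[THEN iffD2, OF subH] by blast
    then obtain a where a: "a \<noteq> 0" "a \<in> span H" "\<And>y. y \<in> span G \<Longrightarrow> orthogonal a y"
      by (rule orthogonal_to_subspace_exists_gen) blast
    have aH: "a \<in> H" using a(2) subH by (simp add: span_eq_iff[THEN iffD2])
    obtain C where C: "C > 0" "\<And>y. (\<forall>i. y i > 0) \<Longrightarrow> (\<forall>i. y (\<rho> i) = y i) \<Longrightarrow> (\<Prod>i\<in>UNIV. y i) = 1 \<Longrightarrow>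
           (\<exists>u\<in>KU. \<forall>i. norm (u $ i) * y i \<le> C)"
      using units_cocompact[OF pl] by blast
    define s where "s = (\<Sum>i\<in>UNIV. \<bar>a $ i\<bar>) * (of_nat CARD('g) * \<bar>ln C\<bar>)"
    \<comment> \<open>\<open>s\<close> bounds the absolute value of \<open>a \<bullet> e\<close> for
      every \<open>t\<close>, while orthogonality gives
      \<open>a \<bullet> e = - (t * (a \<bullet> a))\<close>. With this \<open>t\<close> the
      absolute value is \<open>s + 1\<close>.\<close>
    define t where "t = (s + 1) / (a \<bullet> a)"
    have aa: "a \<bullet> a > 0" using a(1) by simp
    let ?y = "\<lambda>i. exp (- (t * a $ i))"
    have "(\<Prod>i\<in>UNIV. ?y i) = 1"
      using aH by (simp add: exp_sum[symmetric] sum_negf sum_distrib_left[symmetric] H_def)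
    then obtain u where u: "u \<in> KU" "\<And>i. norm (u $ i) * ?y i \<le> C"
      using C(2)[of ?y] aH by (auto simp: H_def)
    define e where "e = Lg u - t *\<^sub>R a"
    have eH: "e \<in> H" unfolding e_def
      using GH u(1) aH subH by (auto simp: G_def intro!: subspace_diff subspace_scale)
    have e_le: "e $ i \<le> \<bar>ln C\<bar>" for i
    proof -
      have "ln (norm (u $ i) * ?y i) \<le> ln C"
        using u(2)[of i] KU_nonzero[OF u(1), of i] C(1) by (subst ln_le_cancel_iff) auto
      then have "ln (norm (u $ i)) - t * a $ i \<le> ln C"
        using KU_nonzero[OF u(1), of i] by (simp add: ln_mult)
      then show ?thesis by (simp add: e_def Lg_def)
    qed
    \<comment> \<open>The entries of \<open>e\<close> sum to 0, so the upper bounds for the others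
      bound this one from below.\<close>
    have e_ge: "- e $ i \<le> of_nat CARD('g) * \<bar>ln C\<bar>" for i
    proof -
      have "e $ i + (\<Sum>j\<in>UNIV - {i}. e $ j) = 0"
        using eH by (simp add: H_def sum.remove[of UNIV i, symmetric])
      moreover have "(\<Sum>j\<in>UNIV - {i}. e $ j) \<le> (\<Sum>j\<in>UNIV - {i}. \<bar>ln C\<bar>)" by (intro sum_mono e_le)
      moreover have "\<dots> \<le> of_nat CARD('g) * \<bar>ln C\<bar>" by (simp add: mult_right_mono)
      ultimately show ?thesis by linarith
    qed
    have e_abs: "\<bar>e $ i\<bar> \<le> of_nat CARD('g) * \<bar>ln C\<bar>" for i
    proof -
      have "\<bar>ln C\<bar> \<le> of_nat CARD('g) * \<bar>ln C\<bar>" using g3 by (simp add: mult_le_cancel_right1)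
      then show ?thesis using e_le[of i] e_ge[of i] by (intro abs_leI) linarith+
    qed
    have "a \<bullet> e = - (t * (a \<bullet> a))"
      using a(3)[OF span_base[of "Lg u" G]] u(1) by (simp add: e_def inner_diff_right orthogonal_def G_def)
    also have "t * (a \<bullet> a) = s + 1" using aa by (simp add: t_def)
    finally have "\<bar>a \<bullet> e\<bar> = \<bar>s + 1\<bar>" by simp
    moreover have "\<bar>a \<bullet> e\<bar> \<le> s"
    proof -
      have "\<bar>a \<bullet> e\<bar> \<le> (\<Sum>i\<in>UNIV. \<bar>a $ i * e $ i\<bar>)" unfolding inner_vec_def by (simp add: sum_abs)
      also have "\<dots> \<le> (\<Sum>i\<in>UNIV. \<bar>a $ i\<bar> * (of_nat CARD('g) * \<bar>ln C\<bar>))"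
        by (intro sum_mono) (simp add: abs_mult mult_left_mono e_abs)
      also have "\<dots> = s" by (simp add: s_def sum_distrib_right)
      finally show ?thesis .
    qed
    ultimately show False by linarith
  qed
  have \<rho>\<rho>: "\<rho> (\<rho> i) = \<rho> i" for i using places_idem[OF pl] by blast
  have dimH: "dim H + 1 = card (range \<rho>)"
  proof -
    define e where "e = (\<lambda>j. (\<chi> i. if \<rho> i = j then 1 else 0) :: real ^ 'g)"
    define V where "V = {z :: real ^ 'g. \<forall>i. z $ \<rho> i = z $ i}"
    have ind: "independent (e ` range \<rho>)" and inj: "inj_on e (range \<rho>)"
    proof -
      have ee: "e j $ k = (if k = j then 1 else 0)" if "j \<in> range \<rho>" "k \<in> range \<rho>" for j k
        using that \<rho>\<rho> by (auto simp: e_def)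
      show inj: "inj_on e (range \<rho>)" by (rule inj_onI) (metis ee zero_neq_one)
      show "independent (e ` range \<rho>)"
      proof (rule independent_if_scalars_zero)
        fix f x assume s: "(\<Sum>x\<in>e ` range \<rho>. f x *\<^sub>R x) = 0" and "x \<in> e ` range \<rho>"
        then obtain k where k: "k \<in> range \<rho>" "x = e k" by blast
        have "(\<Sum>j\<in>range \<rho>. f (e j) *\<^sub>R e j) $ k = 0" using s by (simp add: sum.reindex[OF inj])
        then have "(\<Sum>j\<in>range \<rho>. f (e j) * (if k = j then 1 else 0)) = 0"
          using k(1) by (simp add: ee)
        then show "f x = 0" using k by (simp add: if_distrib cong: if_cong)
      qed simp
    qed
    have "V \<subseteq> span (e ` range \<rho>)"
    proof
      fix z assume z: "z \<in> V"
      have "z = (\<Sum>j\<in>range \<rho>. z $ j *\<^sub>R e j)"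
        using z by (simp add: vec_eq_iff e_def V_def if_distrib cong: if_cong)
      also have "\<dots> \<in> span (e ` range \<rho>)" by (intro span_sum span_scale span_base) auto
      finally show "z \<in> span (e ` range \<rho>)" .
    qed
    moreover have "e ` range \<rho> \<subseteq> V" using \<rho>\<rho> by (auto simp: e_def V_def)
    ultimately have "dim V = card (e ` range \<rho>)" using ind by (intro dim_unique) auto
    then have "dim V = card (range \<rho>)" using card_image[OF inj] by simp
    \<comment> \<open>The trace condition removes one dimension, spanned by the constant vector,
      from the vectors that are constant on places.\<close>
    moreover have "span (insert 1 H) = V"
    proof
      have "subspace V" by (auto simp: subspace_def V_def)
      then show "span (insert 1 H) \<subseteq> V" by (intro span_minimal) (auto simp: V_def H_def)
      show "V \<subseteq> span (insert 1 H)"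
      proof
        fix z assume z: "z \<in> V"
        define m where "m = (\<Sum>i\<in>UNIV. z $ i) / of_nat CARD('g)"
        have "z - m *\<^sub>R 1 \<in> H" using z g3 by (simp add: H_def V_def m_def sum_subtractf)
        then have "(z - m *\<^sub>R 1) + m *\<^sub>R 1 \<in> span (insert 1 H)"
          by (intro span_add span_scale span_base) auto
        then show "z \<in> span (insert 1 H)" by simp
      qed
    qed
    moreover have "1 \<notin> span H"
    proof
      assume "1 \<in> span H"
      then have "(1 :: real ^ 'g) \<in> H" using subH by (simp add: span_eq_iff[THEN iffD2])
      then show False by (simp add: H_def)
    qed
    ultimately show ?thesis using dim_insert[of 1 H] by (metis dim_span Suc_eq_plus1)
  qed
  have finB: "finite B" using B(2) independent_imp_finite by blast
  have cardB: "card B = dim H" using B(2,3) spanG by (metis dim_eq_card_independent dim_span)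
  obtain h where h: "bij_betw h {0..<card B} B" using ex_bij_betw_nat_finite[OF finB] by blast
  have hB: "h k \<in> B" if "k < card B" for k using h that by (auto simp: bij_betw_def)
  have "\<forall>k. \<exists>x. k < card B \<longrightarrow> x \<in> KU \<and> Lg x = h k" using hB B(1) by (fastforce simp: G_def)
  then obtain u where u: "\<And>k. k < card B \<Longrightarrow> u k \<in> KU \<and> Lg (u k) = h k" by metis
  have reidx: "(\<Sum>k<card B. f (h k)) = (\<Sum>x\<in>B. f x)" for f :: "real ^ 'g \<Rightarrow> real ^ 'g"
    using sum.reindex_bij_betw[OF h, of f] by (simp add: atLeast0LessThan)
  show ?thesis
  proof (intro exI[of _ u] exI[of _ "card B"] conjI ballI allI impI)
    show "card B + 1 = card (range \<rho>)" using cardB dimH by simp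
    show "u k \<in> KU" if "k < card B" for k using u that by blast
    show "\<exists>c :: nat \<Rightarrow> int. Lg x = (\<Sum>k<card B. of_int (c k) *\<^sub>R Lg (u k))" if x: "x \<in> KU" for x
    proof -
      obtain c :: "real ^ 'g \<Rightarrow> int" where c: "Lg x = (\<Sum>b\<in>B. of_int (c b) *\<^sub>R b)"
        using B(4) x by (auto simp: G_def)
      have "Lg x = (\<Sum>k<card B. of_int (c (h k)) *\<^sub>R h k)"
        unfolding c by (rule reidx[symmetric])
      also have "\<dots> = (\<Sum>k<card B. of_int (c (h k)) *\<^sub>R Lg (u k))" using u by (intro sum.cong) auto
      finally show ?thesis by (rule exI[of _ "\<lambda>k. c (h k)"])
    qed
    show "r k = 0" if r: "(\<Sum>k<card B. r k *\<^sub>R Lg (u k)) = 0" and k: "k < card B" for r k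
    proof -
      define g where "g = inv_into {0..<card B} h"
      have gh: "g (h k) = k" if "k < card B" for k
        using h that by (simp add: g_def bij_betw_def inv_into_f_f)
      have "(\<Sum>x\<in>B. r (g x) *\<^sub>R x) = (\<Sum>k<card B. r (g (h k)) *\<^sub>R h k)" by (rule reidx[symmetric])
      also have "\<dots> = (\<Sum>k<card B. r k *\<^sub>R Lg (u k))" using u gh by (intro sum.cong) auto
      finally have "(\<Sum>x\<in>B. r (g x) *\<^sub>R x) = 0" using r by simp
      then have "r (g (h k)) = 0" using independentD[OF B(2) finB order_refl, of "\<lambda>x. r (g x)" "h k"] hB[OF k] by blast
      then show ?thesis by (simp add: gh[OF k])
    qed
  qed
qed

end

lemma sign_group_group: "group sign_group"
  by (rule groupI) (auto simp: sign_group_def)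

lemma free_abelian_rank_group: "group (free_abelian_rank d)"
  by (simp add: free_abelian_rank_def)

lemma of_int_vec_nth [simp]: "(of_int n :: 'a::ring_1 ^ 'n) $ i = of_int n"
  by (induction n rule: int_induct[where k = 0]) simp_all

text \<open>Integer powers are taken in each entry, since the type \<open>complex ^ 'g\<close> is
  not a field.\<close>

definition vpowi :: "complex ^ 'g \<Rightarrow> int \<Rightarrow> complex ^ 'g" where
  "vpowi u n = (\<chi> i. (u $ i) powi n)"

context diag_lattice
begin

lemma KU_vpowi:
  assumes u: "u \<in> KU" shows "vpowi u n \<in> KU"
proof -
  obtain v where v: "v \<in> KU" "u * v = 1" using KU_inverse[OF u] by blast
  have vi: "v $ i = inverse (u $ i)" for i
    using arg_cong[OF v(2), of "\<lambda>v. v $ i"] KU_nonzero[OF u, of i] by (simp add: field_simps)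
  show ?thesis
  proof (cases "n \<ge> 0")
    case True
    then have "vpowi u n = u ^ nat n" by (simp add: vpowi_def vec_eq_iff power_int_def)
    then show ?thesis by (simp only: KU_power[OF u])
  next
    case False
    then have "vpowi u n = v ^ nat (- n)" by (simp add: vpowi_def vec_eq_iff power_int_def vi)
    then show ?thesis by (simp only: KU_power[OF v(1)])
  qed
qed

lemma vpowi_add: "u \<in> KU \<Longrightarrow> vpowi u (m + n) = vpowi u m * vpowi u n"
  by (simp add: vpowi_def vec_eq_iff power_int_add KU_nonzero)

lemma Lg_vpowi: "u \<in> KU \<Longrightarrow> Lg (vpowi u n) = of_int n *\<^sub>R Lg u"
  by (simp add: Lg_def vpowi_def vec_eq_iff norm_power_int powr_real_of_int'[symmetric] ln_powr KU_nonzero)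

lemma KU_prod: "(\<And>k. k \<in> S \<Longrightarrow> f k \<in> KU) \<Longrightarrow> (\<Prod>k\<in>S. f k) \<in> KU"
  by (induction S rule: infinite_finite_induct) (auto simp: KU_1 KU_times)

lemma Lg_prod: "(\<And>k. k \<in> S \<Longrightarrow> f k \<in> KU) \<Longrightarrow> Lg (\<Prod>k\<in>S. f k) = (\<Sum>k\<in>S. Lg (f k))"
  by (induction S rule: infinite_finite_induct) (auto simp: Lg_times KU_prod)

lemma KU_minus: "u \<in> KU \<Longrightarrow> - u \<in> KU"
proof -
  assume u: "u \<in> KU"
  obtain v where v: "v \<in> KU" "u * v = 1" using KU_inverse[OF u] by blast
  have m: "- x \<in> KO" if "x \<in> KO" for x using KO_diff[OF KO_0 that] by simp
  have "(- u) * (- v) = 1" using v(2) by simp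
  moreover have "- u \<in> KO" "- v \<in> KO" using m KU_KO u v(1) by blast+
  ultimately show ?thesis unfolding KU_def by blast
qed

definition KUgrp :: "(complex ^ 'g) monoid" where
  "KUgrp = \<lparr>carrier = KU, monoid.mult = (*), one = 1\<rparr>"

theorem KUgrp_iso:
  assumes pl: "places \<rho> Ir \<kappa>"
  shows "KUgrp \<cong> sign_group \<times>\<times> free_abelian_rank (card (range \<rho>) - 1)" (is ?A)
    and "KUgrp \<cong> free_abelian_rank (card (range \<rho>) - 1) \<times>\<times> sign_group" (is ?B)
proof -
  obtain u d where d: "d + 1 = card (range \<rho>)" and uK: "\<forall>k<d. u k \<in> KU"
    and gen: "\<forall>x\<in>KU. \<exists>c :: nat \<Rightarrow> int. Lg x = (\<Sum>k<d. of_int (c k) *\<^sub>R Lg (u k))"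
    and ind: "\<forall>r. (\<Sum>k<d. r k *\<^sub>R Lg (u k)) = 0 \<longrightarrow> (\<forall>k<d. r k = 0)"
    using unit_log_basis[OF pl] by (elim exE conjE)
  define E where "E = (\<lambda>c :: nat \<Rightarrow> int. \<Prod>k<d. vpowi (u k) (c k))"
  have EK: "E c \<in> KU" for c unfolding E_def by (intro KU_prod KU_vpowi) (use uK in simp)
  have LgE: "Lg (E c) = (\<Sum>k<d. of_int (c k) *\<^sub>R Lg (u k))" for c
    unfolding E_def using uK by (subst Lg_prod) (auto simp: KU_vpowi Lg_vpowi)
  \<comment> \<open>The sign accounts for the kernel of \<open>Lg\<close>, which consists of 1 and
    -1.\<close>
  define \<psi> where "\<psi> = (\<lambda>c s :: int. of_int s * E c)"
  let ?C = "{..<d} \<rightarrow>\<^sub>E (UNIV :: int set)"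
  have \<psi>K: "\<psi> c s \<in> KU" if "s \<in> {1, -1}" for c s
    using that EK KU_minus by (auto simp: \<psi>_def)
  have \<psi>Lg: "Lg (\<psi> c s) = Lg (E c)" if "s \<in> {1, -1}" for c s
    using that by (auto simp: \<psi>_def Lg_def)
  have inj: "c = c' \<and> s = s'" if h: "c \<in> ?C" "c' \<in> ?C" "s \<in> {1, -1}" "s' \<in> {1, -1}" "\<psi> c s = \<psi> c' s'" for c c' s s'
  proof -
    have "Lg (E c) = Lg (E c')" using \<psi>Lg h(3-5) by metis
    then have "(\<Sum>k<d. of_int (c k - c' k) *\<^sub>R Lg (u k)) = 0"
      by (simp add: LgE scaleR_diff_left sum_subtractf)
    then have "\<forall>k<d. real_of_int (c k - c' k) = 0"
      using ind[rule_format, of "\<lambda>k. real_of_int (c k - c' k)"] by blast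
    then have "\<forall>k<d. c k = c' k" by simp
    then have cc: "c = c'" using h(1,2) by (intro PiE_ext[of c "{..<d}" _ c']) auto
    have "(of_int s - of_int s') * E c = 0" using h(5) cc by (simp add: \<psi>_def left_diff_distrib)
    then have "((of_int s - of_int s') * E c) $ undefined = 0" by simp
    then have "s = s'" using KU_nonzero[OF EK] by simp
    then show ?thesis using cc by blast
  qed
  have surj: "\<exists>c s. c \<in> ?C \<and> s \<in> {1, -1} \<and> x = \<psi> c s" if x: "x \<in> KU" for x
  proof -
    obtain c0 :: "nat \<Rightarrow> int" where c0: "Lg x = (\<Sum>k<d. of_int (c0 k) *\<^sub>R Lg (u k))" using gen x by blast
    define c where "c = restrict c0 {..<d}"
    have c: "Lg x = Lg (E c)" unfolding c0 LgE by (intro sum.cong) (auto simp: c_def)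
    obtain v where v: "v \<in> KU" "E c * v = 1" using KU_inverse[OF EK] by blast
    have "Lg (x * v) = Lg (E c * v)" using Lg_times[OF x v(1)] Lg_times[OF EK v(1)] c by simp
    then have "Lg (x * v) = 0" using v(2) by simp
    then have "x * v = 1 \<or> x * v = - 1" by (intro Lg_kernel KU_times x v(1))
    moreover have "x = (x * v) * E c" using v(2) by (simp add: mult.assoc mult.commute[of v])
    ultimately have "x = \<psi> c 1 \<or> x = \<psi> c (-1)" by (auto simp: \<psi>_def)
    moreover have "c \<in> ?C" by (simp add: c_def)
    ultimately show ?thesis by blast
  qed
  have hom: "\<psi> (\<lambda>k\<in>{..<d}. c k + c' k) (s * s') = \<psi> c s * \<psi> c' s'" for c c' s s'
  proof -
    have "E (\<lambda>k\<in>{..<d}. c k + c' k) = (\<Prod>k<d. vpowi (u k) (c k) * vpowi (u k) (c' k))"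
      unfolding E_def using uK by (intro prod.cong) (auto simp: vpowi_add)
    then show ?thesis by (simp add: \<psi>_def E_def prod.distrib mult_ac)
  qed
  have c1: "carrier (sign_group \<times>\<times> free_abelian_rank d) = {1, -1} \<times> ?C"
    by (auto simp: sign_group_def free_abelian_rank_def DirProd_def integer_group_def)
  have m1: "(s, c) \<otimes>\<^bsub>sign_group \<times>\<times> free_abelian_rank d\<^esub> (s', c') = (s * s', \<lambda>k\<in>{..<d}. c k + c' k)"for c c' s s'
    by (simp_all add: sign_group_def free_abelian_rank_def DirProd_def integer_group_def product_group_def)
  have "(\<lambda>(s, c). \<psi> c s) \<in> iso (sign_group \<times>\<times> free_abelian_rank d) KUgrp"
  proof (rule isoI)
    show "(\<lambda>(s, c). \<psi> c s) \<in> hom (sign_group \<times>\<times> free_abelian_rank d) KUgrp"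
      proof (rule homI)
      fix x y :: "int \<times> (nat \<Rightarrow> int)" assume x: "x \<in> carrier (sign_group \<times>\<times> free_abelian_rank d)"
      obtain s c s' c' where xy: "x = (s, c)" "y = (s', c')" by (cases x, cases y)
      show "(\<lambda>(s, c). \<psi> c s) x \<in> carrier KUgrp"
        using x \<psi>K unfolding c1 by (simp add: KUgrp_def xy(1))
      show "(\<lambda>(s, c). \<psi> c s) (x \<otimes>\<^bsub>sign_group \<times>\<times> free_abelian_rank d\<^esub> y) =
              (\<lambda>(s, c). \<psi> c s) x \<otimes>\<^bsub>KUgrp\<^esub> (\<lambda>(s, c). \<psi> c s) y"
        unfolding xy m1 by (simp add: KUgrp_def hom)
    qed
    show "bij_betw (\<lambda>(s, c). \<psi> c s) (carrier (sign_group \<times>\<times> free_abelian_rank d)) (carrier KUgrp)"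
      unfolding bij_betw_def c1
    proof
      show "inj_on (\<lambda>(s, c). \<psi> c s) ({1, -1} \<times> ?C)"
        by (rule inj_onI) (use inj in \<open>clarsimp simp del: insert_iff; blast\<close>)
      show "(\<lambda>(s, c). \<psi> c s) ` ({1, -1} \<times> ?C) = carrier KUgrp"
        unfolding KUgrp_def using surj \<psi>K by (force simp del: insert_iff)
    qed
  qed
  then have "sign_group \<times>\<times> free_abelian_rank d \<cong> KUgrp" by (auto simp: is_iso_def)
  then have 1: "KUgrp \<cong> sign_group \<times>\<times> free_abelian_rank d"
    by (rule group.iso_sym[OF DirProd_group[OF sign_group_group free_abelian_rank_group]])
  have "sign_group \<times>\<times> free_abelian_rank d \<cong> free_abelian_rank d \<times>\<times> sign_group"
    using DirProd_commute_iso by blast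
  then have 2: "KUgrp \<cong> free_abelian_rank d \<times>\<times> sign_group" using 1 iso_trans by blast
  have "d = card (range \<rho>) - 1" using d by simp
  then show ?A ?B using 1 2 by simp_all
qed

section \<open>The case of degree one\<close>

lemma KF_dim_1:
  assumes "ratV.dim KF = 1" shows "KF = range rdiag"
proof -
  have "KF \<subseteq> range rdiag"
  proof
    fix x assume "x \<in> KF"
    then show "x \<in> range rdiag" using subfld_dim_ge[OF subfld_KF, of x] assms g3 by linarith
  qed
  then show ?thesis by (rule subfld_dim_rational(1)[OF subfld_KF])
qed

lemma KO_dim_1:
  assumes "ratV.dim KF = 1" shows "KO = range of_int"
proof
  show "KO \<subseteq> range of_int"
  proof
    fix x assume x: "x \<in> KO"
    then obtain q where q: "x = rdiag q" using KF_dim_1[OF assms] KO_KF by blast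
    obtain k :: "'g + 'g" where True by blast
    have "x * b k = of_rat q *\<^sub>R b k" by (simp add: q)
    moreover have "x * b k \<in> Lat" using x b_Lat unfolding KO_def by blast
    ultimately have "of_rat q *\<^sub>R b k \<in> Lat" by (simp only:)
    then have "co (of_rat q *\<^sub>R b k) k \<in> \<int>" unfolding Lat_def by blast
    then have "(of_rat q :: real) \<in> \<int>" by (simp only: co_scale co_b) simp
    then obtain n where "(of_rat q :: real) = of_int n" by (elim Ints_cases)
    then have "x = of_int n" by (simp add: q vec_eq_iff scaleR_conv_of_real)
    then show "x \<in> range of_int" by blast
  qed
  show "range of_int \<subseteq> KO"
  proof
    fix x assume "x \<in> range (of_int :: int \<Rightarrow> complex ^ 'g)"
    then obtain n where n: "x = of_int n" by blast
    have "x * v = of_int n *\<^sub>R v" for v by (simp add: n vec_eq_iff scaleR_complex)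
    then have "x * v \<in> Lat" if "v \<in> Lat" for v using that by (simp add: Lat_def)
    then show "x \<in> KO" by (simp add: KO_def)
  qed
qed

lemma KU_dim_1:
  assumes "ratV.dim KF = 1" shows "KU = {1, - 1}"
proof
  show "KU \<subseteq> {1, - 1}"
  proof
    fix u assume "u \<in> KU"
    then obtain m n where mn: "u = of_int m" "of_int m * of_int n = (1 :: complex ^ 'g)"
      using KO_dim_1[OF assms] by (auto simp: KU_def)
    then have "of_int (m * n) = (1 :: complex ^ 'g)" by simp
    then have "(of_int (m * n) :: complex) = 1" by (metis of_int_vec_nth one_index)
    then have "m * n = 1" by (simp only: of_int_eq_1_iff)
    then have "m = 1 \<or> m = - 1" by (simp add: zmult_eq_1_iff) blast
    then show "u \<in> {1, - 1}" using mn(1) by auto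
  qed
  show "{1, - 1} \<subseteq> KU" using KU_1 KU_minus by auto
qed

end

section \<open>Endomorphisms as matrices\<close>

definition mat_End :: "(complex ^ 'g) set \<Rightarrow> (complex ^ 'g ^ 'g) ring" where
  "mat_End \<Lambda> = \<lparr>carrier = {A. \<forall>v\<in>\<Lambda>. A *v v \<in> \<Lambda>}, monoid.mult = (**), one = mat 1, ring.zero = 0, add = (+)\<rparr>"

text \<open>The induced map on cosets, evaluated at an arbitrary representative. It is restricted to
  the torus because the members of \<open>End_torus\<close> are extensional.\<close>

definition torus_map :: "(complex ^ 'g) set \<Rightarrow> complex ^ 'g ^ 'g \<Rightarrow> (complex ^ 'g) set \<Rightarrow> (complex ^ 'g) set" where
  "torus_map \<Lambda> A = (\<lambda>c\<in>carrier (torus \<Lambda>). torus_proj \<Lambda> (A *v (SOME v. v \<in> c)))"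

context lattice_coords
begin

lemma torus_proj_eq: "torus_proj Lat v = {w. w - v \<in> Lat}"
proof -
  have "torus_proj Lat v = (\<lambda>l. l + v) ` Lat"
    by (auto simp: torus_proj_def r_coset_def vec_group_def)
  also have "\<dots> = {w. w - v \<in> Lat}"
  proof
    show "{w. w - v \<in> Lat} \<subseteq> (\<lambda>l. l + v) ` Lat"
    proof
      fix w assume "w \<in> {w. w - v \<in> Lat}"
      then show "w \<in> (\<lambda>l. l + v) ` Lat" by (intro image_eqI[of _ _ "w - v"]) auto
    qed
  qed auto
  finally show ?thesis .
qed

lemma torus_proj_mem: "v \<in> torus_proj Lat v"
  by (simp add: torus_proj_eq Lat_0)

lemma torus_proj_eq_iff: "torus_proj Lat v = torus_proj Lat w \<longleftrightarrow> v - w \<in> Lat"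
proof
  assume "torus_proj Lat v = torus_proj Lat w"
  then have "v \<in> torus_proj Lat w" using torus_proj_mem[of v] by simp
  then show "v - w \<in> Lat" by (simp add: torus_proj_eq)
next
  assume vw: "v - w \<in> Lat"
  have "x - v \<in> Lat \<longleftrightarrow> x - w \<in> Lat" for x
    using Lat_add[OF _ vw, of "x - v"] Lat_diff[OF _ vw, of "x - w"] by auto
  then show "torus_proj Lat v = torus_proj Lat w" by (simp add: torus_proj_eq)
qed

lemma carrier_torus: "carrier (torus Lat) = range (torus_proj Lat)"
  by (auto simp: torus_def FactGroup_def RCOSETS_def torus_proj_def vec_group_def)

lemma mult_torus: "torus_proj Lat v \<otimes>\<^bsub>torus Lat\<^esub> torus_proj Lat w = torus_proj Lat (v + w)"
proof -
  have "torus_proj Lat v \<otimes>\<^bsub>torus Lat\<^esub> torus_proj Lat w = {x + y | x y. x - v \<in> Lat \<and> y - w \<in> Lat}"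
    by (auto simp: torus_def FactGroup_def set_mult_def vec_group_def torus_proj_eq)
  also have "\<dots> = {z. z - (v + w) \<in> Lat}"
  proof
    show "{x + y | x y. x - v \<in> Lat \<and> y - w \<in> Lat} \<subseteq> {z. z - (v + w) \<in> Lat}"
    proof clarify
      fix x y assume "x - v \<in> Lat" "y - w \<in> Lat"
      from Lat_add[OF this] show "x + y - (v + w) \<in> Lat" by (simp add: algebra_simps)
    qed
    show "{z. z - (v + w) \<in> Lat} \<subseteq> {x + y | x y. x - v \<in> Lat \<and> y - w \<in> Lat}"
    proof
      fix z assume "z \<in> {z. z - (v + w) \<in> Lat}"
      then have "z = (z - w) + w \<and> (z - w) - v \<in> Lat \<and> w - w \<in> Lat"
        using Lat_0 by (simp add: algebra_simps)
      then show "z \<in> {x + y | x y. x - v \<in> Lat \<and> y - w \<in> Lat}" by blast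
    qed
  qed
  finally show ?thesis by (simp add: torus_proj_eq)
qed

lemma one_torus: "\<one>\<^bsub>torus Lat\<^esub> = torus_proj Lat 0"
  by (simp add: torus_def FactGroup_def torus_proj_eq)

lemma torus_map_proj:
  assumes "A \<in> carrier (mat_End Lat)"
  shows "torus_map Lat A (torus_proj Lat v) = torus_proj Lat (A *v v)"
proof -
  define w where "w = (SOME w. w \<in> torus_proj Lat v)"
  have "w \<in> torus_proj Lat v" unfolding w_def by (rule someI_ex) (use torus_proj_mem in blast)
  then have "w - v \<in> Lat" by (simp add: torus_proj_eq)
  then have "A *v (w - v) \<in> Lat" using assms by (simp add: mat_End_def)
  then have "torus_proj Lat (A *v w) = torus_proj Lat (A *v v)"
    by (simp add: torus_proj_eq_iff matrix_vector_mult_diff_distrib)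
  then show ?thesis by (simp add: torus_map_def carrier_torus w_def)
qed

lemma torus_map_extensional: "torus_map Lat A \<in> extensional (carrier (torus Lat))"
  by (simp add: torus_map_def)

lemma torus_funI:
  assumes "f \<in> extensional (carrier (torus Lat))" "h \<in> extensional (carrier (torus Lat))"
    and "\<And>v. f (torus_proj Lat v) = h (torus_proj Lat v)"
  shows "f = h"
  by (rule extensionalityI[OF assms(1,2)]) (use assms(3) in \<open>auto simp: carrier_torus\<close>)

lemma torus_map_End:
  assumes A: "A \<in> carrier (mat_End Lat)"
  shows "torus_map Lat A \<in> carrier (End_torus Lat)"
proof -
  have "torus_map Lat A \<in> hom (torus Lat) (torus Lat)"
    by (rule homI) (auto simp: carrier_torus torus_map_proj[OF A] mult_torus matrix_vector_right_distrib)
  moreover have "holomorphic_torus_map Lat (torus_map Lat A)"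
    unfolding holomorphic_torus_map_def
  proof
    fix v
    have "holomorphic_vec_on ((*v) A) UNIV"
      unfolding holomorphic_vec_on_def
    proof
      fix z :: "complex ^ 'g"
      have "Vector_Spaces.linear (*s) (*s) ((*v) A)" by (rule matrix_vector_mul_linear_gen)
      moreover have "((*v) A has_derivative (*v) A) (at z)"
        by (rule bounded_linear_imp_has_derivative)
           (use linear_linear linear_matrix_vector_complex[of A] in blast)
      ultimately show "\<exists>D. Vector_Spaces.linear (*s) (*s) D \<and> ((*v) A has_derivative D) (at z)" by blast
    qed
    then show "\<exists>U F. open U \<and> v \<in> U \<and> holomorphic_vec_on F U \<and>
        (\<forall>z\<in>U. torus_map Lat A (torus_proj Lat z) = torus_proj Lat (F z))"
      using torus_map_proj[OF A] by (intro exI[of _ UNIV] exI[of _ "(*v) A"]) auto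
  qed
  ultimately show ?thesis by (simp add: End_torus_def torus_map_extensional)
qed

text \<open>A linear map whose values all lie in the lattice is 0, as an argument could otherwise be
  rescaled until a coordinate of its image is \<open>1 / 2\<close>.\<close>

lemma torus_map_inj:
  assumes A: "A \<in> carrier (mat_End Lat)" and B: "B \<in> carrier (mat_End Lat)" and e: "torus_map Lat A = torus_map Lat B"
  shows "A = B"
proof -
  have d: "(A - B) *v v \<in> Lat" for v
  proof -
    have "torus_proj Lat (A *v v) = torus_proj Lat (B *v v)"
      using torus_map_proj[OF A, of v] torus_map_proj[OF B, of v] e by simp
    then show ?thesis by (simp only: torus_proj_eq_iff matrix_vector_mult_diff_rdistrib)
  qed
  have "co ((A - B) *v v) k = 0" for v k
  proof (rule ccontr)
    assume n: "co ((A - B) *v v) k \<noteq> 0"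
    define r where "r = co ((A - B) *v v) k"
    have "(A - B) *v ((1 / (2 * r)) *\<^sub>R v) = (1 / (2 * r)) *\<^sub>R ((A - B) *v v)"
      by (rule linear_scale[OF linear_matrix_vector_complex])
    then have "co ((A - B) *v ((1 / (2 * r)) *\<^sub>R v)) k = (1 / (2 * r)) * r" by (simp only: co_scale r_def)
    also have "\<dots> = 1 / 2" using n by (simp add: r_def)
    finally have "co ((A - B) *v ((1 / (2 * r)) *\<^sub>R v)) k = 1 / 2" .
    moreover have "co ((A - B) *v ((1 / (2 * r)) *\<^sub>R v)) k \<in> \<int>"
      using d[of "(1 / (2 * r)) *\<^sub>R v"] unfolding Lat_def by blast
    ultimately have "(1 / 2 :: real) \<in> \<int>" by (simp only:)
    then show False using fraction_not_in_Ints[of 2 1, where 'a = real] by simp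
  qed
  then have "(A - B) *v v = 0" for v by (intro co_eqI) simp
  then have "A *v v = B *v v" for v by (simp add: matrix_vector_mult_diff_rdistrib)
  then show ?thesis by (simp add: matrix_eq)
qed

text \<open>If \<open>G\<close> lifts an endomorphism \<open>f\<close> near \<open>0\<close> and \<open>G 0 = 0\<close>, then \<open>n G (v / n)\<close> lifts \<open>f v\<close>; as \<open>n\<close>
  grows it converges to the derivative of \<open>G\<close> at \<open>0\<close>, while the lifts of \<open>f v\<close> form a closed set.\<close>

lemma torus_map_surj:
  assumes f: "f \<in> carrier (End_torus Lat)"
  shows "\<exists>A\<in>carrier (mat_End Lat). f = torus_map Lat A"
proof -
  have hom: "f \<in> hom (torus Lat) (torus Lat)" and ext: "f \<in> extensional (carrier (torus Lat))"
    and hol: "holomorphic_torus_map Lat f" using f by (auto simp: End_torus_def)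
  have fm: "f (torus_proj Lat (v + w)) = f (torus_proj Lat v) \<otimes>\<^bsub>torus Lat\<^esub> f (torus_proj Lat w)" for v w
    using hom_mult[OF hom, of "torus_proj Lat v" "torus_proj Lat w"] by (simp add: carrier_torus mult_torus)
  have "\<forall>v. \<exists>w. f (torus_proj Lat v) = torus_proj Lat w"
    using hom_in_carrier[OF hom] by (auto simp: carrier_torus)
  \<comment> \<open>A lift chosen point by point; it is additive modulo the lattice, and its
    comparison with \<open>F\<close> near 0 supplies the analytic information.\<close>
  then obtain \<phi> where \<phi>: "\<And>v. f (torus_proj Lat v) = torus_proj Lat (\<phi> v)" by metis
  have \<phi>_add: "\<phi> (v + w) - (\<phi> v + \<phi> w) \<in> Lat" for v w
    using fm[of v w] by (simp add: \<phi> mult_torus torus_proj_eq_iff)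
  have \<phi>_0: "\<phi> 0 \<in> Lat" using Lat_minus[OF \<phi>_add[of 0 0]] by simp
  have \<phi>_mult: "\<phi> (of_nat n *\<^sub>R v) - of_nat n *\<^sub>R \<phi> v \<in> Lat" for n v
  proof (induction n)
    case (Suc n)
    have "\<phi> (of_nat n *\<^sub>R v + v) - (\<phi> (of_nat n *\<^sub>R v) + \<phi> v) \<in> Lat" by (rule \<phi>_add)
    from Lat_add[OF this Suc] show ?case by (simp add: algebra_simps)
  qed (simp add: \<phi>_0)
  obtain U F where U: "open U" "0 \<in> U" and F: "holomorphic_vec_on F U"
    and fF: "\<And>z. z \<in> U \<Longrightarrow> f (torus_proj Lat z) = torus_proj Lat (F z)"
    using hol unfolding holomorphic_torus_map_def by (elim allE[of _ 0] exE conjE) blast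
  obtain D where D: "Vector_Spaces.linear (*s) (*s) D" "(F has_derivative D) (at 0)"
    using F U(2) unfolding holomorphic_vec_on_def by blast
  define A where "A = matrix D"
  have DA: "D v = A *v v" for v unfolding A_def using D(1) by (simp add: matrix_works)
  have F\<phi>: "F z - \<phi> z \<in> Lat" if "z \<in> U" for z
    using fF[OF that] by (simp add: \<phi> torus_proj_eq_iff[symmetric])
  have key: "D v - \<phi> v \<in> Lat" for v
  proof -
    \<comment> \<open>The local lift \<open>F\<close> need not fix 0, hence the correction by
      \<open>F 0\<close>, which is a lattice vector.\<close>
    define s where "s = (\<lambda>n::nat. real (Suc n) *\<^sub>R (F ((1 / real (Suc n)) *\<^sub>R v) - F 0))"
    have bl: "bounded_linear D" using D(2) by (rule has_derivative_bounded_linear)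
    define h where "h = (\<lambda>n::nat. (1 / real (Suc n)) *\<^sub>R v)"
    have lim: "(\<lambda>n. 1 / real (Suc n)) \<longlonglongrightarrow> 0" by (rule LIMSEQ_Suc[OF lim_1_over_n])
    have h0: "h \<longlonglongrightarrow> 0"
      using tendsto_scaleR[OF lim tendsto_const[of v]] by (simp add: h_def)
    have s_lim: "s \<longlonglongrightarrow> D v"
    proof (cases "v = 0")
      case True
      then show ?thesis by (simp add: s_def linear_0[OF bounded_linear.linear[OF bl]])
    next
      case False
      have "((\<lambda>h. norm (F (0 + h) - F 0 - D h) / norm h) \<longlongrightarrow> 0) (at 0)"
        using D(2) by (simp only: has_derivative_at)
      moreover have "filterlim h (at 0) sequentially"
        unfolding filterlim_at using h0 False by (simp add: h_def)
      ultimately have "(\<lambda>n. norm (F (0 + h n) - F 0 - D (h n)) / norm (h n)) \<longlonglongrightarrow> 0"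
        by (rule filterlim_compose)
      from tendsto_mult[OF this tendsto_const[of "norm v"]]
      have "(\<lambda>n. norm (F (0 + h n) - F 0 - D (h n)) / norm (h n) * norm v) \<longlonglongrightarrow> 0" by simp
      moreover have "norm (F (0 + h n) - F 0 - D (h n)) / norm (h n) * norm v = norm (s n - D v)" for n
      proof -
        have "D (h n) = (1 / real (Suc n)) *\<^sub>R D v"
          unfolding h_def by (rule linear_scale[OF bounded_linear.linear[OF bl]])
        then have "s n - D v = real (Suc n) *\<^sub>R (F (0 + h n) - F 0 - D (h n))"
          by (simp add: s_def h_def scaleR_diff_right del: of_nat_Suc)
        moreover have "norm (h n) = norm v / real (Suc n)" by (simp add: h_def)
        ultimately show ?thesis using False by (simp del: of_nat_Suc)
      qed
      ultimately have "(\<lambda>n. norm (s n - D v)) \<longlonglongrightarrow> 0" by simp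
      then show ?thesis by (simp only: tendsto_norm_zero_iff LIM_zero_iff)
    qed
    have "eventually (\<lambda>n. (1 / real (Suc n)) *\<^sub>R v \<in> U) sequentially"
    proof -
      have "(\<lambda>n. (1 / real (Suc n)) *\<^sub>R v) \<longlonglongrightarrow> 0 *\<^sub>R v" by (intro tendsto_intros lim)
      then show ?thesis using U by (simp add: tendsto_def)
    qed
    then have ev: "eventually (\<lambda>n. s n - \<phi> v \<in> Lat) sequentially"
    proof (rule eventually_mono)
      fix n assume n: "(1 / real (Suc n)) *\<^sub>R v \<in> U"
      let ?z = "(1 / real (Suc n)) *\<^sub>R v"
      have z: "of_nat (Suc n) *\<^sub>R ?z = v" by simp
      have "F 0 \<in> Lat" using Lat_add[OF F\<phi>[OF U(2)] \<phi>_0] by simp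
      from Lat_diff[OF F\<phi>[OF n] this] have "F ?z - F 0 - \<phi> ?z \<in> Lat" by (simp add: algebra_simps)
      then have "of_nat (Suc n) *\<^sub>R (F ?z - F 0 - \<phi> ?z) \<in> Lat" by (simp add: Lat_def del: of_nat_Suc)
      then have "s n - of_nat (Suc n) *\<^sub>R \<phi> ?z \<in> Lat" by (simp only: s_def scaleR_diff_right)
      moreover have "\<phi> v - of_nat (Suc n) *\<^sub>R \<phi> ?z \<in> Lat" using \<phi>_mult[of "Suc n" ?z] unfolding z .
      ultimately have "(s n - of_nat (Suc n) *\<^sub>R \<phi> ?z) - (\<phi> v - of_nat (Suc n) *\<^sub>R \<phi> ?z) \<in> Lat" by (rule Lat_diff)
      then show "s n - \<phi> v \<in> Lat" by simp
    qed
    have "co (D v - \<phi> v) k \<in> \<int>" for k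
    proof (rule Lim_in_closed_set[OF closed_Ints _ sequentially_bot])
      show "\<forall>\<^sub>F n in sequentially. co (s n - \<phi> v) k \<in> \<int>"
        using ev by (rule eventually_mono) (simp add: Lat_def)
      have "bounded_linear (\<lambda>v. co v k)" using co_linear linear_linear by blast
      then show "(\<lambda>n. co (s n - \<phi> v) k) \<longlonglongrightarrow> co (D v - \<phi> v) k"
        by (rule bounded_linear.tendsto) (intro tendsto_intros s_lim)
    qed
    then show ?thesis by (simp add: Lat_def)
  qed
  have "A *v v \<in> Lat" if v: "v \<in> Lat" for v
  proof -
    have "torus_proj Lat v = torus_proj Lat 0" using v by (simp add: torus_proj_eq_iff)
    then have "torus_proj Lat (\<phi> v) = torus_proj Lat (\<phi> 0)" by (metis \<phi>)
    then have "\<phi> v - \<phi> 0 \<in> Lat" by (simp only: torus_proj_eq_iff)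
    from Lat_add[OF Lat_add[OF this \<phi>_0] key[of v]] show ?thesis by (simp add: DA)
  qed
  then have A: "A \<in> carrier (mat_End Lat)" by (simp add: mat_End_def)
  have "f = torus_map Lat A"
  proof (rule torus_funI[OF ext torus_map_extensional])
    fix v
    have "\<phi> v - A *v v \<in> Lat" using Lat_minus[OF key[of v]] by (simp add: DA)
    then show "f (torus_proj Lat v) = torus_map Lat A (torus_proj Lat v)"
      by (simp add: torus_map_proj[OF A] \<phi> torus_proj_eq_iff)
  qed
  then show ?thesis using A by blast
qed

lemma mat_End_closed:
  assumes "A \<in> carrier (mat_End Lat)" "B \<in> carrier (mat_End Lat)"
  shows "A + B \<in> carrier (mat_End Lat)" "A ** B \<in> carrier (mat_End Lat)"
  using assms by (auto simp: mat_End_def matrix_vector_mult_add_rdistrib Lat_add matrix_vector_mul_assoc[symmetric])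

lemma mat_End_one: "mat 1 \<in> carrier (mat_End Lat)"
  by (simp add: mat_End_def)

lemma mat_End_simps:
  "A \<otimes>\<^bsub>mat_End \<Lambda>\<^esub> B = A ** B" "A \<oplus>\<^bsub>mat_End \<Lambda>\<^esub> B = A + B" "\<one>\<^bsub>mat_End \<Lambda>\<^esub> = mat 1" "\<zero>\<^bsub>mat_End \<Lambda>\<^esub> = 0"
  by (simp_all add: mat_End_def)

theorem torus_map_iso: "torus_map Lat \<in> ring_iso (mat_End Lat) (End_torus Lat)"
proof -
  have E: "\<lbrakk>f \<in> extensional (carrier (torus Lat))\<rbrakk> \<Longrightarrow> compose (carrier (torus Lat)) f h \<in> extensional (carrier (torus Lat))" for f h
    by simp
  have pc: "torus_proj Lat v \<in> carrier (torus Lat)" for v by (simp add: carrier_torus)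
  have "torus_map Lat \<in> ring_hom (mat_End Lat) (End_torus Lat)"
  proof (rule ring_hom_memI)
    show "torus_map Lat A \<in> carrier (End_torus Lat)" if "A \<in> carrier (mat_End Lat)" for A
      by (rule torus_map_End[OF that])
    fix A B assume AB: "A \<in> carrier (mat_End Lat)" "B \<in> carrier (mat_End Lat)"
    show "torus_map Lat (A \<otimes>\<^bsub>mat_End Lat\<^esub> B) = torus_map Lat A \<otimes>\<^bsub>End_torus Lat\<^esub> torus_map Lat B"
      using mat_End_closed(2)[OF AB]
      by (intro torus_funI)
         (auto simp: mat_End_simps End_torus_def torus_map_extensional torus_map_proj AB compose_def pc
           matrix_vector_mul_assoc[symmetric])
    show "torus_map Lat (A \<oplus>\<^bsub>mat_End Lat\<^esub> B) = torus_map Lat A \<oplus>\<^bsub>End_torus Lat\<^esub> torus_map Lat B"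
      using mat_End_closed(1)[OF AB]
      by (intro torus_funI)
         (auto simp: mat_End_simps End_torus_def torus_map_extensional torus_map_proj AB pc
           matrix_vector_mult_add_rdistrib mult_torus)
  next
    show "torus_map Lat \<one>\<^bsub>mat_End Lat\<^esub> = \<one>\<^bsub>End_torus Lat\<^esub>"
      using mat_End_one
      by (intro torus_funI)
         (auto simp: mat_End_simps End_torus_def torus_map_extensional torus_map_proj pc)
  qed
  moreover have "bij_betw (torus_map Lat) (carrier (mat_End Lat)) (carrier (End_torus Lat))"
    unfolding bij_betw_def
  proof
    show "inj_on (torus_map Lat) (carrier (mat_End Lat))" by (rule inj_onI) (rule torus_map_inj)
    show "torus_map Lat ` carrier (mat_End Lat) = carrier (End_torus Lat)"
      using torus_map_End torus_map_surj by blast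
  qed
  ultimately show ?thesis by (simp add: ring_iso_def)
qed

end

section \<open>Transport of the torus to diagonal form\<close>

definition vec_ring :: "(complex ^ 'g) set \<Rightarrow> (complex ^ 'g) ring" where
  "vec_ring S = \<lparr>carrier = S, monoid.mult = (*), one = 1, ring.zero = 0, add = (+)\<rparr>"

lemma vec_ring_simps [simp]:
  "carrier (vec_ring S) = S" "x \<otimes>\<^bsub>vec_ring S\<^esub> y = x * y" "x \<oplus>\<^bsub>vec_ring S\<^esub> y = x + y"
  "\<one>\<^bsub>vec_ring S\<^esub> = 1" "\<zero>\<^bsub>vec_ring S\<^esub> = 0"
  by (simp_all add: vec_ring_def)

text \<open>The change of basis by \<open>P\<close> makes all endomorphisms diagonal; the new
  lattice is the image of \<open>Lat\<close> under \<open>P\<close>. The value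
  \<open>\<theta> 0\<close> is recorded separately because members of \<open>ring_iso\<close> need
  not preserve the zero field of the record.\<close>

theorem (in two_simple_torus) torus_diagonalization:
  shows "\<exists>(b' :: 'g + 'g \<Rightarrow> complex ^ 'g) co'. diag_lattice b' co' \<and>
           (\<exists>\<theta> \<in> ring_iso (vec_ring (lattice_coords.KO co')) (End_torus \<Lambda>).
              \<theta> 0 = \<zero>\<^bsub>End_torus \<Lambda>\<^esub>) \<and>
           (abelian_variety \<Lambda> \<longrightarrow> ratV.dim (lattice_coords.KF co') = CARD('g) \<longrightarrow>
              (\<forall>x\<in>lattice_coords.KF co'. \<forall>i. x $ i \<in> \<real>))"
proof -
  obtain \<phi> :: "'g + 'g \<Rightarrow> 'k" where bij: "bij \<phi>"
  proof -
    have "CARD('g + 'g) = CARD('k)" using cardk by simp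
    then show ?thesis using that finite_same_card_bij[OF finite finite] by blast
  qed
  obtain P where P: "invertible P"
    and Pe: "\<forall>A\<in>EndQ. \<exists>x. eigenbasis P A x \<and> ((\<exists>q\<in>\<rat>. A = mat q) \<or> inj (vec_nth x))"
    using simultaneous_eigenbasis by blast
  obtain Q where PQ: "\<forall>v. P *v (Q *v v) = v" and QP: "\<forall>v. Q *v (P *v v) = v"
    using invertible_inverse_ex[OF P] by blast
  define b' where "b' = (\<lambda>k. P *v b (\<phi> k))"
  define co' where "co' = (\<lambda>v k. co (Q *v v) (\<phi> k))"
  interpret L: lattice_coords b' co'
  proof (rule lattice_coords.intro)
    show "linear (\<lambda>v. co' v k)" for k
      unfolding co'_def
      using linear_compose[OF linear_matrix_vector_complex[of Q] co_linear[of "\<phi> k"]] by (simp add: o_def)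
    show "(\<Sum>k\<in>UNIV. co' v k *\<^sub>R b' k) = v" for v
    proof -
      have "(\<Sum>k\<in>UNIV. co' v k *\<^sub>R b' k) = (\<Sum>k\<in>UNIV. co (Q *v v) (\<phi> k) *\<^sub>R (P *v b (\<phi> k)))"
        by (simp only: b'_def co'_def)
      also have "\<dots> = (\<Sum>k\<in>UNIV. co (Q *v v) k *\<^sub>R (P *v b k))"
        by (rule sum.reindex_bij_betw) (rule bij)
      also have "\<dots> = P *v (\<Sum>k\<in>UNIV. co (Q *v v) k *\<^sub>R b k)"
        by (simp only: linear_sum[OF linear_matrix_vector_complex] linear_scale[OF linear_matrix_vector_complex])
      also have "\<dots> = v" by (simp only: expand PQ)
      finally show ?thesis .
    qed
    show "co' (b' k) l = (if k = l then 1 else 0)" for k l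
      using bij by (simp add: co'_def b'_def QP co_b bij_def inj_eq)
  qed
  have all\<phi>: "(\<forall>k. R (\<phi> k)) \<longleftrightarrow> (\<forall>k. R k)" for R using bij by (metis bij_pointE)
  have Lat': "v \<in> L.Lat \<longleftrightarrow> Q *v v \<in> Lat" for v
    unfolding L.Lat_def Lat_def by (simp add: co'_def all\<phi>[of "\<lambda>k. co (Q *v v) k \<in> \<int>"])
  have LatQ': "v \<in> L.LatQ \<longleftrightarrow> Q *v v \<in> LatQ" for v
    unfolding L.LatQ_def LatQ_def by (simp add: co'_def all\<phi>[of "\<lambda>k. co (Q *v v) k \<in> \<rat>"])
  define \<theta> where "\<theta> = (\<lambda>x :: complex ^ 'g. Q ** (\<chi> i j. if i = j then x $ i else 0) ** P)"
  have \<theta>: "\<theta> x *v v = Q *v (x * (P *v v))" for x v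
  proof -
    have "(\<chi> i j. if i = j then x $ i else 0) *v w = x * w" for w
      by (simp add: vec_eq_iff matrix_vector_mult_def if_distrib[of "\<lambda>y. y * _"] cong: if_cong)
    then show ?thesis by (simp add: \<theta>_def matrix_vector_mul_assoc[symmetric])
  qed
  have \<theta>P: "P *v (\<theta> x *v v) = x * (P *v v)" for x v by (simp add: \<theta> PQ)
  have \<theta>_eq: "\<theta> x = A" if "eigenbasis P A x" for x A
  proof -
    have "\<theta> x *v v = A *v v" for v
    proof -
      have "\<theta> x *v v = Q *v (P *v (A *v v))" using that by (simp add: \<theta> eigenbasis_def)
      then show ?thesis by (simp add: QP)
    qed
    then show ?thesis by (simp add: matrix_eq)
  qed
  have \<theta>_inj: "x = y" if "\<theta> x = \<theta> y" for x y
  proof -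
    have "x * (P *v (Q *v 1)) = y * (P *v (Q *v 1))" using \<theta>P that by metis
    then show ?thesis by (simp add: PQ)
  qed
  have KF: "\<theta> x \<in> EndQ" if "x \<in> L.KF" for x
    unfolding EndQ_def
  proof clarify
    fix v assume "v \<in> LatQ"
    then have "P *v v \<in> L.LatQ" by (simp add: LatQ' QP)
    then have "x * (P *v v) \<in> L.LatQ" using that by (simp add: L.KF_def)
    then show "\<theta> x *v v \<in> LatQ" by (simp add: LatQ' \<theta>)
  qed
  have KO: "x \<in> L.KO \<longleftrightarrow> \<theta> x \<in> carrier (mat_End Lat)" for x
  proof
    assume x: "x \<in> L.KO"
    have "\<theta> x *v v \<in> Lat" if "v \<in> Lat" for v
    proof -
      have "P *v v \<in> L.Lat" using that by (simp add: Lat' QP)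
      then have "x * (P *v v) \<in> L.Lat" using x by (simp add: L.KO_def)
      then show ?thesis by (simp add: Lat' \<theta>)
    qed
    then show "\<theta> x \<in> carrier (mat_End Lat)" by (simp add: mat_End_def)
  next
    assume x: "\<theta> x \<in> carrier (mat_End Lat)"
    have "x * v \<in> L.Lat" if "v \<in> L.Lat" for v
    proof -
      have "\<theta> x *v (Q *v v) \<in> Lat" using x that by (simp add: mat_End_def Lat')
      then show ?thesis by (simp add: \<theta> PQ Lat')
    qed
    then show "x \<in> L.KO" by (simp add: L.KO_def)
  qed
  have mat_End_EndQ: "A \<in> EndQ" if A: "A \<in> carrier (mat_End Lat)" for A
    unfolding EndQ_def
  proof clarify
    fix v assume "v \<in> LatQ"
    then obtain n :: nat where n: "n > 0" "of_nat n *\<^sub>R v \<in> Lat" using denominator by blast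
    then have "A *v (of_nat n *\<^sub>R v) \<in> Lat" using A by (simp add: mat_End_def)
    then have "of_nat n *\<^sub>R (A *v v) \<in> LatQ"
      by (simp only: linear_scale[OF linear_matrix_vector_complex] Lat_LatQ)
    then have "real n * co (A *v v) k \<in> \<rat>" for k by (simp add: LatQ_def)
    then have "real n * co (A *v v) k / real n \<in> \<rat>" for k by (intro Rats_divide) auto
    then show "A *v v \<in> LatQ" using n(1) by (simp add: LatQ_def)
  qed
  interpret D: diag_lattice b' co'
  proof
    show "CARD('g) \<ge> 3" by (rule g3)
    show "inj (vec_nth x)" if x: "x \<in> L.KF" "x \<notin> range rdiag" for x
    proof -
      obtain y where y: "eigenbasis P (\<theta> x) y" "(\<exists>q\<in>\<rat>. \<theta> x = mat q) \<or> inj (vec_nth y)"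
        using Pe KF[OF x(1)] by blast
      have yx: "y = x" using \<theta>_eq[OF y(1)] by (rule \<theta>_inj)
      have "\<theta> x \<noteq> mat q" if q: "q \<in> \<rat>" for q
      proof
        assume e: "\<theta> x = mat q"
        obtain r where r: "q = of_rat r" using q by (elim Rats_cases)
        have "x * (P *v (Q *v 1)) = P *v (q *s (Q *v 1))" using \<theta>P[of x "Q *v 1"] by (simp add: e)
        then have "x = q *s 1" by (simp add: PQ vector_scalar_commute) 
        then have "x = rdiag r" by (simp add: r vec_eq_iff scaleR_complex of_real_of_rat)
        then show False using x(2) by blast
      qed
      then show ?thesis using y(2) yx by blast
    qed
    show "x $ i \<noteq> 0" if x: "x \<in> L.KF" "x \<noteq> 0" for x i
    proof
      assume xi: "x $ i = 0"
      have "\<theta> x \<noteq> 0"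
      proof
        assume "\<theta> x = 0"
        then have "x * (P *v (Q *v 1)) = 0" using \<theta>P[of x "Q *v 1"] by simp
        then show False using x(2) by (simp add: PQ)
      qed
      moreover have "\<theta> x *v (Q *v axis i 1) = 0" using xi by (simp add: \<theta> PQ times_axis)
      moreover have "Q *v axis i 1 \<noteq> 0"
      proof
        assume "Q *v axis i 1 = 0"
        then have "P *v (Q *v axis i 1) = 0" by simp
        then show False by (simp add: PQ)
      qed
      ultimately show False using EndQ_kernel[OF KF[OF x(1)]] by blast
    qed
  qed
  have iso1: "\<theta> \<in> ring_iso (vec_ring L.KO) (mat_End Lat)"
  proof -
    have "\<theta> \<in> ring_hom (vec_ring L.KO) (mat_End Lat)"
    proof (rule ring_hom_memI)
      show "\<theta> x \<in> carrier (mat_End Lat)" if "x \<in> carrier (vec_ring L.KO)" for x using that KO by simp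
      fix x y :: "complex ^ 'g"
      show "\<theta> (x \<otimes>\<^bsub>vec_ring L.KO\<^esub> y) = \<theta> x \<otimes>\<^bsub>mat_End Lat\<^esub> \<theta> y"
        by (simp add: mat_End_simps matrix_eq matrix_vector_mul_assoc[symmetric] \<theta> PQ mult.assoc)
      show "\<theta> (x \<oplus>\<^bsub>vec_ring L.KO\<^esub> y) = \<theta> x \<oplus>\<^bsub>mat_End Lat\<^esub> \<theta> y"
        by (simp add: mat_End_simps matrix_eq matrix_vector_mult_add_rdistrib \<theta> distrib_right matrix_vector_right_distrib)
    next
      show "\<theta> \<one>\<^bsub>vec_ring L.KO\<^esub> = \<one>\<^bsub>mat_End Lat\<^esub>"
        by (simp add: mat_End_simps matrix_eq \<theta> QP)
    qed
    moreover have "bij_betw \<theta> (carrier (vec_ring L.KO)) (carrier (mat_End Lat))"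
      unfolding bij_betw_def
    proof
      show "inj_on \<theta> (carrier (vec_ring L.KO))" using \<theta>_inj by (intro inj_onI)
      show "\<theta> ` carrier (vec_ring L.KO) = carrier (mat_End Lat)"
      proof
        show "carrier (mat_End Lat) \<subseteq> \<theta> ` carrier (vec_ring L.KO)"
        proof
          fix A assume A: "A \<in> carrier (mat_End Lat)"
          obtain x where "eigenbasis P A x" using Pe mat_End_EndQ[OF A] by blast
          then have "\<theta> x = A" by (rule \<theta>_eq)
          then show "A \<in> \<theta> ` carrier (vec_ring L.KO)" using KO[of x] A by auto
        qed
      qed (use KO in auto)
    qed
    ultimately show ?thesis by (simp add: ring_iso_def)
  qed
  have \<theta>0: "\<theta> 0 = 0" by (simp add: matrix_eq \<theta>)
  have "torus_map Lat \<circ> \<theta> \<in> ring_iso (vec_ring L.KO) (End_torus \<Lambda>)"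
    unfolding \<Lambda>_Lat by (rule ring_iso_set_trans[OF iso1 torus_map_iso])
  moreover have "(torus_map Lat \<circ> \<theta>) 0 = \<zero>\<^bsub>End_torus \<Lambda>\<^esub>"
  proof -
    have 0: "0 \<in> carrier (mat_End Lat)" by (simp add: mat_End_def Lat_0)
    have "torus_map Lat 0 = \<zero>\<^bsub>End_torus Lat\<^esub>"
      by (rule torus_funI) (simp_all add: End_torus_def torus_map_extensional torus_map_proj[OF 0] one_torus, simp_all add: carrier_torus)
    then show ?thesis by (simp add: \<theta>0 \<Lambda>_Lat)
  qed
  moreover have "x $ i \<in> \<real>" if ab: "abelian_variety \<Lambda>" and dim: "ratV.dim L.KF = CARD('g)" and x: "x \<in> L.KF" for x i
  proof -
    obtain h where h: "semibilinear id cnj h" "\<And>v w. h w v = cnj (h v w)" "\<And>v. v \<noteq> 0 \<Longrightarrow> Re (h v v) > 0"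
      "\<And>v w. v \<in> \<Lambda> \<Longrightarrow> w \<in> \<Lambda> \<Longrightarrow> Im (h v w) \<in> \<int>"
      using ab unfolding abelian_variety_def riemann_form_def by blast
    let ?h = "\<lambda>v w. h (Q *v v) (Q *v w)"
    have Qs: "Q *v (c *s v) = c *s (Q *v v)" for c v by (rule vector_scalar_commute)
    show ?thesis
    proof (rule D.abelian_totally_real[OF dim _ _ _ _ _ x, where h = ?h])
      show "semibilinear id cnj ?h" using h(1) by (simp add: semibilinear_def matrix_vector_right_distrib Qs)
      show "?h w v = cnj (?h v w)" for v w by (rule h(2))
      show "Re (?h v v) > 0" if "v \<noteq> 0" for v
        using h(3)[of "Q *v v"] that PQ by (metis matrix_vector_mult_0_right)
      show "Im (?h (b' k) (b' l)) \<in> \<rat>" for k l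
        using h(4)[of "b (\<phi> k)" "b (\<phi> l)"] Ints_subset_Rats by (auto simp: b'_def QP \<Lambda>_Lat)
      show "\<exists>x. \<forall>v. A *v v = x * v" if A: "\<And>v. v \<in> L.LatQ \<Longrightarrow> A *v v \<in> L.LatQ" for A
      proof -
        have QAP: "(Q ** A ** P) *v v = Q *v (A *v (P *v v))" for v
          by (simp add: matrix_vector_mul_assoc[symmetric])
        have "Q ** A ** P \<in> EndQ"
          unfolding EndQ_def
        proof clarify
          fix v assume "v \<in> LatQ"
          then have "P *v v \<in> L.LatQ" by (simp add: LatQ' QP)
          then have "A *v (P *v v) \<in> L.LatQ" by (rule A)
          then show "(Q ** A ** P) *v v \<in> LatQ" by (simp add: QAP LatQ')
        qed
        then obtain x where x: "eigenbasis P (Q ** A ** P) x" using Pe by blast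
        have "A *v v = x * v" for v
        proof -
          have "P *v (Q *v (A *v (P *v (Q *v v)))) = x * (P *v (Q *v v))"
            using x by (simp only: eigenbasis_def QAP)
          then show ?thesis by (simp only: PQ)
        qed
        then show ?thesis by blast
      qed
    qed
  qed
  ultimately show ?thesis using D.diag_lattice_axioms by blast
qed

section \<open>Tensor products of rings\<close>

lemma frag_cmul_diff_right: "frag_cmul m (a - b) = frag_cmul m a - frag_cmul m b"
  by (rule poly_mapping_eqI) (simp add: lookup_minus right_diff_distrib)

lemma frag_extend_fun_diff: "frag_extend (\<lambda>x. f x - h x) c = frag_extend f c - frag_extend h c"
  by (simp add: frag_extend_def frag_cmul_diff_right sum_subtractf)

lemma monoid_ring_simps [simp]:
  "c \<in> carrier (monoid_ring M) \<longleftrightarrow> Poly_Mapping.keys c \<subseteq> carrier M"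
  "c \<oplus>\<^bsub>monoid_ring M\<^esub> d = c + d" "\<zero>\<^bsub>monoid_ring M\<^esub> = 0" "\<one>\<^bsub>monoid_ring M\<^esub> = frag_of \<one>\<^bsub>M\<^esub>"
  "frag_of x \<otimes>\<^bsub>monoid_ring M\<^esub> frag_of y = frag_of (x \<otimes>\<^bsub>M\<^esub> y)"
  by (simp_all add: monoid_ring_def)

lemma monoid_ring_mult_diff:
  "(c - c') \<otimes>\<^bsub>monoid_ring M\<^esub> d = c \<otimes>\<^bsub>monoid_ring M\<^esub> d - c' \<otimes>\<^bsub>monoid_ring M\<^esub> d"
  "c \<otimes>\<^bsub>monoid_ring M\<^esub> (d - d') = c \<otimes>\<^bsub>monoid_ring M\<^esub> d - c \<otimes>\<^bsub>monoid_ring M\<^esub> d'"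
  "0 \<otimes>\<^bsub>monoid_ring M\<^esub> d = 0" "c \<otimes>\<^bsub>monoid_ring M\<^esub> 0 = 0"
proof -
  show z: "c \<otimes>\<^bsub>monoid_ring M\<^esub> 0 = 0" for c by (simp add: monoid_ring_def frag_extend_def)
qed (simp_all add: monoid_ring_def frag_extend_diff frag_extend_fun_diff)

lemma monoid_ring_mult_add:
  "(c + c') \<otimes>\<^bsub>monoid_ring M\<^esub> d = c \<otimes>\<^bsub>monoid_ring M\<^esub> d + c' \<otimes>\<^bsub>monoid_ring M\<^esub> d"
  "c \<otimes>\<^bsub>monoid_ring M\<^esub> (d + d') = c \<otimes>\<^bsub>monoid_ring M\<^esub> d + c \<otimes>\<^bsub>monoid_ring M\<^esub> d'"
  using monoid_ring_mult_diff(1)[of M c "- c'" d] monoid_ring_mult_diff(2)[of M c d "- d'"]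
    monoid_ring_mult_diff(1)[of M 0 c' d] monoid_ring_mult_diff(2)[of M c 0 d']
  by (simp_all add: monoid_ring_mult_diff(3,4))

lemma keys_diff_subset: "Poly_Mapping.keys a \<subseteq> S \<Longrightarrow> Poly_Mapping.keys b \<subseteq> S \<Longrightarrow> Poly_Mapping.keys (a - b) \<subseteq> S"
  for a b :: "'a \<Rightarrow>\<^sub>0 int"
  using keys_diff[of a b] by blast

lemma keys_add_subset: "Poly_Mapping.keys a \<subseteq> S \<Longrightarrow> Poly_Mapping.keys b \<subseteq> S \<Longrightarrow> Poly_Mapping.keys (a + b) \<subseteq> S"
  for a b :: "'a \<Rightarrow>\<^sub>0 int"
  using Poly_Mapping.keys_add[of a b] by blast

lemma monoid_ring_is_ring:
  assumes "monoid M"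
  shows "ring (monoid_ring M)"
proof -
  interpret M: monoid M by fact
  let ?F = "monoid_ring M"
  have closed: "Poly_Mapping.keys (c \<otimes>\<^bsub>?F\<^esub> d) \<subseteq> carrier M"
    if c: "Poly_Mapping.keys c \<subseteq> carrier M" and d: "Poly_Mapping.keys d \<subseteq> carrier M" for c d
    using c
  proof (induction c rule: frag_induction)
    case (one x)
    show ?case using d
    proof (induction d rule: frag_induction)
      case (one y)
      then show ?case using \<open>x \<in> carrier M\<close> by (simp add: keys_frag_of)
    qed (simp_all add: monoid_ring_mult_diff keys_diff_subset)
  qed (simp_all add: monoid_ring_mult_diff keys_diff_subset)
  have assoc: "c \<otimes>\<^bsub>?F\<^esub> d \<otimes>\<^bsub>?F\<^esub> e = c \<otimes>\<^bsub>?F\<^esub> (d \<otimes>\<^bsub>?F\<^esub> e)"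
    if c: "Poly_Mapping.keys c \<subseteq> carrier M" and d: "Poly_Mapping.keys d \<subseteq> carrier M"
      and e: "Poly_Mapping.keys e \<subseteq> carrier M" for c d e
    using c
  proof (induction c rule: frag_induction)
    case (one x)
    note x = one
    show ?case using d
    proof (induction d rule: frag_induction)
      case (one y)
      note y = one
      show ?case using e
      proof (induction e rule: frag_induction)
        case (one z)
        then show ?case using x y by (simp add: M.m_assoc)
      qed (simp_all add: monoid_ring_mult_diff)
    qed (simp_all add: monoid_ring_mult_diff)
  qed (simp_all add: monoid_ring_mult_diff)
  have one_l: "frag_of \<one>\<^bsub>M\<^esub> \<otimes>\<^bsub>?F\<^esub> c = c" and one_r: "c \<otimes>\<^bsub>?F\<^esub> frag_of \<one>\<^bsub>M\<^esub> = c" if "Poly_Mapping.keys c \<subseteq> carrier M" for c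
    using that by (induction c rule: frag_induction) (simp_all add: monoid_ring_mult_diff)
  show ?thesis
  proof (rule ringI)
    show "abelian_group ?F"
    proof (rule abelian_groupI)
      show "\<exists>y\<in>carrier ?F. y \<oplus>\<^bsub>?F\<^esub> x = \<zero>\<^bsub>?F\<^esub>" if "x \<in> carrier ?F" for x
        using that by (intro bexI[of _ "- x"]) simp_all
    qed (simp_all add: keys_add_subset)
    show "monoid ?F"
      by (rule monoidI) (simp_all add: closed assoc one_l one_r keys_frag_of)
  qed (simp_all add: monoid_ring_mult_add)
qed

section \<open>Tensor products with the rational and the real numbers\<close>

definition subring_vec :: "(complex ^ 'g) set \<Rightarrow> bool" where
  "subring_vec K \<longleftrightarrow> 1 \<in> K \<and> (\<forall>x\<in>K. \<forall>y\<in>K. x - y \<in> K \<and> x * y \<in> K)"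

lemma subring_vecD:
  assumes "subring_vec K"
  shows "1 \<in> K" "x \<in> K \<Longrightarrow> y \<in> K \<Longrightarrow> x - y \<in> K" "x \<in> K \<Longrightarrow> y \<in> K \<Longrightarrow> x * y \<in> K"
    "0 \<in> K" "x \<in> K \<Longrightarrow> - x \<in> K" "x \<in> K \<Longrightarrow> y \<in> K \<Longrightarrow> x + y \<in> K"
proof -
  show 1: "1 \<in> K" and d: "x \<in> K \<Longrightarrow> y \<in> K \<Longrightarrow> x - y \<in> K" and "x \<in> K \<Longrightarrow> y \<in> K \<Longrightarrow> x * y \<in> K" for x y
    using assms by (auto simp: subring_vec_def)
  show 0: "0 \<in> K" using d[OF 1 1] by simp
  show m: "x \<in> K \<Longrightarrow> - x \<in> K" for x using d[OF 0] by fastforce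
  show "x \<in> K \<Longrightarrow> y \<in> K \<Longrightarrow> x + y \<in> K" using d[OF _ m, of x y] by simp
qed

lemma subring_vec_sum:
  assumes "subring_vec K"
  shows "(\<And>i. i \<in> I \<Longrightarrow> f i \<in> K) \<Longrightarrow> (\<Sum>i\<in>I. f i) \<in> K"
  by (induction I rule: infinite_finite_induct) (auto intro: subring_vecD[OF assms])

lemma subring_vec_of_int:
  assumes "subring_vec K" "x \<in> K"
  shows "of_int m *\<^sub>R x \<in> K"
proof (induction m rule: int_induct[where k = 0])
  case (step1 i)
  then show ?case using subring_vecD(6)[OF assms(1) _ assms(2), of "of_int i *\<^sub>R x"] by (simp add: scaleR_left_distrib)
next
  case (step2 i)
  then show ?case using subring_vecD(2)[OF assms(1) _ assms(2), of "of_int i *\<^sub>R x"] by (simp add: scaleR_left_diff_distrib)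
qed (simp add: subring_vecD[OF assms(1)])

lemma vec_ring_cring:
  assumes K: "subring_vec K"
  shows "cring (vec_ring K)"
proof (rule cringI)
  show "abelian_group (vec_ring K)"
  proof (rule abelian_groupI)
    show "\<exists>y\<in>carrier (vec_ring K). y \<oplus>\<^bsub>vec_ring K\<^esub> x = \<zero>\<^bsub>vec_ring K\<^esub>" if "x \<in> carrier (vec_ring K)" for x
      using that subring_vecD(5)[OF K] by (intro bexI[of _ "- x"]) simp_all
  qed (simp_all add: subring_vecD[OF K] add_ac)
  show "Group.comm_monoid (vec_ring K)"
    by (rule comm_monoidI) (simp_all add: subring_vecD[OF K] mult_ac)
qed (simp add: distrib_right)

text \<open>Covers both \<open>KO \<otimes> \<rat>\<close> and \<open>KF \<otimes> \<real>\<close>.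
  The evaluation \<open>H\<close>, which sends \<open>x \<otimes> r\<close> to \<open>r\<close>
  times \<open>x\<close>, kills the tensor relations. That its kernel is no larger is left to the
  two instances, each of which has its own normal form for tensors.\<close>

locale scalar_tensor =
  fixes K :: "(complex ^ 'g) set" and \<phi> :: "complex ^ 'g \<Rightarrow> 'a" and R :: "('a, 'c) ring_scheme"
    and emb :: "'b::comm_ring_1 \<Rightarrow> real"
  assumes \<phi>: "\<phi> \<in> ring_iso (vec_ring K) R" and K: "subring_vec K"
    and emb_add: "emb (r + s) = emb r + emb s" and emb_mult: "emb (r * s) = emb r * emb s" and emb_1: "emb 1 = 1"
begin

definition S :: "'b ring" where "S = ring_of_type_algebra"
definition F :: "(('a \<times> 'b) \<Rightarrow>\<^sub>0 int) ring" where "F = monoid_ring (R \<times>\<times> S)"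
definition I :: "(('a \<times> 'b) \<Rightarrow>\<^sub>0 int) set" where "I = Idl\<^bsub>F\<^esub> (tensor_relators R S)"
definition \<psi> :: "'a \<Rightarrow> complex ^ 'g" where "\<psi> = inv_into K \<phi>"
definition h :: "'a \<times> 'b \<Rightarrow> complex ^ 'g" where "h p = emb (snd p) *\<^sub>R \<psi> (fst p)"
definition H :: "(('a \<times> 'b) \<Rightarrow>\<^sub>0 int) \<Rightarrow> complex ^ 'g" where
  "H c = (\<Sum>p\<in>Poly_Mapping.keys c. of_int (poly_mapping.lookup c p) *\<^sub>R h p)"

lemma S_simps [simp]: "carrier S = UNIV" "r \<otimes>\<^bsub>S\<^esub> s = r * s" "r \<oplus>\<^bsub>S\<^esub> s = r + s" "\<one>\<^bsub>S\<^esub> = 1" "\<zero>\<^bsub>S\<^esub> = 0"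
  by (simp_all add: S_def ring_of_type_algebra_def)

lemma bij: "bij_betw \<phi> K (carrier R)"
  and \<phi>_mult: "x \<in> K \<Longrightarrow> y \<in> K \<Longrightarrow> \<phi> (x * y) = \<phi> x \<otimes>\<^bsub>R\<^esub> \<phi> y"
  and \<phi>_add: "x \<in> K \<Longrightarrow> y \<in> K \<Longrightarrow> \<phi> (x + y) = \<phi> x \<oplus>\<^bsub>R\<^esub> \<phi> y"
  and \<phi>_1: "\<phi> 1 = \<one>\<^bsub>R\<^esub>"
  using \<phi> by (auto simp: ring_iso_def ring_hom_def)

lemma carrierE: assumes "a \<in> carrier R" obtains x where "x \<in> K" "a = \<phi> x"
  using assms bij by (auto simp: bij_betw_def)

lemma \<phi>_carrier: "x \<in> K \<Longrightarrow> \<phi> x \<in> carrier R"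
  using bij by (auto simp: bij_betw_def)

lemma \<psi>\<phi> [simp]: "x \<in> K \<Longrightarrow> \<psi> (\<phi> x) = x"
  using bij by (simp add: \<psi>_def bij_betw_def inv_into_f_f)

lemma R_monoid: "monoid R"
proof (rule monoidI)
  fix a b c assume "a \<in> carrier R" "b \<in> carrier R" "c \<in> carrier R"
  then obtain x y z where K': "x \<in> K" "y \<in> K" "z \<in> K" "a = \<phi> x" "b = \<phi> y" "c = \<phi> z" by (elim carrierE)
  then show "a \<otimes>\<^bsub>R\<^esub> b \<otimes>\<^bsub>R\<^esub> c = a \<otimes>\<^bsub>R\<^esub> (b \<otimes>\<^bsub>R\<^esub> c)"
    by (simp add: \<phi>_mult[symmetric] subring_vecD[OF K] mult.assoc)
next
  fix a b assume "a \<in> carrier R" "b \<in> carrier R"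
  then obtain x y where K': "x \<in> K" "y \<in> K" "a = \<phi> x" "b = \<phi> y" by (elim carrierE)
  then show "a \<otimes>\<^bsub>R\<^esub> b \<in> carrier R"
    by (simp add: \<phi>_mult[symmetric] \<phi>_carrier subring_vecD[OF K])
next
  show "\<one>\<^bsub>R\<^esub> \<in> carrier R" using \<phi>_carrier[OF subring_vecD(1)[OF K]] by (simp add: \<phi>_1)
next
  fix a assume "a \<in> carrier R"
  then obtain x where x: "x \<in> K" "a = \<phi> x" by (elim carrierE)
  show "\<one>\<^bsub>R\<^esub> \<otimes>\<^bsub>R\<^esub> a = a" "a \<otimes>\<^bsub>R\<^esub> \<one>\<^bsub>R\<^esub> = a"
    using \<phi>_mult[OF subring_vecD(1)[OF K] x(1)] \<phi>_mult[OF x(1) subring_vecD(1)[OF K]] by (simp_all add: \<phi>_1 x(2))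
qed

lemma RS_monoid: "monoid (R \<times>\<times> S)"
proof -
  have "ring S" unfolding S_def by (rule ring_from_type_algebra)
  then show ?thesis using DirProd_monoid[OF R_monoid ring.is_monoid] by blast
qed

lemma F_ring: "ring F"
  unfolding F_def by (rule monoid_ring_is_ring[OF RS_monoid])

lemma F_simps [simp]:
  "c \<in> carrier F \<longleftrightarrow> Poly_Mapping.keys c \<subseteq> carrier R \<times> UNIV"
  "c \<oplus>\<^bsub>F\<^esub> d = c + d" "\<zero>\<^bsub>F\<^esub> = 0"
  by (simp_all add: F_def)

lemma relators_carrier: "tensor_relators R S \<subseteq> carrier F"
proof -
  have c: "a \<oplus>\<^bsub>R\<^esub> b \<in> carrier R" if "a \<in> carrier R" "b \<in> carrier R" for a b
    using that by (elim carrierE) (simp add: \<phi>_add[symmetric] \<phi>_carrier subring_vecD[OF K])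
  have d: "x - y \<in> carrier F" if "x \<in> carrier F" "y \<in> carrier F" for x y
    using that keys_diff_subset by (simp only: F_simps(1))
  have f: "frag_of (a, r) \<in> carrier F" if "a \<in> carrier R" for a r
    using that by (simp add: keys_frag_of)
  show ?thesis
    unfolding tensor_relators_def
    by (auto simp del: F_simps(1) intro!: d f c)
qed

lemma I_ideal: "ideal I F"
  unfolding I_def by (rule ring.genideal_ideal[OF F_ring relators_carrier])

lemma I_relators: "tensor_relators R S \<subseteq> I"
  unfolding I_def by (rule ring.genideal_self[OF F_ring relators_carrier])

lemma I_0: "0 \<in> I"
  using additive_subgroup.zero_closed[OF ideal.axioms(1)[OF I_ideal]] by simp

lemma I_add: "c \<in> I \<Longrightarrow> d \<in> I \<Longrightarrow> c + d \<in> I"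
  using additive_subgroup.a_closed[OF ideal.axioms(1)[OF I_ideal]] by fastforce

lemma I_carrier: "c \<in> I \<Longrightarrow> c \<in> carrier F"
  using additive_subgroup.a_subset[OF ideal.axioms(1)[OF I_ideal]] by blast

lemma F_minus: "c \<in> carrier F \<Longrightarrow> \<ominus>\<^bsub>F\<^esub> c = - c"
  using abelian_group.minus_equality[OF ring.is_abelian_group[OF F_ring], of "- c" c] by simp

lemma I_minus: "c \<in> I \<Longrightarrow> - c \<in> I"
  using additive_subgroup.a_inv_closed[OF ideal.axioms(1)[OF I_ideal], of c] F_minus[OF I_carrier, of c]
    ring.is_abelian_group[OF F_ring] by simp

lemma I_diff: "c \<in> I \<Longrightarrow> d \<in> I \<Longrightarrow> c - d \<in> I"
  using I_add[OF _ I_minus, of c d] by simp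

lemma I_trans: "c - d \<in> I \<Longrightarrow> d - e \<in> I \<Longrightarrow> c - e \<in> I"
  using I_add[of "c - d" "d - e"] by simp

lemma I_sum: "(\<And>i. i \<in> A \<Longrightarrow> f i \<in> I) \<Longrightarrow> (\<Sum>i\<in>A. f i) \<in> I"
  by (induction A rule: infinite_finite_induct) (auto simp: I_0 I_add)

definition T :: "complex ^ 'g \<Rightarrow> 'b \<Rightarrow> ('a \<times> 'b) \<Rightarrow>\<^sub>0 int" where
  "T x r = frag_of (\<phi> x, r)"

lemma T_add_left: "x \<in> K \<Longrightarrow> y \<in> K \<Longrightarrow> T (x + y) r - (T x r + T y r) \<in> I"
proof -
  assume xy: "x \<in> K" "y \<in> K"
  have "frag_of (\<phi> x \<oplus>\<^bsub>R\<^esub> \<phi> y, r) - frag_of (\<phi> x, r) - frag_of (\<phi> y, r) \<in> tensor_relators R S"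
    unfolding tensor_relators_def using \<phi>_carrier[OF xy(1)] \<phi>_carrier[OF xy(2)] by force
  then show ?thesis using I_relators by (auto simp: T_def \<phi>_add xy diff_diff_eq)
qed

lemma T_add_right: "x \<in> K \<Longrightarrow> T x (r + s) - (T x r + T x s) \<in> I"
proof -
  assume x: "x \<in> K"
  have "frag_of (\<phi> x, r \<oplus>\<^bsub>S\<^esub> s) - frag_of (\<phi> x, r) - frag_of (\<phi> x, s) \<in> tensor_relators R S"
    unfolding tensor_relators_def using \<phi>_carrier[OF x] by (intro UnI2) (use S_simps(1) in blast)
  then show ?thesis using I_relators by (auto simp: T_def diff_diff_eq)
qed

lemma I_int_multiple:
  assumes "\<forall>m n. f (m + n) - (f m + f n) \<in> I"
  shows "f m - frag_cmul m (f 1) \<in> I"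
proof -
  have 0: "f 0 \<in> I" using assms[rule_format, of 0 0] I_minus[of "f 0 - (f 0 + f 0)"] by simp
  show ?thesis
  proof (induction m rule: int_induct[where k = 0])
    case (step1 i)
    have "(f (i + 1) - (f i + f 1)) + (f i - frag_cmul i (f 1)) \<in> I"
      using I_add[OF assms[rule_format] step1(2)] .
    then show ?case by (simp add: frag_cmul_distrib algebra_simps)
  next
    case (step2 i)
    have "(f i - frag_cmul i (f 1)) - (f ((i - 1) + 1) - (f (i - 1) + f 1)) \<in> I"
      using I_diff[OF step2(2) assms[rule_format]] .
    then show ?case by (simp add: frag_cmul_diff_distrib algebra_simps)
  qed (use 0 in simp)
qed

lemma T_int_left: "x \<in> K \<Longrightarrow> T (of_int m *\<^sub>R x) r - frag_cmul m (T x r) \<in> I"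
proof -
  assume x: "x \<in> K"
  have "T (of_int (m + n) *\<^sub>R x) r - (T (of_int m *\<^sub>R x) r + T (of_int n *\<^sub>R x) r) \<in> I" for m n
    using T_add_left[OF subring_vec_of_int[OF K x] subring_vec_of_int[OF K x], of m n r]
    by (simp add: scaleR_left_distrib)
  then show ?thesis using I_int_multiple[of "\<lambda>m. T (of_int m *\<^sub>R x) r" m] by simp
qed

lemma T_int_right: "x \<in> K \<Longrightarrow> T x (of_int m * r) - frag_cmul m (T x r) \<in> I"
proof -
  assume x: "x \<in> K"
  have "T x (of_int (m + n) * r) - (T x (of_int m * r) + T x (of_int n * r)) \<in> I" for m n
    using T_add_right[OF x, of "of_int m * r" "of_int n * r"] by (simp add: distrib_right)
  then show ?thesis using I_int_multiple[of "\<lambda>m. T x (of_int m * r)" m] by simp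
qed

lemma T_move: "x \<in> K \<Longrightarrow> T (of_int m *\<^sub>R x) r - T x (of_int m * r) \<in> I"
  using I_diff[OF T_int_left[of x m r] T_int_right[of x m r]] by simp

lemma T_0: "T 0 r \<in> I"
  using T_int_left[OF subring_vecD(1)[OF K], of 0 r] by simp

lemma T_sum_left:
  assumes "finite A" "\<And>i. i \<in> A \<Longrightarrow> x i \<in> K"
  shows "T (\<Sum>i\<in>A. x i) r - (\<Sum>i\<in>A. T (x i) r) \<in> I"
  using assms
proof (induction A rule: finite_induct)
  case (insert a A)
  have 1: "T (x a + (\<Sum>i\<in>A. x i)) r - (T (x a) r + T (\<Sum>i\<in>A. x i) r) \<in> I"
    using insert.prems by (intro T_add_left subring_vec_sum[OF K]) auto
  from I_add[OF this insert.IH] show ?case using insert by (simp add: algebra_simps)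
qed (simp add: T_0)

lemma T_carrier: "x \<in> K \<Longrightarrow> T x r \<in> carrier F"
  by (simp add: T_def keys_frag_of \<phi>_carrier)

lemma H_superset:
  assumes "finite A" "Poly_Mapping.keys c \<subseteq> A"
  shows "H c = (\<Sum>p\<in>A. of_int (poly_mapping.lookup c p) *\<^sub>R h p)"
  unfolding H_def by (rule sum.mono_neutral_left) (use assms in \<open>auto simp: in_keys_iff\<close>)

lemma H_add: "H (c + d) = H c + H d"
proof -
  let ?A = "Poly_Mapping.keys c \<union> Poly_Mapping.keys d"
  have "Poly_Mapping.keys (c + d) \<subseteq> ?A" by (rule Poly_Mapping.keys_add)
  then have "H (c + d) = (\<Sum>p\<in>?A. of_int (poly_mapping.lookup (c + d) p) *\<^sub>R h p)" by (intro H_superset) auto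
  also have "\<dots> = (\<Sum>p\<in>?A. of_int (poly_mapping.lookup c p) *\<^sub>R h p) + (\<Sum>p\<in>?A. of_int (poly_mapping.lookup d p) *\<^sub>R h p)"
    by (simp add: lookup_add scaleR_left_distrib sum.distrib)
  also have "\<dots> = H c + H d" using H_superset[of ?A c] H_superset[of ?A d] by simp
  finally show ?thesis .
qed

lemma H_0 [simp]: "H 0 = 0" by (simp add: H_def)

lemma H_diff: "H (c - d) = H c - H d"
  using H_add[of "c - d" d] by (simp add: algebra_simps)

lemma H_sum: "H (\<Sum>i\<in>A. f i) = (\<Sum>i\<in>A. H (f i))"
  by (induction A rule: infinite_finite_induct) (auto simp: H_add)

lemma H_frag_of: "H (frag_of p) = h p"
  by (simp add: H_def keys_frag_of)

lemma H_T: "x \<in> K \<Longrightarrow> H (T x r) = emb r *\<^sub>R x"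
  by (simp add: T_def H_frag_of h_def)

lemma F_induct [consumes 1, case_names zero T diff]:
  assumes "c \<in> carrier F" "P 0" "\<And>x r. x \<in> K \<Longrightarrow> P (T x r)" "\<And>a b. P a \<Longrightarrow> P b \<Longrightarrow> P (a - b)"
  shows "P c"
proof -
  have "Poly_Mapping.keys c \<subseteq> carrier R \<times> UNIV" using assms(1) by simp
  then show ?thesis
  proof (induction c rule: frag_induction)
    case (one p)
    then obtain x where "x \<in> K" "fst p = \<phi> x" by (auto elim: carrierE)
    then have "p = (\<phi> x, snd p)" by (simp add: prod_eq_iff)
    then show ?case using assms(3)[OF \<open>x \<in> K\<close>, of "snd p"] by (simp only: T_def)
  qed (use assms in auto)
qed

lemma T_mult: "x \<in> K \<Longrightarrow> y \<in> K \<Longrightarrow> T x r \<otimes>\<^bsub>F\<^esub> T y s = T (x * y) (r * s)"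
  by (simp add: T_def F_def \<phi>_mult)

lemma H_mult:
  assumes c: "c \<in> carrier F" and d: "d \<in> carrier F"
  shows "H (c \<otimes>\<^bsub>F\<^esub> d) = H c * H d"
  using c
proof (induction c rule: F_induct)
  case (T x r)
  note x = T
  show ?case using d
  proof (induction d rule: F_induct)
    case (T y s)
    then show ?case using x by (simp add: T_mult H_T subring_vecD[OF K] emb_mult)
  qed (simp_all add: F_def monoid_ring_mult_diff H_diff right_diff_distrib)
qed (simp_all add: F_def monoid_ring_mult_diff H_diff left_diff_distrib)

lemma one_F: "\<one>\<^bsub>F\<^esub> = T 1 1"
  by (simp add: F_def T_def \<phi>_1)

lemma image_subring: "subring_vec (H ` carrier F)"
  unfolding subring_vec_def
proof (intro conjI ballI)
  have "T 1 1 \<in> carrier F" by (rule T_carrier[OF subring_vecD(1)[OF K]])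
  then show "1 \<in> H ` carrier F" using H_T[OF subring_vecD(1)[OF K], of 1] by (metis emb_1 image_eqI scaleR_one)
  fix x y assume "x \<in> H ` carrier F" "y \<in> H ` carrier F"
  then obtain c d where cd: "c \<in> carrier F" "d \<in> carrier F" "x = H c" "y = H d" by blast
  have "c - d \<in> carrier F" using cd by (simp add: keys_diff_subset)
  then show "x - y \<in> H ` carrier F" using cd by (auto simp: H_diff[symmetric] simp del: F_simps)
  have "c \<otimes>\<^bsub>F\<^esub> d \<in> carrier F" using monoid.m_closed[OF ring.is_monoid[OF F_ring]] cd by blast
  then show "x * y \<in> H ` carrier F" using cd by (auto simp: H_mult[symmetric] simp del: F_simps)
qed

lemma H_hom: "ring_hom_ring F (vec_ring (H ` carrier F)) H"
proof -
  have "H \<in> ring_hom F (vec_ring (H ` carrier F))"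
    by (rule ring_hom_memI) (simp_all add: H_mult H_add one_F H_T subring_vecD(1)[OF K] emb_1 del: F_simps(1))
  then show ?thesis
    by (rule ring_hom_ringI2[OF F_ring cring.axioms(1)[OF vec_ring_cring[OF image_subring]]])
qed

lemma H_I:
  assumes "c \<in> I"
  shows "H c = 0"
proof -
  interpret ring_hom_ring F "vec_ring (H ` carrier F)" H by (rule H_hom)
  have "tensor_relators R S \<subseteq> a_kernel F (vec_ring (H ` carrier F)) H"
  proof
    fix c assume c: "c \<in> tensor_relators R S"
    have "H c = 0"
      using c unfolding tensor_relators_def
    proof (elim UnE CollectE exE conjE)
      fix a a' r assume ca: "c = frag_of (a \<oplus>\<^bsub>R\<^esub> a', r) - frag_of (a, r) - frag_of (a', r)" "a \<in> carrier R" "a' \<in> carrier R"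
      obtain x y where xy: "x \<in> K" "y \<in> K" "a = \<phi> x" "a' = \<phi> y" using ca(2,3) by (elim carrierE)
      have "c = T (x + y) r - T x r - T y r" using ca xy by (simp add: T_def \<phi>_add)
      then show ?thesis using xy by (simp add: H_diff H_T subring_vecD[OF K] scaleR_right_distrib)
    next
      fix a r s assume ca: "c = frag_of (a, r \<oplus>\<^bsub>S\<^esub> s) - frag_of (a, r) - frag_of (a, s)" "a \<in> carrier R"
      obtain x where x: "x \<in> K" "a = \<phi> x" using ca(2) by (elim carrierE)
      have "c = T x (r + s) - T x r - T x s" using ca x by (simp add: T_def)
      then show ?thesis using x by (simp add: H_diff H_T emb_add scaleR_left_distrib)
    qed
    then show "c \<in> a_kernel F (vec_ring (H ` carrier F)) H"
      using c relators_carrier unfolding a_kernel_def' by (auto simp del: F_simps(1))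
  qed
  then have "I \<subseteq> a_kernel F (vec_ring (H ` carrier F)) H"
    unfolding I_def by (rule ring.genideal_minimal[OF F_ring kernel_is_ideal])
  then show ?thesis using assms unfolding a_kernel_def' by auto
qed

theorem tensor_is_ring: "ring (tensor_ring R (ring_of_type_algebra :: 'b ring))"
  using ideal.quotient_is_ring[OF I_ideal] by (simp add: tensor_ring_def Let_def F_def I_def S_def)

theorem tensor_iso:
  assumes kernel: "\<And>c. c \<in> carrier F \<Longrightarrow> H c = 0 \<Longrightarrow> c \<in> I"
  shows "tensor_ring R (ring_of_type_algebra :: 'b ring) \<simeq> vec_ring (H ` carrier F)"
proof -
  interpret ring_hom_ring F "vec_ring (H ` carrier F)" H by (rule H_hom)
  have "a_kernel F (vec_ring (H ` carrier F)) H = I"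
    unfolding a_kernel_def' using kernel H_I I_carrier by (auto simp del: F_simps(1))
  then have "F Quot I \<simeq> vec_ring (H ` carrier F)" using FactRing_iso by simp
  then show ?thesis by (simp add: tensor_ring_def Let_def F_def I_def S_def)
qed

end

context diag_lattice
begin

lemma KF_subring: "subring_vec KF"
  using KF_1 KF_diff KF_times by (simp add: subring_vec_def)

lemma KO_subring: "subring_vec KO"
  using KO_1 KO_diff KO_times by (simp add: subring_vec_def)

theorem tensor_rat:
  assumes \<phi>: "\<phi> \<in> ring_iso (vec_ring KO) R"
  shows "ring (tensor_ring R rat_ring)" "tensor_ring R rat_ring \<simeq> vec_ring KF"
proof -
  interpret t: scalar_tensor KO \<phi> R "of_rat :: rat \<Rightarrow> real"
    by unfold_locales (simp_all add: \<phi> KO_subring of_rat_add of_rat_mult)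
  show "ring (tensor_ring R rat_ring)" by (rule t.tensor_is_ring)
  have KOi: "of_int m *\<^sub>R x \<in> KO" if "x \<in> KO" for m x by (rule subring_vec_of_int[OF KO_subring that])
  \<comment> \<open>Common denominators turn every tensor into a single
    \<open>x \<otimes> (1 / n)\<close>, which evaluates to 0 only if \<open>x\<close> is 0.\<close>
  have normal: "\<exists>x n. x \<in> KO \<and> n > 0 \<and> c - t.T x (1 / of_int n) \<in> t.I" if "c \<in> carrier t.F" for c
    using that
  proof (induction c rule: t.F_induct)
    case zero
    have "0 - t.T 0 (1 / of_int 1) \<in> t.I" using t.I_minus[OF t.T_0] by simp
    then show ?case using KO_0 zero_less_one by blast
  next
    case (T x r)
    obtain m n where mn: "r = of_int m / of_int n" "n > 0"
      using quotient_of_div[of r] quotient_of_denom_pos by (metis surj_pair)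
    have "t.T x r - t.T (of_int m *\<^sub>R x) (1 / of_int n) \<in> t.I"
      using t.I_minus[OF t.T_move[OF T, of m "1 / of_int n"]] by (simp add: mn(1))
    then show ?case using KOi[OF T] mn(2) by blast
  next
    case (diff c d)
    obtain x n where x: "x \<in> KO" "n > 0" "c - t.T x (1 / of_int n) \<in> t.I" using diff(1) by blast
    obtain y k where y: "y \<in> KO" "k > 0" "d - t.T y (1 / of_int k) \<in> t.I" using diff(2) by blast
    define r where "r = (1 / of_int (n * k) :: rat)"
    have 1: "t.T (of_int k *\<^sub>R x) r - t.T x (1 / of_int n) \<in> t.I"
      using t.T_move[OF x(1), of k r] x(2) y(2) by (simp add: r_def)
    have 2: "t.T (of_int n *\<^sub>R y) r - t.T y (1 / of_int k) \<in> t.I"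
      using t.T_move[OF y(1), of n r] x(2) y(2) by (simp add: r_def)
    let ?z = "of_int k *\<^sub>R x - of_int n *\<^sub>R y"
    have z: "?z \<in> KO" by (rule KO_diff[OF KOi[OF x(1)] KOi[OF y(1)]])
    have 3: "t.T (?z + of_int n *\<^sub>R y) r - (t.T ?z r + t.T (of_int n *\<^sub>R y) r) \<in> t.I"
      by (rule t.T_add_left[OF z KOi[OF y(1)]])
    have "(c - t.T x (1 / of_int n)) - (t.T (of_int k *\<^sub>R x) r - t.T x (1 / of_int n)) \<in> t.I" (is "?a \<in> _")
      by (rule t.I_diff[OF x(3) 1])
    moreover have "(d - t.T y (1 / of_int k)) - (t.T (of_int n *\<^sub>R y) r - t.T y (1 / of_int k)) \<in> t.I" (is "?b \<in> _")
      by (rule t.I_diff[OF y(3) 2])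
    ultimately have "?a - ?b + (t.T (?z + of_int n *\<^sub>R y) r - (t.T ?z r + t.T (of_int n *\<^sub>R y) r)) \<in> t.I"
      by (rule t.I_add[OF t.I_diff 3])
    then have "c - d - t.T ?z r \<in> t.I" by (simp add: algebra_simps)
    then have "c - d - t.T ?z (1 / of_int (n * k)) \<in> t.I" by (simp only: r_def)
    moreover have "n * k > 0" using x(2) y(2) by simp
    ultimately show ?case using z by blast
  qed
  have kernel: "c \<in> t.I" if c: "c \<in> carrier t.F" "t.H c = 0" for c
  proof -
    obtain x n where x: "x \<in> KO" "n > 0" "c - t.T x (1 / of_int n) \<in> t.I" using normal[OF c(1)] by blast
    have "t.H (c - t.T x (1 / of_int n)) = 0" by (rule t.H_I[OF x(3)])
    then have "(of_rat (1 / of_int n) :: real) *\<^sub>R x = 0" using c(2) by (simp add: t.H_diff t.H_T[OF x(1)])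
    then have "x = 0" using x(2) by simp
    then have "c - t.T x (1 / of_int n) + t.T x (1 / of_int n) \<in> t.I" using t.T_0 by (intro t.I_add[OF x(3)]) simp
    then show ?thesis by simp
  qed
  have "t.H ` carrier t.F = KF"
  proof
    show "t.H ` carrier t.F \<subseteq> KF"
    proof clarify
      fix c assume "c \<in> carrier t.F"
      then show "t.H c \<in> KF"
        by (induction c rule: t.F_induct) (simp_all add: KF_0 t.H_T KF_scale KO_KF t.H_diff KF_diff)
    qed
    show "KF \<subseteq> t.H ` carrier t.F"
    proof
      fix y assume "y \<in> KF"
      then obtain n :: nat where n: "n > 0" "of_nat n *\<^sub>R y \<in> KO" using KF_denominator by blast
      have "t.H (t.T (of_nat n *\<^sub>R y) (1 / of_nat n)) = y"
        using n(1) by (simp add: t.H_T[OF n(2)] of_rat_divide)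
      then show "y \<in> t.H ` carrier t.F" using t.T_carrier[OF n(2)] by (metis image_eqI)
    qed
  qed
  then show "tensor_ring R rat_ring \<simeq> vec_ring KF" using t.tensor_iso[OF kernel] by simp
qed

text \<open>Multiplication by a lattice vector moves the family into \<open>LatQ\<close>, where
  independence over \<rat> implies independence over \<real>. This is why
  \<open>KF \<otimes> \<real>\<close> is the real span of \<open>KF\<close>.\<close>

lemma ratindependent_KF:
  assumes C: "C \<subseteq> KF" "ratV.independent C"
  shows "independent C"
proof -
  obtain k :: "'g + 'g" where True by blast
  let ?m = "\<lambda>x. x * b k"
  have finC: "finite C" using independent_KF_card[OF C] by blast
  have inj: "inj_on ?m C"
  proof (rule inj_onI)
    fix x y assume "x \<in> C" "y \<in> C" "x * b k = y * b k"
    then have "(x - y) * b k = 0" "x - y \<in> KF" using C(1) KF_diff by (auto simp: left_diff_distrib)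
    then show "x = y" using KF_times_eq_0 b_nonzero by fastforce
  qed
  have "ratV.independent (?m ` C)"
  proof (rule ratV.independent_if_scalars_zero)
    show "finite (?m ` C)" using finC by simp
    fix f x assume s: "(\<Sum>x\<in>?m ` C. of_rat (f x) *\<^sub>R x) = 0" and "x \<in> ?m ` C"
    then obtain y where y: "y \<in> C" "x = ?m y" by blast
    have "(\<Sum>x\<in>C. of_rat (f (?m x)) *\<^sub>R x) * b k = 0"
      using s by (simp add: sum.reindex[OF inj] sum_distrib_right)
    moreover have "(\<Sum>x\<in>C. of_rat (f (?m x)) *\<^sub>R x) \<in> KF" using C(1) by (intro KF_sum KF_scale) auto
    ultimately have "(\<Sum>x\<in>C. of_rat (f (?m x)) *\<^sub>R x) = 0" using KF_times_eq_0 b_nonzero by blast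
    then show "f x = 0" using ratV.independentD[OF C(2) finC order_refl, of "\<lambda>x. f (?m x)" y] y by blast
  qed
  moreover have "?m ` C \<subseteq> LatQ" using C(1) b_LatQ by (auto simp: KF_def)
  ultimately have ind: "independent (?m ` C)" by (intro LatQ_independent)
  show ?thesis
  proof (rule independent_if_scalars_zero[OF finC])
    fix f x assume s: "(\<Sum>x\<in>C. f x *\<^sub>R x) = 0" and x: "x \<in> C"
    have "(\<Sum>x\<in>C. f x *\<^sub>R (?m x)) = (\<Sum>x\<in>C. f x *\<^sub>R x) * b k" by (simp add: sum_distrib_right)
    then have "(\<Sum>x\<in>C. f (inv_into C ?m (?m x)) *\<^sub>R ?m x) = 0" using s by (simp add: inv_into_f_f[OF inj])
    then have "(\<Sum>y\<in>?m ` C. f (inv_into C ?m y) *\<^sub>R y) = 0" by (simp add: sum.reindex[OF inj])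
    then have "f (inv_into C ?m (?m x)) = 0"
      using independentD[OF ind _ order_refl, of "\<lambda>y. f (inv_into C ?m y)" "?m x"] finC x by blast
    then show "f x = 0" by (simp add: inv_into_f_f[OF inj x])
  qed
qed

theorem tensor_real:
  assumes \<phi>: "\<phi> \<in> ring_iso (vec_ring KF) R"
  shows "ring (tensor_ring R real_ring)" "tensor_ring R real_ring \<simeq> vec_ring (span KF)"
proof -
  interpret t: scalar_tensor KF \<phi> R "\<lambda>r :: real. r"
    by unfold_locales (simp_all add: \<phi> KF_subring)
  show "ring (tensor_ring R real_ring)" by (rule t.tensor_is_ring)
  obtain C where C: "C \<subseteq> KF" "ratV.independent C" "KF \<subseteq> ratV.span C" "finite C"
    by (rule subfld_basis[OF order_refl]) (rule that)
  have ind: "independent C" by (rule ratindependent_KF[OF C(1,2)])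
  have move: "t.T (of_rat q *\<^sub>R x) s - t.T x (of_rat q * s) \<in> t.I" if x: "x \<in> KF" for q x s
  proof -
    obtain m n where mn: "q = of_int m / of_int n" "n > 0"
      using quotient_of_div[of q] quotient_of_denom_pos by (metis surj_pair)
    define y where "y = of_rat (1 / of_int n) *\<^sub>R x"
    have y: "y \<in> KF" unfolding y_def by (rule KF_scale[OF x])
    have 1: "of_int m *\<^sub>R y = of_rat q *\<^sub>R x" "of_int n *\<^sub>R y = x"
      using mn(2) by (simp_all add: y_def mn(1) of_rat_divide)
    have 2: "of_int n * (of_rat q * s) = of_int m * s" using mn(2) by (simp add: mn(1) of_rat_divide)
    show ?thesis using t.I_diff[OF t.T_move[OF y, of m s] t.T_move[OF y, of n "of_rat q * s"]]
      unfolding 1 2 by simp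
  qed
  \<comment> \<open>Expanding in a rational basis \<open>C\<close> of \<open>KF\<close> and moving
    the rational coefficients to the right-hand factor by \<open>move\<close>, every tensor becomes
    a sum of \<open>e \<otimes> r e\<close> over \<open>C\<close>.\<close>
  have normal: "\<exists>r. c - (\<Sum>e\<in>C. t.T e (r e)) \<in> t.I" if "c \<in> carrier t.F" for c
    using that
  proof (induction c rule: t.F_induct)
    case zero
    have "t.T e 0 \<in> t.I" if "e \<in> C" for e using t.T_int_right[of e 0 0] C(1) that by auto
    then have "0 - (\<Sum>e\<in>C. t.T e 0) \<in> t.I" by (intro t.I_diff t.I_0 t.I_sum)
    then show ?case by (rule exI[of _ "\<lambda>e. 0"])
  next
    case (T x s)
    obtain q where q: "x = (\<Sum>e\<in>C. of_rat (q e) *\<^sub>R e)"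
      using ratspan_range[OF C(4), of x "\<lambda>e. e"] C(3) T by auto
    have "t.T x s - (\<Sum>e\<in>C. t.T (of_rat (q e) *\<^sub>R e) s) \<in> t.I"
      unfolding q using C(1) KF_scale by (intro t.T_sum_left[OF C(4)]) auto
    moreover have "(\<Sum>e\<in>C. t.T (of_rat (q e) *\<^sub>R e) s - t.T e (of_rat (q e) * s)) \<in> t.I"
      using C(1) by (intro t.I_sum move) auto
    ultimately have "t.T x s - (\<Sum>e\<in>C. t.T e (of_rat (q e) * s)) \<in> t.I"
      unfolding sum_subtractf by (rule t.I_trans)
    then show ?case by (rule exI[of _ "\<lambda>e. of_rat (q e) * s"])
  next
    case (diff c d)
    obtain r where r: "c - (\<Sum>e\<in>C. t.T e (r e)) \<in> t.I" using diff(1) by blast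
    obtain s where s: "d - (\<Sum>e\<in>C. t.T e (s e)) \<in> t.I" using diff(2) by blast
    have "t.T e (r e - s e + s e) - (t.T e (r e - s e) + t.T e (s e)) \<in> t.I" if "e \<in> C" for e
      using C(1) that by (intro t.T_add_right) auto
    then have "(\<Sum>e\<in>C. t.T e (r e - s e + s e) - (t.T e (r e - s e) + t.T e (s e))) \<in> t.I" by (intro t.I_sum)
    from t.I_add[OF t.I_diff[OF r s] this]
    have "c - d - (\<Sum>e\<in>C. t.T e (r e - s e)) \<in> t.I" by (simp add: sum_subtractf sum.distrib algebra_simps)
    then show ?case by (rule exI[of _ "\<lambda>e. r e - s e"])
  qed
  have HC: "t.H (\<Sum>e\<in>C. t.T e (r e)) = (\<Sum>e\<in>C. r e *\<^sub>R e)" for r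
    using C(1) by (auto simp: t.H_sum t.H_T intro!: sum.cong)
  have kernel: "c \<in> t.I" if c: "c \<in> carrier t.F" "t.H c = 0" for c
  proof -
    obtain r where r: "c - (\<Sum>e\<in>C. t.T e (r e)) \<in> t.I" using normal[OF c(1)] by blast
    have "t.H (c - (\<Sum>e\<in>C. t.T e (r e))) = 0" by (rule t.H_I[OF r])
    then have "(\<Sum>e\<in>C. r e *\<^sub>R e) = 0" by (simp add: t.H_diff c(2) HC)
    then have r0: "r e = 0" if "e \<in> C" for e
      using independentD[OF ind C(4) order_refl, of r e] that by blast
    have "t.T e (r e) \<in> t.I" if "e \<in> C" for e using t.T_int_right[of e 0 0] C(1) that r0[OF that] by auto
    then have "c - (\<Sum>e\<in>C. t.T e (r e)) + (\<Sum>e\<in>C. t.T e (r e)) \<in> t.I" by (intro t.I_add[OF r] t.I_sum)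
    then show ?thesis by simp
  qed
  have "t.H ` carrier t.F = span KF"
  proof
    show "t.H ` carrier t.F \<subseteq> span KF"
    proof clarify
      fix c assume "c \<in> carrier t.F"
      then show "t.H c \<in> span KF"
        by (induction c rule: t.F_induct) (simp_all add: span_0 t.H_T span_scale span_base t.H_diff span_diff)
    qed
    show "span KF \<subseteq> t.H ` carrier t.F"
    proof
      fix z assume z: "z \<in> span KF"
      have "KF \<subseteq> span C"
      proof
        fix x assume "x \<in> KF"
        then obtain q where "x = (\<Sum>e\<in>C. of_rat (q e) *\<^sub>R e)"
          using ratspan_range[OF C(4), of x "\<lambda>e. e"] C(3) by auto
        then show "x \<in> span C" by (simp add: span_sum span_scale span_base)
      qed
      then have "z \<in> span C" using z span_minimal[OF _ subspace_span] by blast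
      then obtain r where r: "z = (\<Sum>e\<in>C. r e *\<^sub>R e)" using span_finite[OF C(4)] by auto
      have "(\<Sum>e\<in>A. t.T e (r e)) \<in> carrier t.F" if "finite A" "A \<subseteq> C" for A
        using that
      proof (induction A rule: finite_induct)
        case (insert a A)
        have "t.T a (r a) \<in> carrier t.F" using insert C(1) by (intro t.T_carrier) auto
        then show ?case using insert by (simp add: keys_add_subset)
      qed simp
      then have "(\<Sum>e\<in>C. t.T e (r e)) \<in> carrier t.F" using C(4) by blast
      moreover have "z = t.H (\<Sum>e\<in>C. t.T e (r e))" by (simp only: HC r)
      ultimately show "z \<in> t.H ` carrier t.F" by (rule rev_image_eqI)
    qed
  qed
  then show "tensor_ring R real_ring \<simeq> vec_ring (span KF)" using t.tensor_iso[OF kernel] by simp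
qed

end

section \<open>The signature of a number field\<close>

text \<open>Arbitrary factors instead of \<real> and \<complex> make induction on the list of
  factors possible.\<close>

definition complex_subset_product :: "complex set list \<Rightarrow> complex list ring" where
  "complex_subset_product As = RDirProd_list (map (\<lambda>A. complex_ring\<lparr>carrier := A\<rparr>) As)"

lemma real_complex_product_eq:
  "real_complex_product r s = complex_subset_product (replicate r \<real> @ replicate s UNIV)"
proof -
  have "complex_ring\<lparr>carrier := UNIV\<rparr> = complex_ring" by (simp add: ring_of_type_algebra_def)
  then show ?thesis by (simp add: real_complex_product_def complex_subset_product_def)
qed

lemma carrier_complex_subset_product: "carrier (complex_subset_product As) = listset As"
proof (induction As)
  case (Cons A As)
  then show ?case by (auto simp: complex_subset_product_def RDirProd_list_carrier set_Cons_def)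
qed (simp add: complex_subset_product_def RDirProd_list_def monoid.defs)

lemma mem_listset: "xs \<in> listset As \<longleftrightarrow> length xs = length As \<and> (\<forall>i<length As. xs ! i \<in> As ! i)"
proof (induction As arbitrary: xs)
  case (Cons A As)
  show ?case by (cases xs) (auto simp: set_Cons_def Cons less_Suc_eq_0_disj)
qed simp

lemma complex_subset_product_ops:
  assumes "xs \<in> listset As" "ys \<in> listset As"
  shows "xs \<otimes>\<^bsub>complex_subset_product As\<^esub> ys = map2 (*) xs ys"
    and "xs \<oplus>\<^bsub>complex_subset_product As\<^esub> ys = map2 (+) xs ys"
proof -
  have "xs \<otimes>\<^bsub>complex_subset_product As\<^esub> ys = map2 (*) xs ys \<and> xs \<oplus>\<^bsub>complex_subset_product As\<^esub> ys = map2 (+) xs ys"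
    using assms
  proof (induction As arbitrary: xs ys)
    case Nil
    then show ?case by (simp add: complex_subset_product_def RDirProd_list_def monoid.defs)
  next
    case (Cons A As)
    obtain x xs' where x: "xs = x # xs'" "x \<in> A" "xs' \<in> listset As" using Cons.prems(1) by (auto simp: set_Cons_def)
    obtain y ys' where y: "ys = y # ys'" "y \<in> A" "ys' \<in> listset As" using Cons.prems(2) by (auto simp: set_Cons_def)
    let ?R = "complex_ring\<lparr>carrier := A\<rparr>" and ?P = "complex_subset_product As"
    have hom: "(\<lambda>(a, as). a # as) \<in> ring_hom (RDirProd ?R ?P) (complex_subset_product (A # As))"
      using RDirProd_list_hom1 by (simp add: complex_subset_product_def)
    have xy: "(x, xs') \<in> carrier (RDirProd ?R ?P)" "(y, ys') \<in> carrier (RDirProd ?R ?P)"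
      using x y by (simp_all add: RDirProd_def DirProd_def monoid.defs carrier_complex_subset_product)
    show ?case
      using ring_hom_memE(2)[OF hom xy] ring_hom_memE(3)[OF hom xy] Cons.IH[OF x(3) y(3)] x(1) y(1)
      by (simp add: RDirProd_def DirProd_def monoid.defs ring_of_type_algebra_def)
  qed
  then show "xs \<otimes>\<^bsub>complex_subset_product As\<^esub> ys = map2 (*) xs ys"
    "xs \<oplus>\<^bsub>complex_subset_product As\<^esub> ys = map2 (+) xs ys" by blast+
qed

lemma complex_subset_product_one: "\<one>\<^bsub>complex_subset_product As\<^esub> = map (\<lambda>A. 1) As"
  unfolding complex_subset_product_def RDirProd_list_one by (induction As) (simp_all add: ring_of_type_algebra_def)

lemma card_listset: "card (listset As) = (\<Prod>A\<leftarrow>As. card A)"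
proof (induction As)
  case (Cons A As)
  have "set_Cons A (listset As) = (\<lambda>(x, xs). x # xs) ` (A \<times> listset As)" by (auto simp: set_Cons_def)
  moreover have "inj_on (\<lambda>(x, xs). x # xs) (A \<times> listset As)" by (auto simp: inj_on_def)
  ultimately show ?case using Cons by (simp add: card_image card_cartesian_product)
qed simp

text \<open>The equations \<open>x\<^sup>3 = x\<close> and \<open>x\<^sup>3 = - x\<close> have \<open>3\<^sup>r\<^sup>+\<^sup>s\<close> and \<open>3\<^sup>s\<close> solutions in \<open>\<real>\<^sup>r \<times> \<complex>\<^sup>s\<close>, which
  determines the signature. The second one is written without the zero of the ring because
  elements of \<^const>\<open>ring_iso\<close> need not preserve that field of the record.\<close>

definition cube_roots :: "('a, 'b) ring_scheme \<Rightarrow> 'a set" where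
  "cube_roots R = {x \<in> carrier R. x \<otimes>\<^bsub>R\<^esub> (x \<otimes>\<^bsub>R\<^esub> x) = x}"

definition neg_cube_roots :: "('a, 'b) ring_scheme \<Rightarrow> 'a set" where
  "neg_cube_roots R = {x \<in> carrier R. x \<otimes>\<^bsub>R\<^esub> (x \<otimes>\<^bsub>R\<^esub> x) \<oplus>\<^bsub>R\<^esub> x \<oplus>\<^bsub>R\<^esub> \<one>\<^bsub>R\<^esub> = \<one>\<^bsub>R\<^esub>}"

lemma image_Collect_restrict:
  assumes "\<And>x. x \<in> A \<Longrightarrow> P x \<longleftrightarrow> Q (h x)"
  shows "h ` {x \<in> A. P x} = {y \<in> h ` A. Q y}"
  using assms by auto

lemma card_cube_roots_iso:
  assumes R: "ring R" and iso: "R \<simeq> S"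
  shows "card (cube_roots R) = card (cube_roots S)" "card (neg_cube_roots R) = card (neg_cube_roots S)"
proof -
  interpret ring R by fact
  obtain h where h: "h \<in> ring_hom R S" "bij_betw h (carrier R) (carrier S)"
    using iso by (auto simp: is_ring_iso_def ring_iso_def)
  have inj: "inj_on h (carrier R)" and im: "h ` carrier R = carrier S" using h(2) by (auto simp: bij_betw_def)
  note hom = ring_hom_memE[OF h(1)]
  have "h ` cube_roots R = cube_roots S"
  proof -
    have "x \<otimes>\<^bsub>R\<^esub> (x \<otimes>\<^bsub>R\<^esub> x) = x \<longleftrightarrow> h x \<otimes>\<^bsub>S\<^esub> (h x \<otimes>\<^bsub>S\<^esub> h x) = h x" if x: "x \<in> carrier R" for x
    proof -
      have "h (x \<otimes>\<^bsub>R\<^esub> (x \<otimes>\<^bsub>R\<^esub> x)) = h x \<otimes>\<^bsub>S\<^esub> (h x \<otimes>\<^bsub>S\<^esub> h x)" using x by (simp add: hom)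
      then show ?thesis using inj_onD[OF inj, of "x \<otimes>\<^bsub>R\<^esub> (x \<otimes>\<^bsub>R\<^esub> x)" x] x by auto
    qed
    then show ?thesis unfolding cube_roots_def im[symmetric] by (rule image_Collect_restrict)
  qed
  moreover have "inj_on h (cube_roots R)" by (rule inj_on_subset[OF inj]) (auto simp: cube_roots_def)
  ultimately show "card (cube_roots R) = card (cube_roots S)" using card_image by fastforce
  have "h ` neg_cube_roots R = neg_cube_roots S"
  proof -
    have "x \<otimes>\<^bsub>R\<^esub> (x \<otimes>\<^bsub>R\<^esub> x) \<oplus>\<^bsub>R\<^esub> x \<oplus>\<^bsub>R\<^esub> \<one>\<^bsub>R\<^esub> = \<one>\<^bsub>R\<^esub> \<longleftrightarrow> h x \<otimes>\<^bsub>S\<^esub> (h x \<otimes>\<^bsub>S\<^esub> h x) \<oplus>\<^bsub>S\<^esub> h x \<oplus>\<^bsub>S\<^esub> \<one>\<^bsub>S\<^esub> = \<one>\<^bsub>S\<^esub>" if x: "x \<in> carrier R" for x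
    proof -
      have "h (x \<otimes>\<^bsub>R\<^esub> (x \<otimes>\<^bsub>R\<^esub> x) \<oplus>\<^bsub>R\<^esub> x \<oplus>\<^bsub>R\<^esub> \<one>\<^bsub>R\<^esub>) = h x \<otimes>\<^bsub>S\<^esub> (h x \<otimes>\<^bsub>S\<^esub> h x) \<oplus>\<^bsub>S\<^esub> h x \<oplus>\<^bsub>S\<^esub> \<one>\<^bsub>S\<^esub>" using x by (simp add: hom)
      then show ?thesis using inj_onD[OF inj, of "x \<otimes>\<^bsub>R\<^esub> (x \<otimes>\<^bsub>R\<^esub> x) \<oplus>\<^bsub>R\<^esub> x \<oplus>\<^bsub>R\<^esub> \<one>\<^bsub>R\<^esub>" "\<one>\<^bsub>R\<^esub>"] x hom(4) by auto
    qed
    then show ?thesis unfolding neg_cube_roots_def im[symmetric] by (rule image_Collect_restrict)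
  qed
  moreover have "inj_on h (neg_cube_roots R)" by (rule inj_on_subset[OF inj]) (auto simp: neg_cube_roots_def)
  ultimately show "card (neg_cube_roots R) = card (neg_cube_roots S)" using card_image by fastforce
qed

lemma mem_listset_real_complex:
  "xs \<in> listset (replicate r \<real> @ replicate s (UNIV :: complex set)) \<longleftrightarrow> length xs = r + s \<and> (\<forall>i<r. xs ! i \<in> \<real>)"
proof -
  let ?As = "replicate r \<real> @ replicate s (UNIV :: complex set)"
  have "?As ! i = (if i < r then \<real> else UNIV)" if "i < r + s" for i using that by (simp add: nth_append)
  then have "(\<forall>i<r + s. xs ! i \<in> ?As ! i) \<longleftrightarrow> (\<forall>i<r + s. xs ! i \<in> (if i < r then \<real> else UNIV))" by simp
  also have "\<dots> \<longleftrightarrow> (\<forall>i<r. xs ! i \<in> \<real>)" by auto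
  finally show ?thesis by (simp only: mem_listset length_append length_replicate)
qed

lemma card_cube_roots_product:
  "card (cube_roots (real_complex_product r s)) = 3 ^ (r + s)"
  "card (neg_cube_roots (real_complex_product r s)) = 3 ^ s"
proof -
  let ?As = "replicate r \<real> @ replicate s (UNIV :: complex set)"
  have C: "c * (c * c) = c \<longleftrightarrow> c \<in> {0, 1, -1}" for c :: complex
  proof -
    have e: "c * (c * c) - c = c * ((c - 1) * (c + 1))" by (simp add: algebra_simps)
    have "c * (c * c) = c \<longleftrightarrow> c * (c * c) - c = 0" by (simp only: right_minus_eq)
    also have "\<dots> \<longleftrightarrow> c * ((c - 1) * (c + 1)) = 0" by (simp only: e)
    also have "\<dots> \<longleftrightarrow> c \<in> {0, 1, -1}" by (simp add: eq_neg_iff_add_eq_0)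
    finally show ?thesis .
  qed
  have N: "c * (c * c) + c + 1 = 1 \<longleftrightarrow> c \<in> {0, \<i>, - \<i>}" for c :: complex
  proof -
    have e: "c * (c * c) + c = c * ((c - \<i>) * (c + \<i>))" by (simp add: algebra_simps)
    have "c * (c * c) + c + 1 = 1 \<longleftrightarrow> c * ((c - \<i>) * (c + \<i>)) = 0" unfolding e by simp
    also have "\<dots> \<longleftrightarrow> c \<in> {0, \<i>, - \<i>}" by (simp add: eq_neg_iff_add_eq_0)
    finally show ?thesis .
  qed
  have closed: "map2 (*) xs ys \<in> listset ?As" "map2 (+) xs ys \<in> listset ?As"
    if "xs \<in> listset ?As" "ys \<in> listset ?As" for xs ys
    using that unfolding mem_listset_real_complex by simp_all
  have one: "map (\<lambda>A. 1) ?As \<in> listset ?As" unfolding mem_listset_real_complex by (simp add: nth_append)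
  let ?P = "complex_subset_product ?As"
  have nth: "xs \<otimes>\<^bsub>?P\<^esub> (xs \<otimes>\<^bsub>?P\<^esub> xs) = xs \<longleftrightarrow> (\<forall>i<length ?As. xs ! i \<in> {0, 1, -1})" (is ?th1)
    "xs \<otimes>\<^bsub>?P\<^esub> (xs \<otimes>\<^bsub>?P\<^esub> xs) \<oplus>\<^bsub>?P\<^esub> xs \<oplus>\<^bsub>?P\<^esub> \<one>\<^bsub>?P\<^esub> = \<one>\<^bsub>?P\<^esub> \<longleftrightarrow> (\<forall>i<length ?As. xs ! i \<in> {0, \<i>, - \<i>})" (is ?th2)
    if xs: "xs \<in> listset ?As" for xs
  proof -
    have len: "length xs = length ?As" using xs by (simp add: mem_listset)
    have cube: "xs \<otimes>\<^bsub>?P\<^esub> (xs \<otimes>\<^bsub>?P\<^esub> xs) = map2 (*) xs (map2 (*) xs xs)"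
      by (simp only: complex_subset_product_ops(1)[OF xs xs] complex_subset_product_ops(1)[OF xs closed(1)[OF xs xs]])
    have "map2 (*) xs (map2 (*) xs xs) = xs \<longleftrightarrow> (\<forall>i<length ?As. xs ! i * (xs ! i * xs ! i) = xs ! i)"
      using len by (simp add: list_eq_iff_nth_eq del: mult_cancel_left1 mult_cancel_left2 mult_cancel_right1 mult_cancel_right2)
    then show ?th1 unfolding cube C .
    have cl: "map2 (*) xs (map2 (*) xs xs) \<in> listset ?As" by (rule closed(1)[OF xs closed(1)[OF xs xs]])
    have "xs \<otimes>\<^bsub>?P\<^esub> (xs \<otimes>\<^bsub>?P\<^esub> xs) \<oplus>\<^bsub>?P\<^esub> xs \<oplus>\<^bsub>?P\<^esub> \<one>\<^bsub>?P\<^esub> =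
        map2 (+) (map2 (+) (map2 (*) xs (map2 (*) xs xs)) xs) (map (\<lambda>A. 1) ?As)"
      unfolding cube complex_subset_product_one complex_subset_product_ops(2)[OF cl xs]
      by (rule complex_subset_product_ops(2)[OF closed(2)[OF cl xs] one])
    moreover have "map2 (+) (map2 (+) (map2 (*) xs (map2 (*) xs xs)) xs) (map (\<lambda>A. 1) ?As) = map (\<lambda>A. 1) ?As
        \<longleftrightarrow> (\<forall>i<length ?As. xs ! i * (xs ! i * xs ! i) + xs ! i + 1 = 1)"
      using len by (simp add: list_eq_iff_nth_eq nth_append)
    ultimately show ?th2 unfolding N complex_subset_product_one by (rule subst[OF sym])
  qed
  have "cube_roots (complex_subset_product ?As) = {xs \<in> listset ?As. \<forall>i<length ?As. xs ! i \<in> {0, 1, -1}}"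
    unfolding cube_roots_def carrier_complex_subset_product using nth(1) by blast
  also have "\<dots> = listset (map (\<lambda>A. A \<inter> {0, 1, -1}) ?As)"
    by (auto simp: mem_listset simp del: insert_iff map_append map_replicate)
  also have "card \<dots> = card ((\<real> :: complex set) \<inter> {0, 1, -1}) ^ r * card {0, 1, -1 :: complex} ^ s"
    by (simp add: card_listset prod_list_replicate)
  also have "(\<real> :: complex set) \<inter> {0, 1, -1} = {0, 1, -1}" by auto
  also have "card {0, 1, -1 :: complex} = 3" by (simp add: card_insert_if)
  finally show "card (cube_roots (real_complex_product r s)) = 3 ^ (r + s)"
    by (simp add: real_complex_product_eq power_add)
  have "neg_cube_roots (complex_subset_product ?As) = {xs \<in> listset ?As. \<forall>i<length ?As. xs ! i \<in> {0, \<i>, - \<i>}}"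
    unfolding neg_cube_roots_def carrier_complex_subset_product using nth(2) by blast
  also have "\<dots> = listset (map (\<lambda>A. A \<inter> {0, \<i>, - \<i>}) ?As)"
    by (auto simp: mem_listset simp del: insert_iff map_append map_replicate)
  also have "card \<dots> = card ((\<real> :: complex set) \<inter> {0, \<i>, - \<i>}) ^ r * card {0, \<i>, - \<i> :: complex} ^ s"
    by (simp add: card_listset prod_list_replicate)
  also have "(\<real> :: complex set) \<inter> {0, \<i>, - \<i>} = {0}" by (auto simp: complex_is_Real_iff)
  also have "card {0, \<i>, - \<i> :: complex} = 3" by (simp add: card_insert_if complex_eq_iff)
  finally show "card (neg_cube_roots (real_complex_product r s)) = 3 ^ s"
    by (simp add: real_complex_product_eq)
qed

lemma field_signature_eq:
  assumes "ring (tensor_ring E real_ring)" "tensor_ring E real_ring \<simeq> real_complex_product r s"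
  shows "field_r E = r" "field_s E = s"
proof -
  have "field_signature E = (r, s)"
    unfolding field_signature_def
  proof (rule the_equality)
    fix p assume p: "tensor_ring E real_ring \<simeq> real_complex_product (fst p) (snd p)"
    have "3 ^ (fst p + snd p) = (3 ^ (r + s) :: nat)" "3 ^ snd p = (3 ^ s :: nat)"
      using card_cube_roots_iso[OF assms(1) p] card_cube_roots_iso[OF assms] by (simp_all add: card_cube_roots_product)
    then have "fst p + snd p = r + s" "snd p = s" by (simp_all add: power_inject_exp)
    then show "p = (r, s)" by (simp add: prod_eq_iff)
  qed (use assms in simp)
  then show "field_r E = r" "field_s E = s" by (simp_all add: field_r_def field_s_def)
qed

text \<open>The isomorphism reads off the entries at the chosen places, those in \<open>Ir\<close>
  first. By \<open>places\<close> these entries determine an element of the real span, and they can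
  be prescribed freely as long as they are real on \<open>Ir\<close>.\<close>

lemma (in diag_lattice) span_KF_iso:
  assumes pl: "places \<rho> Ir \<kappa>"
  shows "vec_ring (span KF) \<simeq> real_complex_product (card Ir) (card (range \<rho> - Ir))"
proof -
  have Ir: "Ir \<subseteq> range \<rho>" by (rule places_real_subset[OF pl])
  obtain lr where lr: "set lr = Ir" "distinct lr" using finite_distinct_list[of Ir] by auto
  obtain lc where lc: "set lc = range \<rho> - Ir" "distinct lc" using finite_distinct_list[of "range \<rho> - Ir"] by auto
  have len: "length lr = card Ir" "length lc = card (range \<rho> - Ir)"
    using distinct_card lr lc by metis+
  let ?As = "replicate (card Ir) \<real> @ replicate (card (range \<rho> - Ir)) (UNIV :: complex set)"
  define l where "l = lr @ lc"
  have l: "set l = range \<rho>" "distinct l" using lr lc Ir by (auto simp: l_def)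
  define \<Psi> where "\<Psi> = (\<lambda>z :: complex ^ 'g. map (vec_nth z) l)"
  have real: "z $ i \<in> \<real>" if "z \<in> span KF" "i \<in> Ir" for z i
  proof -
    have "subspace {z :: complex ^ 'g. z $ i \<in> \<real>}" by (auto simp: subspace_def scaleR_complex)
    moreover have "KF \<subseteq> {z. z $ i \<in> \<real>}" using places_real[OF pl] that(2) by auto
    ultimately show ?thesis using span_minimal that(1) by blast
  qed
  have car: "\<Psi> z \<in> listset ?As" if "z \<in> span KF" for z
  proof -
    have "z $ (lr ! i) \<in> \<real>" if i: "i < card Ir" for i
    proof (rule real[OF \<open>z \<in> span KF\<close>])
      show "lr ! i \<in> Ir" using nth_mem[of i lr] i lr(1) len(1) by simp
    qed
    then show ?thesis unfolding mem_listset_real_complex by (simp add: \<Psi>_def l_def len nth_append)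
  qed
  have hom: "\<Psi> \<in> ring_hom (vec_ring (span KF)) (complex_subset_product ?As)"
  proof (rule ring_hom_memI)
    show "\<Psi> z \<in> carrier (complex_subset_product ?As)" if "z \<in> carrier (vec_ring (span KF))" for z
      using car that by (simp add: carrier_complex_subset_product)
    fix x y assume "x \<in> carrier (vec_ring (span KF))" "y \<in> carrier (vec_ring (span KF))"
    then have xy: "\<Psi> x \<in> listset ?As" "\<Psi> y \<in> listset ?As" using car by simp_all
    show "\<Psi> (x \<otimes>\<^bsub>vec_ring (span KF)\<^esub> y) = \<Psi> x \<otimes>\<^bsub>complex_subset_product ?As\<^esub> \<Psi> y"
      unfolding complex_subset_product_ops[OF xy] by (simp add: \<Psi>_def list_eq_iff_nth_eq)
    show "\<Psi> (x \<oplus>\<^bsub>vec_ring (span KF)\<^esub> y) = \<Psi> x \<oplus>\<^bsub>complex_subset_product ?As\<^esub> \<Psi> y"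
      unfolding complex_subset_product_ops[OF xy] by (simp add: \<Psi>_def list_eq_iff_nth_eq)
  next
    show "\<Psi> \<one>\<^bsub>vec_ring (span KF)\<^esub> = \<one>\<^bsub>complex_subset_product ?As\<^esub>"
      by (intro nth_equalityI) (auto simp: complex_subset_product_one \<Psi>_def l_def len nth_append)
  qed
  have ex: "\<forall>y. (\<forall>i\<in>Ir. y i \<in> \<real>) \<longrightarrow> (\<exists>z\<in>span KF. \<forall>i\<in>range \<rho>. z $ i = y i)"
    and un: "\<forall>z\<in>span KF. (\<forall>i\<in>range \<rho>. z $ i = 0) \<longrightarrow> z = 0"
    using pl[unfolded places_def] by simp_all
  have inj: "inj_on \<Psi> (span KF)"
  proof (rule inj_onI)
    fix x y assume xy: "x \<in> span KF" "y \<in> span KF" "\<Psi> x = \<Psi> y"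
    have "\<forall>i\<in>range \<rho>. (x - y) $ i = 0" using xy(3) l(1) by (simp add: \<Psi>_def)
    then have "x - y = 0" using un span_diff[OF xy(1,2)] by blast
    then show "x = y" by simp
  qed
  have surj: "\<exists>z\<in>span KF. \<Psi> z = ys" if ys: "ys \<in> listset ?As" for ys
  proof -
    have leny: "length ys = length l" using ys unfolding mem_listset_real_complex by (simp add: l_def len)
    define y where "y = (\<lambda>i. the (map_of (zip l ys) i))"
    have y: "y (l ! k) = ys ! k" if "k < length l" for k
      using map_of_zip_nth[OF leny[symmetric] l(2)] that leny by (simp add: y_def)
    have "y i \<in> \<real>" if i: "i \<in> Ir" for i
    proof -
      obtain k where k: "k < length lr" "lr ! k = i" using i lr(1) by (metis in_set_conv_nth)
      have "y i = ys ! k" using y[of k] k by (simp add: l_def nth_append)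
      moreover have "ys ! k \<in> \<real>" using ys k(1) len(1) unfolding mem_listset_real_complex by simp
      ultimately show ?thesis by simp
    qed
    then obtain z where z: "z \<in> span KF" "\<forall>i\<in>range \<rho>. z $ i = y i" using ex by blast
    have "\<Psi> z = ys"
    proof (rule nth_equalityI)
      show "length (\<Psi> z) = length ys" by (simp add: \<Psi>_def leny)
      fix k assume "k < length (\<Psi> z)"
      then have k: "k < length l" by (simp add: \<Psi>_def)
      then have "l ! k \<in> range \<rho>" using l(1) nth_mem by blast
      then have "z $ (l ! k) = ys ! k" using z(2) y[OF k] by metis
      then show "\<Psi> z ! k = ys ! k" using k by (simp add: \<Psi>_def)
    qed
    then show ?thesis using z(1) by blast
  qed
  have "\<Psi> ` span KF = listset ?As" using car surj by blast
  then have "\<Psi> \<in> ring_iso (vec_ring (span KF)) (complex_subset_product ?As)"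
    using hom inj by (simp add: ring_iso_def bij_betw_def carrier_complex_subset_product)
  then show ?thesis unfolding real_complex_product_eq is_ring_iso_def by blast
qed

section \<open>Transfer to number fields\<close>

lemma (in diag_lattice) vec_ring_field:
  assumes S: "subfld S"
  shows "field (vec_ring S)"
proof -
  have sub: "subring_vec S" using subfld_1[OF S] subfld_diff[OF S] subfld_times[OF S] by (simp add: subring_vec_def)
  interpret cring "vec_ring S" by (rule vec_ring_cring[OF sub])
  show ?thesis
  proof (rule cring_fieldI2)
    show "\<zero>\<^bsub>vec_ring S\<^esub> \<noteq> \<one>\<^bsub>vec_ring S\<^esub>" by simp
    fix a assume "a \<in> carrier (vec_ring S)" "a \<noteq> \<zero>\<^bsub>vec_ring S\<^esub>"
    then have a: "a \<in> S" "a \<noteq> 0" by simp_all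
    then show "\<exists>c\<in>carrier (vec_ring S). a \<otimes>\<^bsub>vec_ring S\<^esub> c = \<one>\<^bsub>vec_ring S\<^esub>"
      using subfld_vinv[OF S a] KF_vinv(2)[OF subfld_in_KF[OF S a(1)] a(2)]
      by (intro bexI[of _ "vinv a"]) simp_all
  qed
qed

text \<open>Translates subfields, degrees and the rationals of an abstract ring \<open>Z\<close>
  into statements about a set \<open>S\<close> of vectors. It is instantiated for the endomorphism
  algebra and for each of its subfields.\<close>

locale number_field_model = diag_lattice b co
  for b :: "'g::finite + 'g \<Rightarrow> complex ^ 'g" and co +
  fixes Z :: "('a, 'c) ring_scheme" and h :: "'a \<Rightarrow> complex ^ 'g" and S :: "(complex ^ 'g) set"
  assumes ring_Z: "ring Z" and h_iso: "h \<in> ring_iso Z (vec_ring S)" and S: "subfld S"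
begin

sublocale Z: ring Z by (rule ring_Z)

lemma h_S: "x \<in> carrier Z \<Longrightarrow> h x \<in> S"
  and h_mult: "x \<in> carrier Z \<Longrightarrow> y \<in> carrier Z \<Longrightarrow> h (x \<otimes>\<^bsub>Z\<^esub> y) = h x * h y"
  and h_add: "x \<in> carrier Z \<Longrightarrow> y \<in> carrier Z \<Longrightarrow> h (x \<oplus>\<^bsub>Z\<^esub> y) = h x + h y"
  and h_one: "h \<one>\<^bsub>Z\<^esub> = 1"
  using ring_hom_memE[of h Z "vec_ring S"] h_iso by (auto simp: ring_iso_def)

lemma h_zero: "h \<zero>\<^bsub>Z\<^esub> = 0"
  using h_add[OF Z.zero_closed Z.zero_closed] by simp

lemma h_minus: "x \<in> carrier Z \<Longrightarrow> h (\<ominus>\<^bsub>Z\<^esub> x) = - h x"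
  using h_add[OF Z.a_inv_closed, of x x] by (simp add: Z.l_neg h_zero eq_neg_iff_add_eq_0)

lemma h_bij: "bij_betw h (carrier Z) S"
  using h_iso by (simp add: ring_iso_def)

lemma h_inj: "x \<in> carrier Z \<Longrightarrow> y \<in> carrier Z \<Longrightarrow> h x = h y \<longleftrightarrow> x = y"
  using h_bij by (auto simp: bij_betw_def inj_on_eq_iff)

lemma h_surj: assumes "z \<in> S" obtains x where "x \<in> carrier Z" "h x = z"
  using assms h_bij by (auto simp: bij_betw_def)

lemma Z_field: "field Z"
proof -
  have *: "inv_into (carrier Z) h \<in> ring_iso (vec_ring S) Z" by (rule ring_iso_set_sym[OF ring_Z h_iso])
  have "inv_into (carrier Z) h 0 = \<zero>\<^bsub>Z\<^esub>" "inv_into (carrier Z) h 1 = \<one>\<^bsub>Z\<^esub>"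
    using h_bij h_zero h_one Z.zero_closed Z.one_closed
    by (metis bij_betw_def inv_into_f_f)+
  then show ?thesis using field.ring_iso_imp_img_field[OF vec_ring_field[OF S] *] by simp
qed

lemma h_nat: "x \<in> carrier Z \<Longrightarrow> h ([n] \<cdot>\<^bsub>Z\<^esub> x) = of_nat n *\<^sub>R h x" for n :: nat
proof (induction n)
  case (Suc n)
  then show ?case by (simp add: Z.add.nat_pow_Suc h_add scaleR_left_distrib add.commute)
qed (simp add: h_zero)

lemma h_int: "x \<in> carrier Z \<Longrightarrow> h ([n] \<cdot>\<^bsub>Z\<^esub> x) = of_int n *\<^sub>R h x" for n :: int
proof -
  assume x: "x \<in> carrier Z"
  have "[n] \<cdot>\<^bsub>Z\<^esub> x = (if n < 0 then \<ominus>\<^bsub>Z\<^esub> ([nat (- n)] \<cdot>\<^bsub>Z\<^esub> x) else [nat n] \<cdot>\<^bsub>Z\<^esub> x)"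
    unfolding add_pow_def a_inv_def by (rule int_pow_def2)
  then show ?thesis using x by (simp add: h_minus h_nat)
qed

lemma rat_subfield_eq: "rat_subfield Z = {x \<in> carrier Z. h x \<in> range rdiag}"
proof -
  have "(\<exists>(n::int) (m::int). n \<noteq> 0 \<and> [n] \<cdot>\<^bsub>Z\<^esub> x = [m] \<cdot>\<^bsub>Z\<^esub> \<one>\<^bsub>Z\<^esub>) \<longleftrightarrow> h x \<in> range rdiag" if x: "x \<in> carrier Z" for x
  proof -
    have e: "[n] \<cdot>\<^bsub>Z\<^esub> x = [m] \<cdot>\<^bsub>Z\<^esub> \<one>\<^bsub>Z\<^esub> \<longleftrightarrow> of_int n *\<^sub>R h x = of_int m *\<^sub>R 1" for n m :: int
      using h_inj[of "[n] \<cdot>\<^bsub>Z\<^esub> x" "[m] \<cdot>\<^bsub>Z\<^esub> \<one>\<^bsub>Z\<^esub>"] x by (simp add: h_int h_one)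
    show ?thesis unfolding e
    proof
      assume "\<exists>n m :: int. n \<noteq> 0 \<and> of_int n *\<^sub>R h x = of_int m *\<^sub>R 1"
      then obtain n m :: int where nm: "n \<noteq> 0" "of_int n *\<^sub>R h x = of_int m *\<^sub>R 1" by blast
      have "h x = (1 / of_int n) *\<^sub>R (of_int n *\<^sub>R h x)" using nm(1) by simp
      also have "\<dots> = rdiag (of_int m / of_int n)" unfolding nm(2) by (simp add: of_rat_divide)
      finally show "h x \<in> range rdiag" by blast
    next
      assume "h x \<in> range rdiag"
      then obtain q where q: "h x = rdiag q" by blast
      obtain m n where mn: "q = of_int m / of_int n" "n > 0"
        using quotient_of_div[of q] quotient_of_denom_pos by (metis surj_pair)
      have "of_int n *\<^sub>R h x = of_int m *\<^sub>R 1" using mn by (simp add: q of_rat_divide)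
      then show "\<exists>n m :: int. n \<noteq> 0 \<and> of_int n *\<^sub>R h x = of_int m *\<^sub>R 1" using mn(2) by (intro exI[of _ n] exI[of _ m]) simp
    qed
  qed
  then show ?thesis unfolding rat_subfield_def by (intro Collect_cong conj_cong refl)
qed

lemma subfield_iff_subfld:
  assumes F: "F \<subseteq> carrier Z"
  shows "subfield F Z \<longleftrightarrow> subfld (h ` F)"
proof
  assume sf: "subfield F Z"
  note sr = subringE[OF subfieldE(1)[OF sf]]
  show "subfld (h ` F)"
    unfolding subfld_def
  proof (intro conjI ballI impI)
    show "h ` F \<subseteq> KF" using h_S F subfld_in_KF[OF S] by blast
    show "1 \<in> h ` F" using sr(3) h_one by force
    fix x y assume "x \<in> h ` F" "y \<in> h ` F"
    then obtain u v where uv: "u \<in> F" "v \<in> F" "x = h u" "y = h v" by blast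
    have c: "u \<in> carrier Z" "v \<in> carrier Z" using uv F by auto
    have "x - y = h (u \<oplus>\<^bsub>Z\<^esub> \<ominus>\<^bsub>Z\<^esub> v)" using c by (simp add: h_add h_minus uv)
    then show "x - y \<in> h ` F" using sr(5,7) uv(1,2) by blast
    have "x * y = h (u \<otimes>\<^bsub>Z\<^esub> v)" using c by (simp add: h_mult uv)
    then show "x * y \<in> h ` F" using sr(6) uv(1,2) by blast
  next
    fix x assume "x \<in> h ` F" "x \<noteq> 0"
    then obtain u where u: "u \<in> F" "x = h u" "u \<noteq> \<zero>\<^bsub>Z\<^esub>" using h_zero by blast
    then have uF: "u \<in> F - {\<zero>\<^bsub>Z\<^esub>}" by blast
    note i = Z.subfield_m_inv[OF sf uF]
    have c: "u \<in> carrier Z" "inv\<^bsub>Z\<^esub> u \<in> carrier Z" using u i(1) F by auto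
    have 1: "h u * h (inv\<^bsub>Z\<^esub> u) = 1" using h_mult[OF c] i(2) by (simp add: h_one)
    have 2: "h u * vinv (h u) = 1" using KF_vinv(2)[OF subfld_in_KF[OF S h_S[OF c(1)]]] \<open>x \<noteq> 0\<close> u(2) by blast
    have "vinv (h u) = (h u * h (inv\<^bsub>Z\<^esub> u)) * vinv (h u)" by (simp add: 1)
    also have "\<dots> = h (inv\<^bsub>Z\<^esub> u) * (h u * vinv (h u))" by (simp only: mult_ac)
    finally have "vinv x = h (inv\<^bsub>Z\<^esub> u)" by (simp add: 2 u(2))
    then show "vinv x \<in> h ` F" using i(1) by blast
  qed
next
  assume sf: "subfld (h ` F)"
  interpret field Z by (rule Z_field)
  have mem: "x \<in> F" if "x \<in> carrier Z" "h x \<in> h ` F" for x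
    using that F h_inj by (metis image_iff subsetD)
  show "subfield F Z"
  proof (rule subfieldI')
    show "subring F Z"
    proof (rule Z.subringI[OF F])
      show "\<one>\<^bsub>Z\<^esub> \<in> F" using subfld_1[OF sf] by (intro mem) (simp_all add: h_one)
      show "\<ominus>\<^bsub>Z\<^esub> x \<in> F" if "x \<in> F" for x
      proof (rule mem)
        show "\<ominus>\<^bsub>Z\<^esub> x \<in> carrier Z" using that F by auto
        have "0 - h x \<in> h ` F" using subfld_diff[OF sf subfld_0[OF sf]] that by blast
        then show "h (\<ominus>\<^bsub>Z\<^esub> x) \<in> h ` F" using h_minus[of x] that F by auto
      qed
      fix x y assume xy: "x \<in> F" "y \<in> F"
      then have c: "x \<in> carrier Z" "y \<in> carrier Z" using F by auto
      show "x \<otimes>\<^bsub>Z\<^esub> y \<in> F" using subfld_times[OF sf, of "h x" "h y"] xy c by (intro mem) (simp_all add: h_mult)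
      show "x \<oplus>\<^bsub>Z\<^esub> y \<in> F" using subfld_add[OF sf, of "h x" "h y"] xy c by (intro mem) (simp_all add: h_add)
    qed
    fix k assume k: "k \<in> F - {\<zero>\<^bsub>Z\<^esub>}"
    have kc: "k \<in> carrier Z" using k F by blast
    have kU: "k \<in> Units Z" using k F by (auto simp: field_Units)
    have ki: "inv\<^bsub>Z\<^esub> k \<in> carrier Z" using kU by simp
    have hk: "h k \<noteq> 0" using h_inj[OF kc Z.zero_closed] k by (simp add: h_zero)
    have 1: "h k * h (inv\<^bsub>Z\<^esub> k) = 1" using h_mult[OF kc ki] kU by (simp add: h_one)
    have 2: "h k * vinv (h k) = 1" using KF_vinv(2)[OF subfld_in_KF[OF S h_S[OF kc]] hk] .
    have "vinv (h k) = (h k * h (inv\<^bsub>Z\<^esub> k)) * vinv (h k)" by (simp add: 1)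
    also have "\<dots> = h (inv\<^bsub>Z\<^esub> k) * (h k * vinv (h k))" by (simp only: mult_ac)
    finally have "vinv (h k) = h (inv\<^bsub>Z\<^esub> k)" by (simp add: 2)
    moreover have "vinv (h k) \<in> h ` F" using subfld_vinv[OF sf _ hk] k by blast
    ultimately show "inv\<^bsub>Z\<^esub> k \<in> F" using mem[OF ki] by simp
  qed
qed

lemma h_image_rat: "h ` rat_subfield Z = range rdiag"
proof
  show "range rdiag \<subseteq> h ` rat_subfield Z"
  proof
    fix z :: "complex ^ 'g" assume z: "z \<in> range rdiag"
    then have "z \<in> S" using subfld_rdiag[OF S] by blast
    then obtain x where "x \<in> carrier Z" "h x = z" by (elim h_surj)
    then show "z \<in> h ` rat_subfield Z" using z by (auto simp: rat_subfield_eq)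
  qed
qed (auto simp: rat_subfield_eq)

lemma subfld_rdiags: "subfld (range rdiag)"
proof -
  have "rdiag p - rdiag q = (rdiag (p - q) :: complex ^ 'g)" for p q by (simp add: of_rat_diff scaleR_left_diff_distrib)
  moreover have "vinv (rdiag q) = (rdiag (inverse q) :: complex ^ 'g)" for q
    unfolding vec_eq_iff vinv_nth rdiag_nth by (simp add: of_rat_inverse)
  moreover have "(1 :: complex ^ 'g) = rdiag 1" by simp
  ultimately show ?thesis unfolding subfld_def
    using rdiag_KF rdiag_mult by (metis (no_types, lifting) imageE image_subsetI rangeI)
qed

lemma rat_subfield_subfield: "subfield (rat_subfield Z) Z"
proof -
  have "rat_subfield Z \<subseteq> carrier Z" by (auto simp: rat_subfield_def)
  then show ?thesis using subfield_iff_subfld subfld_rdiags by (simp add: h_image_rat)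
qed

text \<open>\<open>Z.dimension\<close> grows by line extensions; each of them corresponds to
  inserting one more member of a rational basis of \<open>S\<close>.\<close>

lemma dimension_carrier: "Z.dimension (ratV.dim S) (rat_subfield Z) (carrier Z)"
proof -
  have SKF: "S \<subseteq> KF" using subfld_in_KF[OF S] by blast
  obtain C where C: "C \<subseteq> S" "ratV.independent C" "S \<subseteq> ratV.span C" "finite C" "card C = ratV.dim S"
    by (rule subfld_basis[OF SKF]) (rule that)
  let ?K = "rat_subfield Z"
  let ?E = "\<lambda>D. {x \<in> carrier Z. h x \<in> ratV.span D}"
  have "Z.dimension (card D) ?K (?E D)" if "finite D" "D \<subseteq> C" for D
    using that
  proof (induction D rule: finite_induct)
    case empty
    have "?E {} = {\<zero>\<^bsub>Z\<^esub>}" using h_inj[OF _ Z.zero_closed] h_zero by auto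
    then show ?case by simp
  next
    case (insert a D)
    have aS: "a \<in> S" using insert.prems C(1) by blast
    then obtain v where v: "v \<in> carrier Z" "h v = a" by (elim h_surj)
    have "ratV.independent (insert a D)" using C(2) insert.prems by (rule ratV.independent_mono)
    then have a: "a \<notin> ratV.span D" using insert.hyps(2) by (simp add: ratV.independent_insert)
    have "Z.dimension (Suc (card D)) ?K (Z.line_extension ?K v (?E D))"
      using insert v a by (intro Z.Suc_dim) auto
    also have "Z.line_extension ?K v (?E D) = ?E (insert a D)"
    proof (rule equalityI; rule subsetI)
      fix x assume "x \<in> Z.line_extension ?K v (?E D)"
      then obtain k e where ke: "k \<in> ?K" "e \<in> ?E D" "x = k \<otimes>\<^bsub>Z\<^esub> v \<oplus>\<^bsub>Z\<^esub> e" by (auto simp: Z.line_extension_mem_iff)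
      obtain q where q: "k \<in> carrier Z" "h k = rdiag q" using ke(1) by (auto simp: rat_subfield_eq)
      have "h x = of_rat q *\<^sub>R a + h e" using ke q v by (simp add: h_add h_mult)
      moreover have "of_rat q *\<^sub>R a + h e \<in> ratV.span (insert a D)"
      proof (rule ratV.span_add)
        show "of_rat q *\<^sub>R a \<in> ratV.span (insert a D)" by (intro ratV.span_scale ratV.span_base) simp
        show "h e \<in> ratV.span (insert a D)" using ke(2) ratV.span_mono[OF subset_insertI] by blast
      qed
      ultimately show "x \<in> ?E (insert a D)" using ke q v by simp
    next
      fix x assume x: "x \<in> ?E (insert a D)"
      then obtain q where q: "h x - of_rat q *\<^sub>R a \<in> ratV.span D" by (auto simp: ratV.span_breakdown_eq)
      have "rdiag q \<in> S" by (rule subfld_rdiag[OF S])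
      then obtain k where k: "k \<in> carrier Z" "h k = rdiag q" by (elim h_surj)
      have kK: "k \<in> ?K" using k by (simp add: rat_subfield_eq)
      let ?e = "x \<oplus>\<^bsub>Z\<^esub> \<ominus>\<^bsub>Z\<^esub> (k \<otimes>\<^bsub>Z\<^esub> v)"
      have "h ?e = h x - of_rat q *\<^sub>R a" using x k v by (simp add: h_add h_minus h_mult)
      then have e: "?e \<in> ?E D" using q x k v by simp
      have "x = k \<otimes>\<^bsub>Z\<^esub> v \<oplus>\<^bsub>Z\<^esub> ?e"
      proof -
        have "h x = h (k \<otimes>\<^bsub>Z\<^esub> v \<oplus>\<^bsub>Z\<^esub> ?e)" using x k v by (simp add: h_add h_minus h_mult)
        then show ?thesis using h_inj[of x "k \<otimes>\<^bsub>Z\<^esub> v \<oplus>\<^bsub>Z\<^esub> ?e"] x k v by simp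
      qed
      then show "x \<in> Z.line_extension ?K v (?E D)" using kK e by (auto simp only: Z.line_extension_mem_iff)
    qed
    finally show ?case using insert.hyps by simp
  qed
  then have "Z.dimension (card C) ?K (?E C)" using C(4) by blast
  moreover have "?E C = carrier Z" using h_S C(3) by auto
  ultimately show ?thesis using C(5) by simp
qed

theorem number_field_Z: "number_field Z"
  unfolding number_field_def
proof (intro conjI allI impI)
  show "field Z" by (rule Z_field)
  show "Z.finite_dimension (rat_subfield Z) (carrier Z)" using dimension_carrier by (rule Z.finite_dimensionI)
  fix n :: nat assume n: "n > 0"
  show "[n] \<cdot>\<^bsub>Z\<^esub> \<one>\<^bsub>Z\<^esub> \<noteq> \<zero>\<^bsub>Z\<^esub>"
  proof
    assume "[n] \<cdot>\<^bsub>Z\<^esub> \<one>\<^bsub>Z\<^esub> = \<zero>\<^bsub>Z\<^esub>"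
    then have "of_nat n *\<^sub>R h \<one>\<^bsub>Z\<^esub> = 0" using h_nat[OF Z.one_closed, of n] by (simp add: h_zero)
    then show False using n by (simp add: h_one)
  qed
qed

theorem rat_degree_Z: "rat_degree Z = ratV.dim S"
  using Z.dimI[OF rat_subfield_subfield dimension_carrier] by (simp add: rat_degree_def over_def)

lemma subfield_model:
  assumes "subfield F Z"
  shows "number_field_model b co (Z\<lparr>carrier := F\<rparr>) h (h ` F)"
proof (rule number_field_model.intro[OF diag_lattice_axioms number_field_model_axioms.intro])
  have F: "F \<subseteq> carrier Z" by (rule subfieldE(3)[OF assms])
  show "subfld (h ` F)" using subfield_iff_subfld[OF F] assms by blast
  have f: "field (Z\<lparr>carrier := F\<rparr>)" by (rule Z.subfield_iff(2)[OF assms])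
  show "ring (Z\<lparr>carrier := F\<rparr>)" by (rule field.is_ring[OF f])
  have "h \<in> ring_hom (Z\<lparr>carrier := F\<rparr>) (vec_ring (h ` F))"
    using F by (intro ring_hom_memI) (auto simp: h_mult h_add h_one subset_iff)
  moreover have "inj_on h F" using F h_inj by (auto intro!: inj_onI)
  ultimately show "h \<in> ring_iso (Z\<lparr>carrier := F\<rparr>) (vec_ring (h ` F))"
    by (simp add: ring_iso_def bij_betw_def)
qed

end

context diag_lattice
begin

lemma KUgrp_group: "group KUgrp"
proof (rule groupI)
  show "\<exists>y\<in>carrier KUgrp. y \<otimes>\<^bsub>KUgrp\<^esub> x = \<one>\<^bsub>KUgrp\<^esub>" if "x \<in> carrier KUgrp" for x
    using KU_inverse[of x] that by (auto simp: KUgrp_def mult.commute)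
qed (auto simp: KUgrp_def KU_1 KU_times mult.assoc)

lemma units_iso:
  assumes \<theta>: "\<theta> \<in> ring_iso (vec_ring KO) R"
  shows "\<theta> ` KU = Units R" "units_of R \<cong> KUgrp"
proof -
  have hom: "\<And>x. x \<in> KO \<Longrightarrow> \<theta> x \<in> carrier R"
    "\<And>x y. x \<in> KO \<Longrightarrow> y \<in> KO \<Longrightarrow> \<theta> (x * y) = \<theta> x \<otimes>\<^bsub>R\<^esub> \<theta> y" "\<theta> 1 = \<one>\<^bsub>R\<^esub>"
    and inj: "inj_on \<theta> KO" and im: "\<theta> ` KO = carrier R"
    using \<theta> ring_hom_memE[of \<theta> "vec_ring KO" R] by (auto simp: ring_iso_def bij_betw_def)
  show U: "\<theta> ` KU = Units R"
  proof
    show "\<theta> ` KU \<subseteq> Units R"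
    proof clarify
      fix u assume "u \<in> KU"
      then obtain v where uv: "u \<in> KO" "v \<in> KO" "u * v = 1" by (auto simp: KU_def)
      have "\<theta> u \<otimes>\<^bsub>R\<^esub> \<theta> v = \<one>\<^bsub>R\<^esub>" "\<theta> v \<otimes>\<^bsub>R\<^esub> \<theta> u = \<one>\<^bsub>R\<^esub>"
        using hom(2)[OF uv(1,2)] hom(2)[OF uv(2,1)] uv(3) hom(3) by (simp_all add: mult.commute)
      then show "\<theta> u \<in> Units R" unfolding Units_def using hom(1) uv by blast
    qed
    show "Units R \<subseteq> \<theta> ` KU"
    proof
      fix y assume "y \<in> Units R"
      then obtain x where x: "x \<in> carrier R" "y \<in> carrier R" "y \<otimes>\<^bsub>R\<^esub> x = \<one>\<^bsub>R\<^esub>" by (auto simp: Units_def)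
      then obtain u v where uv: "u \<in> KO" "v \<in> KO" "y = \<theta> u" "x = \<theta> v" using im by blast
      have "\<theta> (u * v) = \<theta> 1" using hom(2)[OF uv(1,2)] x(3) uv(3,4) hom(3) by simp
      then have "u * v = 1" using inj_onD[OF inj] KO_times[OF uv(1,2)] KO_1 by blast
      then show "y \<in> \<theta> ` KU" using uv unfolding KU_def by blast
    qed
  qed
  have KUKO: "KU \<subseteq> KO" using KU_KO by blast
  have "\<theta> \<in> iso KUgrp (units_of R)"
  proof (rule isoI)
    show "\<theta> \<in> hom KUgrp (units_of R)"
      using U hom(2)[OF subsetD[OF KUKO] subsetD[OF KUKO]] by (intro homI) (auto simp: KUgrp_def units_of_def)
    show "bij_betw \<theta> (carrier KUgrp) (carrier (units_of R))"
      using U inj_on_subset[OF inj KUKO] by (simp add: bij_betw_def KUgrp_def units_of_def)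
  qed
  then show "units_of R \<cong> KUgrp" using group.iso_sym[OF KUgrp_group] by (auto simp: is_iso_def)
qed

text \<open>In degree \<open>g\<close> the powers of any nonrational element already span
  \<open>KF\<close> over \<rat>.\<close>

lemma subfld_dim_g_trivial:
  assumes dim: "ratV.dim KF = CARD('g)" and F: "subfld F"
  shows "F = range rdiag \<or> F = KF"
proof (cases "F \<subseteq> range rdiag")
  case True
  then show ?thesis using subfld_dim_rational(1)[OF F] by blast
next
  case False
  then obtain x where x: "x \<in> F" "x \<notin> range rdiag" by blast
  have xK: "x \<in> KF" by (rule subfld_in_KF[OF F x(1)])
  have "KF \<subseteq> F"
  proof
    fix y assume "y \<in> KF"
    then obtain c where "y = (\<Sum>k<CARD('g). of_rat (c k) *\<^sub>R x ^ k)"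
      using subfld_dim_g_powers[OF subfld_KF dim xK x(2)] by blast
    then show "y \<in> F" using x(1) by (auto intro!: subfld_sum[OF F] subfld_scale[OF F] subfld_power[OF F])
  qed
  then show ?thesis using subfld_in_KF[OF F] by blast
qed

text \<open>If \<open>LatQ\<close> is a line over \<open>F\<close>, then for each element of
  \<open>KF\<close> some element of \<open>F\<close> has the same product with \<open>b k\<close>,
  and the two are equal.\<close>

lemma subfld_dim_2g_cases:
  assumes F: "subfld F"
  shows "F = range rdiag \<or> F = KF \<or> ratV.dim F = CARD('g)"
proof (cases "F \<subseteq> range rdiag")
  case True
  then show ?thesis using subfld_dim_rational(1)[OF F] by blast
next
  case False
  then obtain x where x: "x \<in> F" "x \<notin> range rdiag" by blast
  obtain k :: "'g + 'g" where True by blast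
  have "KF \<subseteq> F" if L: "LatQ \<subseteq> (\<lambda>s. s * b k) ` F"
  proof
    fix y assume y: "y \<in> KF"
    have "y * b k \<in> LatQ" using y b_LatQ[of k] unfolding KF_def by blast
    then obtain s where s: "s \<in> F" "y * b k = s * b k" using L by blast
    have "(y - s) * b k = 0" using s(2) by (simp add: left_diff_distrib)
    then have "y - s = 0" using KF_times_eq_0[OF KF_diff[OF y subfld_in_KF[OF F s(1)]]] b_nonzero by blast
    then show "y \<in> F" using s(1) by simp
  qed
  then show ?thesis using subfld_dim_cases[OF F x, of k] subfld_in_KF[OF F] by blast
qed

end

section \<open>Subfields and signature of the endomorphism algebra\<close>

locale number_field_KF = number_field_model b co Z h "lattice_coords.KF co"
  for b :: "'g::finite + 'g \<Rightarrow> complex ^ 'g" and co and Z :: "('a, 'c) ring_scheme" and h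
begin

lemma h_image_eq_carrier: "F \<subseteq> carrier Z \<Longrightarrow> h ` F = KF \<longleftrightarrow> F = carrier Z"
  using h_bij h_inj unfolding bij_betw_def by (metis inj_on_image_eq_iff order_refl)

lemma h_image_eq_rat: "F \<subseteq> carrier Z \<Longrightarrow> h ` F = range rdiag \<longleftrightarrow> F = rat_subfield Z"
proof -
  assume F: "F \<subseteq> carrier Z"
  have "rat_subfield Z \<subseteq> carrier Z" by (auto simp: rat_subfield_def)
  then show ?thesis using h_bij F inj_on_image_eq_iff[of h "carrier Z" F "rat_subfield Z"]
    by (simp add: bij_betw_def h_image_rat)
qed

lemma rat_proper:
  assumes "ratV.dim KF \<noteq> 1"
  shows "rat_subfield Z \<in> proper_subfields Z"
proof -
  have "rat_subfield Z \<noteq> carrier Z"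
  proof
    assume "rat_subfield Z = carrier Z"
    then have "KF = range rdiag" using h_image_rat h_bij by (simp add: bij_betw_def)
    then show False using assms subfld_dim_rational(2)[OF subfld_KF] by blast
  qed
  then show ?thesis using rat_subfield_subfield by (simp add: proper_subfields_def)
qed

lemma primitive_dim_g:
  assumes dim: "ratV.dim KF = CARD('g)"
  shows "primitive_field Z"
proof -
  have "F = rat_subfield Z" if "F \<in> proper_subfields Z" for F
  proof -
    have sf: "subfield F Z" and ne: "F \<noteq> carrier Z" using that by (auto simp: proper_subfields_def)
    have F: "F \<subseteq> carrier Z" by (rule subfieldE(3)[OF sf])
    have "h ` F = range rdiag \<or> h ` F = KF" using subfld_dim_g_trivial[OF dim] subfield_iff_subfld[OF F] sf by blast
    then show ?thesis using h_image_eq_carrier[OF F] h_image_eq_rat[OF F] ne by blast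
  qed
  moreover have "rat_subfield Z \<in> proper_subfields Z" using rat_proper dim g3 by simp
  ultimately have "proper_subfields Z = {rat_subfield Z}" by blast
  then show ?thesis using number_field_Z by (simp add: primitive_field_def)
qed

lemma unique_intermediate_field:
  assumes dim: "ratV.dim KF = 2 * CARD('g)" and np: "\<not> primitive_field Z"
  shows "\<exists>K. proper_subfields Z - {rat_subfield Z} = {K} \<and> rat_degree (Z\<lparr>carrier := K\<rparr>) = CARD('g)"
proof -
  have dF: "subfld (h ` F) \<and> ratV.dim (h ` F) = CARD('g)" and sub: "F \<subseteq> carrier Z"
    if "F \<in> proper_subfields Z - {rat_subfield Z}" for F
  proof -
    have sf: "subfield F Z" and ne: "F \<noteq> carrier Z" "F \<noteq> rat_subfield Z" using that by (auto simp: proper_subfields_def)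
    show F: "F \<subseteq> carrier Z" by (rule subfieldE(3)[OF sf])
    have s: "subfld (h ` F)" using subfield_iff_subfld[OF F] sf by blast
    show "subfld (h ` F) \<and> ratV.dim (h ` F) = CARD('g)"
      using subfld_dim_2g_cases[OF s] h_image_eq_carrier[OF F] h_image_eq_rat[OF F] ne s by blast
  qed
  have "rat_subfield Z \<in> proper_subfields Z" using rat_proper dim by simp
  moreover have "proper_subfields Z \<noteq> {rat_subfield Z}" using np number_field_Z by (auto simp: primitive_field_def)
  ultimately obtain K where K: "K \<in> proper_subfields Z - {rat_subfield Z}" by blast
  have "F = K" if F: "F \<in> proper_subfields Z - {rat_subfield Z}" for F
  proof -
    have "h ` F = h ` K" using subfield_dim_g_unique[OF dim] dF[OF F] dF[OF K] by blast
    then show ?thesis using h_bij sub[OF F] sub[OF K] inj_on_image_eq_iff[of h "carrier Z" F K]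
      by (simp add: bij_betw_def)
  qed
  then have "proper_subfields Z - {rat_subfield Z} = {K}" using K by blast
  moreover have "rat_degree (Z\<lparr>carrier := K\<rparr>) = CARD('g)"
  proof -
    have "subfield K Z" using K by (simp add: proper_subfields_def)
    then interpret K: number_field_model b co "Z\<lparr>carrier := K\<rparr>" h "h ` K" by (rule subfield_model)
    show ?thesis using K.rat_degree_Z dF[OF K] by simp
  qed
  ultimately show ?thesis by blast
qed

lemma signature:
  assumes pl: "places \<rho> Ir \<kappa>"
  shows "field_r Z = card Ir" "field_s Z = card (range \<rho> - Ir)"
proof -
  have *: "inv_into (carrier Z) h \<in> ring_iso (vec_ring KF) Z" by (rule ring_iso_set_sym[OF ring_Z h_iso])
  have "tensor_ring Z real_ring \<simeq> real_complex_product (card Ir) (card (range \<rho> - Ir))"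
    by (rule ring_iso_trans[OF tensor_real(2)[OF *] span_KF_iso[OF pl]])
  from field_signature_eq[OF tensor_real(1)[OF *] this]
  show "field_r Z = card Ir" "field_s Z = card (range \<rho> - Ir)" .
qed

end

context diag_lattice
begin

text \<open>A place outside \<open>Ir\<close> would allow an element of the real span with entry
  \<open>\<i>\<close> there, whereas all entries of elements of the span are real.\<close>

lemma places_all_real:
  assumes pl: "places \<rho> Ir \<kappa>" and real: "\<And>x i. x \<in> KF \<Longrightarrow> x $ i \<in> \<real>"
  shows "range \<rho> - Ir = {}"
proof (rule ccontr)
  assume "range \<rho> - Ir \<noteq> {}"
  then obtain i where i: "i \<in> range \<rho>" "i \<notin> Ir" by blast
  have ex: "\<forall>y. (\<forall>i\<in>Ir. y i \<in> \<real>) \<longrightarrow> (\<exists>z\<in>span KF. \<forall>i\<in>range \<rho>. z $ i = y i)"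
    using pl[unfolded places_def] by simp
  have "\<exists>z\<in>span KF. \<forall>j\<in>range \<rho>. z $ j = (if j \<in> Ir then 0 else \<i>)" by (rule ex[rule_format]) simp
  then obtain z where z: "z \<in> span KF" "\<forall>j\<in>range \<rho>. z $ j = (if j \<in> Ir then 0 else \<i>)" by blast
  have "subspace {z :: complex ^ 'g. z $ i \<in> \<real>}" by (auto simp: subspace_def scaleR_complex)
  moreover have "KF \<subseteq> {z. z $ i \<in> \<real>}" using real by auto
  ultimately have "z $ i \<in> \<real>" using span_minimal z(1) by blast
  moreover have "z $ i = \<i>" using z(2)[rule_format, OF i(1)] i(2) by simp
  ultimately show False by (simp add: complex_is_Real_iff)
qed

lemma rat_ring_iso_rdiag: "rat_ring \<simeq> vec_ring (range rdiag :: (complex ^ 'g) set)"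
proof -
  have "rdiag \<in> ring_iso rat_ring (vec_ring (range rdiag :: (complex ^ 'g) set))"
    unfolding ring_iso_def
  proof (intro CollectI conjI)
    show "rdiag \<in> ring_hom rat_ring (vec_ring (range rdiag :: (complex ^ 'g) set))"
      by (rule ring_hom_memI)
        (simp_all add: ring_of_type_algebra_def of_rat_mult of_rat_add scaleR_left_distrib)
    show "bij_betw rdiag (carrier rat_ring) (carrier (vec_ring (range rdiag :: (complex ^ 'g) set)))"
      by (auto simp: bij_betw_def ring_of_type_algebra_def inj_on_def)
  qed
  then show ?thesis by (auto simp: is_ring_iso_def)
qed

lemma integers_iso: "\<Z> \<simeq> vec_ring (range of_int :: (complex ^ 'g) set)"
proof -
  have inj: "inj (of_int :: int \<Rightarrow> complex ^ 'g)"
  proof (rule injI)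
    fix m n :: int assume "of_int m = (of_int n :: complex ^ 'g)"
    then have "(of_int m :: complex) = of_int n" using of_int_vec_nth by metis
    then show "m = n" by (simp only: of_int_eq_iff)
  qed
  have "of_int \<in> ring_iso \<Z> (vec_ring (range of_int :: (complex ^ 'g) set))"
    unfolding ring_iso_def
  proof (intro CollectI conjI)
    show "of_int \<in> ring_hom \<Z> (vec_ring (range of_int :: (complex ^ 'g) set))"
      by (rule ring_hom_memI) simp_all
    show "bij_betw of_int (carrier \<Z>) (carrier (vec_ring (range of_int :: (complex ^ 'g) set)))"
      using inj by (simp add: bij_betw_def)
  qed
  then show ?thesis by (auto simp: is_ring_iso_def)
qed

end

theorem theorem1p7:
  fixes \<Lambda> :: "(complex ^ 'g) set"
  assumes "complex_torus \<Lambda>"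
    and "CARD('g) \<ge> 3"
    and "two_simple \<Lambda>"
  shows
    "simple_torus \<Lambda>
     \<and>
     (\<forall>E. subfield E (End0_torus \<Lambda>) \<longrightarrow>
        number_field (End0_torus \<Lambda>\<lparr>carrier := E\<rparr>) \<and>
        rat_degree (End0_torus \<Lambda>\<lparr>carrier := E\<rparr>) \<in> {1, CARD('g), 2 * CARD('g)})
     \<and>
     (number_field (End0_torus \<Lambda>) \<and>
        rat_degree (End0_torus \<Lambda>) \<in> {1, CARD('g), 2 * CARD('g)})
     \<and>
     (rat_degree (End0_torus \<Lambda>) = 1 \<longrightarrow>
        rat_ring \<simeq> End0_torus \<Lambda> \<and>
        \<Z> \<simeq> End_torus \<Lambda> \<and>
        carrier (Aut_torus \<Lambda>) = {\<one>\<^bsub>End_torus \<Lambda>\<^esub>, \<ominus>\<^bsub>End_torus \<Lambda>\<^esub> \<one>\<^bsub>End_torus \<Lambda>\<^esub>})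
     \<and>
     (rat_degree (End0_torus \<Lambda>) = 2 * CARD('g) \<longrightarrow>
        purely_imaginary (End0_torus \<Lambda>) \<and>
        Aut_torus \<Lambda> \<cong> sign_group \<times>\<times> free_abelian_rank (CARD('g) - 1) \<and>
        (\<not> primitive_field (End0_torus \<Lambda>) \<longrightarrow>
           (\<exists>K. proper_subfields (End0_torus \<Lambda>) - {rat_subfield (End0_torus \<Lambda>)} = {K} \<and>
                rat_degree (End0_torus \<Lambda>\<lparr>carrier := K\<rparr>) = CARD('g))))
     \<and>
     (rat_degree (End0_torus \<Lambda>) = CARD('g) \<longrightarrow>
        primitive_field (End0_torus \<Lambda>) \<and>
        (\<exists>d::nat. d > 0 \<and>
           int d = int (field_r (End0_torus \<Lambda>)) + int (field_s (End0_torus \<Lambda>)) - 1 \<and>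
           Aut_torus \<Lambda> \<cong> free_abelian_rank d \<times>\<times> sign_group \<and>
           1 / 2 \<le> real CARD('g) / 2 - 1 \<and>
           real CARD('g) / 2 - 1 \<le> real d \<and>
           real d \<le> real CARD('g) - 1 \<and>
           (abelian_variety \<Lambda> \<longrightarrow>
              primitive_field (End0_torus \<Lambda>) \<and>
              totally_real (End0_torus \<Lambda>) \<and>
              int d = int CARD('g) - 1)))"
proof -
  obtain b :: "'g + 'g \<Rightarrow> complex ^ 'g" and co where bc: "lattice_coords b co"
    "\<Lambda> = lattice_coords.Lat co" "rational_lattice \<Lambda> = lattice_coords.LatQ co"
    using torus_lattice_coords[OF assms(1)] by (elim exE conjE)
  interpret T: two_simple_torus b co \<Lambda>
    by (intro two_simple_torus.intro torus_coords.intro torus_coords_axioms.intro two_simple_torus_axioms.intro)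
       (use bc assms in simp_all)
  obtain b' :: "'g + 'g \<Rightarrow> complex ^ 'g" and co' \<theta> where D: "diag_lattice b' co'"
    and \<theta>: "\<theta> \<in> ring_iso (vec_ring (lattice_coords.KO co')) (End_torus \<Lambda>)" and \<theta>0: "\<theta> 0 = \<zero>\<^bsub>End_torus \<Lambda>\<^esub>"
    and ab: "abelian_variety \<Lambda> \<longrightarrow> ratV.dim (lattice_coords.KF co') = CARD('g) \<longrightarrow>
              (\<forall>x\<in>lattice_coords.KF co'. \<forall>i. x $ i \<in> \<real>)"
    using T.torus_diagonalization by (elim exE conjE bexE)
  interpret D: diag_lattice b' co' by (rule D)
  let ?Z = "End0_torus \<Lambda>"
  have ringZ: "ring ?Z" unfolding End0_torus_def by (rule D.tensor_rat(1)[OF \<theta>])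
  have "?Z \<simeq> vec_ring D.KF" unfolding End0_torus_def by (rule D.tensor_rat(2)[OF \<theta>])
  then obtain h where h: "h \<in> ring_iso ?Z (vec_ring D.KF)" by (auto simp: is_ring_iso_def)
  interpret M: number_field_KF b' co' ?Z h
    by (intro number_field_KF.intro number_field_model.intro number_field_model_axioms.intro D ringZ h D.subfld_KF)
  have Aut: "Aut_torus \<Lambda> \<cong> D.KUgrp" unfolding Aut_torus_def by (rule D.units_iso(2)[OF \<theta>])
  note deg = M.rat_degree_Z
  have g3: "CARD('g) \<ge> 3" by (rule assms(2))
  have i: "simple_torus \<Lambda>" by (rule T.simple_torusI[OF assms(3,2)])
  have ii: "number_field (?Z\<lparr>carrier := E\<rparr>) \<and> rat_degree (?Z\<lparr>carrier := E\<rparr>) \<in> {1, CARD('g), 2 * CARD('g)}"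
    if "subfield E ?Z" for E
  proof -
    interpret E: number_field_model b' co' "?Z\<lparr>carrier := E\<rparr>" h "h ` E" by (rule M.subfield_model[OF that])
    show ?thesis using E.number_field_Z E.rat_degree_Z D.subfld_dim[OF E.S] by simp
  qed
  have iii: "number_field ?Z \<and> rat_degree ?Z \<in> {1, CARD('g), 2 * CARD('g)}"
    using M.number_field_Z deg D.subfld_dim[OF D.subfld_KF] by simp
  have iv: "rat_ring \<simeq> ?Z \<and> \<Z> \<simeq> End_torus \<Lambda> \<and>
      carrier (Aut_torus \<Lambda>) = {\<one>\<^bsub>End_torus \<Lambda>\<^esub>, \<ominus>\<^bsub>End_torus \<Lambda>\<^esub> \<one>\<^bsub>End_torus \<Lambda>\<^esub>}" if "rat_degree ?Z = 1"
  proof (intro conjI)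
    have dim: "ratV.dim D.KF = 1" using that deg by simp
    have "vec_ring D.KF \<simeq> ?Z" by (rule ring_iso_sym[OF ringZ \<open>?Z \<simeq> vec_ring D.KF\<close>])
    then show "rat_ring \<simeq> ?Z" using ring_iso_trans[OF D.rat_ring_iso_rdiag] D.KF_dim_1[OF dim] by simp
    have "vec_ring D.KO \<simeq> End_torus \<Lambda>" using \<theta> by (auto simp: is_ring_iso_def)
    then show "\<Z> \<simeq> End_torus \<Lambda>" using ring_iso_trans[OF D.integers_iso] D.KO_dim_1[OF dim] by simp
    \<comment> \<open>The ring axioms are carried over along \<open>\<theta>\<close>, with
      \<open>\<theta>0\<close> identifying the zero element.\<close>
    have rE: "ring (End_torus \<Lambda>)"
      using ring.ring_iso_imp_img_ring[OF cring.axioms(1)[OF vec_ring_cring[OF D.KO_subring]] \<theta>] \<theta>0 by simp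
    have hom: "\<theta> \<in> ring_hom (vec_ring D.KO) (End_torus \<Lambda>)" using \<theta> by (simp add: ring_iso_def)
    have m1: "- 1 \<in> D.KO" using D.KO_diff[OF D.KO_0 D.KO_1] by simp
    have "\<theta> (- 1) \<oplus>\<^bsub>End_torus \<Lambda>\<^esub> \<theta> 1 = \<zero>\<^bsub>End_torus \<Lambda>\<^esub>"
      using ring_hom_memE(3)[OF hom, of "- 1" 1] m1 D.KO_1 \<theta>0 by simp
    moreover have one: "\<theta> 1 = \<one>\<^bsub>End_torus \<Lambda>\<^esub>" using ring_hom_memE(4)[OF hom] by simp
    moreover have "\<theta> (- 1) \<in> carrier (End_torus \<Lambda>)" using ring_hom_memE(1)[OF hom] m1 by simp
    ultimately have "\<theta> (- 1) = \<ominus>\<^bsub>End_torus \<Lambda>\<^esub> \<one>\<^bsub>End_torus \<Lambda>\<^esub>"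
      using abelian_group.minus_equality[OF ring.is_abelian_group[OF rE], of "\<theta> (- 1)"] ring.ring_simprules(6)[OF rE] by simp
    moreover have "carrier (Aut_torus \<Lambda>) = {\<theta> 1, \<theta> (- 1)}"
      using D.units_iso(1)[OF \<theta>] D.KU_dim_1[OF dim] by (simp add: Aut_torus_def units_of_def)
    ultimately show "carrier (Aut_torus \<Lambda>) = {\<one>\<^bsub>End_torus \<Lambda>\<^esub>, \<ominus>\<^bsub>End_torus \<Lambda>\<^esub> \<one>\<^bsub>End_torus \<Lambda>\<^esub>}"
      using one by simp
  qed
  have v: "purely_imaginary ?Z \<and> Aut_torus \<Lambda> \<cong> sign_group \<times>\<times> free_abelian_rank (CARD('g) - 1) \<and>
      (\<not> primitive_field ?Z \<longrightarrow> (\<exists>K. proper_subfields ?Z - {rat_subfield ?Z} = {K} \<and>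
                rat_degree (?Z\<lparr>carrier := K\<rparr>) = CARD('g)))" if "rat_degree ?Z = 2 * CARD('g)"
  proof (intro conjI impI)
    have dim: "ratV.dim D.KF = 2 * CARD('g)" using that deg by simp
    then have "ratV.dim D.KF \<noteq> 1" by simp
    then obtain \<rho> Ir \<kappa> where pl: "D.places \<rho> Ir \<kappa>" using D.places_exist by blast
    have Ir: "Ir = {}" using pl dim unfolding D.places_def by simp
    have "card (range \<rho>) = CARD('g)" using D.places_card[OF pl] dim Ir by simp
    then show "Aut_torus \<Lambda> \<cong> sign_group \<times>\<times> free_abelian_rank (CARD('g) - 1)"
      using iso_trans[OF Aut D.KUgrp_iso(1)[OF pl]] by simp
    show "purely_imaginary ?Z" using iii M.signature(1)[OF pl] Ir by (simp add: purely_imaginary_def)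
    show "\<exists>K. proper_subfields ?Z - {rat_subfield ?Z} = {K} \<and> rat_degree (?Z\<lparr>carrier := K\<rparr>) = CARD('g)"
      if "\<not> primitive_field ?Z" by (rule M.unique_intermediate_field[OF dim that])
  qed
  have vi: "primitive_field ?Z \<and>
        (\<exists>d::nat. d > 0 \<and> int d = int (field_r ?Z) + int (field_s ?Z) - 1 \<and>
           Aut_torus \<Lambda> \<cong> free_abelian_rank d \<times>\<times> sign_group \<and>
           1 / 2 \<le> real CARD('g) / 2 - 1 \<and> real CARD('g) / 2 - 1 \<le> real d \<and> real d \<le> real CARD('g) - 1 \<and>
           (abelian_variety \<Lambda> \<longrightarrow> primitive_field ?Z \<and> totally_real ?Z \<and> int d = int CARD('g) - 1))"
    if "rat_degree ?Z = CARD('g)"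
  proof -
    have dim: "ratV.dim D.KF = CARD('g)" using that deg by simp
    then have "ratV.dim D.KF \<noteq> 1" using g3 by simp
    then obtain \<rho> Ir \<kappa> where pl: "D.places \<rho> Ir \<kappa>" using D.places_exist by blast
    have prim: "primitive_field ?Z" by (rule M.primitive_dim_g[OF dim])
    have card: "card Ir + 2 * card (range \<rho> - Ir) = CARD('g)" using D.places_card[OF pl] dim by simp
    have "card (range \<rho>) = card Ir + card (range \<rho> - Ir)"
      using D.places_real_subset[OF pl] card_Diff_subset[of Ir "range \<rho>"] card_mono[of "range \<rho>" Ir] by simp
    then have rs: "card (range \<rho>) = field_r ?Z + field_s ?Z" by (simp add: M.signature[OF pl])
    have rs2: "field_r ?Z + 2 * field_s ?Z = CARD('g)" using card by (simp add: M.signature[OF pl])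
    \<comment> \<open>From \<open>r + 2 s = g\<close> it follows that \<open>r + s\<close> lies
      between \<open>g / 2\<close> and \<open>g\<close>, and that it is at least 2 because
      \<open>g \<ge> 3\<close>; this yields all bounds on \<open>d\<close>.\<close>
    define d where "d = card (range \<rho>) - 1"
    have "totally_real ?Z \<and> int d = int CARD('g) - 1" if "abelian_variety \<Lambda>"
    proof -
      have "range \<rho> - Ir = {}" using D.places_all_real[OF pl] ab that dim by blast
      then have "field_s ?Z = 0" by (simp add: M.signature[OF pl])
      then show ?thesis using iii rs rs2 g3 by (simp add: totally_real_def d_def)
    qed
    moreover have "Aut_torus \<Lambda> \<cong> free_abelian_rank d \<times>\<times> sign_group"
      unfolding d_def by (rule iso_trans[OF Aut D.KUgrp_iso(2)[OF pl]])
    moreover have "d > 0" "int d = int (field_r ?Z) + int (field_s ?Z) - 1"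
      "real CARD('g) / 2 - 1 \<le> real d" "real d \<le> real CARD('g) - 1" "1 / 2 \<le> real CARD('g) / 2 - 1"
      using rs rs2 g3 by (simp_all add: d_def)
    ultimately show ?thesis using prim by blast
  qed
  show ?thesis using i ii iii iv v vi by blast
qed

end
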